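(* Consider a rank 2 $(TE)$-structure $(H\to\mathbb C\times(M,t^0),\nabla)$ over $(M,t^0)=(\mathbb C,0)$ (with coordinate $t$) which is generically regular singular (so of generic type (Reg) or (Log)), which has trace free pole part, whose restriction over $t^0$ is logarithmic, and whose monodromy has a $2\times2$ Jordan block. The leading exponents of the $(TE)$-structures over $t\neq0$ are independent of $t$ and are called $\alpha_1$ and $\alpha_2$, with $\alpha_1-\alpha_2\in\mathbb N_0$. The leading exponents of the logarithmic $(TE)$-structure over $t^0=0$ are called $\alpha_1^0$ and $\alpha_2^0$, with $\alpha_1^0-\alpha_2^0\in\mathbb N_0$. Precisely one of the following three cases holds: (I) $\alpha_1^0=\alpha_1$, $\alpha_2^0=\alpha_2+1$ (thus $\alpha_1-\alpha_2\in\mathbb N$); (II) $\alpha_1^0=\alpha_1+1$, $\alpha_2^0=\alpha_2$; (III) $\alpha_1^0=\alpha_1$, $\alpha_2^0=\alpha_2$. Choose any section $s_1\in C^{\alpha_1}\setminus\ker(\nabla_{z\partial_z}-\alpha_1:C^{\alpha_1}\to C^{\alpha_1})$. It determines uniquely a section $s_2\in\ker(\nabla_{z\partial_z}-\alpha_2:C^{\alpha_2}\to C^{\alpha_2})\setminus\{0\}$ with $(\nabla_{z\partial_z}-\alpha_1)(s_1)=z^{\alpha_1-\alpha_2}s_2$. Then $$\mathcal O(H)_{(0,0)}=\mathbb C\{t,z\}(s_1+fs_2)\oplus\mathbb C\{t,z\}\,zs_2\quad\text{for some }f\in t\mathbb C\{t\}\setminus\{0\}\text{ in case (I)},$$ $$\mathcal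 O(H)_{(0,0)}=\mathbb C\{t,z\}(s_2+fs_1)\oplus\mathbb C\{t,z\}\,zs_1\quad\text{for some }f\in t\mathbb C\{t\}\setminus\{0\}\text{ in case (II)},$$ $$\mathcal O(H)_{(0,0)}=\mathbb C\{t,z\}s_1\oplus\mathbb C\{t,z\}s_2\quad\text{in case (III)}.$$ The function $f$ in the cases (I) and (II) is independent of the choice of $s_1$, so it is an invariant of the gauge equivalence class of the $(TE)$-structure.
   Context: A $(TE)$-structure over a complex manifold $M$ (or a germ) is a holomorphic vector bundle $H\to\mathbb C\times M$ ($z$ the coordinate on $\mathbb C$) with a flat connection $\nabla$ on $H':=H|_{\mathbb C^*\times M}$ such that $\nabla:\mathcal O(H)\to(z^{-1}\mathcal O_{\mathbb C\times M}\cdot\Omega^1_M+z^{-2}\mathcal O_{\mathbb C\times M}\,dz)\otimes\mathcal O(H)$. Its pole part is $\mathcal U:=[z^2\nabla_{\partial_z}]$ on $K:=H|_{\{0\}\times M}$. A gauge isomorphism is a holomorphic bundle isomorphism over $\mathrm{id}_{\mathbb C\times M}$ respecting the connections. A $(TE)$-structure over a point is logarithmic if $z\nabla_{\partial_z}\mathcal O(H)_0\subset\mathcal O(H)_0$ and regular singular if all sections in $\mathcal O(H)_0$ have moderate growth at $z=0$. In rank 2 with trace free pole part, generic type (Log) means $\mathcal U=0$ near $t^0$, and generic type (Reg) means that over generic $t$ the $(TE)$-structure is regular singular and not logarithmic. Over a simply connected $M$, the monodromy $M^{\mathrm{mon}}$ is the one along $z\mapsto ze^{2\pi i}$ on flat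 multivalued sections of $H'$. For $\alpha\in\mathbb C$, $C^\alpha$ is the space of global holomorphic sections $\sigma$ of $H'$ with $(\nabla_{z\partial_z}-\alpha)^2\sigma=0$ and $\nabla_X\sigma=0$ for $X\in\mathcal T_M$; one has $z^kC^\alpha=C^{\alpha+k}$ for $k\in\mathbb Z$. Leading exponents (rank 2, $M^{\mathrm{mon}}$ with a $2\times2$ Jordan block and eigenvalue $\lambda$): for a regular singular $(TE)$-structure over a point they are the unique numbers $\alpha_1,\alpha_2$ with $e^{-2\pi i\alpha_j}=\lambda$, $\alpha_1-\alpha_2\in\mathbb N_0$ such that for any $s_1\in C^{\alpha_1}\setminus\ker(\nabla_{z\partial_z}-\alpha_1)$ and the $s_2\in C^{\alpha_2}$ with $(\nabla_{z\partial_z}-\alpha_1)s_1=z^{\alpha_1-\alpha_2}s_2$ one has: $\mathcal O(H)_0=\mathbb C\{z\}(s_1+t_2s_2)\oplus\mathbb C\{z\}zs_2$ for some $t_2\in\mathbb C$ (with $t_2\in\mathbb C^*$ if $\alpha_1>\alpha_2$, i.e. $\alpha_1-\alpha_2\in\mathbb N$) if it is not logarithmic; $\mathcal O(H)_0=\mathbb C\{z\}s_1\oplus\mathbb C\{z\}s_2$ if it is logarithmic. $\mathbb N=\{1,2,\dots\}$, $\mathbb N_0=\mathbb N\cup\{0\}$.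
   Formalization: In case (II) with α1 = α2 the function f does depend on s1 (s1 → s1 + d s2 turns f into f/(1 − d f)), so independence of f is claimed in case (I) and in case (II) with α1 ≠ α2; for α1 = α2 in case (II) it is shown that f' = f/(1 + c f) for a constant c. *)

theory Defs
  imports "HOL-Complex_Analysis.Complex_Analysis"
begin

section \<open>Holomorphic functions on open subsets of $C \times M$\<close>

text \<open>
  Points are pairs \<open>(z, t)\<close>, \<open>t\<close> in the base manifold \<open>M\<close>.  The base \<open>M\<close> is either an open subset
  of the complex plane or a single point; the latter gives the structures over a point, to which
  a structure over an open set is restricted.  "Open" always means relatively open in
  \<open>UNIV \<times> M\<close>, and holomorphic means complex differentiable within the set: on a relatively open
  subset of \<open>UNIV \<times> {t}\<close> this is holomorphy in \<open>z\<close>.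
\<close>

type_synonym pt = "complex \<times> complex"

definition hol2_on :: "(pt \<Rightarrow> complex) \<Rightarrow> pt set \<Rightarrow> bool" where
  "hol2_on h W \<longleftrightarrow>
     (\<forall>x\<in>W. \<exists>a b. (h has_derivative (\<lambda>v. a * fst v + b * snd v)) (at x within W))"

definition hol2_vec_on :: "(pt \<Rightarrow> complex^2) \<Rightarrow> pt set \<Rightarrow> bool" where
  "hol2_vec_on u W \<longleftrightarrow> (\<forall>i. hol2_on (\<lambda>x. u x $ i) W)"

definition hol2_mat_on :: "(pt \<Rightarrow> complex^2^2) \<Rightarrow> pt set \<Rightarrow> bool" where
  "hol2_mat_on A W \<longleftrightarrow> (\<forall>i j. hol2_on (\<lambda>x. A x $ i $ j) W)"

definition dz_vec :: "(pt \<Rightarrow> complex^2) \<Rightarrow> pt \<Rightarrow> complex^2" where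
  "dz_vec u x = (\<chi> i. deriv (\<lambda>w. u (w, snd x) $ i) (fst x))"

definition dt_vec :: "(pt \<Rightarrow> complex^2) \<Rightarrow> pt \<Rightarrow> complex^2" where
  "dt_vec u x = (\<chi> i. deriv (\<lambda>w. u (fst x, w) $ i) (snd x))"

definition dz_mat :: "(pt \<Rightarrow> complex^2^2) \<Rightarrow> pt \<Rightarrow> complex^2^2" where
  "dz_mat A x = (\<chi> i j. deriv (\<lambda>w. A (w, snd x) $ i $ j) (fst x))"

definition dt_mat :: "(pt \<Rightarrow> complex^2^2) \<Rightarrow> pt \<Rightarrow> complex^2^2" where
  "dt_mat A x = (\<chi> i j. deriv (\<lambda>w. A (fst x, w) $ i $ j) (snd x))"

section \<open>Rank 2 (TE)-structures\<close>

text \<open>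
  A bundle \<open>H\<close> of rank 2 is given by a set of charts.  Every fibre \<open>H_x\<close> is \<open>C^2\<close> as a vector
  space, with no relation assumed between different fibres; the holomorphic structure is carried
  by the local trivialisations \<open>triv c x\<close> from \<open>H_x\<close> to \<open>C^2\<close>, for which only the transition
  functions are holomorphic.  The bundle need not be globally trivial.  In a chart, the connection is
  \<open>d + z^(-2) pole_z dz + z^(-1) pole_t dt\<close> with \<open>pole_z\<close>, \<open>pole_t\<close> holomorphic on the whole
  chart domain, including its points with \<open>z = 0\<close>.
\<close>

record te_chart =
  chart_dom :: "pt set"
  triv :: "pt \<Rightarrow> complex^2^2"
  pole_z :: "pt \<Rightarrow> complex^2^2"
  pole_t :: "pt \<Rightarrow> complex^2^2"

record te =
  base :: "complex set"
  atlas :: "te_chart set"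

abbreviation total_base :: "te \<Rightarrow> pt set" where
  "total_base P \<equiv> UNIV \<times> base P"

abbreviation punctured :: "te \<Rightarrow> pt set" where
  "punctured P \<equiv> (- {0}) \<times> base P"

definition omega_z :: "te_chart \<Rightarrow> pt \<Rightarrow> complex^2^2" where
  "omega_z c x = (\<chi> i j. pole_z c x $ i $ j / fst x ^ 2)"

definition omega_t :: "te_chart \<Rightarrow> pt \<Rightarrow> complex^2^2" where
  "omega_t c x = (\<chi> i j. pole_t c x $ i $ j / fst x)"

definition transition :: "te_chart \<Rightarrow> te_chart \<Rightarrow> pt \<Rightarrow> complex^2^2" where
  "transition c c' x = triv c' x ** matrix_inv (triv c x)"

text \<open>
  If the base is a point, then \<open>interior (base P)\<close> is empty.  So all conditions on the direction
  \<open>t\<close> are guarded by \<open>snd x \<in> interior (base P)\<close>: they hold everywhere for an open base and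
  disappear over a point.
\<close>

definition te_structure :: "te \<Rightarrow> bool" where
  "te_structure P \<longleftrightarrow>
     base P \<noteq> {} \<and> (open (base P) \<or> (\<exists>t. base P = {t})) \<and>
     (\<Union>c\<in>atlas P. chart_dom c) = total_base P \<and>
     (\<forall>c\<in>atlas P.
        openin (top_of_set (total_base P)) (chart_dom c) \<and>
        (\<forall>x\<in>chart_dom c. invertible (triv c x)) \<and>
        hol2_mat_on (pole_z c) (chart_dom c) \<and>
        hol2_mat_on (pole_t c) (chart_dom c)) \<and>
     \<comment> \<open>transition functions, and gluing of the local connections\<close>
     (\<forall>c\<in>atlas P. \<forall>c'\<in>atlas P.
        hol2_mat_on (transition c c') (chart_dom c \<inter> chart_dom c') \<and>
        (\<forall>x\<in>chart_dom c \<inter> chart_dom c'. fst x \<noteq> 0 \<longrightarrow>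
           dz_mat (transition c c') x + omega_z c' x ** transition c c' x
             = transition c c' x ** omega_z c x \<and>
           (snd x \<in> interior (base P) \<longrightarrow>
              dt_mat (transition c c') x + omega_t c' x ** transition c c' x
                = transition c c' x ** omega_t c x))) \<and>
     \<comment> \<open>flatness\<close>
     (\<forall>c\<in>atlas P. \<forall>x\<in>chart_dom c. fst x \<noteq> 0 \<and> snd x \<in> interior (base P) \<longrightarrow>
        dz_mat (omega_t c) x - dt_mat (omega_z c) x
          + (omega_z c x ** omega_t c x - omega_t c x ** omega_z c x) = 0)"

definition chart_at :: "te \<Rightarrow> pt \<Rightarrow> te_chart" where
  "chart_at P x = (SOME c. c \<in> atlas P \<and> x \<in> chart_dom c)"

text \<open>By the gluing conditions, the next three notions do not depend on the chosen charts.\<close>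

definition nabla_z :: "te \<Rightarrow> (pt \<Rightarrow> complex^2) \<Rightarrow> pt \<Rightarrow> complex^2" where
  "nabla_z P \<sigma> x = (let c = chart_at P x in
     matrix_inv (triv c x) *v
       (dz_vec (\<lambda>y. triv c y *v \<sigma> y) x + omega_z c x *v (triv c x *v \<sigma> x)))"

definition nabla_t :: "te \<Rightarrow> (pt \<Rightarrow> complex^2) \<Rightarrow> pt \<Rightarrow> complex^2" where
  "nabla_t P \<sigma> x = (let c = chart_at P x in
     matrix_inv (triv c x) *v
       (dt_vec (\<lambda>y. triv c y *v \<sigma> y) x + omega_t c x *v (triv c x *v \<sigma> x)))"

text \<open>
  The pole part at \<open>t\<close> as an endomorphism of the fibre over \<open>(0, t)\<close>: in a chart,
  \<open>z^2 nabla_z\<close> is \<open>z^2 d/dz + pole_z\<close>, which is \<open>pole_z\<close> at \<open>z = 0\<close>.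
\<close>

definition pole_part :: "te \<Rightarrow> complex \<Rightarrow> complex^2^2" where
  "pole_part P t = (let c = chart_at P (0, t) in
     matrix_inv (triv c (0, t)) ** pole_z c (0, t) ** triv c (0, t))"

definition restr :: "te \<Rightarrow> complex \<Rightarrow> te" where
  "restr P t = \<lparr>base = {t},
     atlas = (\<lambda>c. c\<lparr>chart_dom := chart_dom c \<inter> UNIV \<times> {t}\<rparr>) ` atlas P\<rparr>"

definition holsec_on :: "te \<Rightarrow> (pt \<Rightarrow> complex^2) \<Rightarrow> pt set \<Rightarrow> bool" where
  "holsec_on P \<sigma> W \<longleftrightarrow>
     (\<forall>c\<in>atlas P. hol2_vec_on (\<lambda>x. triv c x *v \<sigma> x) (W \<inter> chart_dom c))"

definition gauge_isomorphic :: "te \<Rightarrow> te \<Rightarrow> bool" where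
  "gauge_isomorphic P Q \<longleftrightarrow> te_structure P \<and> te_structure Q \<and> base P = base Q \<and>
     (\<exists>\<Phi>. (\<forall>x\<in>total_base P. invertible (\<Phi> x)) \<and>
       (\<forall>c\<in>atlas P. \<forall>c'\<in>atlas Q.
          hol2_mat_on (\<lambda>x. triv c' x ** \<Phi> x ** matrix_inv (triv c x))
            (chart_dom c \<inter> chart_dom c')) \<and>
       (\<forall>W \<sigma>. openin (top_of_set (total_base P)) W \<and> W \<subseteq> punctured P \<and> holsec_on P \<sigma> W \<longrightarrow>
          (\<forall>x\<in>W. nabla_z Q (\<lambda>y. \<Phi> y *v \<sigma> y) x = \<Phi> x *v nabla_z P \<sigma> x \<and>
             (snd x \<in> interior (base P) \<longrightarrow>
                nabla_t Q (\<lambda>y. \<Phi> y *v \<sigma> y) x = \<Phi> x *v nabla_t P \<sigma> x))))"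

section \<open>Germs at points with $z = 0$\<close>

text \<open>
  Germs are represented by functions.  The stalk of the sheaf of sections of \<open>H\<close> at \<open>x\<close> consists
  of the germs of sections of \<open>H'\<close> which extend holomorphically to a neighbourhood of \<open>x\<close>;
  values of a representative at \<open>z = 0\<close> are irrelevant, as the elements of \<open>C^\<alpha>\<close> are
  sections of \<open>H'\<close> only.
\<close>

definition hol_germ :: "te \<Rightarrow> pt \<Rightarrow> (pt \<Rightarrow> complex) \<Rightarrow> bool" where
  "hol_germ P x a \<longleftrightarrow> (\<exists>W. openin (top_of_set (total_base P)) W \<and> x \<in> W \<and> hol2_on a W)"

definition stalk :: "te \<Rightarrow> pt \<Rightarrow> (pt \<Rightarrow> complex^2) set" where
  "stalk P x = {\<tau>. \<exists>\<sigma> W. openin (top_of_set (total_base P)) W \<and> x \<in> W \<and> holsec_on P \<sigma> W \<and>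
     (\<forall>y\<in>W. fst y \<noteq> 0 \<longrightarrow> \<tau> y = \<sigma> y)}"

definition stalk_direct_sum ::
    "te \<Rightarrow> pt \<Rightarrow> (pt \<Rightarrow> complex^2) \<Rightarrow> (pt \<Rightarrow> complex^2) \<Rightarrow> bool" where
  "stalk_direct_sum P x v1 v2 \<longleftrightarrow>
     (\<forall>\<tau>. \<tau> \<in> stalk P x \<longleftrightarrow>
        (\<exists>a b. hol_germ P x a \<and> hol_germ P x b \<and>
           (\<forall>\<^sub>F y in at x within punctured P. \<tau> y = a y *s v1 y + b y *s v2 y))) \<and>
     (\<forall>a b. hol_germ P x a \<and> hol_germ P x b \<and>
        (\<forall>\<^sub>F y in at x within punctured P. a y *s v1 y + b y *s v2 y = 0) \<longrightarrow>
        (\<forall>\<^sub>F y in nhds x. y \<in> total_base P \<longrightarrow> a y = 0 \<and> b y = 0))"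

section \<open>Flat multivalued sections and monodromy\<close>

text \<open>
  A multivalued section of \<open>H'\<close> is a function \<open>S\<close> of \<open>(\<zeta>, t)\<close>, where \<open>\<zeta>\<close> is a logarithm of \<open>z\<close>, with
  \<open>S (\<zeta>, t)\<close> in the fibre over \<open>(exp \<zeta>, t)\<close>.  It is flat if all of its univalued branches are.
\<close>

definition covering :: "pt \<Rightarrow> pt" where
  "covering y = (exp (fst y), snd y)"

definition flat_multivalued :: "te \<Rightarrow> (pt \<Rightarrow> complex^2) \<Rightarrow> bool" where
  "flat_multivalued P S \<longleftrightarrow>
     (\<forall>V \<sigma>. openin (top_of_set (total_base P)) V \<and> inj_on covering V \<and>
        (\<forall>y\<in>V. \<sigma> (covering y) = S y) \<longrightarrow>
        holsec_on P \<sigma> (covering ` V) \<and>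
        (\<forall>x\<in>covering ` V. nabla_z P \<sigma> x = 0 \<and>
           (snd x \<in> interior (base P) \<longrightarrow> nabla_t P \<sigma> x = 0)))"

definition flat_basis :: "te \<Rightarrow> (pt \<Rightarrow> complex^2) \<Rightarrow> (pt \<Rightarrow> complex^2) \<Rightarrow> bool" where
  "flat_basis P S1 S2 \<longleftrightarrow> flat_multivalued P S1 \<and> flat_multivalued P S2 \<and>
     (\<forall>S. flat_multivalued P S \<longrightarrow>
        (\<exists>!(a, b). \<forall>y\<in>total_base P. S y = a *s S1 y + b *s S2 y))"

definition monodromy :: "(pt \<Rightarrow> complex^2) \<Rightarrow> pt \<Rightarrow> complex^2" where
  "monodromy S y = S (fst y + 2 * of_real pi * \<i>, snd y)"

definition monodromy_jordan_block :: "te \<Rightarrow> complex \<Rightarrow> bool" where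
  "monodromy_jordan_block P \<mu> \<longleftrightarrow>
     (\<exists>S1 S2. flat_basis P S1 S2 \<and>
        (\<forall>y\<in>total_base P. monodromy S1 y = \<mu> *s S1 y + S2 y \<and> monodromy S2 y = \<mu> *s S2 y))"

section \<open>Structures over a point\<close>

definition origin :: "te \<Rightarrow> pt" where
  "origin R = (0, the_elem (base R))"

definition logarithmic :: "te \<Rightarrow> bool" where
  "logarithmic R \<longleftrightarrow>
     (\<forall>\<sigma>\<in>stalk R (origin R). (\<lambda>x. fst x *s nabla_z R \<sigma> x) \<in> stalk R (origin R))"

text \<open>
  Moderate growth: the coefficients with respect to a basis of flat multivalued sections grow at
  most like a power of \<open>1 / |z|\<close> on every sector.
\<close>

definition moderate_growth :: "te \<Rightarrow> (pt \<Rightarrow> complex^2) \<Rightarrow> bool" where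
  "moderate_growth R \<tau> \<longleftrightarrow>
     (\<exists>S1 S2 a1 a2. flat_basis R S1 S2 \<and>
        (\<forall>y\<in>total_base R. \<tau> (covering y) = a1 (fst y) *s S1 y + a2 (fst y) *s S2 y) \<and>
        (\<forall>\<theta>1 \<theta>2 :: real. \<exists>C r :: real. \<exists>N :: nat. \<forall>\<zeta>. Re \<zeta> < r \<and> \<theta>1 \<le> Im \<zeta> \<and> Im \<zeta> \<le> \<theta>2 \<longrightarrow>
           norm (a1 \<zeta>) \<le> C / norm (exp \<zeta>) ^ N \<and> norm (a2 \<zeta>) \<le> C / norm (exp \<zeta>) ^ N))"

definition regular_singular :: "te \<Rightarrow> bool" where
  "regular_singular R \<longleftrightarrow> (\<forall>\<tau>\<in>stalk R (origin R). moderate_growth R \<tau>)"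

section \<open>The spaces $C^\alpha$ and leading exponents\<close>

definition nabla_log :: "te \<Rightarrow> complex \<Rightarrow> (pt \<Rightarrow> complex^2) \<Rightarrow> pt \<Rightarrow> complex^2" where
  "nabla_log P \<alpha> \<sigma> x = fst x *s nabla_z P \<sigma> x - \<alpha> *s \<sigma> x"

definition C_space :: "te \<Rightarrow> complex \<Rightarrow> (pt \<Rightarrow> complex^2) set" where
  "C_space P \<alpha> = {\<sigma>. holsec_on P \<sigma> (punctured P) \<and>
     (\<forall>x\<in>punctured P. nabla_log P \<alpha> (nabla_log P \<alpha> \<sigma>) x = 0 \<and>
        (snd x \<in> interior (base P) \<longrightarrow> nabla_t P \<sigma> x = 0))}"

definition C_kernel :: "te \<Rightarrow> complex \<Rightarrow> (pt \<Rightarrow> complex^2) set" where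
  "C_kernel P \<alpha> = {\<sigma>\<in>C_space P \<alpha>. \<forall>x\<in>punctured P. nabla_log P \<alpha> \<sigma> x = 0}"

definition linked :: "te \<Rightarrow> complex \<Rightarrow> complex \<Rightarrow> (pt \<Rightarrow> complex^2) \<Rightarrow> (pt \<Rightarrow> complex^2) \<Rightarrow> bool" where
  "linked P \<alpha>1 \<alpha>2 s1 s2 \<longleftrightarrow>
     s1 \<in> C_space P \<alpha>1 - C_kernel P \<alpha>1 \<and> s2 \<in> C_space P \<alpha>2 \<and>
     (\<exists>k :: nat. \<alpha>1 - \<alpha>2 = of_nat k \<and>
        (\<forall>x\<in>punctured P. nabla_log P \<alpha>1 s1 x = fst x ^ k *s s2 x))"

definition leading_exponents_form :: "te \<Rightarrow> complex \<Rightarrow> complex \<Rightarrow> bool" where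
  "leading_exponents_form R \<alpha>1 \<alpha>2 \<longleftrightarrow>
     (\<exists>\<mu>. monodromy_jordan_block R \<mu> \<and>
        exp (- 2 * of_real pi * \<i> * \<alpha>1) = \<mu> \<and> exp (- 2 * of_real pi * \<i> * \<alpha>2) = \<mu>) \<and>
     \<alpha>1 - \<alpha>2 \<in> \<nat> \<and>
     (\<forall>s1 s2. linked R \<alpha>1 \<alpha>2 s1 s2 \<longrightarrow>
        (if logarithmic R then stalk_direct_sum R (origin R) s1 s2
         else \<exists>t2. (\<alpha>1 \<noteq> \<alpha>2 \<longrightarrow> t2 \<noteq> 0) \<and>
           stalk_direct_sum R (origin R) (\<lambda>x. s1 x + t2 *s s2 x) (\<lambda>x. fst x *s s2 x)))"

definition leading_exponents :: "te \<Rightarrow> complex \<Rightarrow> complex \<Rightarrow> bool" where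
  "leading_exponents R \<alpha>1 \<alpha>2 \<longleftrightarrow> leading_exponents_form R \<alpha>1 \<alpha>2 \<and>
     (\<forall>\<beta>1 \<beta>2. leading_exponents_form R \<beta>1 \<beta>2 \<longrightarrow> \<beta>1 = \<alpha>1 \<and> \<beta>2 = \<alpha>2)"

section \<open>Structures over the germ $(C, 0)$\<close>

text \<open>
  A structure over the germ is given by a representative whose base is a simply connected open
  neighbourhood of 0.  A proper analytic subset germ of \<open>(C, 0)\<close> is contained in \<open>{0}\<close>, so
  "for generic \<open>t\<close>" is "eventually at 0".
\<close>

definition te_germ :: "te \<Rightarrow> bool" where
  "te_germ P \<longleftrightarrow> te_structure P \<and> open (base P) \<and> simply_connected (base P) \<and> 0 \<in> base P"

definition trace_free_pole_part :: "te \<Rightarrow> bool" where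
  "trace_free_pole_part P \<longleftrightarrow> (\<forall>t\<in>base P. trace (pole_part P t) = 0)"

definition generically_regular_singular :: "te \<Rightarrow> bool" where
  "generically_regular_singular P \<longleftrightarrow> (\<forall>\<^sub>F t in at 0. regular_singular (restr P t))"

definition generic_type_Reg :: "te \<Rightarrow> bool" where
  "generic_type_Reg P \<longleftrightarrow>
     (\<forall>\<^sub>F t in at 0. regular_singular (restr P t) \<and> \<not> logarithmic (restr P t))"

definition generic_type_Log :: "te \<Rightarrow> bool" where
  "generic_type_Log P \<longleftrightarrow> (\<forall>\<^sub>F t in nhds 0. pole_part P t = 0)"

definition generic_leading_exponents :: "te \<Rightarrow> complex \<Rightarrow> complex \<Rightarrow> bool" where
  "generic_leading_exponents P \<alpha>1 \<alpha>2 \<longleftrightarrow> (\<forall>\<^sub>F t in at 0. leading_exponents (restr P t) \<alpha>1 \<alpha>2)"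

text \<open>Membership of (the germ at 0 of) a function in \<open>t C{t} - {0}\<close>:\<close>

definition nonzero_vanishing_germ :: "(complex \<Rightarrow> complex) \<Rightarrow> bool" where
  "nonzero_vanishing_germ f \<longleftrightarrow> f analytic_on {0} \<and> f 0 = 0 \<and> \<not> (\<forall>\<^sub>F t in nhds 0. f t = 0)"

text \<open>
  In the second normal form with \<open>\<alpha>1 = \<alpha>2\<close>, the function \<open>f\<close> depends on the choice of \<open>s1\<close>:
  replacing \<open>s1\<close> by \<open>s1 + d s2\<close> replaces \<open>f\<close> by \<open>f / (1 - d f)\<close>.
\<close>

definition normal_form_I ::
    "te \<Rightarrow> (pt \<Rightarrow> complex^2) \<Rightarrow> (pt \<Rightarrow> complex^2) \<Rightarrow> (complex \<Rightarrow> complex) \<Rightarrow> bool" where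
  "normal_form_I P s1 s2 f \<longleftrightarrow> nonzero_vanishing_germ f \<and>
     stalk_direct_sum P (0, 0) (\<lambda>x. s1 x + f (snd x) *s s2 x) (\<lambda>x. fst x *s s2 x)"

definition normal_form_II ::
    "te \<Rightarrow> (pt \<Rightarrow> complex^2) \<Rightarrow> (pt \<Rightarrow> complex^2) \<Rightarrow> (complex \<Rightarrow> complex) \<Rightarrow> bool" where
  "normal_form_II P s1 s2 f \<longleftrightarrow> nonzero_vanishing_germ f \<and>
     stalk_direct_sum P (0, 0) (\<lambda>x. s2 x + f (snd x) *s s1 x) (\<lambda>x. fst x *s s1 x)"

text \<open>
  The functions \<open>f\<close> which occur in the normal form of a structure, for some choice of \<open>s1\<close>, in
  the case with special leading exponents \<open>(\<alpha>1, \<alpha>2 + 1)\<close>, respectively \<open>(\<alpha>1 + 1, \<alpha>2)\<close>.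
\<close>

definition case_I_function :: "te \<Rightarrow> (complex \<Rightarrow> complex) \<Rightarrow> bool" where
  "case_I_function P f \<longleftrightarrow>
     (\<exists>\<alpha>1 \<alpha>2 s1 s2. generic_leading_exponents P \<alpha>1 \<alpha>2 \<and>
        leading_exponents (restr P 0) \<alpha>1 (\<alpha>2 + 1) \<and>
        linked P \<alpha>1 \<alpha>2 s1 s2 \<and> normal_form_I P s1 s2 f)"

definition case_II_function :: "te \<Rightarrow> (complex \<Rightarrow> complex) \<Rightarrow> bool" where
  "case_II_function P f \<longleftrightarrow>
     (\<exists>\<alpha>1 \<alpha>2 s1 s2. generic_leading_exponents P \<alpha>1 \<alpha>2 \<and>
        leading_exponents (restr P 0) (\<alpha>1 + 1) \<alpha>2 \<and>
        linked P \<alpha>1 \<alpha>2 s1 s2 \<and> normal_form_II P s1 s2 f)"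

end

theory Submission
 imports Defs
begin

text \<open>
 A Jordan block in the monodromy yields a frame \<open>E = (e\<^sub>1, e\<^sub>2)\<close> of \<open>H'\<close> over the whole base with
 \<open>e\<^sub>1, e\<^sub>2 \<in> C^\<alpha>\<close> and \<open>(\<nabla>\<^bsub>z\<partial>z\<^esub> - \<alpha>) e\<^sub>1 = e\<^sub>2\<close>, \<open>(\<nabla>\<^bsub>z\<partial>z\<^esub> - \<alpha>) e\<^sub>2 = 0\<close> (\<open>adapted_frame_exists\<close>).
 It is constant in \<open>t\<close>, so the structure is encoded in the family of lattices which the stalks \<open>O(H)\<close>
 form in \<open>C({z}) e\<^sub>1 \<oplus> C({z}) e\<^sub>2\<close>.

 Over one point such a lattice is meromorphic, by moderate growth or, in the logarithmic case, by
 Gronwall's inequality on rays, and stability under \<open>z\<^sup>2 \<nabla>\<^bsub>\<partial>z\<^esub>\<close> forces a basis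
 \<open>z^a e\<^sub>1 + h z^(b - 1) e\<^sub>2\<close>, \<open>z^b e\<^sub>2\<close> with \<open>b <= a + 1\<close> and a number \<open>h\<close>
 (\<open>lattice_normal_form_exists\<close>).  It is logarithmic iff \<open>h = 0\<close> and \<open>b <= a\<close>, and the leading
 exponents are read off from \<open>a\<close>, \<open>b\<close>, \<open>h\<close> (\<open>leading_exponents_nf\<close>).

 Along the base \<open>a + b\<close> is constant, being the \<open>z\<close>-derivative at \<open>0\<close> of the trace of the pole part
 minus \<open>2 \<alpha>\<close> (\<open>trace_exponent_sum\<close>).  The generic \<open>a\<close> is the order of the first Laurent coefficient of the
 inverse frame that is not identically zero.  At \<open>t = 0\<close> either \<open>a\<close> stays, and \<open>h = f(t)\<close> is holomorphic
 with \<open>f(0) = 0\<close>, which gives case (I) or, if \<open>f\<close> vanishes identically, case (III); or \<open>a\<close> jumps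
 to \<open>a + 1\<close>, and \<open>1 / h = f(t)\<close> is holomorphic with \<open>f(0) = 0\<close>, which gives case (II)
 (\<open>lattice_family_trichotomy\<close>).  Bases of all fibres that depend holomorphically on \<open>t\<close> are bases of the stalk at
 the origin, by Cauchy's formula (\<open>joint_lattice_basis\<close>).

 The function \<open>f\<close> is determined by comparing two normal forms at \<open>z = 0\<close>.  A gauge isomorphism
 transports the frame, hence all lattices and normal forms with the same numbers.
\<close>

abbreviation (input) eventually_at_zero :: "(complex => bool) => bool" (binder \<open>EV \<close> 10) where
 "eventually_at_zero Q \<equiv> eventually Q (at 0)"

no_notation fps_nth (infixl \<open>$\<close> 75)

section \<open>Holomorphic functions of two variables\<close>

subsection \<open>Closure properties\<close>

lemma hol2_on_subset: "hol2_on h W ==> V \<subseteq> W ==> hol2_on h V"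
 unfolding hol2_on_def by (meson has_derivative_subset subsetD)

lemma hol2_on_cong:
 assumes "!!x. x : W ==> h x = k x"
 shows "hol2_on h W \<longleftrightarrow> hol2_on k W"
proof -
 have "(h has_derivative D) (at x within W) \<longleftrightarrow> (k has_derivative D) (at x within W)"
  if "x : W" for x D
  using has_derivative_transform[of x W h k D] has_derivative_transform[of x W k h D] assms that by auto
 then show ?thesis unfolding hol2_on_def by blast
qed

lemma hol2_on_const [intro]: "hol2_on (%x. c) W" unfolding hol2_on_def by (intro ballI exI[of _ 0]) simp

lemma hol2_on_fst [intro]: "hol2_on fst W" unfolding hol2_on_def
 by (intro ballI exI[of _ 1] exI[of _ 0]) (auto intro!: derivative_eq_intros)

lemma hol2_on_snd [intro]: "hol2_on snd W" unfolding hol2_on_def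
 by (intro ballI exI[of _ 1] exI[of _ 0]) (auto intro!: derivative_eq_intros)

lemma hol2_on_add:
 assumes "hol2_on h W" "hol2_on k W"
 shows "hol2_on (%x. h x + k x) W" unfolding hol2_on_def
proof
 fix x assume "x : W"
 then obtain a b c d where "(h has_derivative (%v. a * fst v + b * snd v)) (at x within W)"
   "(k has_derivative (%v. c * fst v + d * snd v)) (at x within W)" using assms unfolding hol2_on_def by blast
 then show "EX a b. ((%x. h x + k x) has_derivative (%v. a * fst v + b * snd v)) (at x within W)"
  by (intro exI[of _ "a + c"] exI[of _ "b + d"])
    (auto intro!: derivative_eq_intros simp: algebra_simps fun_eq_iff)
qed

lemma hol2_on_mult:
 assumes "hol2_on h W" "hol2_on k W"
 shows "hol2_on (%x. h x * k x) W" unfolding hol2_on_def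
proof
 fix x assume "x : W"
 then obtain a b c d where "(h has_derivative (%v. a * fst v + b * snd v)) (at x within W)"
   "(k has_derivative (%v. c * fst v + d * snd v)) (at x within W)" using assms unfolding hol2_on_def by blast
 then show "EX a b. ((%x. h x * k x) has_derivative (%v. a * fst v + b * snd v)) (at x within W)"
  by (intro exI[of _ "a * k x + h x * c"] exI[of _ "b * k x + h x * d"])
    (auto intro!: derivative_eq_intros simp: algebra_simps fun_eq_iff)
qed

lemma hol2_on_compose:
 assumes h: "hol2_on h W" and f: "!!x. x : W ==> f field_differentiable at (h x)"
 shows "hol2_on (%x. f (h x)) W" unfolding hol2_on_def
proof
 fix x assume x: "x : W"
 then obtain a b where h': "(h has_derivative (%v. a * fst v + b * snd v)) (at x within W)"
  using h unfolding hol2_on_def by blast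
 obtain f' where "(f has_field_derivative f') (at (h x))" using f[OF x] by (auto simp: field_differentiable_def)
 then have f': "(f has_derivative (*) f') (at (h x))" by (simp add: has_field_derivative_def)
 have "((%x. f (h x)) has_derivative (%v. f' * (a * fst v + b * snd v))) (at x within W)"
  using has_derivative_compose[OF h' f'] by simp
 then show "EX a b. ((%x. f (h x)) has_derivative (%v. a * fst v + b * snd v)) (at x within W)"
  by (intro exI[of _ "f' * a"] exI[of _ "f' * b"]) (simp add: algebra_simps)
qed

lemma hol2_on_uminus: "hol2_on h W ==> hol2_on (%x. - h x) W" using hol2_on_mult[OF hol2_on_const[of "-1"]] by auto

lemma hol2_on_diff: "hol2_on h W ==> hol2_on k W ==> hol2_on (%x. h x - k x) W"
 using hol2_on_add[OF _ hol2_on_uminus] by auto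

lemma hol2_on_inverse:
 "hol2_on h W ==> (!!x. x : W ==> h x ~= 0) ==> hol2_on (%x. inverse (h x)) W"
 by (rule hol2_on_compose) (auto intro!: derivative_intros field_differentiable_inverse)

lemma hol2_on_divide:
 "hol2_on h W ==> hol2_on k W ==> (!!x. x : W ==> k x ~= 0) ==> hol2_on (%x. h x / k x) W"
 unfolding divide_inverse by (intro hol2_on_mult hol2_on_inverse)

lemma hol2_on_powi:
 assumes "hol2_on h W" "!!x. x : W ==> h x ~= 0"
 shows "hol2_on (%x. h x powi n) W"
proof (rule hol2_on_compose[OF assms(1)])
 show "(%w. w powi n) field_differentiable at (h x)" if "x : W" for x
  using DERIV_power_int[OF DERIV_ident, where x="h x" and n=n and s=UNIV] assms(2)[OF that]
  by (auto simp: field_differentiable_def)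
qed

lemma hol2_on_power: "hol2_on h W ==> hol2_on (%x. h x ^ n) W" by (induction n) (auto intro: hol2_on_mult)

lemma hol2_on_imp_continuous_on: "hol2_on h W ==> continuous_on W h"
 unfolding hol2_on_def continuous_on_eq_continuous_within using has_derivative_continuous by blast

lemma hol2_on_local:
 assumes "!!x. x : W ==> EX V. open V & x : V & hol2_on h (W Int V)"
 shows "hol2_on h W" unfolding hol2_on_def
proof
 fix x assume x: "x : W"
 from assms[OF this] obtain V where V: "open V" "x : V" "hol2_on h (W Int V)" by blast
 have "at x within W = at x within (W Int V)" by (rule at_within_nhd[of x V]) (use V in auto)
 then show "EX a b. (h has_derivative (%v. a * fst v + b * snd v)) (at x within W)"
  using V x unfolding hol2_on_def by auto
qed

subsection \<open>Slices and partial derivatives\<close>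

lemma has_derivative_slice_fst:
 fixes h :: "pt => complex"
 assumes "(h has_derivative (%v. a * fst v + b * snd v)) (at (z, t) within W)"
  and "open S" "z : S" "!!w. w : S ==> (w, t) : W"
 shows "((%w. h (w, t)) has_field_derivative a) (at z)"
proof -
 have "(h has_derivative (%v. a * fst v + b * snd v)) (at (z, t) within (%w. (w, t)) ` S)"
  by (rule has_derivative_subset[OF assms(1)]) (use assms in auto)
 moreover have "((%w::complex. (w, t)) has_derivative (%v. (v, 0))) (at z within S)"
  by (auto intro!: derivative_eq_intros)
 ultimately have "((%w. h (w, t)) has_derivative (%v. a * fst (v, 0::complex) + b * snd (v, 0))) (at z within S)"
  by (rule has_derivative_in_compose[where f="%w. (w, t)" and g=h, rotated])
 then have "((%w. h (w, t)) has_derivative (*) a) (at z within S)" by simp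
 then show ?thesis by (simp only: has_field_derivative_def at_within_open[OF assms(3,2)])
qed

lemma has_derivative_slice_snd:
 fixes h :: "pt => complex"
 assumes "(h has_derivative (%v. a * fst v + b * snd v)) (at (z, t) within W)"
  and "open S" "t : S" "!!w. w : S ==> (z, w) : W"
 shows "((%w. h (z, w)) has_field_derivative b) (at t)"
proof -
 have "(h has_derivative (%v. a * fst v + b * snd v)) (at (z, t) within (%w. (z, w)) ` S)"
  by (rule has_derivative_subset[OF assms(1)]) (use assms in auto)
 moreover have "((%w::complex. (z, w)) has_derivative (%v. (0, v))) (at t within S)"
  by (auto intro!: derivative_eq_intros)
 ultimately have "((%w. h (z, w)) has_derivative (%v. a * fst (0::complex, v) + b * snd (0::complex, v))) (at t within S)"
  by (rule has_derivative_in_compose[where f="%w. (z, w)" and g=h, rotated])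
 then have "((%w. h (z, w)) has_derivative (*) b) (at t within S)" by simp
 then show ?thesis by (simp only: has_field_derivative_def at_within_open[OF assms(3,2)])
qed

lemma hol2_on_slice_fst:
 assumes "hol2_on h W" "open S" "!!w. w : S ==> (w, t) : W"
 shows "(%w. h (w, t)) holomorphic_on S"
proof (rule holomorphic_onI)
 fix z assume z: "z : S"
 then obtain a b where "(h has_derivative (%v. a * fst v + b * snd v)) (at (z, t) within W)"
  using assms(1) assms(3)[OF z] unfolding hol2_on_def by blast
 from has_derivative_slice_fst[OF this assms(2) z assms(3)]
 show "(%w. h (w, t)) field_differentiable at z within S"
  by (auto simp: field_differentiable_def intro: has_field_derivative_at_within)
qed

lemma hol2_on_slice_snd:
 assumes "hol2_on h W" "open S" "!!w. w : S ==> (z, w) : W"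
 shows "(%w. h (z, w)) holomorphic_on S"
proof (rule holomorphic_onI)
 fix t assume t: "t : S"
 then obtain a b where "(h has_derivative (%v. a * fst v + b * snd v)) (at (z, t) within W)"
  using assms(1) assms(3)[OF t] unfolding hol2_on_def by blast
 from has_derivative_slice_snd[OF this assms(2) t assms(3)]
 show "(%w. h (z, w)) field_differentiable at t within S"
  by (auto simp: field_differentiable_def intro: has_field_derivative_at_within)
qed

lemma hol2_on_point_iff:
 "hol2_on h (S \<times> {t}) \<longleftrightarrow> (%w. h (w, t)) holomorphic_on S" (is "?l \<longleftrightarrow> ?r")
proof
 assume l: ?l
 show ?r
 proof (rule holomorphic_onI)
  fix z assume z: "z : S"
  then obtain a b where *: "(h has_derivative (%v. a * fst v + b * snd v)) (at (z, t) within S \<times> {t})"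
   using l unfolding hol2_on_def by force
  have im: "(%w. (w, t)) ` S = S \<times> {t}" by auto
  have "((%w::complex. (w, t)) has_derivative (%v. (v, 0))) (at z within S)" by (auto intro!: derivative_eq_intros)
  then have "((%w. h (w, t)) has_derivative (%v. a * fst (v, 0::complex) + b * snd (v, 0))) (at z within S)"
   using * by (intro has_derivative_in_compose[where f="%w. (w, t)" and g=h]) (simp_all add: im)
  then show "(%w. h (w, t)) field_differentiable at z within S"
   by (auto simp: field_differentiable_def has_field_derivative_def)
 qed
next
 assume r: ?r
 show ?l unfolding hol2_on_def
 proof
  fix x assume x: "x : S \<times> {t}"
  then obtain z where z: "x = (z, t)" "z : S" by auto
  obtain a where "((%w. h (w, t)) has_field_derivative a) (at z within S)"
   using r z by (auto simp: holomorphic_on_def field_differentiable_def)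
  then have a: "((%w. h (w, t)) has_derivative (*) a) (at z within S)" by (simp add: has_field_derivative_def)
  have im: "fst ` (S \<times> {t}) = S" by force
  have "(fst has_derivative fst) (at x within S \<times> {t})" by (auto intro!: derivative_eq_intros)
  then have "((%y. h (fst y, t)) has_derivative (%v. a * fst v)) (at x within S \<times> {t})"
   using a by (intro has_derivative_in_compose[where f=fst and g="%w. h (w, t)"]) (simp_all add: im z)
  then have "(h has_derivative (%v. a * fst v)) (at x within S \<times> {t})"
   by (rule has_derivative_transform[OF x, rotated]) auto
  then show "EX a b. (h has_derivative (%v. a * fst v + b * snd v)) (at x within S \<times> {t})"
   by (intro exI[of _ a] exI[of _ 0]) simp
 qed
qed

lemma hol2_on_of_snd:
 assumes "f holomorphic_on T" "open T"
 shows "hol2_on (%x. f (snd x)) (S \<times> T)"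
 by (rule hol2_on_compose) (use assms in \<open>auto simp: holomorphic_on_open field_differentiable_def\<close>)

lemma hol2_onI_partials:
 assumes W: "open W"
  and z: "!!z t. (z, t) : W ==> (%w. h (w, t)) field_differentiable at z"
  and t: "!!z t. (z, t) : W ==> ((%s. h (z, s)) has_field_derivative ht (z, t)) (at t)"
  and c: "continuous_on W ht"
 shows "hol2_on h W" unfolding hol2_on_def
proof
 fix x assume x: "x : W"
 obtain z0 t0 where x0: "x = (z0, t0)" by force
 obtain A B where AB: "open A" "open B" "(z0, t0) : A \<times> B" "A \<times> B \<subseteq> W"
  using open_prod_elim[OF W] x x0 by metis
 obtain r where r: "r > 0" "ball z0 r \<subseteq> A" using AB open_contains_ball by (metis mem_Sigma_iff)
 obtain s where s: "s > 0" "ball t0 s \<subseteq> B" using AB open_contains_ball by (metis mem_Sigma_iff)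
 let ?X = "ball z0 r" and ?Y = "ball t0 s"
 have sub: "?X \<times> ?Y \<subseteq> W" using r s AB by blast
 obtain a where a: "((%w. h (w, t0)) has_field_derivative a) (at z0)"
  using z x x0 by (auto simp: field_differentiable_def)
 have "((%(w, s). h (w, s)) has_derivative (%(u, v). a * u + blinfun_apply (blinfun_mult_right (ht (z0, t0))) v))
   (at (z0, t0) within ?X \<times> ?Y)"
 proof (rule has_derivative_partialsI[where fy = "%z t. blinfun_mult_right (ht (z, t))"])
  show "((%w. h (w, t0)) has_derivative (*) a) (at z0 within ?X)"
   using a by (auto simp: has_field_derivative_def intro: has_derivative_at_withinI)
  show "((%s. h (z, s)) has_derivative blinfun_apply (blinfun_mult_right (ht (z, t)))) (at t within ?Y)"
   if "z : ?X" "t : ?Y" for z t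
  proof -
   have "(z, t) : W" using that sub by blast
   from t[OF this] show ?thesis by (simp add: has_field_derivative_def has_derivative_at_withinI)
  qed
  have "continuous_on (?X \<times> ?Y) (%x. blinfun_mult_right (ht x))"
   using continuous_on_subset[OF c sub] by (intro continuous_intros)
  then show "continuous (at (z0, t0) within ?X \<times> ?Y) (%(z, t). blinfun_mult_right (ht (z, t)))"
   using r s by (simp add: continuous_on_eq_continuous_within split_beta')
 qed (use s in auto)
 moreover have "at (z0, t0) within ?X \<times> ?Y = at (z0, t0)"
  by (rule at_within_open) (use r s in \<open>auto intro: open_Times\<close>)
 ultimately have "(h has_derivative (%v. a * fst v + ht (z0, t0) * snd v)) (at x)" by (simp add: x0 case_prod_unfold)
 then show "EX a b. (h has_derivative (%v. a * fst v + b * snd v)) (at x within W)"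
  by (blast intro: has_derivative_at_withinI)
qed

subsection \<open>Circle integrals with parameters\<close>

lemma continuous_on_circlepath_integral:
 assumes c: "continuous_on (X \<times> sphere c r) (%(x, w). \<phi> x w)" and r: "r >= 0"
 shows "continuous_on X (%x. contour_integral (circlepath c r) (\<phi> x))"
proof -
 have "continuous_on X (%x. integral (cbox 0 1)
   (%s. \<phi> x (circlepath c r s) * (2 * pi * \<i> * r * exp (2 * of_real pi * \<i> * s))))"
 proof (rule integral_continuous_on_param)
  have "continuous_on (X \<times> cbox 0 1) (%y. \<phi> (fst y) (circlepath c r (snd y)))"
  proof (rule continuous_on_compose2[OF c[unfolded split_beta], where f="%y. (fst y, circlepath c r (snd y))", unfolded fst_conv snd_conv])
   show "continuous_on (X \<times> cbox 0 1) (%y. (fst y, circlepath c r (snd y)))"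
    unfolding circlepath by (intro continuous_intros)
   show "(%y. (fst y, circlepath c r (snd y))) ` (X \<times> cbox 0 1) \<subseteq> X \<times> sphere c r"
    using r by (auto simp: circlepath dist_norm norm_mult)
  qed
  then show "continuous_on (X \<times> cbox 0 1) (%(x, s). \<phi> x (circlepath c r s) *
    (2 * pi * \<i> * r * exp (2 * of_real pi * \<i> * s)))" by (auto simp: split_beta intro!: continuous_intros)
 qed
 then show ?thesis by (simp add: contour_integral_integral vector_derivative_circlepath)
qed

lemma has_field_derivative_circlepath_integral:
 assumes d: "!!x w. x : U ==> w : sphere c r ==>
    ((%x. \<phi> x w) has_field_derivative \<phi>' x w) (at x)"
  and c: "!!x. x : U ==> continuous_on (sphere c r) (\<phi> x)"
  and c': "continuous_on (U \<times> sphere c r) (%(x, w). \<phi>' x w)"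
  and U: "convex U" "open U" "x : U" and r: "r >= 0"
 shows "((%x. contour_integral (circlepath c r) (\<phi> x)) has_field_derivative
      contour_integral (circlepath c r) (\<phi>' x)) (at x)"
proof -
 let ?v = "%s::real. 2 * of_real pi * \<i> * of_real r * exp (2 * of_real pi * \<i> * of_real s) :: complex"
 have cp: "circlepath c r s : sphere c r" for s using r by (auto simp: circlepath dist_norm norm_mult)
 have "((%x. integral (cbox 0 1) (%s. \<phi> x (circlepath c r s) * ?v s)) has_field_derivative
   integral (cbox 0 1) (%s. \<phi>' x (circlepath c r s) * ?v s)) (at x within U)"
 proof (rule leibniz_rule_field_derivative)
  show "((%x. \<phi> x (circlepath c r s) * ?v s) has_field_derivative \<phi>' x (circlepath c r s) * ?v s)
    (at x within U)" if "x : U" for x s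
   by (rule has_field_derivative_at_within[OF DERIV_cmult_right[OF d[OF that cp]]])
  show "(%s. \<phi> x (circlepath c r s) * ?v s) integrable_on cbox 0 1" if "x : U" for x
  proof (rule integrable_continuous)
   have "continuous_on (cbox 0 1) (%s. \<phi> x (circlepath c r s))" by (rule continuous_on_compose2[OF c[OF that]])
      (use cp in \<open>auto simp: circlepath intro!: continuous_intros\<close>)
   then show "continuous_on (cbox 0 1) (%s. \<phi> x (circlepath c r s) * ?v s)" by (intro continuous_intros)
  qed
  have "continuous_on (U \<times> cbox 0 1) (%y. \<phi>' (fst y) (circlepath c r (snd y)))"
  proof (rule continuous_on_compose2[OF c'[unfolded split_beta], where f="%y. (fst y, circlepath c r (snd y))", unfolded fst_conv snd_conv])
   show "continuous_on (U \<times> cbox 0 1) (%y. (fst y, circlepath c r (snd y)))"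
    unfolding circlepath by (intro continuous_intros)
   show "(%y. (fst y, circlepath c r (snd y))) ` (U \<times> cbox 0 1) \<subseteq> U \<times> sphere c r"
    using cp by auto
  qed
  then show "continuous_on (U \<times> cbox 0 1) (%(x, s). \<phi>' x (circlepath c r s) * ?v s)"
   by (auto simp: split_beta intro!: continuous_intros)
 qed (use U in auto)
 then show ?thesis by (simp add: contour_integral_integral vector_derivative_circlepath at_within_open[OF U(3,2)])
qed

lemma hol2_on_swap:
 assumes "hol2_on h W" shows "hol2_on (%x. h (prod.swap x)) (prod.swap ` W)" unfolding hol2_on_def
proof
 fix x assume "x : prod.swap ` W"
 then have x: "prod.swap x : W" by auto
 then obtain a b where ab: "(h has_derivative (%v. a * fst v + b * snd v)) (at (prod.swap x) within W)"
  using assms unfolding hol2_on_def by blast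
 have im: "prod.swap ` prod.swap ` W = W" by (auto simp: image_image)
 have "(prod.swap has_derivative prod.swap) (at x within prod.swap ` W)"
  unfolding prod.swap_def by (auto intro!: derivative_eq_intros)
 then have "((%x. h (prod.swap x)) has_derivative (%v. a * fst (prod.swap v) + b * snd (prod.swap v)))
   (at x within prod.swap ` W)" by (rule has_derivative_in_compose[where f=prod.swap]) (use ab im in simp)
 then show "EX a b. ((%x. h (prod.swap x)) has_derivative (%v. a * fst v + b * snd v)) (at x within prod.swap ` W)"
  by (intro exI[of _ b] exI[of _ a]) (simp add: add.commute)
qed

text \<open>Partial derivatives are again continuous, by Cauchy's formula for the derivative.\<close>

lemma hol2_on_continuous_deriv_snd:
 assumes h: "hol2_on h W" and W: "open W"
 shows "continuous_on W (%x. deriv (%s. h (fst x, s)) (snd x))" unfolding continuous_on_eq_continuous_at[OF W]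
proof
 fix x assume x: "x : W"
 obtain z0 t0 where x0: "x = (z0, t0)" by force
 obtain A B where AB: "open A" "open B" "(z0, t0) : A \<times> B" "A \<times> B \<subseteq> W"
  using open_prod_elim[OF W] x x0 by metis
 obtain r where r: "r > 0" "cball t0 r \<subseteq> B" using AB open_contains_cball by (metis mem_Sigma_iff)
 let ?V = "A \<times> ball t0 r"
 let ?g = "%x. 1 / (2 * of_real pi * \<i>) *
   contour_integral (circlepath t0 r) (%u. h (fst x, u) / (u - snd x)^2)"
 have inW: "!!z u. z : A ==> u : sphere t0 r ==> (z, u) : W" using AB r sphere_cball[of t0 r] by blast
 have V: "open ?V" "x : ?V" using AB x0 r by (auto intro: open_Times)
 have holB: "(%s. h (z, s)) holomorphic_on B" if "z : A" for z by (rule hol2_on_slice_snd[OF h]) (use that AB in auto)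
 have "deriv (%s. h (fst y, s)) (snd y) = ?g y" if "y : ?V" for y
 proof -
  have "(%s. h (fst y, s)) holomorphic_on cball t0 r" by (rule holomorphic_on_subset[OF holB]) (use that r in auto)
  then have "((%s. h (fst y, s)) has_field_derivative ?g y) (at (snd y))"
   by (intro Cauchy_derivative_integral_circlepath(2) holomorphic_on_imp_continuous_on)
     (use that in \<open>auto intro: holomorphic_on_subset\<close>)
  then show ?thesis by (rule DERIV_imp_deriv)
 qed
 moreover have "continuous_on ?V ?g"
 proof (intro continuous_intros continuous_on_circlepath_integral)
  have "continuous_on (?V \<times> sphere t0 r) (%y. h (fst (fst y), snd y))"
   by (rule continuous_on_compose2[OF hol2_on_imp_continuous_on[OF h]])
     (use inW in \<open>auto intro!: continuous_intros simp del: mem_sphere\<close>)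
  then show "continuous_on (?V \<times> sphere t0 r) (%(x, u). h (fst x, u) / (u - snd x)\<^sup>2)"
   by (auto simp: split_beta intro!: continuous_intros)
 qed (use r in auto)
 ultimately have "continuous_on ?V (%x. deriv (%s. h (fst x, s)) (snd x))" by (simp cong: continuous_on_cong)
 then show "isCont (%x. deriv (%s. h (fst x, s)) (snd x)) x" using V continuous_on_eq_continuous_at[OF V(1)] by blast
qed

lemma hol2_on_continuous_deriv_fst:
 assumes h: "hol2_on h W" and W: "open W"
 shows "continuous_on W (%x. deriv (%w. h (w, snd x)) (fst x))"
proof -
 have "prod.swap ` W = prod.swap -` W" by force
 then have "open (prod.swap ` W)" using open_vimage[OF W continuous_on_swap] by simp
 from hol2_on_continuous_deriv_snd[OF hol2_on_swap[OF h] this]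
 have "continuous_on (prod.swap ` W) (%x. deriv (%s. h (s, fst x)) (snd x))" by simp
 then have "continuous_on W (%x. deriv (%s. h (s, fst (prod.swap x))) (snd (prod.swap x)))"
  by (rule continuous_on_compose2) (auto intro: continuous_on_swap)
 then show ?thesis by (simp only: fst_swap snd_swap)
qed

section \<open>Removable singularities at the origin\<close>

text \<open>
 A removable singularity at the origin with value \<open>c\<close>.  The value \<open>f 0\<close> does not
 enter, as for the germs of sections of \<open>H'\<close>.
\<close>

definition ext0 :: "(complex => complex) => complex => bool" where
 "ext0 f c \<longleftrightarrow> (EX F. F analytic_on {0} & F 0 = c & (EV z. f z = F z))"

lemma ext0I: "F analytic_on {0} ==> (EV z. f z = F z) ==> F 0 = c ==> ext0 f c" by (auto simp: ext0_def)

lemma ext0_analytic: "F analytic_on {0} ==> ext0 F (F 0)" by (auto simp: ext0_def)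

lemma ext0_cong:
 assumes "ext0 f c" "EV z. g z = f z" shows "ext0 g c"
proof -
 obtain F where F: "F analytic_on {0}" "F 0 = c" "EV z. f z = F z" using assms by (auto simp: ext0_def)
 have "EV z. g z = F z" using F(3) assms(2) by eventually_elim simp
 then show ?thesis using F by (auto simp: ext0_def)
qed

lemma ext0_tendsto:
 assumes "ext0 f c" shows "f \<midarrow>0\<rightarrow> c"
proof -
 obtain F where F: "F analytic_on {0}" "F 0 = c" "EV z. f z = F z" using assms by (auto simp: ext0_def)
 have "F \<midarrow>0\<rightarrow> c" using analytic_at_imp_isCont[OF F(1)] F(2) by (simp add: isCont_def)
 then show ?thesis by (rule Lim_transform_eventually) (use F(3) in \<open>auto elim: eventually_mono\<close>)
qed

lemma ext0_unique: "ext0 f c ==> ext0 f d ==> c = d" using ext0_tendsto LIM_unique by blast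

lemma ext0_const: "ext0 (%z. c) c"
 and ext0_ident: "ext0 (%z. z) 0" by (rule ext0I[of "%z. c"] ext0I[of "%z. z"]; simp)+

lemma ext0_add: assumes "ext0 f c" "ext0 g d" shows "ext0 (%z. f z + g z) (c + d)"
proof -
 obtain F where F: "F analytic_on {0}" "F 0 = c" "EV z. f z = F z" using assms by (auto simp: ext0_def)
 obtain G where G: "G analytic_on {0}" "G 0 = d" "EV z. g z = G z" using assms by (auto simp: ext0_def)
 have "EV z. f z + g z = F z + G z" using F(3) G(3) by eventually_elim simp
 then show ?thesis
  by (rule ext0I[of "%z. F z + G z", rotated]) (use F G in \<open>auto intro: analytic_intros\<close>)
qed

lemma ext0_mult: assumes "ext0 f c" "ext0 g d" shows "ext0 (%z. f z * g z) (c * d)"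
proof -
 obtain F where F: "F analytic_on {0}" "F 0 = c" "EV z. f z = F z" using assms by (auto simp: ext0_def)
 obtain G where G: "G analytic_on {0}" "G 0 = d" "EV z. g z = G z" using assms by (auto simp: ext0_def)
 have "EV z. f z * g z = F z * G z" using F(3) G(3) by eventually_elim simp
 then show ?thesis
  by (rule ext0I[of "%z. F z * G z", rotated]) (use F G in \<open>auto intro: analytic_intros\<close>)
qed

lemma ext0_uminus: "ext0 f c ==> ext0 (%z. - f z) (- c)" using ext0_mult[OF ext0_const[of "-1"]] by auto

lemma ext0_diff: "ext0 f c ==> ext0 g d ==> ext0 (%z. f z - g z) (c - d)" using ext0_add[OF _ ext0_uminus] by auto

lemma ext0_inverse: assumes "ext0 f c" "c ~= 0" shows "ext0 (%z. inverse (f z)) (inverse c)"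
proof -
 obtain F where F: "F analytic_on {0}" "F 0 = c" "EV z. f z = F z" using assms by (auto simp: ext0_def)
 have "EV z. inverse (f z) = inverse (F z)" using F(3) by eventually_elim simp
 then show ?thesis
  by (rule ext0I[of "%z. inverse (F z)", rotated]) (use F assms in \<open>auto intro: analytic_intros\<close>)
qed

lemma ext0_divide: "ext0 f c ==> ext0 g d ==> d ~= 0 ==> ext0 (%z. f z / g z) (c / d)"
 unfolding divide_inverse by (intro ext0_mult ext0_inverse)

lemma ext0_power: "ext0 f c ==> ext0 (%z. f z ^ n) (c ^ n)" by (induction n) (auto intro: ext0_const ext0_mult)

lemma ext0_powi:
 assumes "n >= 0" shows "ext0 (%z. z powi n) (0 powi n)"
 using ext0_power[OF ext0_ident, of "nat n"] assms by (simp add: power_int_def)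

lemmas ext0_intros = ext0_const ext0_ident ext0_add ext0_mult ext0_diff ext0_uminus
 ext0_power ext0_powi ext0_inverse ext0_divide

lemma ext0_holomorphic:
 assumes "ext0 f c"
 obtains r F where "r > 0" "F holomorphic_on ball 0 r" "F 0 = c" "!!z. z : ball 0 r - {0} ==> f z = F z"
proof -
 obtain F where F: "F analytic_on {0}" "F 0 = c" "EV z. f z = F z" using assms by (auto simp: ext0_def)
 obtain r1 where r1: "r1 > 0" "F holomorphic_on ball 0 r1" using F(1) by (auto simp: analytic_at_ball)
 obtain r2 where r2: "r2 > 0" "!!z. z ~= 0 ==> dist z 0 < r2 ==> f z = F z" using F(3) by (auto simp: eventually_at)
 show ?thesis
  by (rule that[of "min r1 r2" F]) (use F r1 r2 in \<open>auto intro: holomorphic_on_subset simp: dist_norm\<close>)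
qed

lemma ext0_nonzero: "ext0 f c ==> c ~= 0 ==> EV z. f z ~= 0" using ext0_tendsto tendsto_imp_eventually_ne by blast

lemma ext0_holomorphic_extension:
 assumes f: "f holomorphic_on ball 0 r - {0}" and e: "ext0 f c" and r: "r > 0"
 shows "(%z. if z = 0 then c else f z) holomorphic_on ball 0 r"
 using removable_singularity[OF f _ ext0_tendsto[OF e]] by auto

lemma ext0_of_tendsto:
 assumes f: "f holomorphic_on ball 0 r - {0}" and e: "f \<midarrow>0\<rightarrow> c" and r: "r > 0"
 shows "ext0 f c"
proof (rule ext0I[of "%z. if z = 0 then c else f z"])
 have "(%z. if z = 0 then c else f z) holomorphic_on ball 0 r" using removable_singularity[OF f _ e] by auto
 then show "(%z. if z = 0 then c else f z) analytic_on {0}" using r by (auto simp: analytic_at_ball)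
qed (auto simp: eventually_at intro!: exI[of _ 1])

lemma ext0_of_growth:
 assumes f: "f holomorphic_on ball 0 r - {0}" and r: "r > 0"
  and b: "EV z. norm (f z) <= C / norm z ^ N"
 shows "ext0 (%z. z ^ Suc N * f z) 0"
proof (rule ext0_of_tendsto[OF _ _ r])
 show "(%z. z ^ Suc N * f z) holomorphic_on ball 0 r - {0}" using f by (intro holomorphic_intros)
 have nz: "EV z. z ~= (0::complex)" by (simp add: eventually_at_filter)
 have "EV z. norm (z ^ Suc N * f z) <= norm (of_real C * z :: complex)" using b nz
 proof eventually_elim
  case (elim z)
  have "norm (z ^ Suc N * f z) = norm z * (norm z ^ N * norm (f z))" by (simp add: norm_mult norm_power)
  also have "\<dots> <= norm z * C" using elim by (intro mult_left_mono) (simp_all add: field_simps)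
  also have "\<dots> <= norm (of_real C * z)" by (simp add: norm_mult mult.commute mult_right_mono)
  finally show ?case .
 qed
 moreover have "(%z. of_real C * z :: complex) \<midarrow>0\<rightarrow> of_real C * 0" by (intro tendsto_intros)
 ultimately show "(%z. z ^ Suc N * f z) \<midarrow>0\<rightarrow> 0"
  using Lim_null_comparison[OF _ tendsto_norm_zero[of "%z. of_real C * z :: complex"]] by simp
qed

lemma powi_ev: "\<forall>\<^sub>F z in at (0::complex). z powi (m + n) = z powi m * z powi n"
 by (auto simp: eventually_at_filter power_int_add)

lemma ev_nz: "EV z. z ~= (0::complex)" by (simp add: eventually_at_filter)

lemma ext0_powi_unit_nonneg:
 assumes "ext0 (%z. z powi n * u z) d" "ext0 u c" "c ~= 0"
 shows "n >= 0"
proof (rule ccontr)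
 assume "~ n >= 0"
 then have n: "n < 0" by simp
 have "ext0 (%z. z powi (-n) * (z powi n * u z)) (0 powi (-n) * d)" using n by (intro ext0_intros assms) auto
 moreover have "EV z. u z = z powi (-n) * (z powi n * u z)" using ev_nz by eventually_elim (simp add: power_int_minus)
 ultimately have "ext0 u (0 powi (-n) * d)" by (rule ext0_cong)
 then have "c = 0 powi (-n) * d" using assms ext0_unique by blast
 then show False using n assms(3) by (simp add: power_int_0_left_if)
qed

lemma ext0_deriv:
 assumes "ext0 f c" shows "EX d. ext0 (deriv f) d"
proof -
 obtain r F where rF: "r > 0" "F holomorphic_on ball 0 r" "F 0 = c" "!!z. z : ball 0 r - {0} ==> f z = F z"
  using ext0_holomorphic[OF assms] by metis
 have "deriv F analytic_on {0}" using rF by (auto simp: analytic_at_ball intro!: holomorphic_deriv)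
 moreover have "EV z. deriv f z = deriv F z"
 proof -
  have "deriv f z = deriv F z" if "z : ball 0 r - {0}" for z
  proof (rule deriv_cong_ev)
   have "\<forall>\<^sub>F w in nhds z. w : ball 0 r - {0}" using that by (intro eventually_nhds_in_open) auto
   then show "\<forall>\<^sub>F w in nhds z. f w = F w" by eventually_elim (use rF in auto)
  qed simp
  then show ?thesis unfolding eventually_at using rF(1) by (intro exI[of _ r]) (auto simp: dist_norm)
 qed
 ultimately show ?thesis by (auto simp: ext0_def)
qed

lemma ext0_div_ident:
 assumes "ext0 f 0" shows "EX d. ext0 (%z. f z / z) d"
proof -
 obtain r F where rF: "r > 0" "F holomorphic_on ball 0 r" "F 0 = 0" "!!z. z : ball 0 r - {0} ==> f z = F z"
  using ext0_holomorphic[OF assms] by metis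
 have "(F has_field_derivative deriv F 0) (at 0)" using rF by (intro holomorphic_derivI[of _ "ball 0 r"]) auto
 then have "(%z. F z / z) \<midarrow>0\<rightarrow> deriv F 0" using rF by (simp add: has_field_derivative_iff)
 moreover have "EV z. F z / z = f z / z"
  unfolding eventually_at using rF by (intro exI[of _ r]) (auto simp: dist_norm)
 ultimately have "(%z. f z / z) \<midarrow>0\<rightarrow> deriv F 0" by (rule Lim_transform_eventually)
 moreover have "(%z. F z / z) holomorphic_on ball 0 r - {0}"
  using rF by (intro holomorphic_intros) (auto intro: holomorphic_on_subset)
 then have "(%z. f z / z) holomorphic_on ball 0 r - {0}" by (rule holomorphic_transform) (use rF in auto)
 ultimately show ?thesis using ext0_of_tendsto rF(1) by blast
qed

lemma meromorphic_order:
 assumes e: "ext0 (%z. z ^ N * f z) c"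
 shows "(EV z. f z = 0) \<or>
  (EX n u c. ext0 u c & c ~= 0 & (EV z. f z = z powi n * u z))"
proof -
 obtain r F where rF: "r > 0" "F holomorphic_on ball 0 r" "F 0 = c"
   "!!z. z : ball 0 r - {0} ==> z ^ N * f z = F z" using ext0_holomorphic[OF e] by metis
 show ?thesis
 proof (cases "ALL z:ball 0 r. F z = 0")
  case True
  have "f z = 0" if "z : ball 0 r - {0}" for z using rF(4)[OF that] that True by auto
  then show ?thesis unfolding eventually_at using rF(1) by (intro disjI1 exI[of _ r]) (auto simp: dist_norm)
 next
  case False
  obtain g n s where g: "0 < s" "ball (0::complex) s \<subseteq> ball 0 r" "g holomorphic_on ball 0 s"
    "!!w. w : ball 0 s ==> F w = (w - 0) ^ n * g w" "!!w. w : ball 0 s ==> g w ~= 0"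
  proof (cases "F 0 = 0")
   case True
   have nc: "~ F constant_on ball 0 r" using True False rF(1) unfolding constant_on_def by (metis centre_in_ball)
   show ?thesis
   proof (rule holomorphic_factor_zero_nonconstant[OF rF(2) _ _ _ True nc])
    fix g s n assume h: "0 < (n::nat)" "0 < s" "ball (0::complex) s \<subseteq> ball 0 r" "g holomorphic_on ball 0 s"
     "!!w. w : ball 0 s ==> F w = (w - 0) ^ n * g w" "!!w. w : ball 0 s ==> g w ~= 0"
    show thesis by (rule that[of s g n]) (fact h)+
   qed (use rF(1) in auto)
  next
   case nz: False
   have "continuous_on (ball 0 r) F" using rF(2) by (rule holomorphic_on_imp_continuous_on)
   then have "isCont F 0" using rF(1) by (simp add: continuous_on_eq_continuous_at)
   from continuous_at_avoid[OF this nz] obtain e where e: "e > 0" "ALL y. dist 0 y < e --> F y ~= 0" by blast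
   show ?thesis by (rule that[of "min e r" F 0]) (use e rF in \<open>auto intro: holomorphic_on_subset\<close>)
  qed
  have "ext0 g (g 0)" using g by (intro ext0_analytic) (auto simp: analytic_at_ball)
  moreover have "g 0 ~= 0" using g by auto
  moreover have "f z = z powi (int n - int N) * g z" if "z : ball 0 s - {0}" for z
   using rF(4)[of z] g(4)[of z] that g(2) by (auto simp: power_int_diff field_simps)
  then have "EV z. f z = z powi (int n - int N) * g z"
   unfolding eventually_at using g(1) by (intro exI[of _ s]) (auto simp: dist_norm)
  ultimately show ?thesis by blast
 qed
qed

lemma meromorphic_common_order:
 assumes "ext0 (%z. z ^ N * f z) c" "ext0 (%z. z ^ N * g z) d"
  and "~ (EV z. f z = 0 & g z = 0)"
 shows "EX n u v c d. ext0 u c & ext0 v d & (c ~= 0 \<or> d ~= 0) &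
  (EV z. f z = z powi n * u z & g z = z powi n * v z)"
proof -
 have *: "EX n u v c d. ext0 u c & ext0 v d & c ~= 0 &
  (EV z. f z = z powi n * u z & g z = z powi n * v z)"
  if f: "ext0 u c" "c ~= 0" "EV z. f z = z powi n * u z"
   and g: "(EV z. g z = 0) \<or> (n <= m & ext0 v d & (EV z. g z = z powi m * v z))"
  for f g u c n v d m using g
 proof
  assume "EV z. g z = 0"
  then have "EV z. f z = z powi n * u z & g z = z powi n * 0" using f(3) by eventually_elim simp
  then show ?thesis using f ext0_const[of 0] by blast
 next
  assume g: "n <= m & ext0 v d & (EV z. g z = z powi m * v z)"
  then have "EV z. g z = z powi m * v z" by blast
  then have "EV z. f z = z powi n * u z & g z = z powi n * (z powi (m - n) * v z)"
   using f(3) powi_ev[of n "m - n"] by eventually_elim simp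
  moreover have "ext0 (%z. z powi (m - n) * v z) (0 powi (m - n) * d)" using g by (intro ext0_intros) auto
  ultimately show ?thesis using f by blast
 qed
 from meromorphic_order[OF assms(1)] meromorphic_order[OF assms(2)] show ?thesis
 proof (elim disjE exE conjE)
  assume "EV z. f z = 0" "EV z. g z = 0"
  then have "EV z. f z = 0 & g z = 0" by eventually_elim simp
  then show ?thesis using assms(3) by blast
 next
  fix m v d assume "EV z. f z = 0" "ext0 v d" "d ~= 0" "EV z. g z = z powi m * v z"
  from *[OF this(2-4), of f] this(1) show ?thesis by (auto simp: conj_commute) blast
 next
  fix m v d assume "EV z. g z = 0" "ext0 v d" "d ~= 0" "EV z. f z = z powi m * v z"
  from *[OF this(2-4), of g] this(1) show ?thesis by blast
 next
  fix m v d n u c assume f: "ext0 u c" "c ~= 0" "EV z. f z = z powi n * u z"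
   and g: "ext0 v d" "d ~= 0" "EV z. g z = z powi m * v z"
  show ?thesis
  proof (cases "n <= m")
   case True
   with *[OF f, of g m v d] g show ?thesis by blast
  next
   case False
   with *[OF g, of f n u c] f show ?thesis by (auto simp: conj_commute) blast
  qed
 qed
qed

text \<open>
 The equation \<open>z f' = -1 + z^(-k) \<theta>\<close> is solved coefficientwise: \<open>n f_n = - \<delta>_(n,0)\<close> for
 \<open>n < -k\<close>.  The coefficient at \<open>n = 0\<close> forces \<open>k \<ge> 0\<close>, the others show that only the order
 \<open>-k\<close> is left.
\<close>

lemma euler_equation_pole:
 fixes k :: int
 assumes f: "f holomorphic_on ball 0 r - {0}" "r > 0" and e: "ext0 (%z. z ^ N * f z) c"
  and \<theta>: "ext0 \<theta> d" and eq: "EV z. z * deriv f z = - 1 + z powi (- k) * \<theta> z"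
 shows "k >= 0 & (EX h w w0. ext0 w w0 & (EV z. f z = h * z powi (- k) + z powi (1 - k) * w z))"
proof -
 obtain g where g: "g analytic_on {0}" "EV z. z ^ N * f z = g z" using e by (auto simp: ext0_def)
 obtain T where T: "T analytic_on {0}" "EV z. \<theta> z = T z" using \<theta> by (auto simp: ext0_def)
 obtain GF where "g has_fps_expansion GF" using analytic_at_imp_has_fps_expansion_0[OF g(1)] by blast
 then have G: "g has_laurent_expansion fps_to_fls GF" by (rule has_laurent_expansion_fps)
 obtain TF where "T has_fps_expansion TF" using analytic_at_imp_has_fps_expansion_0[OF T(1)] by blast
 then have TL: "T has_laurent_expansion fps_to_fls TF" by (rule has_laurent_expansion_fps)
 have "(%z. g z * z powi (- int N)) has_laurent_expansion fps_to_fls GF * fls_X_intpow (- int N)"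
  by (intro laurent_expansion_intros G)
 moreover have "EV z. g z * z powi (- int N) = f z"
  using g(2) ev_nz by eventually_elim (auto simp: power_int_minus field_simps)
 ultimately have "f has_laurent_expansion fps_to_fls GF * fls_X_intpow (- int N)"
  using has_laurent_expansion_cong by fast
 then obtain F where F: "f has_laurent_expansion F" by blast
 have L: "(%z. z * deriv f z) has_laurent_expansion fls_X * fls_deriv F" by (intro laurent_expansion_intros F)
 have R: "(%z. - 1 + z powi (- k) * T z) has_laurent_expansion - 1 + fls_X_intpow (- k) * fps_to_fls TF"
  by (intro laurent_expansion_intros TL)
 have "EV z. z * deriv f z = - 1 + z powi (- k) * T z" using eq T(2) by eventually_elim simp
 then have "(%z. z * deriv f z) has_laurent_expansion - 1 + fls_X_intpow (- k) * fps_to_fls TF"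
  using R has_laurent_expansion_cong by fast
 from has_laurent_expansion_unique[OF L this]
 have FE: "fls_X * fls_deriv F = - 1 + fls_X_intpow (- k) * fps_to_fls TF" .
 have nth: "of_int n * fls_nth F n = (if n = 0 then - 1 else 0)" if "n < - k" for n
 proof -
  have "fls_nth (fls_X * fls_deriv F) n = of_int n * fls_nth F n" by (simp add: fls_X_times_conv_shift)
  moreover have "fls_nth (- 1 + fls_X_intpow (- k) * fps_to_fls TF) n = (if n = 0 then - 1 else 0)"
   using that by (simp add: fls_shifted_times_simps)
  ultimately show ?thesis using FE by simp
 qed
 have k: "k >= 0" using nth[of 0] by force
 have F0: "fls_nth F n = 0" if "n < - k" for n using nth[OF that] that k by auto
 define H where "H = fls_shift (- k) F"
 have H0: "fls_subdegree H >= 0"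
 proof (cases "H = 0")
  case False
  then show ?thesis by (intro fls_subdegree_geI) (auto simp: H_def F0)
 qed simp
 have HL: "(%z. z powi k * f z) has_laurent_expansion H"
 proof -
  have "(%z. z powi k * f z) has_laurent_expansion fls_X_intpow k * F" by (intro laurent_expansion_intros F)
  then show ?thesis by (simp add: H_def fls_X_intpow_times_conv_shift)
 qed
 have "ext0 (%z. z powi k * f z) (eval_fls H 0)"
 proof (rule ext0I[of "eval_fls H"])
  show "eval_fls H analytic_on {0}"
   using HL H0 by (intro analytic_on_eval_fls) (auto simp: has_laurent_expansion_def zero_ereal_def)
  show "EV z. z powi k * f z = eval_fls H z" using HL by (auto simp: has_laurent_expansion_def elim: eventually_mono)
 qed simp
 then obtain h where h: "ext0 (%z. z powi k * f z) h" by blast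
 then have "ext0 (%z. z powi k * f z - h) 0" using ext0_diff[OF h ext0_const[of h]] by simp
 then obtain w0 where w: "ext0 (%z. (z powi k * f z - h) / z) w0" using ext0_div_ident by blast
 have "EV z. f z = h * z powi (- k) + z powi (1 - k) * ((z powi k * f z - h) / z)" using ev_nz
 proof eventually_elim
  case (elim z)
  have "z powi (1 - k) = z * z powi (- k)" using elim power_int_add[of z 1 "- k"] by simp
  moreover have "z powi (- k) * (z powi k * f z) = f z" using elim by (simp add: power_int_minus)
  ultimately show ?case using elim by (simp add: field_simps)
 qed
 with w k show ?thesis by blast
qed

section \<open>Normal form of a lattice over a point\<close>

definition mat2 :: "complex => complex => complex => complex => complex^2^2" where
 "mat2 p q r s = vector [vector [p, q], vector [r, s]]"

lemma mat2_nth [simp]: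
 "mat2 p q r s $ 1 $ 1 = p" "mat2 p q r s $ 1 $ 2 = q"
 "mat2 p q r s $ 2 $ 1 = r" "mat2 p q r s $ 2 $ 2 = s" by (simp_all add: mat2_def)

lemma mat2_eqI:
 fixes A B :: "complex^2^2"
 assumes "A$1$1 = B$1$1" "A$1$2 = B$1$2" "A$2$1 = B$2$1" "A$2$2 = B$2$2"
 shows "A = B" using assms by (simp add: vec_eq_iff forall_2)

lemma matrix_mult2 [simp]:
 "((A::complex^2^2) ** B) $ i $ j = A$i$1 * B$1$j + A$i$2 * B$2$j" by (simp add: matrix_matrix_mult_def sum_2)

lemma matrix_vec2 [simp]:
 "((A::complex^2^2) *v x) $ i = A$i$1 * x$1 + A$i$2 * x$2" by (simp add: matrix_vector_mult_def sum_2)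

definition nf_mat :: "int => int => complex => complex => complex^2^2" where
 "nf_mat a b h z = mat2 (z powi a) 0 (h * z powi (b - 1)) (z powi b)"

definition ext0_mat :: "(complex => complex^2^2) => complex^2^2 => bool" where
 "ext0_mat U U0 \<longleftrightarrow> (ALL i j. ext0 (%z. U z $ i $ j) (U0 $ i $ j))"

text \<open>
 \<open>M\<close> is the inverse of the frame \<open>E\<close> in a chart: its columns are the coordinates of
 a basis of the lattice. Up to a unit \<open>U\<close>, that is, a change of basis, they are those of the
 triangular basis.
\<close>

definition lattice_nf :: "(complex => complex^2^2) => int => int => complex => bool" where
 "lattice_nf M a b h \<longleftrightarrow> b <= a + 1 &
   (EX U U0. ext0_mat U U0 & det U0 ~= 0 & (EV z. M z = nf_mat a b h z ** U z))"

lemma eventually_at0_deriv_cong: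
 fixes f g :: "complex => complex"
 assumes "EV z. f z = g z" shows "EV z. deriv f z = deriv g z"
proof -
 obtain d where d: "d > 0" "!!z. z ~= 0 ==> dist z 0 < d ==> f z = g z" using assms unfolding eventually_at by blast
 have "deriv f z = deriv g z" if "z ~= 0" "dist z 0 < d" for z
 proof (rule deriv_cong_ev)
  have "\<forall>\<^sub>F w in nhds z. w : ball 0 d - {0}"
   using that by (intro eventually_nhds_in_open) (auto simp: dist_commute)
  then show "\<forall>\<^sub>F w in nhds z. f w = g w"
   by eventually_elim (use d in \<open>auto simp: dist_commute\<close>)
 qed simp
 then show ?thesis using d(1) unfolding eventually_at by blast
qed

lemma eventually_at0_in_ball: "r > 0 ==> \<forall>\<^sub>F z in at (0::complex). z : ball 0 r - {0}"
 unfolding eventually_at by (intro exI[of _ r]) (auto simp: dist_commute)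

lemma ext0_deriv_ball:
 assumes "y holomorphic_on ball 0 r" "r > 0"
 shows "ext0 y (y 0)" "ext0 (deriv y) (deriv y 0)"
proof -
 have "deriv y holomorphic_on ball 0 r" by (intro holomorphic_deriv assms) simp
 then show "ext0 y (y 0)" "ext0 (deriv y) (deriv y 0)"
  using assms by (auto intro!: ext0_analytic simp: analytic_at_ball)
qed

text \<open>
 Hermite normal form with respect to \<open>e\<^sub>1, e\<^sub>2\<close>: the orders \<open>a\<close> and \<open>b\<close> come from the first
 coordinates and from the determinant; a first basis vector is \<open>z^a (e\<^sub>1 + f e\<^sub>2)\<close> with a Laurent
 tail \<open>f\<close>.  Stability under \<open>z\<^sup>2 \<nabla>\<^sub>z\<close> is the Euler equation for \<open>f\<close>, so that
 \<open>f\<close> is a monomial modulo \<open>z^(b-a)\<close>.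
\<close>

lemma lattice_normal_form_exists:
 fixes p1 p2 q1 q2 :: "complex => complex" and \<beta> :: "complex => complex^2^2"
 assumes r: "r > 0"
  and hol: "p1 holomorphic_on ball 0 r - {0}" "p2 holomorphic_on ball 0 r - {0}"
   "q1 holomorphic_on ball 0 r - {0}" "q2 holomorphic_on ball 0 r - {0}"
  and mer: "EX c. ext0 (%z. z ^ N * p1 z) c" "EX c. ext0 (%z. z ^ N * p2 z) c"
   "EX c. ext0 (%z. z ^ N * q1 z) c" "EX c. ext0 (%z. z ^ N * q2 z) c"
  and det: "!!z. z : ball 0 r - {0} ==> p1 z * q2 z - p2 z * q1 z ~= 0"
  and \<beta>: "ext0_mat \<beta> \<beta>0"
  and ode: "!!z. z : ball 0 r - {0} ==> z\<^sup>2 * deriv p1 z = p1 z * \<beta> z $1$1 + p2 z * \<beta> z $2$1"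
    "!!z. z : ball 0 r - {0} ==> z\<^sup>2 * deriv p2 z = p1 z * \<beta> z $1$2 + p2 z * \<beta> z $2$2"
    "!!z. z : ball 0 r - {0} ==> z\<^sup>2 * deriv q1 z + z * p1 z = q1 z * \<beta> z $1$1 + q2 z * \<beta> z $2$1"
    "!!z. z : ball 0 r - {0} ==> z\<^sup>2 * deriv q2 z + z * p2 z = q1 z * \<beta> z $1$2 + q2 z * \<beta> z $2$2"
 shows "EX a b h. lattice_nf (%z. mat2 (p1 z) (p2 z) (q1 z) (q2 z)) a b h"
proof -
 note evr = eventually_at0_in_ball[OF r]
 have ntriv: "~ (EV z. p1 z = 0 & p2 z = 0)"
 proof
  assume "EV z. p1 z = 0 & p2 z = 0"
  then have "\<forall>\<^sub>F z in at (0::complex). False" using evr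
  proof eventually_elim
   case (elim z)
   show ?case using det[OF elim(2)] elim(1) by simp
  qed
  then show False by simp
 qed
 obtain cp1 cp2 where cp: "ext0 (%z. z ^ N * p1 z) cp1" "ext0 (%z. z ^ N * p2 z) cp2" using mer(1,2) by blast
 from meromorphic_common_order[OF cp ntriv] obtain a u1 u2 c1 c2 where u: "ext0 u1 c1" "ext0 u2 c2" "c1 ~= 0 \<or> c2 ~= 0"
  and pu: "EV z. p1 z = z powi a * u1 z & p2 z = z powi a * u2 z" by blast
 define d where "d = (%z. p1 z * q2 z - p2 z * q1 z)"
 obtain \<delta> where "ext0 (%z. z ^ (N + N) * d z) \<delta>"
 proof -
  obtain x1 x2 y1 y2 where "ext0 (%z. z ^ N * p1 z) x1" "ext0 (%z. z ^ N * p2 z) x2"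
   "ext0 (%z. z ^ N * q1 z) y1" "ext0 (%z. z ^ N * q2 z) y2" using mer by blast
  then have "ext0 (%z. (z ^ N * p1 z) * (z ^ N * q2 z) - (z ^ N * p2 z) * (z ^ N * q1 z)) (x1 * y2 - x2 * y1)"
   by (intro ext0_diff ext0_mult)
  then show ?thesis by (intro that[of "x1 * y2 - x2 * y1"]) (simp add: d_def power_add algebra_simps)
 qed
 from meromorphic_order[OF this] obtain m v v0 where v: "ext0 v v0" "v0 ~= 0"
  and dv: "EV z. d z = z powi m * v z"
 proof (elim disjE exE conjE)
  assume "EV z. d z = 0"
  then have "\<forall>\<^sub>F z in at (0::complex). False" using evr
  proof eventually_elim
   case (elim z)
   show ?case using det[OF elim(2)] elim(1) by (simp add: d_def)
  qed
  then show ?thesis by simp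
 qed (use that in blast)
 define b where "b = m - a"
 \<comment> \<open>a vector \<open>y\<close> on which the first coordinate is exactly \<open>z^a\<close>\<close>
 obtain y1 y2 \<rho> where \<rho>: "\<rho> > 0" and yh: "y1 holomorphic_on ball 0 \<rho>" "y2 holomorphic_on ball 0 \<rho>"
  and uy: "EV z. u1 z * y1 z + u2 z * y2 z = 1"
 proof -
  have *: "EX \<rho> y. \<rho> > 0 & y holomorphic_on ball 0 \<rho> & (EV z. u z * y z = 1)"
   if u: "ext0 u c" "c ~= 0" for u c
  proof -
   obtain \<rho> y where y: "\<rho> > 0" "y holomorphic_on ball 0 \<rho>" "!!z. z : ball 0 \<rho> - {0} ==> inverse (u z) = y z"
    using ext0_holomorphic[OF ext0_inverse[OF u]] by metis
   have "EV z. u z * y z = 1" using ext0_nonzero[OF u] eventually_at0_in_ball[OF y(1)]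
   proof eventually_elim
    case (elim z) show ?case using elim(1) y(3)[OF elim(2)] by (metis right_inverse)
   qed
   with y show ?thesis by blast
  qed
  show ?thesis
  proof (cases "c1 = 0")
   case False
   from *[OF u(1) this] obtain \<rho> y where "\<rho> > 0" "y holomorphic_on ball 0 \<rho>" "EV z. u1 z * y z = 1" by blast
   then show ?thesis by (intro that[of \<rho> y "%_. 0"]) auto
  next
   case True
   then have "c2 ~= 0" using u(3) by simp
   from *[OF u(2) this] obtain \<rho> y where "\<rho> > 0" "y holomorphic_on ball 0 \<rho>" "EV z. u2 z * y z = 1" by blast
   then show ?thesis by (intro that[of \<rho> "%_. 0" y]) auto
  qed
 qed
 note ye = ext0_deriv_ball[OF yh(1) \<rho>] ext0_deriv_ball[OF yh(2) \<rho>]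
 define s where "s = (%z. q1 z * y1 z + q2 z * y2 z)"
 define \<eta>1 where "\<eta>1 = (%z. \<beta> z $1$1 * y1 z + \<beta> z $1$2 * y2 z + z\<^sup>2 * deriv y1 z)"
 define \<eta>2 where "\<eta>2 = (%z. \<beta> z $2$1 * y1 z + \<beta> z $2$2 * y2 z + z\<^sup>2 * deriv y2 z)"
 define \<theta> where "\<theta> = (%z. v z * (y1 z * \<eta>2 z - y2 z * \<eta>1 z))"
 have \<beta>e: "ext0 (%z. \<beta> z $ i $ j) (\<beta>0 $ i $ j)" for i j using \<beta> by (simp add: ext0_mat_def)
 have \<eta>1: "ext0 \<eta>1 (\<beta>0$1$1 * y1 0 + \<beta>0$1$2 * y2 0 + 0\<^sup>2 * deriv y1 0)" (is "ext0 _ ?\<eta>10")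
  unfolding \<eta>1_def by (intro ext0_add ext0_mult ext0_power ext0_ident \<beta>e ye)
 have \<eta>2: "ext0 \<eta>2 (\<beta>0$2$1 * y1 0 + \<beta>0$2$2 * y2 0 + 0\<^sup>2 * deriv y2 0)" (is "ext0 _ ?\<eta>20")
  unfolding \<eta>2_def by (intro ext0_add ext0_mult ext0_power ext0_ident \<beta>e ye)
 have \<theta>: "ext0 \<theta> (v0 * (y1 0 * ?\<eta>20 - y2 0 * ?\<eta>10))"
  unfolding \<theta>_def by (intro ext0_diff ext0_mult v(1) ye \<eta>1 \<eta>2)
 have qs: "EV z. q1 z = s z * u1 z - z powi b * v z * y2 z & q2 z = s z * u2 z + z powi b * v z * y1 z"
  using pu uy dv ev_nz
 proof eventually_elim
  case (elim z)
  have "z powi a * (z powi b * v z) = d z" using elim by (simp add: b_def power_int_diff)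
  also have "\<dots> = z powi a * (u1 z * q2 z - u2 z * q1 z)" using elim by (simp add: d_def algebra_simps)
  finally have db: "z powi b * v z = u1 z * q2 z - u2 z * q1 z" using elim by simp
  have "s z * u1 z - (z powi b * v z) * y2 z = q1 z * (u1 z * y1 z + u2 z * y2 z)"
   unfolding db by (simp add: s_def algebra_simps)
  moreover have "s z * u2 z + (z powi b * v z) * y1 z = q2 z * (u1 z * y1 z + u2 z * y2 z)"
   unfolding db by (simp add: s_def algebra_simps)
  ultimately show ?case using elim by simp
 qed
 have py: "EV z. p1 z * y1 z + p2 z * y2 z = z powi a" using pu uy
 proof eventually_elim
  case (elim z)
  have "p1 z * y1 z + p2 z * y2 z = z powi a * (u1 z * y1 z + u2 z * y2 z)"
   unfolding conjunct1[OF elim(1)] conjunct2[OF elim(1)] by (simp only: distrib_left mult.assoc)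
  then show ?case using elim by simp
 qed
 define R where "R = min r \<rho>"
 have R: "R > 0" using r \<rho> by (simp add: R_def)
 have sub: "ball 0 R - {0} \<subseteq> ball 0 r - {0}" "ball 0 R - {0} \<subseteq> ball 0 \<rho>" by (auto simp: R_def)
 have holR: "p1 holomorphic_on ball 0 R - {0}" "p2 holomorphic_on ball 0 R - {0}"
   "q1 holomorphic_on ball 0 R - {0}" "q2 holomorphic_on ball 0 R - {0}"
   "y1 holomorphic_on ball 0 R - {0}" "y2 holomorphic_on ball 0 R - {0}"
  using hol yh sub by (auto intro: holomorphic_on_subset)
 have D: "(g has_field_derivative deriv g z) (at z)"
  if "g holomorphic_on ball 0 R - {0}" "z : ball 0 R - {0}" for g z
  by (rule holomorphic_derivI[OF that(1) _ that(2)]) auto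
 have u\<eta>: "EV z. u1 z * \<eta>1 z + u2 z * \<eta>2 z = of_int a * z"
  using eventually_at0_deriv_cong[OF py] eventually_at0_in_ball[OF R] pu
 proof eventually_elim
  case (elim z)
  have z: "z : ball 0 r - {0}" "z ~= 0" using subsetD[OF sub(1) elim(2)] by auto
  have "((%z. p1 z * y1 z + p2 z * y2 z) has_field_derivative
   deriv p1 z * y1 z + deriv y1 z * p1 z + (deriv p2 z * y2 z + deriv y2 z * p2 z)) (at z)"
   by (intro DERIV_add DERIV_mult D elim holR)
  then have "deriv p1 z * y1 z + deriv y1 z * p1 z + (deriv p2 z * y2 z + deriv y2 z * p2 z)
    = deriv (%z. z powi a) z" using elim DERIV_imp_deriv by metis
  also have "\<dots> = of_int a * z powi (a - 1)"
   by (rule DERIV_imp_deriv) (use z in \<open>auto intro!: derivative_eq_intros\<close>)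
  finally have "z\<^sup>2 * (deriv p1 z * y1 z + deriv y1 z * p1 z + (deriv p2 z * y2 z + deriv y2 z * p2 z))
    = z powi a * (of_int a * z)" using z by (simp add: power_int_diff power2_eq_square)
  moreover have "z\<^sup>2 * (deriv p1 z * y1 z + deriv y1 z * p1 z + (deriv p2 z * y2 z + deriv y2 z * p2 z))
    = (z\<^sup>2 * deriv p1 z) * y1 z + (z\<^sup>2 * deriv p2 z) * y2 z + z\<^sup>2 * deriv y1 z * p1 z + z\<^sup>2 * deriv y2 z * p2 z"
   by (simp add: algebra_simps)
  moreover have "\<dots> = p1 z * \<eta>1 z + p2 z * \<eta>2 z"
   unfolding ode(1)[OF z(1)] ode(2)[OF z(1)] by (simp add: \<eta>1_def \<eta>2_def algebra_simps)
  moreover have "\<dots> = z powi a * (u1 z * \<eta>1 z + u2 z * \<eta>2 z)"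
   unfolding conjunct1[OF elim(3)] conjunct2[OF elim(3)] by (simp only: distrib_left mult.assoc)
  ultimately show ?case using z by simp
 qed
 have hols: "s holomorphic_on ball 0 R - {0}" unfolding s_def by (intro holomorphic_intros holR)
 have sode: "EV z. z\<^sup>2 * deriv s z = of_int a * z * s z + z powi b * \<theta> z - z powi (a + 1)"
  using u\<eta> eventually_at0_in_ball[OF R] py qs
 proof eventually_elim
  case (elim z)
  have z: "z : ball 0 r - {0}" "z ~= 0" using subsetD[OF sub(1) elim(2)] by auto
  have "(s has_field_derivative
   deriv q1 z * y1 z + deriv y1 z * q1 z + (deriv q2 z * y2 z + deriv y2 z * q2 z)) (at z)"
   unfolding s_def by (intro DERIV_add DERIV_mult D elim holR)
  then have "z\<^sup>2 * deriv s z = (z\<^sup>2 * deriv q1 z + z * p1 z) * y1 z + (z\<^sup>2 * deriv q2 z + z * p2 z) * y2 z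
    + z\<^sup>2 * deriv y1 z * q1 z + z\<^sup>2 * deriv y2 z * q2 z - z * (p1 z * y1 z + p2 z * y2 z)"
   by (simp add: DERIV_imp_deriv algebra_simps)
  also have "\<dots> = q1 z * \<eta>1 z + q2 z * \<eta>2 z - z * z powi a"
   unfolding ode(3)[OF z(1)] ode(4)[OF z(1)] using elim by (simp add: \<eta>1_def \<eta>2_def algebra_simps)
  also have "\<dots> = s z * (u1 z * \<eta>1 z + u2 z * \<eta>2 z) + z powi b * \<theta> z - z powi (a + 1)"
   unfolding conjunct1[OF elim(4)] conjunct2[OF elim(4)]
   using z by (simp add: \<theta>_def power_int_add algebra_simps)
  finally show ?case unfolding elim(1) by (simp add: algebra_simps)
 qed
 define k where "k = a - b + 1"
 define f where "f = (%z. z powi (- a) * s z)"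
 have holf: "f holomorphic_on ball 0 R - {0}" unfolding f_def by (intro holomorphic_intros hols) auto
 have fode: "EV z. z * deriv f z = - 1 + z powi (- k) * \<theta> z" using sode eventually_at0_in_ball[OF R]
 proof eventually_elim
  case (elim z)
  have z: "z ~= 0" using elim by auto
  have "(f has_field_derivative of_int (- a) * z powi (- a - 1) * s z + z powi (- a) * deriv s z) (at z)"
   unfolding f_def by (rule derivative_eq_intros D[OF hols elim(2)] refl | simp add: z)+
  then have "z * deriv f z = z * (of_int (- a) * z powi (- a - 1) * s z + z powi (- a) * deriv s z)"
   by (simp add: DERIV_imp_deriv)
  also have "\<dots> = z powi (- a - 1) * (z\<^sup>2 * deriv s z - of_int a * z * s z)"
   using z by (simp add: power_int_diff power2_eq_square field_simps)
  also have "\<dots> = z powi (- a - 1) * (z powi b * \<theta> z - z powi (a + 1))" unfolding elim(1) by simp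
  also have "\<dots> = z powi (- a - 1 + b) * \<theta> z - z powi (- a - 1 + (a + 1))"
   by (simp only: right_diff_distrib power_int_add[OF disjI1[OF z]] mult.assoc)
  also have "\<dots> = z powi (- k) * \<theta> z - 1" by (simp add: k_def algebra_simps)
  finally show ?case by simp
 qed
 have merf: "EX c. ext0 (%z. z ^ (N + nat \<bar>a\<bar>) * f z) c"
 proof -
  obtain x1 x2 where x: "ext0 (%z. z ^ N * q1 z) x1" "ext0 (%z. z ^ N * q2 z) x2" using mer by blast
  have "ext0 (%z. z powi (\<bar>a\<bar> - a) * ((z ^ N * q1 z) * y1 z + (z ^ N * q2 z) * y2 z))
    (0 powi (\<bar>a\<bar> - a) * (x1 * y1 0 + x2 * y2 0))" by (intro ext0_mult ext0_add ext0_powi x ye) simp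
  moreover have "EV z. z ^ (N + nat \<bar>a\<bar>) * f z =
    z powi (\<bar>a\<bar> - a) * ((z ^ N * q1 z) * y1 z + (z ^ N * q2 z) * y2 z)" using ev_nz
  proof eventually_elim
   case (elim z)
   have "z powi (\<bar>a\<bar> - a) = z ^ nat \<bar>a\<bar> * z powi (- a)"
    using elim power_int_add[of z "\<bar>a\<bar>" "- a"] by (simp add: power_int_def)
   then show ?case by (simp add: f_def s_def power_add algebra_simps)
  qed
  ultimately have "ext0 (%z. z ^ (N + nat \<bar>a\<bar>) * f z) (0 powi (\<bar>a\<bar> - a) * (x1 * y1 0 + x2 * y2 0))"
   by (rule ext0_cong)
  then show ?thesis by blast
 qed
 then obtain fc where fc: "ext0 (%z. z ^ (N + nat \<bar>a\<bar>) * f z) fc" by blast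
 from euler_equation_pole[OF holf R fc \<theta> fode]
 obtain h w w0 where k: "k >= 0" and w: "ext0 w w0"
  and fw: "EV z. f z = h * z powi (- k) + z powi (1 - k) * w z" by blast
 have sw: "EV z. s z = h * z powi (b - 1) + z powi b * w z" using fw ev_nz
 proof eventually_elim
  case (elim z)
  have "s z = z powi a * f z" using elim(2) by (simp add: f_def power_int_minus)
  also have "\<dots> = h * z powi (a + - k) + z powi (a + (1 - k)) * w z"
   unfolding elim(1) power_int_add[OF disjI1[OF elim(2)]] by (simp only: distrib_left mult_ac)
  finally show ?case by (simp add: k_def)
 qed
 define w1 where "w1 = (%z. w z * u1 z - v z * y2 z)"
 define w2 where "w2 = (%z. w z * u2 z + v z * y1 z)"
 have w12: "ext0 w1 (w0 * c1 - v0 * y2 0)" "ext0 w2 (w0 * c2 + v0 * y1 0)"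
  unfolding w1_def w2_def by (intro ext0_add ext0_diff ext0_mult w u v ye)+
 have uy0: "c1 * y1 0 + c2 * y2 0 = 1"
 proof (rule ext0_unique)
  show "ext0 (%z. u1 z * y1 z + u2 z * y2 z) (c1 * y1 0 + c2 * y2 0)" by (intro ext0_add ext0_mult u ye)
  show "ext0 (%z. u1 z * y1 z + u2 z * y2 z) 1" by (rule ext0_cong[OF ext0_const uy])
 qed
 show ?thesis unfolding lattice_nf_def
 proof (intro exI conjI)
  show "b <= a + 1" using k by (simp add: k_def)
  show "ext0_mat (%z. mat2 (u1 z) (u2 z) (w1 z) (w2 z))
   (mat2 c1 c2 (w0 * c1 - v0 * y2 0) (w0 * c2 + v0 * y1 0))" using u w12 by (simp add: ext0_mat_def forall_2)
  have "det (mat2 c1 c2 (w0 * c1 - v0 * y2 0) (w0 * c2 + v0 * y1 0)) = v0 * (c1 * y1 0 + c2 * y2 0)"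
   by (simp add: det_2 algebra_simps)
  then show "det (mat2 c1 c2 (w0 * c1 - v0 * y2 0) (w0 * c2 + v0 * y1 0)) ~= 0" using v(2) uy0 by simp
  show "EV z. mat2 (p1 z) (p2 z) (q1 z) (q2 z) =
    nf_mat a b h z ** mat2 (u1 z) (u2 z) (w1 z) (w2 z)" using sw pu qs
  proof eventually_elim
   case (elim z)
   show ?case by (rule mat2_eqI) (use elim in \<open>simp_all add: nf_mat_def w1_def w2_def algebra_simps\<close>)
  qed
 qed
qed

section \<open>Extension and Laurent coefficients in families\<close>

lemma hol2_on_circle_kernel:
 assumes h: "hol2_on h ((ball 0 r - {0}) \<times> T)" and T: "open T" and \<rho>: "0 < \<rho>" "\<rho> < r"
 shows "hol2_on (%x. contour_integral (circlepath 0 \<rho>) (%w. h (w, snd x) / (w - fst x))) (ball 0 \<rho> \<times> T)"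
  and "(%t. contour_integral (circlepath 0 \<rho>) (%w. h (w, t) * w powi n)) holomorphic_on T"
proof -
 let ?W = "(ball 0 r - {0}) \<times> T"
 have W: "open ?W" using T by (intro open_Times) auto
 let ?ht = "%x. deriv (%s. h (fst x, s)) (snd x)"
 have ch: "continuous_on ?W h" and cht: "continuous_on ?W ?ht"
  using hol2_on_imp_continuous_on[OF h] hol2_on_continuous_deriv_snd[OF h W] by auto
 have inW: "(w, t) : ?W" if "w : sphere 0 \<rho>" "t : T" for w t using that \<rho> by auto
 have chc0: "continuous_on X (%x. k (f x, g x))"
  if "continuous_on ?W k" "continuous_on X f" "continuous_on X g"
   "!!x. x : X ==> f x : sphere 0 \<rho>" "!!x. x : X ==> g x : T"
  for X :: "'x::topological_space set" and f g and k :: "pt => complex"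
 proof (rule continuous_on_compose2[OF that(1)])
  show "continuous_on X (%x. (f x, g x))" using that by (intro continuous_intros)
  show "(%x. (f x, g x)) ` X \<subseteq> ?W" using inW that(4,5) by blast
 qed
 note chc = chc0[OF ch] chc0[OF cht, unfolded fst_conv snd_conv]
 have dt: "((%s. h (w, s)) has_field_derivative ?ht (w, t)) (at t)" if "w : sphere 0 \<rho>" "t : T" for w t
 proof -
  have "(%s. h (w, s)) holomorphic_on T" by (rule hol2_on_slice_snd[OF h T inW[OF that(1)]])
  then show ?thesis using that T by (auto intro: holomorphic_derivI)
 qed
 have ne: "w - z ~= 0" if "w : sphere 0 \<rho>" "z : ball 0 \<rho>" for w z :: complex using that by auto
 show "hol2_on (%x. contour_integral (circlepath 0 \<rho>) (%w. h (w, snd x) / (w - fst x))) (ball 0 \<rho> \<times> T)"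
 proof (rule hol2_onI_partials)
  show "open (ball 0 \<rho> \<times> T)" using T by (intro open_Times) auto
  show "(%z. contour_integral (circlepath 0 \<rho>) (%w. h (w, snd (z, t)) / (w - fst (z, t)))) field_differentiable at z"
   if zt: "(z, t) : ball 0 \<rho> \<times> T" for z t
  proof -
   have "((%z. contour_integral (circlepath 0 \<rho>) (%w. h (w, t) / (w - z))) has_field_derivative
     contour_integral (circlepath 0 \<rho>) (%w. h (w, t) / (w - z)^2)) (at z)"
   proof (rule has_field_derivative_circlepath_integral[where U="ball 0 \<rho>"])
    show "((%z. h (w, t) / (w - z)) has_field_derivative h (w, t) / (w - z)\<^sup>2) (at z)"
     if "z : ball 0 \<rho>" "w : sphere 0 \<rho>" for z w
     using ne[OF that(2,1)] by (auto intro!: derivative_eq_intros simp: power2_eq_square)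
    show "continuous_on (sphere 0 \<rho>) (%w. h (w, t) / (w - z))" if "z : ball 0 \<rho>" for z
     using ne[OF _ that] zt by (intro continuous_intros chc) auto
    show "continuous_on (ball 0 \<rho> \<times> sphere 0 \<rho>) (%(z, w). h (w, t) / (w - z)\<^sup>2)"
     using ne zt unfolding case_prod_unfold by (intro continuous_intros chc) auto
   qed (use that \<rho> in auto)
   then show ?thesis by (auto simp: field_differentiable_def)
  qed
  show "((%s. contour_integral (circlepath 0 \<rho>) (%w. h (w, snd (z, s)) / (w - fst (z, s)))) has_field_derivative
    (%x. contour_integral (circlepath 0 \<rho>) (%w. ?ht (w, snd x) / (w - fst x))) (z, t)) (at t)"
   if zt: "(z, t) : ball 0 \<rho> \<times> T" for z t
  proof -
   obtain e where e: "e > 0" "ball t e \<subseteq> T" using T zt open_contains_ball by (metis mem_Sigma_iff)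
   have "((%s. contour_integral (circlepath 0 \<rho>) (%w. h (w, s) / (w - z))) has_field_derivative
     contour_integral (circlepath 0 \<rho>) (%w. ?ht (w, t) / (w - z))) (at t)"
   proof (rule has_field_derivative_circlepath_integral[where U="ball t e"])
    show "((%s. h (w, s) / (w - z)) has_field_derivative ?ht (w, s) / (w - z)) (at s)"
     if "s : ball t e" "w : sphere 0 \<rho>" for s w by (rule DERIV_cdivide[OF dt]) (use that e in auto)
    show "continuous_on (sphere 0 \<rho>) (%w. h (w, s) / (w - z))" if "s : ball t e" for s
     using ne[of _ z] zt that e by (intro continuous_intros chc) auto
    have "continuous_on (ball t e \<times> sphere 0 \<rho>) (%x. ?ht (snd x, fst x) / (snd x - z))"
     using ne[of _ z] zt e by (intro continuous_on_divide chc(2) continuous_intros) auto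
    then show "continuous_on (ball t e \<times> sphere 0 \<rho>) (%(s, w). ?ht (w, s) / (w - z))"
     unfolding case_prod_unfold .
   qed (use e \<rho> in auto)
   then show ?thesis by simp
  qed
  show "continuous_on (ball 0 \<rho> \<times> T) (%x. contour_integral (circlepath 0 \<rho>) (%w. ?ht (w, snd x) / (w - fst x)))"
  proof (rule continuous_on_circlepath_integral)
   have "continuous_on ((ball 0 \<rho> \<times> T) \<times> sphere 0 \<rho>) (%x. ?ht (snd x, snd (fst x)) / (snd x - fst (fst x)))"
    using ne by (intro continuous_on_divide chc(2) continuous_intros) auto
   then show "continuous_on ((ball 0 \<rho> \<times> T) \<times> sphere 0 \<rho>) (%(x, w). ?ht (w, snd x) / (w - fst x))"
    unfolding case_prod_unfold .
  qed (use \<rho> in auto)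
 qed
 show "(%t. contour_integral (circlepath 0 \<rho>) (%w. h (w, t) * w powi n)) holomorphic_on T"
 proof (rule holomorphic_onI)
  fix t assume t: "t : T"
  obtain e where e: "e > 0" "ball t e \<subseteq> T" using T t open_contains_ball by metis
  have "((%s. contour_integral (circlepath 0 \<rho>) (%w. h (w, s) * w powi n)) has_field_derivative
    contour_integral (circlepath 0 \<rho>) (%w. ?ht (w, t) * w powi n)) (at t)"
  proof (rule has_field_derivative_circlepath_integral[where U="ball t e"])
   show "((%s. h (w, s) * w powi n) has_field_derivative ?ht (w, s) * w powi n) (at s)"
    if "s : ball t e" "w : sphere 0 \<rho>" for s w by (rule DERIV_cmult_right[OF dt]) (use that e in auto)
   show "continuous_on (sphere 0 \<rho>) (%w. h (w, s) * w powi n)" if "s : ball t e" for s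
    using that e \<rho> by (intro continuous_intros chc) auto
   have "continuous_on (ball t e \<times> sphere 0 \<rho>) (%x. ?ht (snd x, fst x) * snd x powi n)"
    using e \<rho> by (intro continuous_on_mult chc(2) continuous_intros) auto
   then show "continuous_on (ball t e \<times> sphere 0 \<rho>) (%(s, w). ?ht (w, s) * w powi n)"
    unfolding case_prod_unfold .
  qed (use e \<rho> in auto)
  then show "(%t. contour_integral (circlepath 0 \<rho>) (%w. h (w, t) * w powi n)) field_differentiable at t within T"
   by (auto simp: field_differentiable_def intro: has_field_derivative_at_within)
 qed
qed

text \<open>The Cauchy integral over a fixed circle extends every slice and is holomorphic in both variables.\<close>

lemma hol2_on_extension:
 assumes h: "hol2_on h ((ball 0 r - {0}) \<times> T)" and T: "open T" and \<rho>: "0 < \<rho>" "\<rho> < r"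
  and e: "!!t. t : T ==> EX c. ext0 (%z. h (z, t)) c"
 shows "EX H. hol2_on H (ball 0 \<rho> \<times> T) & (ALL z:ball 0 \<rho> - {0}. ALL t:T. H (z, t) = h (z, t)) &
   (ALL t:T. ext0 (%z. h (z, t)) (H (0, t)))"
proof -
 define H where "H x = 1 / (2 * of_real pi * \<i>) *
   contour_integral (circlepath 0 \<rho>) (%w. h (w, snd x) / (w - fst x))" for x
 have "hol2_on H (ball 0 \<rho> \<times> T)"
  unfolding H_def by (intro hol2_on_mult hol2_on_const hol2_on_circle_kernel(1)[OF h T \<rho>])
 moreover have "(ALL z:ball 0 \<rho> - {0}. H (z, t) = h (z, t)) & ext0 (%z. h (z, t)) (H (0, t))" if t: "t : T" for t
 proof -
  obtain c where c: "ext0 (%z. h (z, t)) c" using e[OF t] by blast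
  define g where "g z = (if z = 0 then c else h (z, t))" for z
  have "(%z. h (z, t)) holomorphic_on ball 0 r - {0}" by (rule hol2_on_slice_fst[OF h]) (use t in auto)
  then have g: "g holomorphic_on ball 0 r" unfolding g_def using ext0_holomorphic_extension[OF _ c] \<rho> by simp
  have Hg: "H (z, t) = g z" if "z : ball 0 \<rho>" for z
  proof -
   have "((%u. g u/(u-z)) has_contour_integral (2 * of_real pi * \<i> * g z)) (circlepath 0 \<rho>)"
    by (rule Cauchy_integral_circlepath)
      (use g \<rho> that in \<open>auto intro!: holomorphic_on_imp_continuous_on intro: holomorphic_on_subset\<close>)
   then have "contour_integral (circlepath 0 \<rho>) (%u. g u/(u-z)) = 2 * of_real pi * \<i> * g z"
    by (rule contour_integral_unique)
   moreover have "contour_integral (circlepath 0 \<rho>) (%u. g u/(u-z)) =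
     contour_integral (circlepath 0 \<rho>) (%w. h (w, t) / (w - z))"
    by (rule contour_integral_cong) (use \<rho> in \<open>auto simp: g_def\<close>)
   ultimately show ?thesis by (simp add: H_def)
  qed
  then have "H (0, t) = c" using \<rho> by (simp add: g_def)
  then show ?thesis using Hg c by (auto simp: g_def)
 qed
 ultimately show ?thesis by blast
qed

definition lcoef :: "real => (complex => complex) => int => complex" where
 "lcoef \<rho> f n = contour_integral (circlepath 0 \<rho>) (%w. f w * w powi (- n - 1)) / (2 * of_real pi * \<i>)"

lemma lcoef_of_order:
 assumes f: "f holomorphic_on ball 0 r - {0}" and \<rho>: "0 < \<rho>" "\<rho> < r"
  and e: "ext0 u c" and fu: "EV z. f z = z powi m * u z"
 shows "n < m ==> lcoef \<rho> f n = 0" and "lcoef \<rho> f m = c"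
proof -
 let ?g = "%z. if z = 0 then c else f z * z powi (- m)"
 have "EV z. f z * z powi (- m) = u z" using fu ev_nz by eventually_elim (simp add: power_int_minus)
 then have "ext0 (%z. f z * z powi (- m)) c" by (rule ext0_cong[OF e])
 moreover have "(%z. f z * z powi (- m)) holomorphic_on ball 0 r - {0}" by (intro holomorphic_intros f) auto
 ultimately have g: "?g holomorphic_on ball 0 r" using \<rho> by (intro ext0_holomorphic_extension) auto
 have eq: "contour_integral (circlepath 0 \<rho>) (%w. f w * w powi (- n - 1)) =
    contour_integral (circlepath 0 \<rho>) (%w. ?g w * w powi (m - n - 1))" for n
 proof (rule contour_integral_cong)
  fix w assume "w : path_image (circlepath 0 \<rho>)"
  then have w: "w ~= 0" using \<rho> by auto
  have "w powi (- n - 1) = w powi (- m) * w powi (m - n - 1)" using w by (subst power_int_add[symmetric]) auto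
  then show "f w * w powi (- n - 1) = ?g w * w powi (m - n - 1)" using w by simp
 qed simp
 show "lcoef \<rho> f n = 0" if "n < m"
 proof -
  have "(%w. ?g w * w ^ nat (m - n - 1)) holomorphic_on ball 0 r" by (intro holomorphic_intros g)
  then have "((%w. ?g w * w ^ nat (m - n - 1)) has_contour_integral 0) (circlepath 0 \<rho>)"
   by (rule Cauchy_theorem_disc_simple) (use \<rho> in auto)
  then have "contour_integral (circlepath 0 \<rho>) (%w. ?g w * w ^ nat (m - n - 1)) = 0"
   by (rule contour_integral_unique)
  then show ?thesis using that eq[of n] by (simp add: lcoef_def power_int_def)
 qed
 show "lcoef \<rho> f m = c"
 proof -
  have "((%u. ?g u/(u-0)) has_contour_integral (2 * of_real pi * \<i> * ?g 0)) (circlepath 0 \<rho>)"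
   by (rule Cauchy_integral_circlepath)
     (use g \<rho> in \<open>auto intro!: holomorphic_on_imp_continuous_on intro: holomorphic_on_subset\<close>)
  then have "contour_integral (circlepath 0 \<rho>) (%u. ?g u/(u-0)) = 2 * of_real pi * \<i> * c"
   using contour_integral_unique by fastforce
  moreover have "contour_integral (circlepath 0 \<rho>) (%w. ?g w * w powi (m - m - 1)) =
    contour_integral (circlepath 0 \<rho>) (%u. ?g u/(u-0))"
   by (rule contour_integral_cong) (simp_all add: power_int_minus divide_inverse)
  ultimately show ?thesis using eq[of m] by (simp add: lcoef_def)
 qed
qed

lemma fsigma_ball: "fsigma (ball (0::complex) r)"
proof -
 have "ball (0::complex) r = (\<Union>n. cball 0 (r - inverse (real (Suc n))))"
 proof (intro equalityI subsetI)
  fix x :: complex assume "x : ball 0 r"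
  then obtain n where "inverse (real (Suc n)) < r - norm x" using reals_Archimedean[of "r - norm x"] by auto
  then show "x : (\<Union>n. cball 0 (r - inverse (real (Suc n))))" by (intro UN_I[of n]) auto
 next
  fix x :: complex assume "x : (\<Union>n. cball 0 (r - inverse (real (Suc n))))"
  then obtain n where "norm x <= r - inverse (real (Suc n))" by auto
  moreover have "inverse (real (Suc n)) > 0" by simp
  ultimately have "norm x < r" by linarith
  then show "x : ball 0 r" by simp
 qed
 then show ?thesis by (auto intro: fsigma.intros)
qed

text \<open>
 If at every point of a disc almost all coefficients with negative index vanish, then so they do
 uniformly: otherwise the disc is covered by countably many zero sets of nonzero holomorphic
 functions, which are countable.
\<close>

lemma uniform_lower_bound_coefficients:
 fixes C :: "int => complex => complex"
 assumes hol: "!!n. C n holomorphic_on ball 0 eps" and eps: "eps > 0"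
  and pt: "!!t. t : ball 0 eps ==> EX m. ALL n<m. C n t = 0"
 shows "EX m. ALL n<m. ALL t:ball 0 eps. C n t = 0"
proof (rule ccontr)
 assume "~ ?thesis"
 then have "EX n. n < m & (EX t:ball 0 eps. C n t ~= 0)" for m by auto
 then obtain \<nu> where \<nu>: "!!m. \<nu> m < m" "!!m. EX t:ball 0 eps. C (\<nu> m) t ~= 0" by metis
 let ?Z = "%m. {t : ball 0 eps. C (\<nu> m) t = 0}"
 have "countable (?Z m)" for m
 proof (cases "C (\<nu> m) constant_on ball 0 eps")
  case True
  then have "?Z m = {}" using \<nu>(2)[of m] by (auto simp: constant_on_def)
  then show ?thesis by (simp only: countable_empty)
 next
  case False
  then show ?thesis by (intro holomorphic_countable_zeros hol) (use False fsigma_ball in auto)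
 qed
 moreover have "ball 0 eps \<subseteq> (\<Union>m. ?Z m)"
 proof
  fix t :: complex assume t: "t : ball 0 eps"
  obtain m where "ALL n<m. C n t = 0" using pt[OF t] by blast
  then show "t : (\<Union>m. ?Z m)" using \<nu>(1)[of m] t by auto
 qed
 ultimately have "countable (ball (0::complex) eps)"
  by (meson countable_UN countable_subset uncountable_def countableI_type)
 then show False using uncountable_ball[of eps "0::complex"] eps by simp
qed

section \<open>Lattices in a family\<close>

lemma lattice_nf_coefficients:
 fixes M :: "complex => complex^2^2"
 assumes M: "!!i j. (%z. M z $ i $ j) holomorphic_on ball 0 r - {0}" and \<rho>: "0 < \<rho>" "\<rho> < r"
  and nf: "lattice_nf M a b h"
 shows "!!n j. n < a ==> lcoef \<rho> (%z. M z $ 1 $ j) n = 0"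
  and "EX j. lcoef \<rho> (%z. M z $ 1 $ j) a ~= 0"
  and "!!n j. n < b - 1 ==> lcoef \<rho> (%z. M z $ 2 $ j) n = 0"
  and "!!j. lcoef \<rho> (%z. M z $ 2 $ j) (b - 1) = h * lcoef \<rho> (%z. M z $ 1 $ j) a"
  and "h = 0 ==> EX j. lcoef \<rho> (%z. M z $ 2 $ j) b ~= 0"
proof -
 obtain U U0 where U: "ext0_mat U U0" "det U0 ~= 0" and MU: "EV z. M z = nf_mat a b h z ** U z"
  using nf by (auto simp: lattice_nf_def)
 have Ue: "ext0 (%z. U z $ i $ j) (U0 $ i $ j)" for i j using U by (simp add: ext0_mat_def)
 have r1: "EV z. M z $ 1 $ j = z powi a * U z $ 1 $ j" for j using MU by eventually_elim (simp add: nf_mat_def)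
 have r2: "EV z. M z $ 2 $ j = z powi (b - 1) * (h * U z $ 1 $ j + z * U z $ 2 $ j)" for j using MU ev_nz
 proof eventually_elim
  case (elim z)
  have "z powi b = z powi (b - 1) * z" using elim power_int_add[of z "b - 1" 1] by simp
  then show ?case using elim by (simp add: nf_mat_def algebra_simps)
 qed
 have e2: "ext0 (%z. h * U z $ 1 $ j + z * U z $ 2 $ j) (h * U0 $ 1 $ j + 0 * U0 $ 2 $ j)" for j
  by (intro ext0_add ext0_mult ext0_const ext0_ident Ue)
 note c1 = lcoef_of_order[OF M \<rho> Ue r1]
 note c2 = lcoef_of_order[OF M \<rho> e2 r2]
 show "!!n j. n < a ==> lcoef \<rho> (%z. M z $ 1 $ j) n = 0" by (rule c1)
 show "!!n j. n < b - 1 ==> lcoef \<rho> (%z. M z $ 2 $ j) n = 0" by (rule c2)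
 show "!!j. lcoef \<rho> (%z. M z $ 2 $ j) (b - 1) = h * lcoef \<rho> (%z. M z $ 1 $ j) a" by (simp add: c1 c2)
 show "EX j. lcoef \<rho> (%z. M z $ 1 $ j) a ~= 0"
 proof (rule ccontr)
  assume "~ ?thesis"
  then have "U0 $ 1 $ j = 0" for j by (simp add: c1)
  then show False using U(2) by (simp add: det_2)
 qed
 show "EX j. lcoef \<rho> (%z. M z $ 2 $ j) b ~= 0" if "h = 0"
 proof (rule ccontr)
  assume *: "~ ?thesis"
  have r3: "EV z. M z $ 2 $ j = z powi b * U z $ 2 $ j" for j using MU by eventually_elim (simp add: nf_mat_def that)
  have "U0 $ 2 $ j = 0" for j using * by (simp add: lcoef_of_order(2)[OF M \<rho> Ue r3])
  then show False using U(2) by (simp add: det_2)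
 qed
qed

lemma holomorphic_nonzero_near:
 fixes f :: "complex => complex"
 assumes "f holomorphic_on ball 0 eps" "t0 : ball 0 eps" "f t0 ~= 0"
 shows "EX \<delta>>0. \<delta> <= eps & (ALL t:ball 0 \<delta> - {0}. f t ~= 0)"
proof -
 have eps: "eps > 0" using assms(2) le_less_trans[OF norm_ge_zero, of t0 eps] by simp
 have "EV t. t : ball 0 eps & f t ~= 0" using non_zero_neighbour_alt[OF assms(1) _ _ _ assms(2,3), of 0] eps
  by (auto simp: conj_commute)
 then obtain \<delta> where "\<delta> > 0" "!!t. t ~= 0 ==> dist t 0 < \<delta> ==> f t ~= 0"
  unfolding eventually_at by blast
 then show ?thesis using eps by (intro exI[of _ "min \<delta> eps"]) auto
qed

lemma holomorphic_nonzero_near_centre: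
 fixes f :: "complex => complex"
 assumes "f holomorphic_on ball 0 eps" "eps > 0" "f 0 ~= 0"
 shows "EX \<delta>>0. \<delta> <= eps & (ALL t:ball 0 \<delta>. f t ~= 0)"
proof -
 obtain \<delta> where "\<delta> > 0" "\<delta> <= eps" "ALL t:ball 0 \<delta> - {0}. f t ~= 0"
  using holomorphic_nonzero_near[OF assms(1) _ assms(3)] assms(2) by auto
 then show ?thesis using assms(3) by (metis Diff_iff singletonD)
qed

text \<open>
 The generic orders \<open>a\<close>, \<open>b\<close> are those of the first nonvanishing Laurent coefficients.  At \<open>t = 0\<close>
 the orders can only go up, \<open>a\<^sub>0 >= a\<close> and \<open>b\<^sub>0 >= b - 1\<close>, while their sum is fixed; this leaves two
 cases.  The parameter \<open>h\<close> is a quotient of leading coefficients, so it is meromorphic in \<open>t\<close>.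
\<close>

lemma lattice_family_trichotomy:
 fixes M :: "pt => complex^2^2"
 assumes M: "!!i j. hol2_on (%x. M x $ i $ j) ((ball 0 r - {0}) \<times> ball 0 eps)"
  and r: "r > 0" and eps: "eps > 0"
  and nf: "!!t. t : ball 0 eps ==> EX a b h. a + b = m & lattice_nf (%z. M (z, t)) a b h"
  and nf0: "lattice_nf (%z. M (z, 0)) a0 b0 0" "a0 + b0 = m" "b0 <= a0"
 shows "EX a b \<delta> f. \<delta> > 0 & \<delta> <= eps & f holomorphic_on ball 0 \<delta> & f 0 = 0 &
   ((b <= a & (ALL t:ball 0 \<delta>. lattice_nf (%z. M (z, t)) a b (f t)) &
     ((ALL t:ball 0 \<delta>. f t = 0) \<or> (ALL t:ball 0 \<delta> - {0}. f t ~= 0))) \<or>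
   (b <= a + 1 & (ALL t:ball 0 \<delta> - {0}. f t ~= 0 & lattice_nf (%z. M (z, t)) a b (1 / f t)) &
     lattice_nf (%z. M (z, 0)) (a + 1) (b - 1) 0))"
proof -
 define \<rho> where "\<rho> = r / 2"
 have \<rho>: "0 < \<rho>" "\<rho> < r" using r by (auto simp: \<rho>_def)
 define L where "L i j n t = lcoef \<rho> (%z. M (z, t) $ i $ j) n" for i j n t
 have Lhol: "L i j n holomorphic_on ball 0 eps" for i j n unfolding L_def lcoef_def
  by (intro holomorphic_intros hol2_on_circle_kernel(2)[OF M _ \<rho>]) auto
 have slice: "(%z. M (z, t) $ i $ j) holomorphic_on ball 0 r - {0}" if "t : ball 0 eps" for t i j
  by (rule hol2_on_slice_fst[OF M]) (use that in auto)
 note C = lattice_nf_coefficients[OF slice \<rho>, folded L_def]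
 have lower: "EX m. ALL n<m. ALL t:ball 0 eps. L 1 j n t = 0" for j
 proof (rule uniform_lower_bound_coefficients[OF Lhol eps])
  fix t :: complex assume t: "t : ball 0 eps"
  obtain a b h where "lattice_nf (%z. M (z, t)) a b h" using nf[OF t] by blast
  from C(1)[OF t this] show "EX m. ALL n<m. L 1 j n t = 0" by blast
 qed
 define Q where "Q n \<longleftrightarrow> (EX j. EX t:ball 0 eps. L 1 j n t ~= 0)" for n
 obtain m1 m2 where m12: "ALL n<m1. ALL t:ball 0 eps. L 1 1 n t = 0" "ALL n<m2. ALL t:ball 0 eps. L 1 2 n t = 0"
  using lower[of 1] lower[of 2] by blast
 have Qlow: "min m1 m2 <= n" if "Q n" for n
 proof (rule ccontr)
  assume "~ ?thesis"
  then have "n < m1" "n < m2" by auto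
  then have "L 1 j n t = 0" if "t : ball 0 eps" for j t using m12 that exhaust_2[of j] by metis
  then show False using \<open>Q n\<close> by (auto simp: Q_def)
 qed
 have "Q a0" using C(2)[OF _ nf0(1)] eps by (auto simp: Q_def intro!: bexI[of _ 0])
 define a where "a = min m1 m2 + int (LEAST k. Q (min m1 m2 + int k))"
 have exk: "EX k. n = min m1 m2 + int k" if "Q n" for n
  using Qlow[OF that] by (intro exI[of _ "nat (n - min m1 m2)"]) simp
 have Qa: "Q a"
 proof -
  obtain k where "a0 = min m1 m2 + int k" using exk[OF \<open>Q a0\<close>] by blast
  then show ?thesis unfolding a_def using LeastI[of "%k. Q (min m1 m2 + int k)" k] \<open>Q a0\<close> by simp
 qed
 have aleast: "a <= n" if Qn: "Q n" for n
 proof -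
  obtain k where "n = min m1 m2 + int k" using exk[OF Qn] by blast
  then show ?thesis unfolding a_def using Least_le[of "%k. Q (min m1 m2 + int k)" k] Qn by simp
 qed
 define b where "b = m - a"
 obtain j0 t0 where j0: "t0 : ball 0 eps" "L 1 j0 a t0 ~= 0" using Qa by (auto simp: Q_def)
 obtain \<delta>1 where \<delta>1: "\<delta>1 > 0" "\<delta>1 <= eps" "!!t. t : ball 0 \<delta>1 - {0} ==> L 1 j0 a t ~= 0"
  using holomorphic_nonzero_near[OF Lhol j0] by auto
 have generic: "EX h. lattice_nf (%z. M (z, t)) a b h" if t: "t : ball 0 \<delta>1 - {0}" for t
 proof -
  have te: "t : ball 0 eps" using t \<delta>1 by auto
  obtain a' b' h where *: "a' + b' = m" "lattice_nf (%z. M (z, t)) a' b' h" using nf[OF te] by blast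
  have "Q a'" unfolding Q_def using C(2)[OF te *(2)] te by blast
  then have "a <= a'" by (rule aleast)
  moreover have "~ a < a'" using C(1)[OF te *(2)] \<delta>1(3)[OF t] by blast
  ultimately have "a' = a" by simp
  then show ?thesis using * by (auto simp: b_def)
 qed
 have le: "b <= a + 1"
 proof -
  have "of_real (\<delta>1 / 2) : ball (0::complex) \<delta>1 - {0}" using \<delta>1 by auto
  from generic[OF this] show ?thesis by (auto simp: lattice_nf_def)
 qed
 have z0: "(0::complex) : ball 0 eps" using eps by simp
 have a0: "a <= a0" using aleast \<open>Q a0\<close> .
 have L2: "L 2 j n t = 0" if n: "n < b - 1" and t: "t : ball 0 \<delta>1 - {0}" for j n t
 proof -
  obtain h where "lattice_nf (%z. M (z, t)) a b h" using generic[OF t] by blast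
  from C(3)[OF _ this n] show ?thesis using t \<delta>1 by auto
 qed
 have L20: "L 2 j n 0 = 0" if n: "n < b - 1" for j n
 proof (rule LIM_unique)
  have "continuous_on (ball 0 eps) (L 2 j n)" using Lhol by (rule holomorphic_on_imp_continuous_on)
  then show "L 2 j n \<midarrow>0\<rightarrow> L 2 j n 0"
   using z0 by (simp add: continuous_on_eq_continuous_at isCont_def)
  have "EV t. 0 = L 2 j n t" using eventually_at0_in_ball[OF \<delta>1(1)] by eventually_elim (use L2[OF n] in auto)
  then show "L 2 j n \<midarrow>0\<rightarrow> 0" by (rule Lim_transform_eventually[OF tendsto_const])
 qed
 have b0: "b - 1 <= b0"
 proof (rule ccontr)
  assume "~ b - 1 <= b0"
  then have "L 2 j b0 0 = 0" for j using L20 by simp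
  then show False using C(5)[OF z0 nf0(1)] by simp
 qed
 have cases: "(a0 = a & b0 = b) \<or> (a0 = a + 1 & b0 = b - 1)" using a0 b0 nf0(2) by (auto simp: b_def)
 have sub: "L i j n holomorphic_on ball 0 \<delta>" if "\<delta> <= eps" for i j n \<delta>
  by (rule holomorphic_on_subset[OF Lhol]) (use that in auto)
 show ?thesis
 proof (cases "a0 = a")
  case True
  then have ab: "a0 = a" "b0 = b" using cases by auto
  obtain j where j: "L 1 j a 0 ~= 0" using C(2)[OF z0 nf0(1)] ab by auto
  obtain \<delta>2 where \<delta>2: "\<delta>2 > 0" "\<delta>2 <= eps" "!!t. t : ball 0 \<delta>2 ==> L 1 j a t ~= 0"
   using holomorphic_nonzero_near_centre[OF Lhol eps j] by blast
  define f where "f t = L 2 j (b - 1) t / L 1 j a t" for t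
  define \<delta>3 where "\<delta>3 = min \<delta>1 \<delta>2"
  have \<delta>3: "\<delta>3 > 0" "\<delta>3 <= eps" using \<delta>1 \<delta>2 by (auto simp: \<delta>3_def)
  have fh: "f holomorphic_on ball 0 \<delta>3"
   unfolding f_def by (intro holomorphic_intros sub \<delta>3) (use \<delta>2 in \<open>auto simp: \<delta>3_def\<close>)
  have f0: "f 0 = 0" using C(4)[OF z0 nf0(1)] ab by (simp add: f_def)
  have nff: "lattice_nf (%z. M (z, t)) a b (f t)" if t: "t : ball 0 \<delta>3" for t
  proof (cases "t = 0")
   case True
   then show ?thesis using nf0(1) ab f0 by simp
  next
   case False
   then have t1: "t : ball 0 \<delta>1 - {0}" and t2: "t : ball 0 \<delta>2" using t by (auto simp: \<delta>3_def)
   obtain h where h: "lattice_nf (%z. M (z, t)) a b h" using generic[OF t1] by blast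
   have "L 2 j (b - 1) t = h * L 1 j a t" using C(4)[OF _ h] t2 \<delta>2(2) by auto
   then have "f t = h" using \<delta>2(3)[OF t2] by (simp add: f_def)
   then show ?thesis using h by simp
  qed
  show ?thesis
  proof (cases "ALL t:ball 0 \<delta>3. f t = 0")
   case True
   then show ?thesis using \<delta>3 fh f0 nff nf0(3) ab by (intro exI[of _ a] exI[of _ b] exI[of _ \<delta>3] exI[of _ f]) auto
  next
   case False
   then obtain t1 where "t1 : ball 0 \<delta>3" "f t1 ~= 0" by blast
   from holomorphic_nonzero_near[OF fh this]
   obtain \<delta>4 where \<delta>4: "\<delta>4 > 0" "\<delta>4 <= \<delta>3" "ALL t:ball 0 \<delta>4 - {0}. f t ~= 0" by blast
   have "f holomorphic_on ball 0 \<delta>4" by (rule holomorphic_on_subset[OF fh]) (use \<delta>4 in auto)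
   moreover have "ALL t:ball 0 \<delta>4. lattice_nf (%z. M (z, t)) a b (f t)" using nff \<delta>4 by auto
   ultimately show ?thesis using \<delta>4 \<delta>3 f0 nf0(3) ab
    by (intro exI[of _ a] exI[of _ b] exI[of _ \<delta>4] exI[of _ f]) auto
  qed
 next
  case False
  then have ab: "a0 = a + 1" "b0 = b - 1" using cases by auto
  obtain j where j: "L 2 j (b - 1) 0 ~= 0" using C(5)[OF z0 nf0(1)] ab by auto
  obtain \<delta>2 where \<delta>2: "\<delta>2 > 0" "\<delta>2 <= eps" "!!t. t : ball 0 \<delta>2 ==> L 2 j (b - 1) t ~= 0"
   using holomorphic_nonzero_near_centre[OF Lhol eps j] by blast
  define f where "f t = L 1 j a t / L 2 j (b - 1) t" for t
  define \<delta>3 where "\<delta>3 = min \<delta>1 \<delta>2"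
  have \<delta>3: "\<delta>3 > 0" "\<delta>3 <= eps" using \<delta>1 \<delta>2 by (auto simp: \<delta>3_def)
  have fh: "f holomorphic_on ball 0 \<delta>3"
   unfolding f_def by (intro holomorphic_intros sub \<delta>3) (use \<delta>2 in \<open>auto simp: \<delta>3_def\<close>)
  have f0: "f 0 = 0" using C(1)[OF z0 nf0(1), of a] ab by (simp add: f_def)
  have nff: "f t ~= 0 & lattice_nf (%z. M (z, t)) a b (1 / f t)" if t: "t : ball 0 \<delta>3 - {0}" for t
  proof -
   have t1: "t : ball 0 \<delta>1 - {0}" and t2: "t : ball 0 \<delta>2" using t by (auto simp: \<delta>3_def)
   obtain h where h: "lattice_nf (%z. M (z, t)) a b h" using generic[OF t1] by blast
   have "L 2 j (b - 1) t = h * L 1 j a t" using C(4)[OF _ h] t2 \<delta>2(2) by auto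
   then have "f t ~= 0" "1 / f t = h" using \<delta>2(3)[OF t2] by (auto simp: f_def)
   then show ?thesis using h by simp
  qed
  have nf00: "lattice_nf (%z. M (z, 0)) (a + 1) (b - 1) 0" using nf0(1) ab by simp
  have "ALL t:ball 0 \<delta>3 - {0}. f t ~= 0 & lattice_nf (%z. M (z, t)) a b (1 / f t)" using nff by (rule ballI)
  note II = conjI[OF le conjI[OF this nf00]]
  show ?thesis by (rule exI[of _ a], rule exI[of _ b], rule exI[of _ \<delta>3], rule exI[of _ f])
     (rule conjI[OF \<delta>3(1) conjI[OF \<delta>3(2) conjI[OF fh conjI[OF f0 disjI2[OF II]]]]])
 qed
qed

section \<open>Matrices of size two\<close>

lemma det_mult2: "det ((A::complex^2^2) ** B) = det A * det B" by (rule det_mul)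

lemma matrix_inv_unique:
 fixes A B :: "complex^2^2"
 assumes "A ** B = mat 1" shows "matrix_inv A = B"
proof -
 have BA: "B ** A = mat 1" using assms by (simp add: matrix_left_right_inverse)
 have "A ** matrix_inv A = mat 1 & matrix_inv A ** A = mat 1"
  unfolding matrix_inv_def by (rule someI_ex) (use assms BA in blast)
 then have "matrix_inv A ** A = mat 1" by blast
 then have "matrix_inv A = matrix_inv A ** (A ** B)" by (simp add: assms)
 also have "\<dots> = B" by (simp add: matrix_mul_assoc \<open>matrix_inv A ** A = mat 1\<close>)
 finally show ?thesis .
qed

lemma matrix_inv2:
 fixes A :: "complex^2^2"
 assumes "invertible A"
 shows "matrix_inv A = mat2 (A$2$2 / det A) (- A$1$2 / det A) (- A$2$1 / det A) (A$1$1 / det A)"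
proof (rule matrix_inv_unique)
 have d: "det A ~= 0" using assms by (simp add: invertible_det_nz)
 have e: "A$1$1 * A$2$2 - A$1$2 * A$2$1 = det A" by (simp add: det_2)
 show "A ** mat2 (A$2$2 / det A) (- A$1$2 / det A) (- A$2$1 / det A) (A$1$1 / det A) = mat 1"
 proof (rule mat2_eqI)
  have "A$1$1 * (A$2$2 / det A) + A$1$2 * (- A$2$1 / det A) = (A$1$1 * A$2$2 - A$1$2 * A$2$1) / det A"
   by (simp add: diff_divide_distrib)
  then show "(A ** mat2 (A$2$2 / det A) (- A$1$2 / det A) (- A$2$1 / det A) (A$1$1 / det A)) $1$1 = mat 1 $1$1"
   using d by (simp add: e mat_def)
  have "A$2$1 * (- A$1$2 / det A) + A$2$2 * (A$1$1 / det A) = (A$1$1 * A$2$2 - A$1$2 * A$2$1) / det A"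
   by (simp add: diff_divide_distrib mult.commute)
  then show "(A ** mat2 (A$2$2 / det A) (- A$1$2 / det A) (- A$2$1 / det A) (A$1$1 / det A)) $2$2 = mat 1 $2$2"
   using d by (simp add: e mat_def)
 qed (simp_all add: mat_def mult.commute)
qed

lemma inv_cancel [simp]:
 fixes A :: "complex^2^2"
 assumes "invertible A"
 shows "matrix_inv A ** A = mat 1" "A ** matrix_inv A = mat 1"
  "matrix_inv A ** (A ** B) = B" "A ** (matrix_inv A ** B) = B"
  "matrix_inv A *v (A *v v) = v" "A *v (matrix_inv A *v v) = v"
proof -
 have "A ** matrix_inv A = mat 1 & matrix_inv A ** A = mat 1"
  unfolding matrix_inv_def by (rule someI_ex) (use assms invertible_def in blast)
 then show "matrix_inv A ** A = mat 1" "A ** matrix_inv A = mat 1"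
  "matrix_inv A ** (A ** B) = B" "A ** (matrix_inv A ** B) = B"
  "matrix_inv A *v (A *v v) = v" "A *v (matrix_inv A *v v) = v"
  by (simp_all add: matrix_mul_assoc matrix_vector_mul_assoc)
qed

lemma invertible_inv: "invertible (A::complex^2^2) ==> invertible (matrix_inv A)"
 unfolding invertible_def using inv_cancel(1,2)[of A] invertible_def by blast

lemma invertible_cancel_left:
 fixes A :: "complex^2^2"
 assumes "invertible A" "A ** B = A ** C" shows "B = C"
proof -
 have "B = matrix_inv A ** (A ** B)" by (rule inv_cancel(3)[OF assms(1), symmetric])
 also have "\<dots> = C" unfolding assms(2) by (rule inv_cancel(3)[OF assms(1)])
 finally show ?thesis .
qed

lemma invertible_cancel_vec:
 fixes A :: "complex^2^2"
 assumes "invertible A" "A *v u = A *v v" shows "u = v"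
proof -
 have "u = matrix_inv A *v (A *v u)" by (rule inv_cancel(5)[OF assms(1), symmetric])
 also have "\<dots> = v" unfolding assms(2) by (rule inv_cancel(5)[OF assms(1)])
 finally show ?thesis .
qed

lemma matrix_inv_mult2:
 fixes A B :: "complex^2^2"
 assumes "invertible A" "invertible B"
 shows "matrix_inv (A ** B) = matrix_inv B ** matrix_inv A"
 by (rule matrix_inv_unique) (simp add: assms matrix_mul_assoc[symmetric])

lemma matrix_vec_column: "column j (A ** B) = A *v column j (B::complex^2^2)" for A :: "complex^2^2"
 by (simp add: vec_eq_iff column_def)

lemma columns_eqI:
 fixes A B :: "complex^2^2"
 assumes "column 1 A = column 1 B" "column 2 A = column 2 B" shows "A = B"
 using assms by (simp add: vec_eq_iff column_def forall_2)

definition colmat :: "complex^2 => complex^2 => complex^2^2" where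
 "colmat v w = mat2 (v$1) (w$1) (v$2) (w$2)"

lemma column_colmat [simp]: "column 1 (colmat v w) = v" "column 2 (colmat v w) = w"
 by (simp_all add: vec_eq_iff column_def colmat_def forall_2)

lemma colmat_column: "colmat (column 1 A) (column 2 A) = A" by (rule columns_eqI) simp_all

lemma colmat_mult: "A ** colmat v w = colmat (A *v v) (A *v w)"
 by (rule columns_eqI) (simp_all add: matrix_vec_column)

lemma colmat_vec: "colmat v w *v c = c$1 *s v + c$2 *s w" by (simp add: vec_eq_iff forall_2 colmat_def algebra_simps)

lemma smult_vec: "A *v (k *s v) = k *s (A *v v)" for A :: "complex^2^2" by (simp add: vec_eq_iff algebra_simps)

lemma mat_vec_sums:
 fixes A B :: "complex^2^2"
 shows "A *v (u + v) = A *v u + A *v v" "A *v (u - v) = A *v u - A *v v" "(A + B) *v u = A *v u + B *v u"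
  "A *v 0 = 0" by (simp_all add: vec_eq_iff algebra_simps)

lemma mat_mult_sums:
 fixes A B C :: "complex^2^2"
 shows "A ** (B + C) = A ** B + A ** C" "(A + B) ** C = A ** C + B ** C"
  "A ** (B - C) = A ** B - A ** C" "(A - B) ** C = A ** C - B ** C" "A ** 0 = 0" "0 ** A = 0"
  "A ** (- B) = - (A ** B)" "(- A) ** B = - (A ** B)" by (simp_all add: vec_eq_iff algebra_simps)

subsection \<open>Holomorphic matrices\<close>

lemma hol2_mat_onI: "(!!i j. hol2_on (%x. A x $ i $ j) W) ==> hol2_mat_on A W"
 and hol2_vec_onI: "(!!i. hol2_on (%x. u x $ i) W) ==> hol2_vec_on u W"
 and hol2_mat_onD: "hol2_mat_on A W ==> hol2_on (%x. A x $ i $ j) W"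
 and hol2_vec_onD: "hol2_vec_on u W ==> hol2_on (%x. u x $ i) W" by (simp_all add: hol2_mat_on_def hol2_vec_on_def)

lemma hol2_mat_on_subset: "hol2_mat_on A W ==> V \<subseteq> W ==> hol2_mat_on A V"
 and hol2_vec_on_subset: "hol2_vec_on u W ==> V \<subseteq> W ==> hol2_vec_on u V"
 by (auto simp: hol2_mat_on_def hol2_vec_on_def intro: hol2_on_subset)

lemma hol2_mat_on_cong: "(!!x. x : W ==> A x = B x) ==> hol2_mat_on A W \<longleftrightarrow> hol2_mat_on B W"
 and hol2_vec_on_cong: "(!!x. x : W ==> u x = v x) ==> hol2_vec_on u W \<longleftrightarrow> hol2_vec_on v W"
 unfolding hol2_mat_on_def hol2_vec_on_def by (intro all_cong1 hol2_on_cong; simp)+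

lemma hol2_mat_on_mult: "hol2_mat_on A W ==> hol2_mat_on B W ==> hol2_mat_on (%x. A x ** B x) W"
 by (rule hol2_mat_onI) (simp add: hol2_on_add hol2_on_mult hol2_mat_onD)

lemma hol2_vec_on_mult: "hol2_mat_on A W ==> hol2_vec_on u W ==> hol2_vec_on (%x. A x *v u x) W"
 by (rule hol2_vec_onI) (simp add: hol2_on_add hol2_on_mult hol2_mat_onD hol2_vec_onD)

lemma hol2_on_det: "hol2_mat_on A W ==> hol2_on (%x. det (A x)) W"
 unfolding det_2 by (intro hol2_on_diff hol2_on_mult hol2_mat_onD)

lemma hol2_mat_on_mat2:
 "hol2_on p W ==> hol2_on q W ==> hol2_on r W ==> hol2_on s W ==>
  hol2_mat_on (%x. mat2 (p x) (q x) (r x) (s x)) W" by (simp add: hol2_mat_on_def forall_2)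

lemma hol2_mat_on_inv:
 assumes A: "hol2_mat_on A W" and i: "!!x. x : W ==> invertible (A x)"
 shows "hol2_mat_on (%x. matrix_inv (A x)) W"
proof -
 have "hol2_mat_on (%x. mat2 (A x$2$2 / det (A x)) (- A x$1$2 / det (A x)) (- A x$2$1 / det (A x)) (A x$1$1 / det (A x))) W"
  using i by (intro hol2_mat_on_mat2 hol2_on_divide hol2_on_uminus hol2_on_det A hol2_mat_onD)
   (auto simp: invertible_det_nz)
 then show ?thesis by (subst hol2_mat_on_cong[OF matrix_inv2[OF i]])
qed

lemma hol2_mat_on_colmat: "hol2_vec_on u W ==> hol2_vec_on v W ==> hol2_mat_on (%x. colmat (u x) (v x)) W"
 unfolding colmat_def by (intro hol2_mat_on_mat2 hol2_vec_onD)

lemma hol2_vec_on_column: "hol2_mat_on A W ==> hol2_vec_on (%x. column j (A x)) W"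
 by (simp add: hol2_vec_on_def hol2_mat_on_def column_def)

lemma hol2_mat_on_local:
 assumes "!!x. x : W ==> EX V. open V & x : V & hol2_mat_on A (W Int V)"
 shows "hol2_mat_on A W"
proof (rule hol2_mat_onI, rule hol2_on_local)
 fix i j x assume "x : W"
 then show "EX V. open V & x : V & hol2_on (%x. A x $ i $ j) (W Int V)" using assms[of x] hol2_mat_onD by blast
qed

lemma hol2_vec_on_local:
 assumes "!!x. x : W ==> EX V. open V & x : V & hol2_vec_on u (W Int V)"
 shows "hol2_vec_on u W"
proof (rule hol2_vec_onI, rule hol2_on_local)
 fix i x assume "x : W"
 then show "EX V. open V & x : V & hol2_on (%x. u x $ i) (W Int V)" using assms[of x] hol2_vec_onD by blast
qed

subsection \<open>Derivatives along slices\<close>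

abbreviation rel_open :: "complex set => pt set => bool" where
 "rel_open B W \<equiv> openin (top_of_set (UNIV \<times> B)) W"

definition zdiff :: "(pt => complex) => pt => bool" where
 "zdiff h x \<longleftrightarrow> (%w. h (w, snd x)) field_differentiable at (fst x)"

definition tdiff :: "(pt => complex) => pt => bool" where
 "tdiff h x \<longleftrightarrow> (%s. h (fst x, s)) field_differentiable at (snd x)"

lemma rel_open_slice_fst:
 assumes "rel_open B W" "x : W"
 shows "EX S. open S & fst x : S & (ALL w:S. (w, snd x) : W)"
proof -
 obtain T where T: "open T" "W = (UNIV \<times> B) Int T" using assms(1) by (auto simp: openin_open)
 have "open ((%w. (w, snd x)) -` T)" by (intro open_vimage T continuous_intros)
 then show ?thesis using T assms(2) by (intro exI[of _ "(%w. (w, snd x)) -` T"]) auto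
qed

lemma rel_open_slice_snd:
 assumes "rel_open B W" "x : W" "snd x : interior B"
 shows "EX S. open S & snd x : S & (ALL w:S. (fst x, w) : W)"
proof -
 obtain T where T: "open T" "W = (UNIV \<times> B) Int T" using assms(1) by (auto simp: openin_open)
 have "open ((%w. (fst x, w)) -` T)" by (intro open_vimage T continuous_intros)
 then have "open ((%w. (fst x, w)) -` T Int interior B)" by blast
 then show ?thesis using T assms(2,3) interior_subset[of B]
  by (intro exI[of _ "(%w. (fst x, w)) -` T Int interior B"]) auto
qed

lemma rel_open_ev_fst:
 assumes "rel_open B W" "x : W" shows "\<forall>\<^sub>F w in nhds (fst x). (w, snd x) : W"
 using rel_open_slice_fst[OF assms] unfolding eventually_nhds by blast

lemma rel_open_ev_snd:
 assumes "rel_open B W" "x : W" "snd x : interior B" shows "\<forall>\<^sub>F w in nhds (snd x). (fst x, w) : W"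
 using rel_open_slice_snd[OF assms] unfolding eventually_nhds by blast

lemma hol2_on_zdiff:
 assumes "hol2_on h W" "rel_open B W" "x : W" shows "zdiff h x"
proof -
 obtain S where S: "open S" "fst x : S" "ALL w:S. (w, snd x) : W" using rel_open_slice_fst[OF assms(2,3)] by blast
 have "(%w. h (w, snd x)) holomorphic_on S" by (rule hol2_on_slice_fst[OF assms(1) S(1)]) (use S in auto)
 then show ?thesis unfolding zdiff_def using S holomorphic_on_imp_differentiable_at by blast
qed

lemma hol2_on_tdiff:
 assumes "hol2_on h W" "rel_open B W" "x : W" "snd x : interior B" shows "tdiff h x"
proof -
 obtain S where S: "open S" "snd x : S" "ALL w:S. (fst x, w) : W" using rel_open_slice_snd[OF assms(2,3,4)] by blast
 have "(%w. h (fst x, w)) holomorphic_on S" by (rule hol2_on_slice_snd[OF assms(1) S(1)]) (use S in auto)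
 then show ?thesis unfolding tdiff_def using S holomorphic_on_imp_differentiable_at by blast
qed

lemma deriv_add_mult:
 fixes f g h k :: "complex => complex"
 assumes "f field_differentiable at z" "g field_differentiable at z"
  "h field_differentiable at z" "k field_differentiable at z"
 shows "deriv (%w. f w * g w + h w * k w) z =
   deriv f z * g z + deriv h z * k z + (f z * deriv g z + h z * deriv k z)"
proof -
 have D: "(p has_field_derivative deriv p z) (at z)" if "p field_differentiable at z" for p :: "complex => complex"
  using that by (simp add: DERIV_deriv_iff_field_differentiable)
 have "((%w. f w * g w + h w * k w) has_field_derivative
   deriv f z * g z + deriv g z * f z + (deriv h z * k z + deriv k z * h z)) (at z)"
  by (intro DERIV_add DERIV_mult D assms)
 then show ?thesis by (simp add: DERIV_imp_deriv algebra_simps)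
qed

lemma dz_vec_mult:
 fixes A :: "pt => complex^2^2" and u :: "pt => complex^2"
 assumes "!!i j. zdiff (%y. A y $ i $ j) x" "!!i. zdiff (%y. u y $ i) x"
 shows "dz_vec (%y. A y *v u y) x = dz_mat A x *v u x + A x *v dz_vec u x" using assms unfolding zdiff_def
 by (simp add: vec_eq_iff dz_vec_def dz_mat_def deriv_add_mult)

lemma dt_vec_mult:
 fixes A :: "pt => complex^2^2" and u :: "pt => complex^2"
 assumes "!!i j. tdiff (%y. A y $ i $ j) x" "!!i. tdiff (%y. u y $ i) x"
 shows "dt_vec (%y. A y *v u y) x = dt_mat A x *v u x + A x *v dt_vec u x" using assms unfolding tdiff_def
 by (simp add: vec_eq_iff dt_vec_def dt_mat_def deriv_add_mult)

lemma dz_mat_mult: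
 fixes A B :: "pt => complex^2^2"
 assumes "!!i j. zdiff (%y. A y $ i $ j) x" "!!i j. zdiff (%y. B y $ i $ j) x"
 shows "dz_mat (%y. A y ** B y) x = dz_mat A x ** B x + A x ** dz_mat B x" using assms unfolding zdiff_def
 by (simp add: vec_eq_iff dz_mat_def deriv_add_mult)

lemma dt_mat_mult:
 fixes A B :: "pt => complex^2^2"
 assumes "!!i j. tdiff (%y. A y $ i $ j) x" "!!i j. tdiff (%y. B y $ i $ j) x"
 shows "dt_mat (%y. A y ** B y) x = dt_mat A x ** B x + A x ** dt_mat B x" using assms unfolding tdiff_def
 by (simp add: vec_eq_iff dt_mat_def deriv_add_mult)

lemma ev_vec_nth: "\<forall>\<^sub>F w in F. f w = g w ==> \<forall>\<^sub>F w in F. vec_nth (f w) i = vec_nth (g w) i"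
 by (erule eventually_mono) simp

lemma dz_vec_cong:
 assumes "\<forall>\<^sub>F w in nhds (fst x). u (w, snd x) = v (w, snd x)" shows "dz_vec u x = dz_vec v x"
 unfolding dz_vec_def by (simp add: vec_eq_iff deriv_cong_ev[OF ev_vec_nth[OF assms]])

lemma dt_vec_cong:
 assumes "\<forall>\<^sub>F w in nhds (snd x). u (fst x, w) = v (fst x, w)" shows "dt_vec u x = dt_vec v x"
 unfolding dt_vec_def by (simp add: vec_eq_iff deriv_cong_ev[OF ev_vec_nth[OF assms]])

lemma dz_mat_cong:
 assumes "\<forall>\<^sub>F w in nhds (fst x). A (w, snd x) = B (w, snd x)" shows "dz_mat A x = dz_mat B x"
 unfolding dz_mat_def by (simp add: vec_eq_iff deriv_cong_ev[OF ev_vec_nth[OF ev_vec_nth[OF assms]]])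

lemma dt_mat_cong:
 assumes "\<forall>\<^sub>F w in nhds (snd x). A (fst x, w) = B (fst x, w)" shows "dt_mat A x = dt_mat B x"
 unfolding dt_mat_def by (simp add: vec_eq_iff deriv_cong_ev[OF ev_vec_nth[OF ev_vec_nth[OF assms]]])

section \<open>Charts and frames\<close>

lemma te_structureD:
 assumes "te_structure P"
 shows "base P ~= {}" "open (base P) \<or> (EX t. base P = {t})"
  "!!x. x : total_base P ==> EX c:atlas P. x : chart_dom c"
  "!!c. c : atlas P ==> rel_open (base P) (chart_dom c)"
  "!!c x. c : atlas P ==> x : chart_dom c ==> invertible (triv c x)"
  "!!c x. c : atlas P ==> x : chart_dom c ==> x : total_base P"
  "!!c. c : atlas P ==> hol2_mat_on (pole_z c) (chart_dom c)"
  "!!c. c : atlas P ==> hol2_mat_on (pole_t c) (chart_dom c)"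
  "!!c c'. c : atlas P ==> c' : atlas P ==> hol2_mat_on (transition c c') (chart_dom c Int chart_dom c')"
  "!!c c' x. c : atlas P ==> c' : atlas P ==> x : chart_dom c Int chart_dom c' ==> fst x ~= 0 ==>
    dz_mat (transition c c') x + omega_z c' x ** transition c c' x = transition c c' x ** omega_z c x"
  "!!c c' x. c : atlas P ==> c' : atlas P ==> x : chart_dom c Int chart_dom c' ==> fst x ~= 0 ==>
    snd x : interior (base P) ==>
    dt_mat (transition c c') x + omega_t c' x ** transition c c' x = transition c c' x ** omega_t c x"
proof -
 note a = assms[unfolded te_structure_def]
 show "base P ~= {}" "open (base P) \<or> (EX t. base P = {t})" using a by blast+
 have U: "(\<Union>c\<in>atlas P. chart_dom c) = total_base P" using a by blast
 show "!!x. x : total_base P ==> EX c:atlas P. x : chart_dom c" unfolding U[symmetric] by blast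
 show "!!c x. c : atlas P ==> x : chart_dom c ==> x : total_base P" unfolding U[symmetric] by blast
qed (use assms in \<open>unfold te_structure_def, blast\<close>)+

lemma chart_at:
 assumes "te_structure P" "x : total_base P"
 shows "chart_at P x : atlas P" "x : chart_dom (chart_at P x)"
proof -
 have "EX c. c : atlas P & x : chart_dom c" using te_structureD(3)[OF assms] by blast
 from someI_ex[OF this] show "chart_at P x : atlas P" "x : chart_dom (chart_at P x)" unfolding chart_at_def by blast+
qed

lemma transition_triv:
 assumes "te_structure P" "c : atlas P" "x : chart_dom c"
 shows "transition c c' x ** triv c x = triv c' x"
 using te_structureD(5)[OF assms] by (simp add: transition_def matrix_mul_assoc[symmetric])

lemma rel_open_punctured: "rel_open B ((- {0}) \<times> B)"
proof -
 have "open ((- {0::complex}) \<times> (UNIV :: complex set))" by (intro open_Times) auto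
 then show ?thesis by (auto simp: openin_open intro!: exI[of _ "(- {0::complex}) \<times> (UNIV :: complex set)"])
qed

lemma rel_open_Int: "rel_open B V ==> rel_open B W ==> rel_open B (V Int W)" by (rule openin_Int)

lemma rel_open_ev_within:
 assumes "rel_open B W" "x : W" "S \<subseteq> UNIV \<times> B"
 shows "\<forall>\<^sub>F y in at x within S. y : W"
proof -
 obtain T where T: "open T" "W = (UNIV \<times> B) Int T" using assms(1) by (auto simp: openin_open)
 have "\<forall>\<^sub>F y in nhds x. y : T" using T assms(2) by (intro eventually_nhds_in_open) auto
 then show ?thesis unfolding eventually_at_filter by eventually_elim (use T assms(3) in auto)
qed

lemma ev_within_rel_open:
 assumes "\<forall>\<^sub>F y in at x within ((- {0}) \<times> B). Q y" "x : UNIV \<times> B" "fst x = 0"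
 shows "EX W. rel_open B W & x : W & (ALL y:W. fst y ~= 0 --> Q y)"
proof -
 have "\<forall>\<^sub>F y in nhds x. y ~= x --> y : (- {0}) \<times> B --> Q y"
  using assms(1) unfolding eventually_at_filter .
 then obtain T where T: "open T" "x : T" "!!y. y : T ==> y ~= x --> y : (- {0}) \<times> B --> Q y"
  unfolding eventually_nhds by blast
 have "rel_open B ((UNIV \<times> B) Int T)" using T(1) by (rule openin_open_Int)
 moreover have "ALL y:(UNIV \<times> B) Int T. fst y ~= 0 --> Q y"
 proof (intro ballI impI)
  fix y assume y: "y : (UNIV \<times> B) Int T" "fst y ~= 0"
  then have "y ~= x" "y : (- {0}) \<times> B" "y : T" using assms(3) by (auto simp: mem_Times_iff)
  then show "Q y" using T(3) by blast
 qed
 ultimately show ?thesis using T(2) assms(2) by blast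
qed

definition jordan_pole :: "complex => complex => complex^2^2" where
 "jordan_pole \<alpha> z = mat2 (\<alpha> / z) 0 (1 / z) (\<alpha> / z)"

text \<open>
 A frame \<open>E = (e\<^sub>1, e\<^sub>2)\<close> of \<open>H'\<close> with \<open>e\<^sub>1, e\<^sub>2 \<in> C^\<alpha>\<close> and
 \<open>(\<nabla>\<^bsub>z\<partial>z\<^esub> - \<alpha>) e\<^sub>1 = e\<^sub>2\<close>, \<open>(\<nabla>\<^bsub>z\<partial>z\<^esub> - \<alpha>) e\<^sub>2 = 0\<close>, written in the charts.
\<close>

definition adapted_frame :: "te => complex => (pt => complex^2^2) => bool" where
 "adapted_frame P \<alpha> E \<longleftrightarrow> te_structure P & (ALL x:punctured P. invertible (E x)) &
  (ALL c:atlas P. hol2_mat_on (%x. triv c x ** E x) (chart_dom c Int punctured P) &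
    (ALL x:chart_dom c Int punctured P.
     dz_mat (%x. triv c x ** E x) x + omega_z c x ** (triv c x ** E x)
      = (triv c x ** E x) ** jordan_pole \<alpha> (fst x) &
     (snd x : interior (base P) -->
      dt_mat (%x. triv c x ** E x) x + omega_t c x ** (triv c x ** E x) = 0)))"

locale framed_te =
 fixes P :: te and \<alpha> :: complex and E :: "pt => complex^2^2"
 assumes frame: "adapted_frame P \<alpha> E"
begin

lemma te: "te_structure P" and E_inv: "x : punctured P ==> invertible (E x)"
 and E_hol: "c : atlas P ==> hol2_mat_on (%x. triv c x ** E x) (chart_dom c Int punctured P)"
 and E_z: "c : atlas P ==> x : chart_dom c ==> x : punctured P ==>
    dz_mat (%x. triv c x ** E x) x + omega_z c x ** (triv c x ** E x)
      = (triv c x ** E x) ** jordan_pole \<alpha> (fst x)"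
 and E_t: "c : atlas P ==> x : chart_dom c ==> x : punctured P ==> snd x : interior (base P) ==>
    dt_mat (%x. triv c x ** E x) x + omega_t c x ** (triv c x ** E x) = 0"
 using frame unfolding adapted_frame_def by blast+

lemmas teD = te_structureD[OF te]

lemma rel_open_chart_punctured: "c : atlas P ==> rel_open (base P) (chart_dom c Int punctured P)"
 by (intro rel_open_Int teD rel_open_punctured)

lemma triv_E_inv: "c : atlas P ==> x : chart_dom c ==> x : punctured P ==> invertible (triv c x ** E x)"
 by (intro invertible_mult teD E_inv)

lemma nabla_z_frame:
 fixes g :: "pt => complex^2"
 assumes x: "x : punctured P" and g: "!!i. zdiff (%y. g y $ i) x"
  and \<sigma>: "\<forall>\<^sub>F w in nhds (fst x). \<sigma> (w, snd x) = E (w, snd x) *v g (w, snd x)"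
 shows "nabla_z P \<sigma> x = E x *v (dz_vec g x + jordan_pole \<alpha> (fst x) *v g x)"
proof -
 define c where "c = chart_at P x"
 have c: "c : atlas P" "x : chart_dom c" using chart_at[OF te, of x] x by (auto simp: c_def)
 let ?F = "%y. triv c y ** E y"
 have Fz: "zdiff (%y. ?F y $ i $ j) x" for i j
  using hol2_on_zdiff[OF hol2_mat_onD[OF E_hol[OF c(1)]] rel_open_chart_punctured[OF c(1)]] c x by auto
 have "dz_vec (%y. triv c y *v \<sigma> y) x = dz_vec (%y. ?F y *v g y) x"
  by (rule dz_vec_cong) (use \<sigma> in \<open>auto elim!: eventually_mono simp: matrix_vector_mul_assoc\<close>)
 also have "\<dots> = dz_mat ?F x *v g x + ?F x *v dz_vec g x" by (rule dz_vec_mult[OF Fz g])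
 finally have 1: "dz_vec (%y. triv c y *v \<sigma> y) x = dz_mat ?F x *v g x + ?F x *v dz_vec g x" .
 have "\<sigma> x = E x *v g x" using eventually_nhds_x_imp_x[OF \<sigma>] by simp
 then have "omega_z c x *v (triv c x *v \<sigma> x) = (omega_z c x ** ?F x) *v g x"
  by (simp add: matrix_vector_mul_assoc matrix_mul_assoc)
 then have "dz_vec (%y. triv c y *v \<sigma> y) x + omega_z c x *v (triv c x *v \<sigma> x) =
   (dz_mat ?F x + omega_z c x ** ?F x) *v g x + ?F x *v dz_vec g x" unfolding 1 by (simp add: mat_vec_sums)
 also have "\<dots> = triv c x *v (E x *v (dz_vec g x + jordan_pole \<alpha> (fst x) *v g x))"
  unfolding E_z[OF c x] by (simp add: mat_vec_sums matrix_vector_mul_assoc matrix_mul_assoc add.commute)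
 finally show ?thesis by (simp add: nabla_z_def Let_def c_def[symmetric] teD(5)[OF c])
qed

lemma nabla_t_frame:
 fixes g :: "pt => complex^2"
 assumes x: "x : punctured P" and xi: "snd x : interior (base P)" and g: "!!i. tdiff (%y. g y $ i) x"
  and \<sigma>: "\<forall>\<^sub>F w in nhds (snd x). \<sigma> (fst x, w) = E (fst x, w) *v g (fst x, w)"
 shows "nabla_t P \<sigma> x = E x *v dt_vec g x"
proof -
 define c where "c = chart_at P x"
 have c: "c : atlas P" "x : chart_dom c" using chart_at[OF te, of x] x by (auto simp: c_def)
 let ?F = "%y. triv c y ** E y"
 have Ft: "tdiff (%y. ?F y $ i $ j) x" for i j
  using hol2_on_tdiff[OF hol2_mat_onD[OF E_hol[OF c(1)]] rel_open_chart_punctured[OF c(1)] _ xi] c x by auto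
 have "dt_vec (%y. triv c y *v \<sigma> y) x = dt_vec (%y. ?F y *v g y) x"
  by (rule dt_vec_cong) (use \<sigma> in \<open>auto elim!: eventually_mono simp: matrix_vector_mul_assoc\<close>)
 also have "\<dots> = dt_mat ?F x *v g x + ?F x *v dt_vec g x" by (rule dt_vec_mult[OF Ft g])
 finally have 1: "dt_vec (%y. triv c y *v \<sigma> y) x = dt_mat ?F x *v g x + ?F x *v dt_vec g x" .
 have "\<sigma> x = E x *v g x" using eventually_nhds_x_imp_x[OF \<sigma>] by simp
 then have "omega_t c x *v (triv c x *v \<sigma> x) = (omega_t c x ** ?F x) *v g x"
  by (simp add: matrix_vector_mul_assoc matrix_mul_assoc)
 then have "dt_vec (%y. triv c y *v \<sigma> y) x + omega_t c x *v (triv c x *v \<sigma> x) =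
   (dt_mat ?F x + omega_t c x ** ?F x) *v g x + ?F x *v dt_vec g x" unfolding 1 by (simp add: mat_vec_sums)
 also have "\<dots> = triv c x *v (E x *v dt_vec g x)" unfolding E_t[OF c x xi] by (simp add: matrix_vector_mul_assoc)
 finally show ?thesis by (simp add: nabla_t_def Let_def c_def[symmetric] teD(5)[OF c])
qed

lemma holsec_frame:
 assumes W: "rel_open (base P) W" "W \<subseteq> punctured P"
  and \<sigma>: "!!x. x : W ==> \<sigma> x = E x *v g x"
 shows "holsec_on P \<sigma> W \<longleftrightarrow> hol2_vec_on g W"
proof
 assume g: "hol2_vec_on g W"
 show "holsec_on P \<sigma> W" unfolding holsec_on_def
 proof
  fix c assume c: "c : atlas P"
  have "hol2_vec_on (%x. (triv c x ** E x) *v g x) (W Int chart_dom c)"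
   by (intro hol2_vec_on_mult hol2_mat_on_subset[OF E_hol[OF c]] hol2_vec_on_subset[OF g]) (use W in auto)
  then show "hol2_vec_on (%x. triv c x *v \<sigma> x) (W Int chart_dom c)"
   by (subst hol2_vec_on_cong[where v="%x. (triv c x ** E x) *v g x"]) (simp_all add: \<sigma> matrix_vector_mul_assoc)
 qed
next
 assume h: "holsec_on P \<sigma> W"
 show "hol2_vec_on g W"
 proof (rule hol2_vec_on_local)
  fix x assume x: "x : W"
  then obtain c where c: "c : atlas P" "x : chart_dom c" using teD(3)[of x] W by auto
  obtain V where V: "open V" "chart_dom c = (UNIV \<times> base P) Int V"
   using teD(4)[OF c(1)] by (auto simp: openin_open)
  have WV: "W Int V = W Int chart_dom c" using V W by auto
  have h1: "hol2_vec_on (%x. triv c x *v \<sigma> x) (W Int chart_dom c)" using h c(1) by (simp add: holsec_on_def)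
  have h2: "hol2_mat_on (%x. triv c x ** E x) (W Int chart_dom c)"
   by (rule hol2_mat_on_subset[OF E_hol[OF c(1)]]) (use W in auto)
  have gA: "hol2_vec_on (%x. matrix_inv (triv c x ** E x) *v (triv c x *v \<sigma> x)) (W Int chart_dom c)"
   by (rule hol2_vec_on_mult[OF hol2_mat_on_inv[OF h2 triv_E_inv] h1]) (use c W in auto)
  have gB: "matrix_inv (triv c x ** E x) *v (triv c x *v \<sigma> x) = g x" if "x : W Int chart_dom c" for x
  proof -
   have eq: "triv c x *v \<sigma> x = (triv c x ** E x) *v g x" using that by (simp add: \<sigma> matrix_vector_mul_assoc)
   have "invertible (triv c x ** E x)" using that W by (intro triv_E_inv c) auto
   then show ?thesis unfolding eq by (rule inv_cancel(5))
  qed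
  have "hol2_vec_on g (W Int V)" unfolding WV by (rule iffD1[OF hol2_vec_on_cong[OF gB] gA])
  then show "EX V. open V & x : V & hol2_vec_on g (W Int V)" using V c by auto
 qed
qed

end

section \<open>Bases of stalks\<close>

text \<open>
 The points with \<open>z \<noteq> 0\<close> are dense, in the total space and over a single point.
\<close>

lemma hol2_eq_at_zero:
 assumes "hol2_on p W" "hol2_on q W" "rel_open B W" "!!y. y : W ==> fst y ~= 0 ==> p y = q y" "y : W"
 shows "p y = q y"
proof (cases "fst y = 0")
 case True
 have ev: "EV w. p (w, snd y) = q (w, snd y)" using rel_open_ev_fst[OF assms(3,5)] unfolding eventually_at_filter True
  by eventually_elim (use assms(4) in auto)
 have lim: "(%w. h (w, snd y)) \<midarrow>0\<rightarrow> h y" if "hol2_on h W" for h :: "pt => complex"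
 proof -
  have "isCont (%w. h (w, snd y)) 0" using hol2_on_zdiff[OF that assms(3,5)] True
   unfolding zdiff_def by (auto intro: field_differentiable_imp_continuous_at)
  then show ?thesis using True by (simp add: isCont_def) (metis prod.collapse)
 qed
 show ?thesis by (rule LIM_unique[OF Lim_transform_eventually[OF lim[OF assms(1)] ev] lim[OF assms(2)]])
qed (use assms in auto)

lemma rel_open_nonzero:
 assumes "hol2_on h W" "rel_open B W" "x : W" "h x ~= 0"
 shows "EX V. rel_open B V & x : V & V \<subseteq> W & (ALL y:V. h y ~= 0)"
proof -
 have "openin (top_of_set W) (W Int h -` (- {0}))"
  by (rule continuous_openin_preimage_gen[OF hol2_on_imp_continuous_on[OF assms(1)]]) auto
 then have "rel_open B (W Int h -` (- {0}))" using openin_trans assms(2) by blast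
 then show ?thesis using assms by (intro exI[of _ "W Int h -` (- {0})"]) auto
qed

lemma holsec_of_chart:
 assumes te: "te_structure R" and c: "c : atlas R" and W: "W \<subseteq> chart_dom c" and F: "hol2_vec_on F W"
 shows "holsec_on R (%y. matrix_inv (triv c y) *v F y) W" unfolding holsec_on_def
proof
 fix c' assume c': "c' : atlas R"
 have "hol2_vec_on (%y. transition c c' y *v F y) (W Int chart_dom c')"
  by (intro hol2_vec_on_mult hol2_mat_on_subset[OF te_structureD(9)[OF te c c']] hol2_vec_on_subset[OF F])
    (use W in auto)
 moreover have "triv c' y *v (matrix_inv (triv c y) *v F y) = transition c c' y *v F y" for y
  by (simp add: transition_def matrix_vector_mul_assoc)
 ultimately show "hol2_vec_on (%y. triv c' y *v (matrix_inv (triv c y) *v F y)) (W Int chart_dom c')" by simp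
qed

lemma stalk_chart_iff:
 assumes te: "te_structure R" and c: "c : atlas R" and x: "x : chart_dom c"
 shows "\<tau> : stalk R x \<longleftrightarrow> (EX F W. rel_open (base R) W & x : W & W \<subseteq> chart_dom c & hol2_vec_on F W &
   (ALL y:W. fst y ~= 0 --> F y = triv c y *v \<tau> y))"
proof
 assume "\<tau> : stalk R x"
 then obtain \<sigma> W where *: "rel_open (base R) W" "x : W" "holsec_on R \<sigma> W" "ALL y:W. fst y ~= 0 --> \<tau> y = \<sigma> y"
  unfolding stalk_def by blast
 have "hol2_vec_on (%y. triv c y *v \<sigma> y) (W Int chart_dom c)" using *(3) c by (auto simp: holsec_on_def)
 then show "EX F W. rel_open (base R) W & x : W & W \<subseteq> chart_dom c & hol2_vec_on F W &
   (ALL y:W. fst y ~= 0 --> F y = triv c y *v \<tau> y)" using * x rel_open_Int[OF *(1) te_structureD(4)[OF te c]]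
  by (intro exI[of _ "%y. triv c y *v \<sigma> y"] exI[of _ "W Int chart_dom c"]) auto
next
 assume "EX F W. rel_open (base R) W & x : W & W \<subseteq> chart_dom c & hol2_vec_on F W &
   (ALL y:W. fst y ~= 0 --> F y = triv c y *v \<tau> y)"
 then obtain F W where *: "rel_open (base R) W" "x : W" "W \<subseteq> chart_dom c" "hol2_vec_on F W"
   "ALL y:W. fst y ~= 0 --> F y = triv c y *v \<tau> y" by blast
 have "ALL y:W. fst y ~= 0 --> \<tau> y = matrix_inv (triv c y) *v F y" using * te_structureD(5)[OF te c] by auto
 then show "\<tau> : stalk R x" unfolding stalk_def using holsec_of_chart[OF te c *(3,4)] *(1,2) by blast
qed

text \<open>
 If \<open>v\<^sub>1, v\<^sub>2\<close> generate the stalk, then so in particular the constant sections of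
 the chart; their coefficients form a holomorphic inverse of the matrix of \<open>v\<^sub>1,
 v\<^sub>2\<close>, which is therefore invertible at \<open>z = 0\<close>. Conversely Cramer's rule gives the
 coefficients.
\<close>

lemma stalk_direct_sum_iff:
 assumes te: "te_structure R" and c: "c : atlas R" and x: "x : chart_dom c" "fst x = 0"
 shows "stalk_direct_sum R x v1 v2 \<longleftrightarrow>
  (EX W K. rel_open (base R) W & x : W & W \<subseteq> chart_dom c & hol2_mat_on K W & det (K x) ~= 0 &
    (ALL y:W. fst y ~= 0 --> K y = triv c y ** colmat (v1 y) (v2 y)))" (is "?l \<longleftrightarrow> ?r")
proof
 have xt: "x : total_base R" using te_structureD(6)[OF te c x(1)] .
 have psub: "punctured R \<subseteq> UNIV \<times> base R" by auto
 assume r: ?r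
 then obtain W0 K where W0: "rel_open (base R) W0" "x : W0" "W0 \<subseteq> chart_dom c" and K0: "hol2_mat_on K W0"
  and dK: "det (K x) ~= 0" and Kv0: "ALL y:W0. fst y ~= 0 --> K y = triv c y ** colmat (v1 y) (v2 y)" by blast
 obtain W where W: "rel_open (base R) W" "x : W" "W \<subseteq> W0" "ALL y:W. det (K y) ~= 0"
  using rel_open_nonzero[OF hol2_on_det[OF K0] W0(1,2) dK] by blast
 have K: "hol2_mat_on K W" using hol2_mat_on_subset[OF K0 W(3)] .
 have Ki: "invertible (K y)" if "y : W" for y using W(4) that by (simp add: invertible_det_nz)
 have Kv: "K y *v d = triv c y *v (d$1 *s v1 y + d$2 *s v2 y)" if "y : W" "fst y ~= 0" for y d
 proof -
  have "K y = triv c y ** colmat (v1 y) (v2 y)" using Kv0 that W(3) by blast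
  then show ?thesis by (simp only: matrix_vector_mul_assoc[symmetric] colmat_vec)
 qed
 have Tc: "invertible (triv c y)" if "y : W" for y using te_structureD(5)[OF te c] W(3) W0(3) that by blast
 have inW: "\<forall>\<^sub>F y in at x within punctured R. y : V" if "rel_open (base R) V" "x : V" for V
  using rel_open_ev_within[OF that psub] .
 have evp: "\<forall>\<^sub>F y in at x within punctured R. fst y ~= 0"
  unfolding eventually_at_filter by (intro always_eventually) auto
 show ?l unfolding stalk_direct_sum_def
 proof (intro conjI allI impI iffI)
  fix \<tau> assume "\<tau> : stalk R x"
  then obtain F V where V: "rel_open (base R) V" "x : V" "V \<subseteq> chart_dom c" "hol2_vec_on F V"
   "ALL y:V. fst y ~= 0 --> F y = triv c y *v \<tau> y" using stalk_chart_iff[OF te c x(1)] by blast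
  have VW: "rel_open (base R) (V Int W)" "x : V Int W" using rel_open_Int V W by auto
  define d where "d y = matrix_inv (K y) *v F y" for y
  have d: "hol2_vec_on d (V Int W)" unfolding d_def
   by (intro hol2_vec_on_mult hol2_mat_on_inv hol2_mat_on_subset[OF K] hol2_vec_on_subset[OF V(4)] Ki) auto
  have eq: "\<tau> y = d y $ 1 *s v1 y + d y $ 2 *s v2 y" if "y : V Int W" "fst y ~= 0" for y
  proof (rule invertible_cancel_vec)
   show "invertible (triv c y)" using Tc that by auto
   have "triv c y *v (d y $ 1 *s v1 y + d y $ 2 *s v2 y) = K y *v d y" using Kv that by auto
   also have "\<dots> = triv c y *v \<tau> y" using that V(5) Ki by (auto simp: d_def)
   finally show "triv c y *v \<tau> y = triv c y *v (d y $ 1 *s v1 y + d y $ 2 *s v2 y)" by simp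
  qed
  show "EX a b. hol_germ R x a & hol_germ R x b & (\<forall>\<^sub>F y in at x within punctured R. \<tau> y = a y *s v1 y + b y *s v2 y)"
  proof (intro exI conjI)
   show "hol_germ R x (%y. d y $ 1)" "hol_germ R x (%y. d y $ 2)"
    unfolding hol_germ_def using VW hol2_vec_onD[OF d] by blast+
   show "\<forall>\<^sub>F y in at x within punctured R. \<tau> y = d y $ 1 *s v1 y + d y $ 2 *s v2 y"
    using inW[OF VW] evp by eventually_elim (rule eq)
  qed
 next
  fix \<tau> assume "EX a b. hol_germ R x a & hol_germ R x b & (\<forall>\<^sub>F y in at x within punctured R. \<tau> y = a y *s v1 y + b y *s v2 y)"
  then obtain a b Wa Wb where ab: "rel_open (base R) Wa" "x : Wa" "hol2_on a Wa" "rel_open (base R) Wb" "x : Wb" "hol2_on b Wb"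
    and ev: "\<forall>\<^sub>F y in at x within punctured R. \<tau> y = a y *s v1 y + b y *s v2 y" unfolding hol_germ_def by blast
  obtain V where V: "rel_open (base R) V" "x : V" "ALL y:V. fst y ~= 0 --> \<tau> y = a y *s v1 y + b y *s v2 y"
   using ev_within_rel_open[OF ev xt x(2)] by blast
  let ?V = "V Int (Wa Int (Wb Int W))"
  define d :: "pt => complex^2" where "d y = vector [a y, b y]" for y
  have d: "hol2_vec_on d ?V" unfolding hol2_vec_on_def d_def using ab by (auto simp: forall_2 intro: hol2_on_subset)
  show "\<tau> : stalk R x" unfolding stalk_chart_iff[OF te c x(1)]
  proof (intro exI conjI ballI impI)
   show "rel_open (base R) ?V" by (intro rel_open_Int V W ab)
   show "hol2_vec_on (%y. K y *v d y) ?V" by (intro hol2_vec_on_mult hol2_mat_on_subset[OF K] d) auto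
   show "K y *v d y = triv c y *v \<tau> y" if "y : ?V" "fst y ~= 0" for y
    using Kv[of y "d y"] V(3) that by (simp add: d_def)
  qed (use V ab W W0 in auto)
 next
  fix a b assume "hol_germ R x a & hol_germ R x b & (\<forall>\<^sub>F y in at x within punctured R. a y *s v1 y + b y *s v2 y = 0)"
  then obtain Wa Wb where ab: "rel_open (base R) Wa" "x : Wa" "hol2_on a Wa" "rel_open (base R) Wb" "x : Wb" "hol2_on b Wb"
    and ev: "\<forall>\<^sub>F y in at x within punctured R. a y *s v1 y + b y *s v2 y = 0" unfolding hol_germ_def by blast
  obtain V where V: "rel_open (base R) V" "x : V" "ALL y:V. fst y ~= 0 --> a y *s v1 y + b y *s v2 y = 0"
   using ev_within_rel_open[OF ev xt x(2)] by blast
  let ?V = "V Int (Wa Int (Wb Int W))"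
  have oV: "rel_open (base R) ?V" by (intro rel_open_Int V W ab)
  have z: "a y = 0 & b y = 0" if "y : ?V" "fst y ~= 0" for y
  proof -
   define d :: "complex^2" where "d = vector [a y, b y]"
   have "K y *v d = triv c y *v (a y *s v1 y + b y *s v2 y)" using Kv[of y d] that by (simp add: d_def)
   also have "\<dots> = K y *v 0" using V(3) that by simp
   finally have "d = 0" using invertible_cancel_vec Ki that by blast
   then show ?thesis by (simp add: d_def vec_eq_iff forall_2)
  qed
  have "a y = 0 & b y = 0" if "y : ?V" for y
   using hol2_eq_at_zero[OF hol2_on_subset[OF ab(3)] hol2_on_const oV _ that, of 0]
    hol2_eq_at_zero[OF hol2_on_subset[OF ab(6)] hol2_on_const oV _ that, of 0] z by blast
  moreover obtain T where T: "open T" "?V = (UNIV \<times> base R) Int T" using oV by (auto simp: openin_open)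
  moreover have "x : T" using T V ab W by auto
  ultimately show "\<forall>\<^sub>F y in nhds x. y : total_base R --> a y = 0 & b y = 0"
   unfolding eventually_nhds by (intro exI[of _ T]) blast
 qed
next
 have xt: "x : total_base R" using te_structureD(6)[OF te c x(1)] .
 assume l: ?l
 have cst: "hol_germ R x (%_. k)" for k unfolding hol_germ_def using te_structureD(4)[OF te c] x(1) by blast
 have l1: "\<tau> : stalk R x" if "EX a b. hol_germ R x a & hol_germ R x b &
   (\<forall>\<^sub>F y in at x within punctured R. \<tau> y = a y *s v1 y + b y *s v2 y)" for \<tau>
  using l that unfolding stalk_direct_sum_def by blast
 have l2: "EX a b. hol_germ R x a & hol_germ R x b &
   (\<forall>\<^sub>F y in at x within punctured R. \<tau> y = a y *s v1 y + b y *s v2 y)" if "\<tau> : stalk R x" for \<tau>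
  using l that unfolding stalk_direct_sum_def by blast
 have v: "v1 : stalk R x" "v2 : stalk R x" by (rule l1, rule exI[of _ "%_. 1"], rule exI[of _ "%_. 0"], simp add: cst)
    (rule l1, rule exI[of _ "%_. 0"], rule exI[of _ "%_. 1"], simp add: cst)
 obtain F1 W1 where F1: "rel_open (base R) W1" "x : W1" "W1 \<subseteq> chart_dom c" "hol2_vec_on F1 W1"
   "ALL y:W1. fst y ~= 0 --> F1 y = triv c y *v v1 y" using v(1) stalk_chart_iff[OF te c x(1)] by blast
 obtain F2 W2 where F2: "rel_open (base R) W2" "x : W2" "W2 \<subseteq> chart_dom c" "hol2_vec_on F2 W2"
   "ALL y:W2. fst y ~= 0 --> F2 y = triv c y *v v2 y" using v(2) stalk_chart_iff[OF te c x(1)] by blast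
 let ?W = "W1 Int W2"
 define K where "K y = colmat (F1 y) (F2 y)" for y
 have W: "rel_open (base R) ?W" "x : ?W" using rel_open_Int F1 F2 by auto
 have K: "hol2_mat_on K ?W" unfolding K_def
  by (intro hol2_mat_on_colmat hol2_vec_on_subset[OF F1(4)] hol2_vec_on_subset[OF F2(4)]) auto
 have Kv: "K y = triv c y ** colmat (v1 y) (v2 y)" if "y : ?W" "fst y ~= 0" for y
  using that F1(5) F2(5) by (simp add: K_def colmat_mult)
 have "EX d V. rel_open (base R) V & x : V & hol2_vec_on d V & (ALL y:V. fst y ~= 0 --> K y *v d y = axis j 1)" for j
 proof -
  have "(%y. matrix_inv (triv c y) *v axis j 1) : stalk R x" unfolding stalk_chart_iff[OF te c x(1)]
   using te_structureD(4,5)[OF te c] x(1) by (intro exI[of _ "%_. axis j 1"] exI[of _ "chart_dom c"])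
     (auto intro!: hol2_vec_onI hol2_on_const)
  from l2[OF this] obtain a b where ab0: "hol_germ R x a" "hol_germ R x b"
    and ev: "\<forall>\<^sub>F y in at x within punctured R. matrix_inv (triv c y) *v axis j 1 = a y *s v1 y + b y *s v2 y"
   by blast
  then obtain Wa Wb where ab: "rel_open (base R) Wa" "x : Wa" "hol2_on a Wa" "rel_open (base R) Wb" "x : Wb" "hol2_on b Wb"
   unfolding hol_germ_def by blast
  obtain V where V: "rel_open (base R) V" "x : V"
    "ALL y:V. fst y ~= 0 --> matrix_inv (triv c y) *v axis j 1 = a y *s v1 y + b y *s v2 y"
   using ev_within_rel_open[OF ev xt x(2)] by blast
  let ?V = "V Int (Wa Int (Wb Int ?W))"
  define d :: "pt => complex^2" where "d y = vector [a y, b y]" for y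
  show ?thesis
  proof (intro exI conjI ballI impI)
   show "rel_open (base R) ?V" by (intro rel_open_Int V F1 F2 ab)
   show "hol2_vec_on d ?V" unfolding hol2_vec_on_def d_def using ab by (auto simp: forall_2 intro: hol2_on_subset)
   fix y assume y: "y : ?V" "fst y ~= 0"
   have "K y = triv c y ** colmat (v1 y) (v2 y)" by (rule Kv) (use y in auto)
   then have "K y *v d y = triv c y *v (colmat (v1 y) (v2 y) *v d y)" by (simp only: matrix_vector_mul_assoc)
   also have "\<dots> = triv c y *v (a y *s v1 y + b y *s v2 y)" unfolding colmat_vec by (simp add: d_def)
   also have "\<dots> = triv c y *v (matrix_inv (triv c y) *v axis j 1)" using V(3) y by simp
   also have "\<dots> = axis j 1" using te_structureD(5)[OF te c, of y] y F1(3) by auto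
   finally show "K y *v d y = axis j 1" .
  qed (use V ab F1 F2 in auto)
 qed
 then obtain d V where dV: "!!j. rel_open (base R) (V j)" "!!j. x : V j" "!!j. hol2_vec_on (d j) (V j)"
   "!!j y. y : V j ==> fst y ~= 0 ==> K y *v d j y = axis j 1" by metis
 let ?V = "V 1 Int (V 2 Int ?W)"
 have oV: "rel_open (base R) ?V" by (intro rel_open_Int dV F1 F2)
 have xV: "x : ?V" using dV W by auto
 have Kd: "hol2_vec_on (%y. K y *v d j y) ?V" for j using exhaust_2[of j]
  by (intro hol2_vec_on_mult hol2_mat_on_subset[OF K] hol2_vec_on_subset[OF dV(3)]) auto
 have "(K x *v d j x) $ i = axis j 1 $ i" for i j
 proof (rule hol2_eq_at_zero[OF hol2_vec_onD[OF Kd] hol2_on_const oV _ xV])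
  fix y assume y: "y : ?V" "fst y ~= 0"
  have "K y *v d j y = axis j 1" by (rule dV(4)) (use y exhaust_2[of j] in auto)
  then show "(K y *v d j y) $ i = axis j 1 $ i" by (simp only:)
 qed
 then have "K x *v d j x = axis j 1" for j by (simp add: vec_eq_iff)
 then have "K x ** colmat (d 1 x) (d 2 x) = mat 1"
  by (simp add: colmat_mult) (simp add: colmat_def vec_eq_iff forall_2 mat_def axis_def)
 then have "det (K x) ~= 0" by (metis det_mul det_I mult_zero_left zero_neq_one)
 then show ?r using W K Kv F1(3) by blast
qed

section \<open>Lattice bases in a frame\<close>

text \<open>
 The columns of \<open>V\<close> are coordinates with respect to the frame; all statements about stalks are
 reduced to this form.
\<close>

definition lattice_basis :: "te => (pt => complex^2^2) => pt => (pt => complex^2^2) => bool" where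
 "lattice_basis R E x V \<longleftrightarrow>
   stalk_direct_sum R x (%y. E y *v column 1 (V y)) (%y. E y *v column 2 (V y))"

lemma stalk_direct_sum_cong:
 assumes "!!y. y : punctured R ==> v1 y = w1 y" "!!y. y : punctured R ==> v2 y = w2 y"
 shows "stalk_direct_sum R x v1 v2 \<longleftrightarrow> stalk_direct_sum R x w1 w2"
proof -
 have ev: "\<forall>\<^sub>F y in at x within punctured R. y : punctured R" by (simp add: eventually_at_filter)
 have "(\<forall>\<^sub>F y in at x within punctured R. Q (v1 y) (v2 y) y) \<longleftrightarrow>
   (\<forall>\<^sub>F y in at x within punctured R. Q (w1 y) (w2 y) y)" for Q
 proof
  assume "\<forall>\<^sub>F y in at x within punctured R. Q (v1 y) (v2 y) y"
  with ev show "\<forall>\<^sub>F y in at x within punctured R. Q (w1 y) (w2 y) y"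
   by eventually_elim (simp add: assms)
 next
  assume "\<forall>\<^sub>F y in at x within punctured R. Q (w1 y) (w2 y) y"
  with ev show "\<forall>\<^sub>F y in at x within punctured R. Q (v1 y) (v2 y) y"
   by eventually_elim (simp add: assms)
 qed
 from this[of "%v w y. \<tau> y = a y *s v + b y *s w" for \<tau> a b] this[of "%v w y. a y *s v + b y *s w = 0" for a b]
 show ?thesis unfolding stalk_direct_sum_def by (simp only:)
qed

context framed_te
begin

lemma lattice_basis_iff:
 assumes c: "c : atlas P" and x: "x : chart_dom c" "fst x = 0"
 shows "lattice_basis P E x V \<longleftrightarrow>
  (EX W K. rel_open (base P) W & x : W & W \<subseteq> chart_dom c & hol2_mat_on K W & det (K x) ~= 0 &
    (ALL y:W. fst y ~= 0 --> K y = triv c y ** E y ** V y))"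
proof -
 have "triv c y ** colmat (E y *v column 1 (V y)) (E y *v column 2 (V y)) = triv c y ** E y ** V y" for y
  by (simp only: colmat_mult[symmetric] colmat_column matrix_mul_assoc)
 then show ?thesis unfolding lattice_basis_def stalk_direct_sum_iff[OF te c x] by (simp only:)
qed

lemma lattice_basis_change:
 assumes x: "x : total_base P" "fst x = 0" and V: "lattice_basis P E x V"
  and C: "rel_open (base P) W" "x : W" "hol2_mat_on C W" "det (C x) ~= 0"
  and VC: "!!y. y : W ==> fst y ~= 0 ==> V' y = V y ** C y"
 shows "lattice_basis P E x V'"
proof -
 obtain c where c: "c : atlas P" "x : chart_dom c" using teD(3)[OF x(1)] by blast
 obtain W1 K where K: "rel_open (base P) W1" "x : W1" "W1 \<subseteq> chart_dom c" "hol2_mat_on K W1" "det (K x) ~= 0"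
   "ALL y:W1. fst y ~= 0 --> K y = triv c y ** E y ** V y" using V lattice_basis_iff[OF c x(2)] by blast
 show ?thesis unfolding lattice_basis_iff[OF c x(2)]
 proof (intro exI conjI ballI impI)
  show "rel_open (base P) (W1 Int W)" by (intro rel_open_Int K C)
  show "hol2_mat_on (%y. K y ** C y) (W1 Int W)"
   by (intro hol2_mat_on_mult hol2_mat_on_subset[OF K(4)] hol2_mat_on_subset[OF C(3)]) auto
  show "det (K x ** C x) ~= 0" using K(5) C(4) by (simp add: det_mult2)
  show "K y ** C y = triv c y ** E y ** V' y" if "y : W1 Int W" "fst y ~= 0" for y
  proof -
   have "V' y = V y ** C y" "K y = triv c y ** E y ** V y" using VC K(6) that by blast+
   then show ?thesis by (simp only: matrix_mul_assoc)
  qed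
 qed (use K C in auto)
qed

lemma lattice_bases_related:
 assumes x: "x : total_base P" "fst x = 0" and V: "lattice_basis P E x V" "lattice_basis P E x V'"
  and Vi: "!!y. y : punctured P ==> invertible (V y)"
 shows "EX W C. rel_open (base P) W & x : W & hol2_mat_on C W & det (C x) ~= 0 &
  (ALL y:W. fst y ~= 0 --> V' y = V y ** C y)"
proof -
 obtain c where c: "c : atlas P" "x : chart_dom c" using teD(3)[OF x(1)] by blast
 obtain W1 K where K: "rel_open (base P) W1" "x : W1" "W1 \<subseteq> chart_dom c" "hol2_mat_on K W1" "det (K x) ~= 0"
   "ALL y:W1. fst y ~= 0 --> K y = triv c y ** E y ** V y" using V(1) lattice_basis_iff[OF c x(2)] by blast
 obtain W2 L where L: "rel_open (base P) W2" "x : W2" "W2 \<subseteq> chart_dom c" "hol2_mat_on L W2" "det (L x) ~= 0"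
   "ALL y:W2. fst y ~= 0 --> L y = triv c y ** E y ** V' y" using V(2) lattice_basis_iff[OF c x(2)] by blast
 obtain W3 where W3: "rel_open (base P) W3" "x : W3" "W3 \<subseteq> W1" "ALL y:W3. det (K y) ~= 0"
  using rel_open_nonzero[OF hol2_on_det[OF K(4)] K(1,2,5)] by blast
 have Ki: "invertible (K y)" if "y : W3" for y using W3(4) that by (simp add: invertible_det_nz)
 show ?thesis
 proof (intro exI conjI ballI impI)
  show "rel_open (base P) (W3 Int W2)" by (intro rel_open_Int W3 L)
  show "hol2_mat_on (%y. matrix_inv (K y) ** L y) (W3 Int W2)"
   using W3(3) by (intro hol2_mat_on_mult hol2_mat_on_inv hol2_mat_on_subset[OF K(4)] hol2_mat_on_subset[OF L(4)] Ki) auto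
  have "invertible (matrix_inv (K x))" using Ki[OF W3(2)] by (rule invertible_inv)
  then show "det (matrix_inv (K x) ** L x) ~= 0" using L(5) by (simp add: det_mult2 invertible_det_nz)
  show "V' y = V y ** (matrix_inv (K y) ** L y)" if y: "y : W3 Int W2" "fst y ~= 0" for y
  proof (rule invertible_cancel_left)
   have yc: "y : chart_dom c" using y W3(3) K(3) by blast
   have yp: "y : punctured P" using teD(6)[OF c(1) yc] y(2) by (auto simp: mem_Times_iff)
   show "invertible (triv c y ** E y)" by (rule triv_E_inv[OF c(1) yc yp])
   have Ky: "triv c y ** E y ** V y = K y" and Ly: "triv c y ** E y ** V' y = L y" using K(6) L(6) y W3(3) by auto
   have "triv c y ** E y ** (V y ** (matrix_inv (K y) ** L y)) = K y ** (matrix_inv (K y) ** L y)"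
    unfolding Ky[symmetric] by (simp only: matrix_mul_assoc)
   also have "\<dots> = L y" by (rule inv_cancel(4)) (use Ki y in auto)
   finally show "triv c y ** E y ** V' y = triv c y ** E y ** (V y ** (matrix_inv (K y) ** L y))" using Ly by simp
  qed
 qed (use W3 L in auto)
qed

lemma stalk_lattice_basis_iff:
 assumes x: "x : total_base P" "fst x = 0" and V: "lattice_basis P E x V"
  and Vi: "!!y. y : punctured P ==> invertible (V y)"
  and \<tau>: "!!y. y : punctured P ==> \<tau> y = E y *v (V y *v d y)"
 shows "\<tau> : stalk P x \<longleftrightarrow> (EX W d'. rel_open (base P) W & x : W & hol2_vec_on d' W &
   (ALL y:W. fst y ~= 0 --> d' y = d y))"
proof -
 obtain c where c: "c : atlas P" "x : chart_dom c" using teD(3)[OF x(1)] by blast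
 obtain W1 K where K: "rel_open (base P) W1" "x : W1" "W1 \<subseteq> chart_dom c" "hol2_mat_on K W1" "det (K x) ~= 0"
   "ALL y:W1. fst y ~= 0 --> K y = triv c y ** E y ** V y" using V lattice_basis_iff[OF c x(2)] by blast
 obtain W3 where W3: "rel_open (base P) W3" "x : W3" "W3 \<subseteq> W1" "ALL y:W3. det (K y) ~= 0"
  using rel_open_nonzero[OF hol2_on_det[OF K(4)] K(1,2,5)] by blast
 have Ki: "invertible (K y)" if "y : W3" for y using W3(4) that by (simp add: invertible_det_nz)
 have Kd: "triv c y *v \<tau> y = K y *v d y" if y: "y : W3" "fst y ~= 0" for y
 proof -
  have yc: "y : chart_dom c" using y W3(3) K(3) by blast
  have yp: "y : punctured P" using teD(6)[OF c(1) yc] y(2) by (auto simp: mem_Times_iff)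
  have Ky: "K y = triv c y ** E y ** V y" using K(6) y W3(3) by auto
  show ?thesis unfolding Ky \<tau>[OF yp] by (simp only: matrix_vector_mul_assoc matrix_mul_assoc)
 qed
 show ?thesis
 proof
  assume "\<tau> : stalk P x"
  then obtain F W where F: "rel_open (base P) W" "x : W" "W \<subseteq> chart_dom c" "hol2_vec_on F W"
   "ALL y:W. fst y ~= 0 --> F y = triv c y *v \<tau> y" using stalk_chart_iff[OF te c] by blast
  show "EX W d'. rel_open (base P) W & x : W & hol2_vec_on d' W & (ALL y:W. fst y ~= 0 --> d' y = d y)"
  proof (intro exI conjI ballI impI)
   show "rel_open (base P) (W3 Int W)" by (intro rel_open_Int W3 F)
   show "hol2_vec_on (%y. matrix_inv (K y) *v F y) (W3 Int W)"
    using W3(3) by (intro hol2_vec_on_mult hol2_mat_on_inv hol2_mat_on_subset[OF K(4)] hol2_vec_on_subset[OF F(4)] Ki) auto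
   show "matrix_inv (K y) *v F y = d y" if "y : W3 Int W" "fst y ~= 0" for y
   proof -
    have Fy: "F y = K y *v d y" using F(5) Kd[of y] that by simp
    show ?thesis unfolding Fy by (rule inv_cancel(5)) (use Ki that in auto)
   qed
  qed (use W3 F in auto)
 next
  assume "EX W d'. rel_open (base P) W & x : W & hol2_vec_on d' W & (ALL y:W. fst y ~= 0 --> d' y = d y)"
  then obtain W d' where d: "rel_open (base P) W" "x : W" "hol2_vec_on d' W" "ALL y:W. fst y ~= 0 --> d' y = d y" by blast
  show "\<tau> : stalk P x" unfolding stalk_chart_iff[OF te c]
  proof (intro exI conjI ballI impI)
   show "rel_open (base P) (W3 Int W)" by (intro rel_open_Int W3 d)
   show "hol2_vec_on (%y. K y *v d' y) (W3 Int W)"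
    using W3(3) by (intro hol2_vec_on_mult hol2_mat_on_subset[OF K(4)] hol2_vec_on_subset[OF d(3)]) auto
   show "K y *v d' y = triv c y *v \<tau> y" if "y : W3 Int W" "fst y ~= 0" for y using Kd[of y] d(4) that by simp
  qed (use W3 d K in auto)
 qed
qed

end

section \<open>Restriction to a point\<close>

lemma rel_open_restrict: "rel_open B W ==> t : B ==> rel_open {t} (W Int UNIV \<times> {t})"
 by (auto simp: openin_open)

lemma restr_simps [simp]: "base (restr P t) = {t}"
 "atlas (restr P t) = (%c. c\<lparr>chart_dom := chart_dom c Int UNIV \<times> {t}\<rparr>) ` atlas P"
 by (simp_all add: restr_def)

lemma chart_restrict_simps [simp]:
 "transition (c\<lparr>chart_dom := D\<rparr>) (c'\<lparr>chart_dom := D'\<rparr>) = transition c c'"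
 "omega_z (c\<lparr>chart_dom := D\<rparr>) = omega_z c" "omega_t (c\<lparr>chart_dom := D\<rparr>) = omega_t c"
 by (simp_all add: fun_eq_iff transition_def omega_z_def omega_t_def)

lemma te_structure_restr:
 assumes te: "te_structure P" and t: "t : base P"
 shows "te_structure (restr P t)"
proof -
 note D = te_structureD[OF te]
 have un: "(\<Union>c\<in>atlas P. chart_dom c Int UNIV \<times> {t}) = UNIV \<times> {t}"
 proof (intro equalityI subsetI)
  fix x :: pt assume "x : UNIV \<times> {t}"
  then show "x : (\<Union>c\<in>atlas P. chart_dom c Int UNIV \<times> {t})" using D(3)[of x] t by auto
 qed auto
 have sub: "hol2_mat_on A (chart_dom c Int UNIV \<times> {t} Int (chart_dom c' Int UNIV \<times> {t}))"
  if "hol2_mat_on A (chart_dom c Int chart_dom c')" for A c c' by (rule hol2_mat_on_subset[OF that]) auto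
 show ?thesis unfolding te_structure_def restr_simps
 proof (intro conjI)
  show "(\<Union>c\<in>(%c. c\<lparr>chart_dom := chart_dom c Int UNIV \<times> {t}\<rparr>) ` atlas P. chart_dom c) = UNIV \<times> {t}"
   using un by simp
  show "ALL c:(%c. c\<lparr>chart_dom := chart_dom c Int UNIV \<times> {t}\<rparr>) ` atlas P.
    rel_open {t} (chart_dom c) & (ALL x:chart_dom c. invertible (triv c x)) &
    hol2_mat_on (pole_z c) (chart_dom c) & hol2_mat_on (pole_t c) (chart_dom c)"
  proof
   fix c assume "c : (%c. c\<lparr>chart_dom := chart_dom c Int UNIV \<times> {t}\<rparr>) ` atlas P"
   then obtain c0 where c0: "c0 : atlas P" "c = c0\<lparr>chart_dom := chart_dom c0 Int UNIV \<times> {t}\<rparr>" by blast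
   show "rel_open {t} (chart_dom c) & (ALL x:chart_dom c. invertible (triv c x)) &
    hol2_mat_on (pole_z c) (chart_dom c) & hol2_mat_on (pole_t c) (chart_dom c)"
    unfolding c0 using rel_open_restrict[OF D(4)[OF c0(1)] t] D(5)[OF c0(1)]
     hol2_mat_on_subset[OF D(7)[OF c0(1)] Int_lower1] hol2_mat_on_subset[OF D(8)[OF c0(1)] Int_lower1] by simp
  qed
  show "ALL c:(%c. c\<lparr>chart_dom := chart_dom c Int UNIV \<times> {t}\<rparr>) ` atlas P.
   ALL c':(%c. c\<lparr>chart_dom := chart_dom c Int UNIV \<times> {t}\<rparr>) ` atlas P.
    hol2_mat_on (transition c c') (chart_dom c Int chart_dom c') &
    (ALL x:chart_dom c Int chart_dom c'. fst x ~= 0 -->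
      dz_mat (transition c c') x + omega_z c' x ** transition c c' x = transition c c' x ** omega_z c x &
      (snd x : interior {t} -->
       dt_mat (transition c c') x + omega_t c' x ** transition c c' x = transition c c' x ** omega_t c x))"
   using D(10) sub[OF D(9)] by (simp add: interior_singleton)
  show "ALL c:(%c. c\<lparr>chart_dom := chart_dom c Int UNIV \<times> {t}\<rparr>) ` atlas P.
    ALL x:chart_dom c. fst x ~= 0 & snd x : interior {t} -->
    dz_mat (omega_t c) x - dt_mat (omega_z c) x + (omega_z c x ** omega_t c x - omega_t c x ** omega_z c x) = 0"
   by (simp add: interior_singleton)
 qed auto
qed

lemma restr_frame:
 assumes f: "framed_te P \<alpha> E" and t: "t : base P"
 shows "framed_te (restr P t) \<alpha> E"
proof -
 interpret framed_te P \<alpha> E by (rule f)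
 show ?thesis
 proof (unfold_locales, unfold adapted_frame_def restr_simps, intro conjI ballI)
  show "te_structure (restr P t)" by (rule te_structure_restr[OF te t])
  show "invertible (E x)" if "x : (- {0}) \<times> {t}" for x using E_inv[of x] that t by auto
  fix c assume "c : (%c. c\<lparr>chart_dom := chart_dom c Int UNIV \<times> {t}\<rparr>) ` atlas P"
  then obtain c0 where c0: "c0 : atlas P" "c = c0\<lparr>chart_dom := chart_dom c0 Int UNIV \<times> {t}\<rparr>" by blast
  show "hol2_mat_on (%x. triv c x ** E x) (chart_dom c Int (- {0}) \<times> {t})"
   by (simp add: c0) (rule hol2_mat_on_subset[OF E_hol[OF c0(1)]], use t in auto)
  fix x assume x: "x : chart_dom c Int (- {0}) \<times> {t}"
  show "dz_mat (%x. triv c x ** E x) x + omega_z c x ** (triv c x ** E x) = triv c x ** E x ** jordan_pole \<alpha> (fst x)"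
   using E_z[OF c0(1), of x] x t unfolding c0 by auto
  show "snd x : interior {t} --> dt_mat (%x. triv c x ** E x) x + omega_t c x ** (triv c x ** E x) = 0"
   by (simp add: interior_singleton)
 qed
qed

subsection \<open>One-variable form over a point\<close>

lemma rel_open_point_ball:
 assumes "rel_open {t} W" "(0, t) : W"
 shows "EX r>0. ball 0 r \<times> {t} \<subseteq> W"
proof -
 obtain S where S: "open S" "0 : S" "ALL w:S. (w, t) : W" using rel_open_slice_fst[OF assms] by auto
 then obtain r where "r > 0" "ball 0 r \<subseteq> S" using open_contains_ball by blast
 then show ?thesis using S by auto
qed

lemma rel_open_ball_point: "rel_open {t} (ball 0 r \<times> {t})"
proof -
 have "ball 0 r \<times> {t} = (UNIV \<times> {t}) Int (ball 0 r \<times> UNIV)" by auto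
 then show ?thesis by (metis openin_open_Int open_Times open_ball open_UNIV)
qed

lemma hol2_point_ext0:
 assumes "hol2_on K W" "rel_open {t} W" "(0, t) : W"
 shows "ext0 (%z. K (z, t)) (K (0, t))"
proof -
 obtain r where r: "r > 0" "ball 0 r \<times> {t} \<subseteq> W" using rel_open_point_ball[OF assms(2,3)] by blast
 have "(%z. K (z, t)) holomorphic_on ball 0 r" using hol2_on_subset[OF assms(1) r(2)] by (simp add: hol2_on_point_iff)
 then show ?thesis using r(1) by (intro ext0_analytic) (auto simp: analytic_at_ball)
qed

lemma ext0_hol2_point:
 assumes "!!i. i : I ==> ext0 (f i) (c i)" "finite I"
 shows "EX r>0. ALL i:I. EX K. hol2_on K (ball 0 r \<times> {t}) & K (0, t) = c i & (ALL z:ball 0 r - {0}. K (z, t) = f i z)"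
 using assms(2,1)
proof (induction I)
 case empty
 then show ?case by (intro exI[of _ 1]) auto
next
 case (insert i I)
 then obtain r where r: "r > 0" "ALL i:I. EX K. hol2_on K (ball 0 r \<times> {t}) & K (0, t) = c i & (ALL z:ball 0 r - {0}. K (z, t) = f i z)" by auto
 obtain s F where F: "s > 0" "F holomorphic_on ball 0 s" "F 0 = c i" "!!z. z : ball 0 s - {0} ==> f i z = F z"
  using ext0_holomorphic[of "f i" "c i"] insert.prems by (metis insertI1)
 have sub: "hol2_on K (ball 0 (min r s) \<times> {t})" if "hol2_on K (ball 0 r \<times> {t})" for K
  by (rule hol2_on_subset[OF that]) auto
 have "EX K. hol2_on K (ball 0 (min r s) \<times> {t}) & K (0, t) = c j & (ALL z:ball 0 (min r s) - {0}. K (z, t) = f j z)"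
  if j: "j : insert i I" for j
 proof (cases "j = i")
  case True
  have "F holomorphic_on ball 0 (min r s)" by (rule holomorphic_on_subset[OF F(2)]) auto
  then have "hol2_on (%x. F (fst x)) (ball 0 (min r s) \<times> {t})" by (simp add: hol2_on_point_iff)
  then show ?thesis using F True by (intro exI[of _ "%x. F (fst x)"]) auto
 next
  case False
  then obtain K where "hol2_on K (ball 0 r \<times> {t})" "K (0, t) = c j" "ALL z:ball 0 r - {0}. K (z, t) = f j z"
   using r(2) j by blast
  then show ?thesis using sub by (intro exI[of _ K]) auto
 qed
 then show ?case using r(1) F(1) by (intro exI[of _ "min r s"]) auto
qed

lemma ext0_mat_hol2_point:
 assumes "ext0_mat F K0"
 shows "EX r>0. EX K. hol2_mat_on K (ball 0 r \<times> {t}) & K (0, t) = K0 & (ALL z:ball 0 r - {0}. K (z, t) = F z)"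
proof -
 have "EX r>0. ALL p:UNIV. EX K. hol2_on K (ball 0 r \<times> {t}) & K (0, t) = (%(i, j). K0 $ i $ j) p &
   (ALL z:ball 0 r - {0}. K (z, t) = (%(i, j) z. F z $ i $ j) p z)"
  by (rule ext0_hol2_point) (use assms in \<open>auto simp: ext0_mat_def\<close>)
 then obtain r where r: "r > 0" "!!i j. EX K. hol2_on K (ball 0 r \<times> {t}) & K (0, t) = K0 $ i $ j &
   (ALL z:ball 0 r - {0}. K (z, t) = F z $ i $ j)" by fastforce
 then obtain K where K: "!!i j. hol2_on (K i j) (ball 0 r \<times> {t})" "!!i j. K i j (0, t) = K0 $ i $ j"
   "!!i j. ALL z:ball 0 r - {0}. K i j (z, t) = F z $ i $ j" by metis
 show ?thesis by (intro exI[of _ r] conjI r(1) exI[of _ "%x. \<chi> i j. K i j x"])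
    (use K in \<open>auto simp: hol2_mat_on_def vec_eq_iff\<close>)
qed

lemma ext0_vec_hol2_point:
 fixes F :: "complex => complex^2"
 assumes "!!i. ext0 (%z. F z $ i) (K0 $ i)"
 shows "EX r>0. EX K. hol2_vec_on K (ball 0 r \<times> {t}) & (ALL z:ball 0 r - {0}. K (z, t) = F z)"
proof -
 have "ext0_mat (%z. colmat (F z) (F z)) (colmat K0 K0)" using assms by (simp add: ext0_mat_def colmat_def forall_2)
 from ext0_mat_hol2_point[OF this, of t]
 obtain r K where K: "r > 0" "hol2_mat_on K (ball 0 r \<times> {t})" "ALL z:ball 0 r - {0}. K (z, t) = colmat (F z) (F z)" by blast
 then show ?thesis by (intro exI[of _ r] conjI exI[of _ "%x. column 1 (K x)"] hol2_vec_on_column) auto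
qed

locale framed_point = framed_te R \<alpha> E for R \<alpha> E +
 fixes t :: complex
 assumes base_R: "base R = {t}"
begin

lemma punctured_R: "x : punctured R \<longleftrightarrow> fst x ~= 0 & snd x = t"
 using base_R by (auto simp: mem_Times_iff)

lemma origin_R: "origin R = (0, t)" by (simp add: origin_def base_R)

lemma origin_total: "(0, t) : total_base R" by (simp add: base_R)

lemma lattice_basis_ext0:
 assumes c: "c : atlas R" "(0, t) : chart_dom c"
 shows "lattice_basis R E (0, t) V \<longleftrightarrow>
  (EX K0. ext0_mat (%z. triv c (z, t) ** E (z, t) ** V (z, t)) K0 & det K0 ~= 0)"
proof
 assume "lattice_basis R E (0, t) V"
 then obtain W K where K: "rel_open {t} W" "(0, t) : W" "hol2_mat_on K W" "det (K (0, t)) ~= 0"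
   "ALL y:W. fst y ~= 0 --> K y = triv c y ** E y ** V y" using lattice_basis_iff[OF c] base_R by auto
 obtain r where r: "r > 0" "ball 0 r \<times> {t} \<subseteq> W" using rel_open_point_ball[OF K(1,2)] by blast
 have ev: "EV z. triv c (z, t) ** E (z, t) ** V (z, t) = K (z, t)" using eventually_at0_in_ball[OF r(1)]
 proof eventually_elim
  case (elim z)
  then show ?case using K(5) subsetD[OF r(2), of "(z, t)"] by simp
 qed
 have "ext0_mat (%z. triv c (z, t) ** E (z, t) ** V (z, t)) (K (0, t))" unfolding ext0_mat_def
 proof (intro allI)
  fix i j
  show "ext0 (%z. (triv c (z, t) ** E (z, t) ** V (z, t)) $ i $ j) (K (0, t) $ i $ j)"
   by (rule ext0_cong[OF hol2_point_ext0[OF hol2_mat_onD[OF K(3)] K(1,2)]])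
     (use ev in \<open>rule eventually_mono, simp only:\<close>)
 qed
 then show "EX K0. ext0_mat (%z. triv c (z, t) ** E (z, t) ** V (z, t)) K0 & det K0 ~= 0" using K(4) by blast
next
 assume "EX K0. ext0_mat (%z. triv c (z, t) ** E (z, t) ** V (z, t)) K0 & det K0 ~= 0"
 then obtain K0 where "ext0_mat (%z. triv c (z, t) ** E (z, t) ** V (z, t)) K0" "det K0 ~= 0" by blast
 from ext0_mat_hol2_point[OF this(1), of t] this(2)
 obtain r K where K: "r > 0" "hol2_mat_on K (ball 0 r \<times> {t})" "det (K (0, t)) ~= 0"
   "ALL z:ball 0 r - {0}. K (z, t) = triv c (z, t) ** E (z, t) ** V (z, t)" by blast
 have co: "rel_open {t} (chart_dom c)" using teD(4)[OF c(1)] base_R by simp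
 show "lattice_basis R E (0, t) V" unfolding lattice_basis_iff[OF c fst_conv] base_R
 proof (intro exI conjI ballI impI)
  let ?W = "ball 0 r \<times> {t} Int chart_dom c"
  show "rel_open {t} ?W" by (intro rel_open_Int rel_open_ball_point co)
  show "hol2_mat_on K ?W" by (rule hol2_mat_on_subset[OF K(2)]) auto
  show "K y = triv c y ** E y ** V y" if "y : ?W" "fst y ~= 0" for y using K(4) that by auto
 qed (use K c in auto)
qed

lemma lattice_bases_related_ext0:
 assumes V: "lattice_basis R E (0, t) V" "lattice_basis R E (0, t) V'"
  and Vi: "!!z. z ~= 0 ==> invertible (V (z, t))"
 shows "EX C C0. ext0_mat C C0 & det C0 ~= 0 & (EV z. V' (z, t) = V (z, t) ** C z)"
proof -
 have Vi': "invertible (V y)" if "y : punctured R" for y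
  using Vi[of "fst y"] that by (metis punctured_R prod.collapse)
 obtain W C where C: "rel_open {t} W" "(0, t) : W" "hol2_mat_on C W" "det (C (0, t)) ~= 0"
  "ALL y:W. fst y ~= 0 --> V' y = V y ** C y"
  using lattice_bases_related[OF origin_total fst_conv V Vi'] base_R by auto
 obtain r where r: "r > 0" "ball 0 r \<times> {t} \<subseteq> W" using rel_open_point_ball[OF C(1,2)] by blast
 have "EV z. V' (z, t) = V (z, t) ** C (z, t)" using eventually_at0_in_ball[OF r(1)]
 proof eventually_elim
  case (elim z)
  then show ?case using C(5) subsetD[OF r(2), of "(z, t)"] by simp
 qed
 moreover have "ext0_mat (%z. C (z, t)) (C (0, t))"
  using hol2_point_ext0[OF hol2_mat_onD[OF C(3)] C(1,2)] by (simp add: ext0_mat_def)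
 ultimately show ?thesis using C(4) by blast
qed

lemma stalk_ext0_iff:
 assumes V: "lattice_basis R E (0, t) V"
  and Vi: "!!z. z ~= 0 ==> invertible (V (z, t))"
  and \<tau>: "!!z. z ~= 0 ==> \<tau> (z, t) = E (z, t) *v (V (z, t) *v d z)"
 shows "\<tau> : stalk R (0, t) \<longleftrightarrow> (ALL i. EX c. ext0 (%z. d z $ i) c)"
proof -
 have Vi': "invertible (V y)" if "y : punctured R" for y
  using Vi[of "fst y"] that by (metis punctured_R prod.collapse)
 have \<tau>': "\<tau> y = E y *v (V y *v d (fst y))" if "y : punctured R" for y
  using \<tau>[of "fst y"] that by (metis punctured_R prod.collapse)
 note iff = stalk_lattice_basis_iff[OF origin_total fst_conv V Vi' \<tau>', unfolded base_R]
 show ?thesis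
 proof
  assume "\<tau> : stalk R (0, t)"
  then obtain W d' where d: "rel_open {t} W" "(0, t) : W" "hol2_vec_on d' W" "ALL y:W. fst y ~= 0 --> d' y = d (fst y)"
   using iff by blast
  obtain r where r: "r > 0" "ball 0 r \<times> {t} \<subseteq> W" using rel_open_point_ball[OF d(1,2)] by blast
  have ev: "EV z. d z $ i = d' (z, t) $ i" for i
   using eventually_at0_in_ball[OF r(1)] by eventually_elim (use r d(4) in force)
  show "ALL i. EX c. ext0 (%z. d z $ i) c"
   using ext0_cong[OF hol2_point_ext0[OF hol2_vec_onD[OF d(3)] d(1,2)] ev] by blast
 next
  assume "ALL i. EX c. ext0 (%z. d z $ i) c"
  then obtain c where "!!i. ext0 (%z. d z $ i) (c i)" by metis
  then have "!!i. ext0 (%z. d z $ i) ((\<chi> i. c i) $ i)" by simp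
  from ext0_vec_hol2_point[OF this, of t] obtain r K where K: "r > 0" "hol2_vec_on K (ball 0 r \<times> {t})"
   "ALL z:ball 0 r - {0}. K (z, t) = d z" by blast
  have "rel_open {t} (ball 0 r \<times> {t}) & (0, t) : ball 0 r \<times> {t} & hol2_vec_on K (ball 0 r \<times> {t}) &
    (ALL y:ball 0 r \<times> {t}. fst y ~= 0 --> K y = d (fst y))" using K rel_open_ball_point by auto
  then show "\<tau> : stalk R (0, t)" using iff by blast
 qed
qed

end

section \<open>The spaces $C^\alpha$ in a frame\<close>

lemma euler_first_order:
 fixes f :: "complex => complex"
 assumes f: "f holomorphic_on - {0}" and e: "!!z. z ~= 0 ==> z * deriv f z = of_int n * f z"
 shows "EX c. ALL z. z ~= 0 --> f z = c * z powi n"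
proof -
 have "(%z. z powi (- n) * f z) constant_on - {0}"
 proof (rule has_field_derivative_0_imp_constant_on)
  show "((%z. z powi (- n) * f z) has_field_derivative 0) (at z)" if "z : - {0}" for z
  proof -
   have z: "z ~= 0" using that by auto
   have D: "(f has_field_derivative deriv f z) (at z)" by (rule holomorphic_derivI[OF f _ that]) auto
   have "((%z. z powi (- n) * f z) has_field_derivative
    of_int (- n) * z powi (- n - 1) * f z + z powi (- n) * deriv f z) (at z)"
    by (rule derivative_eq_intros D refl | simp add: z)+
   moreover have "z powi (- n) = z powi (- n - 1) * z" using power_int_add[OF disjI1[OF z], of "- n - 1" 1] by simp
   then have "of_int (- n) * z powi (- n - 1) * f z + z powi (- n) * deriv f z =
     z powi (- n - 1) * (z * deriv f z - of_int n * f z)" by (simp add: algebra_simps)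
   ultimately show ?thesis using e[OF z] by simp
  qed
 qed (auto intro: connected_punctured_universe)
 then obtain c where c: "!!z. z ~= 0 ==> z powi (- n) * f z = c" by (auto simp: constant_on_def)
 have "f z = c * z powi n" if "z ~= 0" for z using c[OF that] that by (simp add: power_int_minus field_simps)
 then show ?thesis by blast
qed

text \<open>There is no holomorphic logarithm on the punctured plane: \<open>z u' = c\<close> forces \<open>c = 0\<close>.\<close>

lemma euler_second_order:
 fixes f :: "complex => complex"
 assumes f: "f holomorphic_on - {0}"
  and e: "!!z. z ~= 0 ==> z * deriv (%w. w * deriv f w - of_int n * f w) z = of_int n * (z * deriv f z - of_int n * f z)"
 shows "EX c. ALL z. z ~= 0 --> f z = c * z powi n" and "!!z. z ~= 0 ==> z * deriv f z - of_int n * f z = 0"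
proof -
 have df: "deriv f holomorphic_on - {0}" by (rule holomorphic_deriv[OF f]) auto
 have "(%w. w * deriv f w - of_int n * f w) holomorphic_on - {0}" by (intro holomorphic_intros df f)
 from euler_first_order[OF this e] obtain c where c: "!!z. z ~= 0 ==> z * deriv f z - of_int n * f z = c * z powi n" by blast
 let ?u = "%z. z powi (- n) * f z"
 have D: "(?u has_field_derivative c / z) (at z)" if z: "z ~= 0" for z
 proof -
  have D: "(f has_field_derivative deriv f z) (at z)" by (rule holomorphic_derivI[OF f]) (use z in auto)
  have du: "(?u has_field_derivative of_int (- n) * z powi (- n - 1) * f z + z powi (- n) * deriv f z) (at z)"
   by (rule derivative_eq_intros D refl | simp add: z)+
  have zn: "z powi (- n) = z powi (- n - 1) * z" using power_int_add[OF disjI1[OF z], of "- n - 1" 1] by simp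
  then have "of_int (- n) * z powi (- n - 1) * f z + z powi (- n) * deriv f z =
    z powi (- n - 1) * (z * deriv f z - of_int n * f z)" by (simp add: algebra_simps)
  also have "\<dots> = z powi (- n - 1) * (c * z powi n)" unfolding c[OF z] ..
  also have "\<dots> = c * z powi (- n - 1 + n)" using power_int_add[OF disjI1[OF z], of "- n - 1" n] by simp
  also have "\<dots> = c / z" by (simp add: divide_inverse)
  finally have "of_int (- n) * z powi (- n - 1) * f z + z powi (- n) * deriv f z = c / z" .
  then show ?thesis using du by simp
 qed
 have "((%z. c / (z - 0)) has_contour_integral ?u (pathfinish (circlepath 0 1)) - ?u (pathstart (circlepath 0 1))) (circlepath 0 1)"
  by (rule contour_integral_primitive[of "- {0}"]) (auto intro!: has_field_derivative_at_within D)
 moreover have "((%z. c / (z - 0)) has_contour_integral (2 * of_real pi * \<i> * c)) (circlepath 0 1)"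
  by (rule Cauchy_integral_circlepath) (auto intro!: continuous_intros)
 ultimately have "2 * of_real pi * \<i> * c = 0" using has_contour_integral_unique by fastforce
 then have c0: "c = 0" by simp
 show z0: "!!z. z ~= 0 ==> z * deriv f z - of_int n * f z = 0" using c c0 by simp
 show "EX c. ALL z. z ~= 0 --> f z = c * z powi n" by (rule euler_first_order[OF f]) (use z0 in auto)
qed

text \<open>
 Coordinates of the elements of \<open>C^(\<alpha> + n)\<close>: multiplication by \<open>z^n\<close> is an
 isomorphism from \<open>C^\<alpha>\<close>.
\<close>

definition power_vec :: "int => complex => complex => pt => complex^2" where
 "power_vec n c d x = vector [c * fst x powi n, d * fst x powi n]"

definition log_op :: "int => (pt => complex^2) => pt => complex^2" where
 "log_op n g x = vector [fst x * deriv (%w. g (w, snd x) $ 1) (fst x) - of_int n * g x $ 1,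
   fst x * deriv (%w. g (w, snd x) $ 2) (fst x) + g x $ 1 - of_int n * g x $ 2]"

lemma log_op_power_vec:
 assumes "fst x ~= 0" shows "log_op n (power_vec m c d) x =
  vector [of_int (m - n) * c * fst x powi m, (of_int (m - n) * d + c) * fst x powi m]"
proof -
 have "deriv (%w. k * w powi m) (fst x) = k * (of_int m * fst x powi (m - 1))" for k
  by (rule DERIV_imp_deriv) (use assms in \<open>auto intro!: derivative_eq_intros\<close>)
 moreover have "fst x * fst x powi (m - 1) = fst x powi m"
  using power_int_add[OF disjI1[OF assms], of 1 "m - 1"] by simp
 then have "fst x * (k * (of_int m * fst x powi (m - 1))) = k * of_int m * fst x powi m" for k
  by (metis (no_types, lifting) mult.assoc mult.left_commute)
 ultimately show ?thesis by (simp add: log_op_def power_vec_def vec_eq_iff forall_2 algebra_simps)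
qed

context framed_te
begin

lemma nabla_log_frame:
 fixes g :: "pt => complex^2"
 assumes x: "x : punctured P" and g: "!!i. zdiff (%y. g y $ i) x"
  and \<sigma>: "!!y. y : punctured P ==> \<sigma> y = E y *v g y"
 shows "nabla_log P (\<alpha> + of_int n) \<sigma> x = E x *v log_op n g x"
proof -
 have z: "fst x ~= 0" using x by auto
 have ev: "\<forall>\<^sub>F w in nhds (fst x). \<sigma> (w, snd x) = E (w, snd x) *v g (w, snd x)"
  using rel_open_ev_fst[OF rel_open_punctured x] by eventually_elim (rule \<sigma>)
 have "nabla_log P (\<alpha> + of_int n) \<sigma> x =
   fst x *s (E x *v (dz_vec g x + jordan_pole \<alpha> (fst x) *v g x)) - (\<alpha> + of_int n) *s (E x *v g x)"
  unfolding nabla_log_def nabla_z_frame[OF x g ev] \<sigma>[OF x] ..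
 also have "\<dots> = E x *v (fst x *s (dz_vec g x + jordan_pole \<alpha> (fst x) *v g x) - (\<alpha> + of_int n) *s g x)"
  by (simp only: smult_vec mat_vec_sums)
 also have "fst x *s (dz_vec g x + jordan_pole \<alpha> (fst x) *v g x) - (\<alpha> + of_int n) *s g x = log_op n g x"
  using z by (simp add: vec_eq_iff forall_2 log_op_def dz_vec_def jordan_pole_def algebra_simps)
 finally show ?thesis .
qed

lemma power_vec_hol: "hol2_vec_on (power_vec n c d) (punctured P)" unfolding hol2_vec_on_def power_vec_def
 by (auto simp: forall_2 intro!: hol2_on_mult hol2_on_const hol2_on_powi hol2_on_fst)

lemma power_vec_zdiff: "x : punctured P ==> zdiff (%y. power_vec n c d y $ i) x"
 by (rule hol2_on_zdiff[OF hol2_vec_onD[OF power_vec_hol] rel_open_punctured])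

lemma nabla_log_power_vec:
 assumes "x : punctured P" "!!y. y : punctured P ==> \<sigma> y = E y *v power_vec m c d y"
 shows "nabla_log P (\<alpha> + of_int n) \<sigma> x = E x *v power_vec m (of_int (m - n) * c) (of_int (m - n) * d + c) x"
proof -
 have "fst x ~= 0" using assms(1) by auto
 then show ?thesis using nabla_log_frame[OF assms(1) power_vec_zdiff[OF assms(1)] assms(2)]
  by (simp add: log_op_power_vec) (simp add: power_vec_def)
qed

lemma power_vec_in_C_space:
 assumes \<sigma>: "!!y. y : punctured P ==> \<sigma> y = E y *v power_vec n c d y"
 shows "\<sigma> : C_space P (\<alpha> + of_int n)" unfolding C_space_def
proof (intro CollectI conjI ballI impI)
 show "holsec_on P \<sigma> (punctured P)"
  using holsec_frame[OF rel_open_punctured order.refl \<sigma>] power_vec_hol by blast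
 fix x assume x: "x : punctured P"
 have 1: "nabla_log P (\<alpha> + of_int n) \<sigma> y = E y *v power_vec n 0 c y" if "y : punctured P" for y
  using nabla_log_power_vec[OF that \<sigma>, of n] by simp
 show "nabla_log P (\<alpha> + of_int n) (nabla_log P (\<alpha> + of_int n) \<sigma>) x = 0"
  using nabla_log_power_vec[OF x 1, of n] by (simp add: power_vec_def vec_eq_iff forall_2)
 assume xi: "snd x : interior (base P)"
 have "nabla_t P \<sigma> x = E x *v dt_vec (power_vec n c d) x"
 proof (rule nabla_t_frame[OF x xi])
  show "tdiff (%y. power_vec n c d y $ i) x" for i
   by (rule hol2_on_tdiff[OF hol2_vec_onD[OF power_vec_hol] rel_open_punctured x xi])
  show "\<forall>\<^sub>F w in nhds (snd x). \<sigma> (fst x, w) = E (fst x, w) *v power_vec n c d (fst x, w)"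
   using rel_open_ev_snd[OF rel_open_punctured x xi] by eventually_elim (rule \<sigma>)
 qed
 also have "dt_vec (power_vec n c d) x = 0" by (simp add: dt_vec_def power_vec_def vec_eq_iff)
 finally show "nabla_t P \<sigma> x = 0" by (simp add: vec_eq_iff)
qed

text \<open>
 In the frame, the defining equation of \<open>C^(\<alpha> + n)\<close> is a pair of Euler equations on the
 punctured plane, solved by \<open>z^n\<close> alone since there is no logarithm; flatness in
 \<open>t\<close> makes the constants independent of \<open>t\<close>.
\<close>

lemma C_space_frame_iff:
 assumes conn: "connected (base P)"
 shows "\<sigma> : C_space P (\<alpha> + of_int n) \<longleftrightarrow>
  (EX c d. ALL x:punctured P. \<sigma> x = E x *v power_vec n c d x)"
proof
 assume "EX c d. ALL x:punctured P. \<sigma> x = E x *v power_vec n c d x"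
 then show "\<sigma> : C_space P (\<alpha> + of_int n)" using power_vec_in_C_space by blast
next
 assume "\<sigma> : C_space P (\<alpha> + of_int n)"
 then have hs: "holsec_on P \<sigma> (punctured P)"
  and L2: "!!x. x : punctured P ==> nabla_log P (\<alpha> + of_int n) (nabla_log P (\<alpha> + of_int n) \<sigma>) x = 0"
  and T: "!!x. x : punctured P ==> snd x : interior (base P) ==> nabla_t P \<sigma> x = 0"
  unfolding C_space_def by blast+
 define g where "g x = matrix_inv (E x) *v \<sigma> x" for x
 have \<sigma>: "\<sigma> x = E x *v g x" if "x : punctured P" for x
  using inv_cancel(6)[OF E_inv[OF that]] by (simp add: g_def)
 have g: "hol2_vec_on g (punctured P)" using holsec_frame[OF rel_open_punctured order.refl \<sigma>] hs by blast
 have gz: "zdiff (%y. g y $ i) x" if "x : punctured P" for x i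
  by (rule hol2_on_zdiff[OF hol2_vec_onD[OF g] rel_open_punctured that])
 have slice: "(%w. g (w, t) $ i) holomorphic_on - {0}" if "t : base P" for t i
  by (rule hol2_on_slice_fst[OF hol2_vec_onD[OF g]]) (use that in auto)
 have N1: "nabla_log P (\<alpha> + of_int n) \<sigma> y = E y *v log_op n g y" if "y : punctured P" for y
  by (rule nabla_log_frame[OF that gz[OF that] \<sigma>])
 have lz: "zdiff (%y. log_op n g y $ i) x" if x: "x : punctured P" for x i
 proof -
  have t: "snd x : base P" "fst x : - {0}" using x by auto
  have dh: "deriv (%w. g (w, snd x) $ j) holomorphic_on - {0}" for j
   by (rule holomorphic_deriv[OF slice[OF t(1)]]) auto
  have "(%w. log_op n g (w, snd x) $ i) holomorphic_on - {0}"
   using exhaust_2[of i] by (auto simp: log_op_def intro!: holomorphic_intros dh slice[OF t(1)])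
  then show ?thesis unfolding zdiff_def by (rule holomorphic_on_imp_differentiable_at) (use t(2) in auto)
 qed
 have LL: "log_op n (log_op n g) x = 0" if x: "x : punctured P" for x
 proof (rule invertible_cancel_vec[OF E_inv[OF x]])
  show "E x *v log_op n (log_op n g) x = E x *v 0"
   using nabla_log_frame[OF x lz[OF x] N1] L2[OF x] mat_vec_sums(4) by metis
 qed
 have form: "EX c d. ALL z. z ~= 0 --> g (z, t) = power_vec n c d (z, t)" if t: "t : base P" for t
 proof -
  let ?f = "%w. g (w, t) $ 1" and ?h = "%w. g (w, t) $ 2"
  have eq: "z * deriv (%w. w * deriv ?f w - of_int n * ?f w) z - of_int n * (z * deriv ?f z - of_int n * ?f z) = 0"
    "z * deriv (%w. w * deriv ?h w + ?f w - of_int n * ?h w) z + (z * deriv ?f z - of_int n * ?f z)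
     - of_int n * (z * deriv ?h z + ?f z - of_int n * ?h z) = 0" if "z ~= 0" for z
   using LL[of "(z, t)"] that t by (simp_all add: log_op_def vec_eq_iff forall_2)
  have e1: "z * deriv (%w. w * deriv ?f w - of_int n * ?f w) z = of_int n * (z * deriv ?f z - of_int n * ?f z)" if "z ~= 0" for z
   using eq(1)[OF that] by simp
  obtain c where c: "!!z. z ~= 0 ==> ?f z = c * z powi n" using euler_second_order(1)[OF slice[OF t] e1] by blast
  have f1: "z * deriv ?f z - of_int n * ?f z = 0" if "z ~= 0" for z
   by (rule euler_second_order(2)[OF slice[OF t] e1 that])
  have e2: "z * deriv (%w. w * deriv ?h w - of_int n * ?h w) z = of_int n * (z * deriv ?h z - of_int n * ?h z)" if z: "z ~= 0" for z
  proof -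
   have D: "(k has_field_derivative deriv k z) (at z)" if "k holomorphic_on - {0}" for k :: "complex => complex"
    by (rule holomorphic_derivI[OF that]) (use z in auto)
   have kh: "(%w. w * deriv ?h w - of_int n * ?h w) holomorphic_on - {0}"
    by (intro holomorphic_intros holomorphic_deriv slice t) auto
   have "((%w. (w * deriv ?h w - of_int n * ?h w) + ?f w) has_field_derivative
     deriv (%w. w * deriv ?h w - of_int n * ?h w) z + deriv ?f z) (at z)" by (intro DERIV_add D kh slice t)
   then have "deriv (%w. w * deriv ?h w + ?f w - of_int n * ?h w) z =
     deriv (%w. w * deriv ?h w - of_int n * ?h w) z + deriv ?f z" by (simp add: DERIV_imp_deriv algebra_simps)
   then show ?thesis using eq(2)[OF z] f1[OF z] by (simp add: algebra_simps)
  qed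
  obtain d where d: "!!z. z ~= 0 ==> ?h z = d * z powi n" using euler_second_order(1)[OF slice[OF t] e2] by blast
  show ?thesis by (intro exI[of _ c] exI[of _ d]) (simp add: power_vec_def vec_eq_iff forall_2 c d)
 qed
 have const: "EX k. ALL t:base P. g (1, t) $ i = k" for i
 proof (cases "open (base P)")
  case True
  have "(%s. g (1, s) $ i) constant_on base P"
  proof (rule has_field_derivative_0_imp_constant_on[OF _ conn True])
   fix s assume s: "s : base P"
   have x: "(1, s) : punctured P" and xi: "snd (1::complex, s) : interior (base P)" using s True by (auto simp: interior_open)
   have td: "tdiff (%y. g y $ i) (1, s)" for i by (rule hol2_on_tdiff[OF hol2_vec_onD[OF g] rel_open_punctured x xi])
   have "\<forall>\<^sub>F w in nhds (snd (1::complex, s)). \<sigma> (fst (1::complex, s), w) = E (fst (1, s), w) *v g (fst (1, s), w)"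
    using rel_open_ev_snd[OF rel_open_punctured x xi] by eventually_elim (rule \<sigma>)
   from nabla_t_frame[OF x xi td this] T[OF x xi] have "E (1, s) *v dt_vec g (1, s) = E (1, s) *v 0"
    using mat_vec_sums(4) by metis
   then have "dt_vec g (1, s) = 0" by (rule invertible_cancel_vec[OF E_inv[OF x]])
   then have "deriv (%s. g (1, s) $ i) s = 0" by (simp add: dt_vec_def vec_eq_iff)
   then show "((%s. g (1, s) $ i) has_field_derivative 0) (at s)"
    using td[of i] unfolding tdiff_def by (metis DERIV_deriv_iff_field_differentiable fst_conv snd_conv)
  qed
  then show ?thesis by (auto simp: constant_on_def)
 next
  case False
  then obtain t where "base P = {t}" using teD(2) by blast
  then show ?thesis by auto
 qed
 obtain c d where cd: "!!t. t : base P ==> g (1, t) $ 1 = c" "!!t. t : base P ==> g (1, t) $ 2 = d"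
  using const[of 1] const[of 2] by blast
 have "g x = power_vec n c d x" if x: "x : punctured P" for x
 proof -
  have t: "snd x : base P" "fst x ~= 0" using x by auto
  obtain c' d' where *: "!!z. z ~= 0 ==> g (z, snd x) = power_vec n c' d' (z, snd x)" using form[OF t(1)] by blast
  have "c' = c" "d' = d" using *[of 1] cd[OF t(1)] by (simp_all add: power_vec_def)
  then show ?thesis using *[OF t(2)] by simp
 qed
 then show "EX c d. ALL x:punctured P. \<sigma> x = E x *v power_vec n c d x" using \<sigma> by metis
qed

end

context framed_te
begin

lemma C_kernel_frame_iff:
 assumes conn: "connected (base P)"
 shows "\<sigma> : C_kernel P (\<alpha> + of_int n) \<longleftrightarrow> (EX d. ALL x:punctured P. \<sigma> x = E x *v power_vec n 0 d x)"
proof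
 assume k: "\<sigma> : C_kernel P (\<alpha> + of_int n)"
 then obtain c d where \<sigma>: "!!x. x : punctured P ==> \<sigma> x = E x *v power_vec n c d x"
  unfolding C_kernel_def using C_space_frame_iff[OF conn] by blast
 obtain t where "t : base P" using teD(1) by blast
 then have x: "(1, t) : punctured P" by simp
 have "E (1, t) *v power_vec n 0 c (1, t) = E (1, t) *v 0"
  using nabla_log_power_vec[OF x \<sigma>, of n] k x unfolding C_kernel_def mat_vec_sums(4) by simp
 from invertible_cancel_vec[OF E_inv[OF x] this] have "c = 0" by (simp add: power_vec_def vec_eq_iff forall_2)
 then show "EX d. ALL x:punctured P. \<sigma> x = E x *v power_vec n 0 d x" using \<sigma> by blast
next
 assume "EX d. ALL x:punctured P. \<sigma> x = E x *v power_vec n 0 d x"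
 then obtain d where \<sigma>: "!!x. x : punctured P ==> \<sigma> x = E x *v power_vec n 0 d x" by blast
 have "nabla_log P (\<alpha> + of_int n) \<sigma> x = 0" if "x : punctured P" for x
  using nabla_log_power_vec[OF that \<sigma>, of n] by (simp add: power_vec_def vec_eq_iff forall_2)
 then show "\<sigma> : C_kernel P (\<alpha> + of_int n)"
  unfolding C_kernel_def using power_vec_in_C_space[OF \<sigma>] by blast
qed

lemma power_vec_shift:
 assumes "fst x ~= 0" shows "power_vec m c d x = fst x ^ k *s power_vec (m - int k) c d x"
proof -
 have "fst x powi m = fst x ^ k * fst x powi (m - int k)"
  using power_int_add[OF disjI1[OF assms], of "int k" "m - int k"] by simp
 then show ?thesis by (simp add: power_vec_def vec_eq_iff forall_2)
qed

text \<open>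
 The nilpotent part of \<open>\<nabla>\<^bsub>z\<partial>z\<^esub>\<close> maps \<open>e\<^sub>1\<close> to
 \<open>e\<^sub>2\<close>, so the leading coefficient \<open>l\<close> of \<open>s\<^sub>1\<close> becomes
 the only coefficient of \<open>s\<^sub>2\<close>, while \<open>d\<close> stays free.
\<close>

lemma linked_frame_iff:
 assumes conn: "connected (base P)"
 shows "linked P (\<alpha> + of_int m) \<beta> s1 s2 \<longleftrightarrow> (EX k l d. l ~= 0 & \<beta> = \<alpha> + of_int (m - int k) &
   (ALL x:punctured P. s1 x = E x *v power_vec m l d x) &
   (ALL x:punctured P. s2 x = E x *v power_vec (m - int k) 0 l x))"
proof
 assume L: "linked P (\<alpha> + of_int m) \<beta> s1 s2"
 then obtain k where k: "\<alpha> + of_int m - \<beta> = of_nat k"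
  "!!x. x : punctured P ==> nabla_log P (\<alpha> + of_int m) s1 x = fst x ^ k *s s2 x" unfolding linked_def by blast
 obtain l d where s1: "!!x. x : punctured P ==> s1 x = E x *v power_vec m l d x"
  using L C_space_frame_iff[OF conn] unfolding linked_def by blast
 have "l ~= 0"
 proof
  assume "l = 0"
  then have "s1 : C_kernel P (\<alpha> + of_int m)" using C_kernel_frame_iff[OF conn] s1 by blast
  then show False using L unfolding linked_def by blast
 qed
 moreover have "\<beta> = \<alpha> + of_int (m - int k)" using k(1) by (simp add: algebra_simps)
 moreover have "s2 x = E x *v power_vec (m - int k) 0 l x" if x: "x : punctured P" for x
 proof -
  have z: "fst x ~= 0" using x by auto
  have "fst x ^ k *s s2 x = E x *v power_vec m 0 l x" using k(2)[OF x] nabla_log_power_vec[OF x s1, of m] by simp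
  also have "\<dots> = fst x ^ k *s (E x *v power_vec (m - int k) 0 l x)"
   unfolding power_vec_shift[OF z, of m 0 l k] smult_vec ..
  finally show ?thesis using z by (simp add: vec_eq_iff)
 qed
 ultimately show "EX k l d. l ~= 0 & \<beta> = \<alpha> + of_int (m - int k) &
   (ALL x:punctured P. s1 x = E x *v power_vec m l d x) &
   (ALL x:punctured P. s2 x = E x *v power_vec (m - int k) 0 l x)" using s1 by blast
next
 assume "EX k l d. l ~= 0 & \<beta> = \<alpha> + of_int (m - int k) &
   (ALL x:punctured P. s1 x = E x *v power_vec m l d x) &
   (ALL x:punctured P. s2 x = E x *v power_vec (m - int k) 0 l x)"
 then obtain k l d where l: "l ~= 0" and \<beta>: "\<beta> = \<alpha> + of_int (m - int k)"
  and s1: "!!x. x : punctured P ==> s1 x = E x *v power_vec m l d x"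
  and s2: "!!x. x : punctured P ==> s2 x = E x *v power_vec (m - int k) 0 l x" by blast
 have nl: "nabla_log P (\<alpha> + of_int m) s1 x = E x *v power_vec m 0 l x" if "x : punctured P" for x
  using nabla_log_power_vec[OF that s1, of m] by simp
 show "linked P (\<alpha> + of_int m) \<beta> s1 s2" unfolding linked_def
 proof (intro conjI DiffI)
  show "s1 : C_space P (\<alpha> + of_int m)" by (rule power_vec_in_C_space[OF s1])
  show "s2 : C_space P \<beta>" unfolding \<beta> by (rule power_vec_in_C_space[OF s2])
  show "s1 \<notin> C_kernel P (\<alpha> + of_int m)"
  proof
   assume "s1 : C_kernel P (\<alpha> + of_int m)"
   obtain t where "t : base P" using teD(1) by blast
   then have x: "(1, t) : punctured P" by simp
   have "E (1, t) *v power_vec m 0 l (1, t) = E (1, t) *v 0"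
    using nl[OF x] \<open>s1 : C_kernel P _\<close> x unfolding C_kernel_def mat_vec_sums(4) by simp
   from invertible_cancel_vec[OF E_inv[OF x] this] show False using l by (simp add: power_vec_def vec_eq_iff forall_2)
  qed
  show "EX k::nat. \<alpha> + of_int m - \<beta> = of_nat k &
   (ALL x:punctured P. nabla_log P (\<alpha> + of_int m) s1 x = fst x ^ k *s s2 x)"
  proof (intro exI conjI ballI)
   show "\<alpha> + of_int m - \<beta> = of_nat k" by (simp add: \<beta>)
   fix x assume x: "x : punctured P"
   then have z: "fst x ~= 0" by auto
   show "nabla_log P (\<alpha> + of_int m) s1 x = fst x ^ k *s s2 x"
    unfolding nl[OF x] s2[OF x] power_vec_shift[OF z, of m 0 l k] smult_vec ..
  qed
 qed
qed

end

section \<open>Flat multivalued sections\<close>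

definition strip :: "complex => complex set" where
 "strip \<zeta>0 = {\<zeta>. \<bar>Im (\<zeta> - \<zeta>0)\<bar> < pi}"

definition local_log :: "complex => complex => complex" where
 "local_log \<zeta>0 z = Ln (z / exp \<zeta>0) + \<zeta>0"

lemma strip_open: "open (strip \<zeta>0)" unfolding strip_def by (intro open_Collect_less continuous_intros)

lemma strip_centre: "\<zeta>0 : strip \<zeta>0" by (simp add: strip_def)

lemma local_log_exp: "\<zeta> : strip \<zeta>0 ==> local_log \<zeta>0 (exp \<zeta>) = \<zeta>"
 by (simp add: local_log_def strip_def exp_diff[symmetric])

lemma exp_local_log: "z ~= 0 ==> exp (local_log \<zeta>0 z) = z" by (simp add: local_log_def exp_add)

lemma exp_strip_inj: "inj_on exp (strip \<zeta>0)"
 by (rule inj_on_inverseI[of _ "local_log \<zeta>0"]) (rule local_log_exp)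

lemma exp_image_open: "open V ==> inj_on exp V ==> open (exp ` V :: complex set)"
 by (rule open_mapping_thm3[of exp]) (auto intro: holomorphic_intros)

lemma local_log_deriv:
 assumes "z : exp ` strip \<zeta>0"
 shows "(local_log \<zeta>0 has_field_derivative 1 / z) (at z)"
proof -
 obtain \<zeta> where \<zeta>: "z = exp \<zeta>" "\<zeta> : strip \<zeta>0" using assms by blast
 have "Ln (z / exp \<zeta>0) = \<zeta> - \<zeta>0"
  using local_log_exp[OF \<zeta>(2)] by (simp add: local_log_def \<zeta> eq_diff_eq)
 then have "Im (Ln (z / exp \<zeta>0)) ~= pi" using \<zeta>(2) by (auto simp: strip_def)
 moreover have "z / exp \<zeta>0 ~= 0" by (simp add: \<zeta>)
 ultimately have n: "z / exp \<zeta>0 \<notin> \<real>\<^sub>\<le>\<^sub>0"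
  using Im_Ln_eq_pi[of "z / exp \<zeta>0"] by (auto simp: complex_nonpos_Reals_iff complex_eq_iff less_le)
 show ?thesis unfolding local_log_def by (rule derivative_eq_intros n refl | simp add: \<zeta>)+
qed

text \<open>
 On a strip of width \<open>2 \<pi>\<close> the covering is injective, so a flat multivalued section has a
 univalued branch over its image.
\<close>

lemma flat_multivalued_branch:
 fixes c :: complex
 assumes te: "te_structure R" and S: "flat_multivalued R S"
 defines "W \<equiv> exp ` strip c \<times> base R"
 defines "\<sigma> \<equiv> (%x. S (local_log c (fst x), snd x))"
 shows "rel_open (base R) W" "W \<subseteq> punctured R" "holsec_on R \<sigma> W"
  "!!x. x : W ==> nabla_z R \<sigma> x = 0"
  "!!x. x : W ==> snd x : interior (base R) ==> nabla_t R \<sigma> x = 0"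
proof -
 let ?V = "strip c \<times> base R"
 have op: "rel_open B (D \<times> B)" if "open D" for D B
 proof -
  have "D \<times> B = (UNIV \<times> B) Int (D \<times> UNIV)" by auto
  then show ?thesis using that by (metis openin_open_Int open_Times open_UNIV)
 qed
 have V: "rel_open (base R) ?V" by (intro op strip_open)
 have W: "covering ` ?V = W" unfolding W_def covering_def by force
 have inj: "inj_on covering ?V" using exp_strip_inj[of c] by (auto simp: inj_on_def covering_def)
 have "ALL y:?V. \<sigma> (covering y) = S y" by (auto simp: \<sigma>_def covering_def local_log_exp)
 then have "holsec_on R \<sigma> W & (ALL x:W. nabla_z R \<sigma> x = 0 & (snd x : interior (base R) --> nabla_t R \<sigma> x = 0))"
  using S V inj unfolding flat_multivalued_def W[symmetric] by blast
 then show "holsec_on R \<sigma> W" "!!x. x : W ==> nabla_z R \<sigma> x = 0"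
  "!!x. x : W ==> snd x : interior (base R) ==> nabla_t R \<sigma> x = 0" by blast+
 show "rel_open (base R) W" unfolding W_def by (intro op exp_image_open strip_open exp_strip_inj)
 show "W \<subseteq> punctured R" unfolding W_def by auto
qed

text \<open>
 In the frame, flat sections are \<open>exp (- \<zeta> (\<alpha> + N))\<close> applied to constant vectors.
\<close>

definition flat_vec :: "complex => complex => complex => complex => complex^2" where
 "flat_vec \<alpha> a b \<zeta> = vector [exp (- \<alpha> * \<zeta>) * a, exp (- \<alpha> * \<zeta>) * (b - a * \<zeta>)]"

lemma flat_vec_lin: "flat_vec \<alpha> a b \<zeta> = a *s flat_vec \<alpha> 1 0 \<zeta> + b *s flat_vec \<alpha> 0 1 \<zeta>"
 by (simp add: flat_vec_def vec_eq_iff forall_2 algebra_simps)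

lemma flat_vec_inj: "flat_vec \<alpha> a b \<zeta> = flat_vec \<alpha> c d \<zeta> \<longleftrightarrow> a = c & b = d"
 by (auto simp: flat_vec_def vec_eq_iff forall_2)

context framed_point
begin

lemma conn: "connected (base R)" by (simp add: base_R)

lemma total_R: "y : total_base R \<longleftrightarrow> snd y = t" using base_R by (auto simp: mem_Times_iff)

lemma nabla_z_zero_iff:
 fixes g :: "pt => complex^2"
 assumes z: "z ~= 0" and g: "!!i. (%w. g (w, t) $ i) field_differentiable at z"
  and \<sigma>: "\<forall>\<^sub>F w in nhds z. \<sigma> (w, t) = E (w, t) *v g (w, t)"
 shows "nabla_z R \<sigma> (z, t) = 0 \<longleftrightarrow>
   z * deriv (%w. g (w, t) $ 1) z = - \<alpha> * g (z, t) $ 1 &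
   z * deriv (%w. g (w, t) $ 2) z = - \<alpha> * g (z, t) $ 2 - g (z, t) $ 1"
proof -
 have x: "(z, t) : punctured R" using z by (simp add: base_R)
 have "nabla_z R \<sigma> (z, t) = E (z, t) *v (dz_vec g (z, t) + jordan_pole \<alpha> z *v g (z, t))"
  using nabla_z_frame[OF x, of g \<sigma>] g \<sigma> by (simp add: zdiff_def)
 then have "nabla_z R \<sigma> (z, t) = 0 \<longleftrightarrow> dz_vec g (z, t) + jordan_pole \<alpha> z *v g (z, t) = 0"
  using invertible_cancel_vec[OF E_inv[OF x], of _ 0] mat_vec_sums(4) by metis
 also have "\<dots> \<longleftrightarrow> z * deriv (%w. g (w, t) $ 1) z = - \<alpha> * g (z, t) $ 1 &
   z * deriv (%w. g (w, t) $ 2) z = - \<alpha> * g (z, t) $ 2 - g (z, t) $ 1"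
 proof -
  have "d + (1 / z * q + \<alpha> / z * p) = 0 \<longleftrightarrow> z * d = - \<alpha> * p - q" for d p q
  proof -
   have "d + (1 / z * q + \<alpha> / z * p) = (z * d + \<alpha> * p + q) / z" using z by (simp add: field_simps)
   then show ?thesis using z by (auto simp: algebra_simps eq_neg_iff_add_eq_0)
  qed
  from this[of _ 0] this[of _ "g (z, t) $ 1"] show ?thesis
   by (simp add: vec_eq_iff forall_2 dz_vec_def jordan_pole_def)
 qed
 finally show ?thesis .
qed

lemma flat_imp_flat_vec:
 assumes S: "flat_multivalued R S"
 shows "EX a b. ALL \<zeta>. S (\<zeta>, t) = E (exp \<zeta>, t) *v flat_vec \<alpha> a b \<zeta>"
proof -
 define G where "G \<zeta> = matrix_inv (E (exp \<zeta>, t)) *v S (\<zeta>, t)" for \<zeta>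
 have Ei: "invertible (E (z, t))" if "z ~= 0" for z using E_inv[of "(z, t)"] that by (simp add: base_R)
 have G: "((%\<zeta>. G \<zeta> $ 1) has_field_derivative - \<alpha> * G \<zeta>0 $ 1) (at \<zeta>0)"
  "((%\<zeta>. G \<zeta> $ 2) has_field_derivative - \<alpha> * G \<zeta>0 $ 2 - G \<zeta>0 $ 1) (at \<zeta>0)" for \<zeta>0
 proof -
  define W where "W = exp ` strip \<zeta>0 \<times> base R"
  define \<sigma> where "\<sigma> x = S (local_log \<zeta>0 (fst x), snd x)" for x
  note br = flat_multivalued_branch[OF te S, where c=\<zeta>0, folded W_def \<sigma>_def]
  define g where "g x = matrix_inv (E x) *v \<sigma> x" for x
  have \<sigma>g: "\<sigma> x = E x *v g x" if "x : W" for x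
   unfolding g_def by (rule inv_cancel(6)[OF E_inv, symmetric]) (use br(2) that in blast)
  have g: "hol2_vec_on g W" using holsec_frame[OF br(1,2) \<sigma>g] br(3) by blast
  have oS: "open (exp ` strip \<zeta>0)" by (intro exp_image_open strip_open exp_strip_inj)
  have gh: "(%w. g (w, t) $ i) holomorphic_on exp ` strip \<zeta>0" for i
   using hol2_vec_onD[OF g] by (simp add: W_def base_R hol2_on_point_iff)
  let ?z = "exp \<zeta>0"
  have z0: "?z : exp ` strip \<zeta>0" using strip_centre by blast
  have gd: "(%w. g (w, t) $ i) field_differentiable at ?z" for i
   by (rule holomorphic_on_imp_differentiable_at[OF gh oS z0])
  have "\<forall>\<^sub>F w in nhds ?z. w : exp ` strip \<zeta>0" by (rule eventually_nhds_in_open[OF oS z0])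
  then have "\<forall>\<^sub>F w in nhds ?z. \<sigma> (w, t) = E (w, t) *v g (w, t)"
   by eventually_elim (rule \<sigma>g, simp add: W_def base_R)
  from nabla_z_zero_iff[OF exp_not_eq_zero gd this] br(4)[of "(?z, t)"] z0
  have eqs: "?z * deriv (%w. g (w, t) $ 1) ?z = - \<alpha> * g (?z, t) $ 1"
   "?z * deriv (%w. g (w, t) $ 2) ?z = - \<alpha> * g (?z, t) $ 2 - g (?z, t) $ 1" by (simp_all add: W_def base_R)
  have GG: "G \<zeta> = g (exp \<zeta>, t)" if "\<zeta> : strip \<zeta>0" for \<zeta>
   by (simp only: G_def g_def \<sigma>_def fst_conv snd_conv local_log_exp[OF that])
  have "\<forall>\<^sub>F \<zeta> in nhds \<zeta>0. \<zeta> : strip \<zeta>0" by (rule eventually_nhds_in_open[OF strip_open strip_centre])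
  then have ev: "\<forall>\<^sub>F \<zeta> in nhds \<zeta>0. g (exp \<zeta>, t) $ i = G \<zeta> $ i" for i
   by eventually_elim (simp only: GG)
  have "((%\<zeta>. g (exp \<zeta>, t) $ i) has_field_derivative deriv (%w. g (w, t) $ i) ?z * ?z) (at \<zeta>0)" for i
   by (rule DERIV_chain2[where f="%w. g (w, t) $ i"]) (use gd in \<open>auto simp: DERIV_deriv_iff_field_differentiable\<close>)
  then have "((%\<zeta>. G \<zeta> $ i) has_field_derivative ?z * deriv (%w. g (w, t) $ i) ?z) (at \<zeta>0)" for i
   using DERIV_cong_ev[OF refl ev refl, THEN iffD1] by (simp only: mult.commute)
  then show "((%\<zeta>. G \<zeta> $ 1) has_field_derivative - \<alpha> * G \<zeta>0 $ 1) (at \<zeta>0)"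
   "((%\<zeta>. G \<zeta> $ 2) has_field_derivative - \<alpha> * G \<zeta>0 $ 2 - G \<zeta>0 $ 1) (at \<zeta>0)"
   unfolding GG[OF strip_centre] by (simp_all only: eqs[symmetric])
 qed
 have expd: "((%\<zeta>. exp (\<alpha> * \<zeta>)) has_field_derivative exp (\<alpha> * \<zeta>) * \<alpha>) (at \<zeta>)" for \<zeta>
  by (auto intro!: derivative_eq_intros)
 have "(%\<zeta>. exp (\<alpha> * \<zeta>) * G \<zeta> $ 1) constant_on UNIV"
 proof (rule has_field_derivative_0_imp_constant_on)
  fix \<zeta> :: complex
  show "((%\<zeta>. exp (\<alpha> * \<zeta>) * G \<zeta> $ 1) has_field_derivative 0) (at \<zeta>)"
   using DERIV_mult[OF expd G(1), of \<zeta>] by (simp add: algebra_simps)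
 qed auto
 then obtain a where a: "!!\<zeta>. exp (\<alpha> * \<zeta>) * G \<zeta> $ 1 = a" by (auto simp: constant_on_def)
 have "(%\<zeta>. exp (\<alpha> * \<zeta>) * G \<zeta> $ 2 + a * \<zeta>) constant_on UNIV"
 proof (rule has_field_derivative_0_imp_constant_on)
  fix \<zeta> :: complex
  have "((%\<zeta>. exp (\<alpha> * \<zeta>) * G \<zeta> $ 2 + a * \<zeta>) has_field_derivative
    exp (\<alpha> * \<zeta>) * \<alpha> * G \<zeta> $ 2 + (- \<alpha> * G \<zeta> $ 2 - G \<zeta> $ 1) * exp (\<alpha> * \<zeta>) + a) (at \<zeta>)"
   by (rule DERIV_add[OF DERIV_mult[OF expd G(2)] DERIV_cmult_Id])
  then show "((%\<zeta>. exp (\<alpha> * \<zeta>) * G \<zeta> $ 2 + a * \<zeta>) has_field_derivative 0) (at \<zeta>)"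
   by (simp add: a[of \<zeta>, symmetric] algebra_simps)
 qed auto
 then obtain b where b: "!!\<zeta>. exp (\<alpha> * \<zeta>) * G \<zeta> $ 2 + a * \<zeta> = b" by (auto simp: constant_on_def)
 have "S (\<zeta>, t) = E (exp \<zeta>, t) *v flat_vec \<alpha> a b \<zeta>" for \<zeta>
 proof -
  have e: "exp (- \<alpha> * \<zeta>) * exp (\<alpha> * \<zeta>) = 1" by (simp add: exp_add[symmetric])
  have "G \<zeta> $ 1 = exp (- \<alpha> * \<zeta>) * (exp (\<alpha> * \<zeta>) * G \<zeta> $ 1)"
   "G \<zeta> $ 2 = exp (- \<alpha> * \<zeta>) * (exp (\<alpha> * \<zeta>) * G \<zeta> $ 2)"
   by (simp_all only: mult.assoc[symmetric] e mult_1_left)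
  moreover have "exp (\<alpha> * \<zeta>) * G \<zeta> $ 2 = b - a * \<zeta>" using b[of \<zeta>] by (simp add: algebra_simps)
  ultimately have Gf: "G \<zeta> = flat_vec \<alpha> a b \<zeta>"
   unfolding flat_vec_def vec_eq_iff forall_2 by (simp only: a vector_2)
  show ?thesis unfolding Gf[symmetric] G_def by (rule inv_cancel(6)[symmetric], rule Ei) simp
 qed
 then show ?thesis by blast
qed

lemma flat_vec_imp_flat:
 assumes S: "!!\<zeta>. S (\<zeta>, t) = E (exp \<zeta>, t) *v flat_vec \<alpha> a b \<zeta>"
 shows "flat_multivalued R S" unfolding flat_multivalued_def
proof (intro allI impI, elim conjE)
 fix V \<sigma> assume V: "rel_open (base R) V" and inj: "inj_on covering V" and \<sigma>: "ALL y:V. \<sigma> (covering y) = S y"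
 define V0 where "V0 = {\<zeta>. (\<zeta>, t) : V}"
 have VV0: "V = V0 \<times> {t}" using openin_imp_subset[OF V] base_R by (auto simp: V0_def)
 have oV0: "open V0"
 proof (subst open_subopen, rule ballI)
  fix \<zeta> assume "\<zeta> : V0"
  then obtain D where "open D" "\<zeta> : D" "ALL w:D. (w, t) : V"
   using rel_open_slice_fst[OF V, of "(\<zeta>, t)"] by (auto simp: V0_def)
  then show "EX T. open T & \<zeta> : T & T \<subseteq> V0" by (auto simp: V0_def)
 qed
 have iV0: "inj_on exp V0" using inj by (auto simp: inj_on_def covering_def VV0)
 define D where "D = exp ` V0"
 have oD: "open D" unfolding D_def by (rule exp_image_open[OF oV0 iV0])
 have cov: "covering ` V = D \<times> {t}" by (force simp: VV0 covering_def D_def image_iff)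
 have D0: "z ~= 0" if "z : D" for z using that by (auto simp: D_def)
 have Dp: "D \<times> {t} \<subseteq> punctured R" using D0 base_R by auto
 have rD: "rel_open (base R) (D \<times> {t})"
 proof -
  have "D \<times> {t} = (UNIV \<times> {t}) Int (D \<times> UNIV)" by auto
  then show ?thesis unfolding base_R using oD by (metis openin_open_Int open_Times open_UNIV)
 qed
 define g where "g x = matrix_inv (E x) *v \<sigma> x" for x
 have \<sigma>g: "\<sigma> x = E x *v g x" if "x : D \<times> {t}" for x
  unfolding g_def by (rule inv_cancel(6)[OF E_inv, symmetric]) (use Dp that in blast)
 have loc: "\<forall>\<^sub>F w in nhds (exp \<zeta>0). flat_vec \<alpha> a b (local_log \<zeta>0 w) = g (w, t)" if \<zeta>0: "\<zeta>0 : V0" for \<zeta>0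
 proof -
  let ?U = "exp ` (V0 Int strip \<zeta>0)"
  have "open ?U" using oV0 strip_open iV0 by (intro exp_image_open) (auto intro: inj_on_subset)
  moreover have "exp \<zeta>0 : ?U" using \<zeta>0 strip_centre by blast
  ultimately have "\<forall>\<^sub>F w in nhds (exp \<zeta>0). w : ?U" by (rule eventually_nhds_in_open)
  then show ?thesis
  proof eventually_elim
   case (elim w)
   then obtain \<zeta> where \<zeta>: "w = exp \<zeta>" "\<zeta> : V0" "\<zeta> : strip \<zeta>0" by blast
   have "\<sigma> (w, t) = S (\<zeta>, t)" using \<sigma> \<zeta> by (force simp: VV0 covering_def)
   then have "g (w, t) = matrix_inv (E (w, t)) *v (E (w, t) *v flat_vec \<alpha> a b \<zeta>)"
    by (simp only: g_def S \<zeta>(1))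
   also have "\<dots> = flat_vec \<alpha> a b \<zeta>" by (rule inv_cancel(5)[OF E_inv]) (simp add: \<zeta> base_R)
   finally show ?case by (simp only: \<zeta>(1) local_log_exp[OF \<zeta>(3)])
  qed
 qed
 have dv: "((%w. flat_vec \<alpha> a b (local_log \<zeta>0 w) $ 1) has_field_derivative (- \<alpha> * (exp (- \<alpha> * \<zeta>0) * a)) / exp \<zeta>0) (at (exp \<zeta>0))"
   "((%w. flat_vec \<alpha> a b (local_log \<zeta>0 w) $ 2) has_field_derivative
     (- \<alpha> * (exp (- \<alpha> * \<zeta>0) * (b - a * \<zeta>0)) - exp (- \<alpha> * \<zeta>0) * a) / exp \<zeta>0) (at (exp \<zeta>0))" for \<zeta>0
 proof -
  have l: "(local_log \<zeta>0 has_field_derivative 1 / exp \<zeta>0) (at (exp \<zeta>0))"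
   by (rule local_log_deriv) (use strip_centre in blast)
  have l0: "local_log \<zeta>0 (exp \<zeta>0) = \<zeta>0" by (rule local_log_exp[OF strip_centre])
  show "((%w. flat_vec \<alpha> a b (local_log \<zeta>0 w) $ 1) has_field_derivative (- \<alpha> * (exp (- \<alpha> * \<zeta>0) * a)) / exp \<zeta>0) (at (exp \<zeta>0))"
   unfolding flat_vec_def vector_2 by (rule derivative_eq_intros l refl)+ (simp add: l0 field_simps)
  show "((%w. flat_vec \<alpha> a b (local_log \<zeta>0 w) $ 2) has_field_derivative
     (- \<alpha> * (exp (- \<alpha> * \<zeta>0) * (b - a * \<zeta>0)) - exp (- \<alpha> * \<zeta>0) * a) / exp \<zeta>0) (at (exp \<zeta>0))"
   unfolding flat_vec_def vector_2 by (rule derivative_eq_intros l refl)+ (simp add: l0 field_simps)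
 qed
 have gd: "((%w. g (w, t) $ 1) has_field_derivative (- \<alpha> * g (exp \<zeta>0, t) $ 1) / exp \<zeta>0) (at (exp \<zeta>0))"
   "((%w. g (w, t) $ 2) has_field_derivative (- \<alpha> * g (exp \<zeta>0, t) $ 2 - g (exp \<zeta>0, t) $ 1) / exp \<zeta>0) (at (exp \<zeta>0))"
  if \<zeta>0: "\<zeta>0 : V0" for \<zeta>0
 proof -
  have ev: "\<forall>\<^sub>F w in nhds (exp \<zeta>0). flat_vec \<alpha> a b (local_log \<zeta>0 w) $ i = g (w, t) $ i" for i
   using loc[OF \<zeta>0] by eventually_elim simp
  have g0: "g (exp \<zeta>0, t) = flat_vec \<alpha> a b \<zeta>0"
   using eventually_nhds_x_imp_x[OF loc[OF \<zeta>0]] by (simp add: local_log_exp[OF strip_centre])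
  show "((%w. g (w, t) $ 1) has_field_derivative (- \<alpha> * g (exp \<zeta>0, t) $ 1) / exp \<zeta>0) (at (exp \<zeta>0))"
   using DERIV_cong_ev[OF refl ev refl, THEN iffD1, OF dv(1)] by (simp add: g0 flat_vec_def)
  show "((%w. g (w, t) $ 2) has_field_derivative (- \<alpha> * g (exp \<zeta>0, t) $ 2 - g (exp \<zeta>0, t) $ 1) / exp \<zeta>0) (at (exp \<zeta>0))"
   using DERIV_cong_ev[OF refl ev refl, THEN iffD1, OF dv(2)] by (simp add: g0 flat_vec_def)
 qed
 have gdiff: "(%w. g (w, t) $ i) field_differentiable at z" if "z : D" for z i
  using gd that exhaust_2[of i] unfolding D_def field_differentiable_def by blast
 have "hol2_vec_on g (D \<times> {t})" unfolding hol2_vec_on_def hol2_on_point_iff holomorphic_on_def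
  using gdiff field_differentiable_at_within by blast
 then have hs: "holsec_on R \<sigma> (D \<times> {t})" using holsec_frame[OF rD Dp \<sigma>g] by blast
 have "nabla_z R \<sigma> (z, t) = 0" if z: "z : D" for z
 proof -
  obtain \<zeta>0 where \<zeta>0: "\<zeta>0 : V0" "z = exp \<zeta>0" using z by (auto simp: D_def)
  have ev: "\<forall>\<^sub>F w in nhds z. \<sigma> (w, t) = E (w, t) *v g (w, t)"
   using eventually_nhds_in_open[OF oD z] by eventually_elim (rule \<sigma>g, simp)
  show ?thesis unfolding nabla_z_zero_iff[OF D0[OF z] gdiff[OF z] ev]
   using DERIV_imp_deriv[OF gd(1)[OF \<zeta>0(1)]] DERIV_imp_deriv[OF gd(2)[OF \<zeta>0(1)]] by (simp add: \<zeta>0(2))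
 qed
 then show "holsec_on R \<sigma> (covering ` V) & (ALL x:covering ` V. nabla_z R \<sigma> x = 0 &
   (snd x : interior (base R) --> nabla_t R \<sigma> x = 0))" using hs by (simp add: cov base_R interior_singleton)
qed

definition flat_sec :: "complex => complex => pt => complex^2" where
 "flat_sec a b y = E (covering y) *v flat_vec \<alpha> a b (fst y)"

lemma flat_sec_flat: "flat_multivalued R (flat_sec a b)"
 by (rule flat_vec_imp_flat) (simp only: flat_sec_def covering_def fst_conv snd_conv)

lemma flat_iff: "flat_multivalued R S ==> EX a b. ALL y:total_base R. S y = flat_sec a b y"
proof -
 assume "flat_multivalued R S"
 from flat_imp_flat_vec[OF this] obtain a b where *: "!!\<zeta>. S (\<zeta>, t) = E (exp \<zeta>, t) *v flat_vec \<alpha> a b \<zeta>" by blast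
 have "S y = flat_sec a b y" if "y : total_base R" for y
 proof -
  have "y = (fst y, t)" using that total_R by (metis prod.collapse)
  then show ?thesis using *[of "fst y"] by (metis flat_sec_def covering_def fst_conv snd_conv)
 qed
 then show ?thesis by blast
qed

lemma flat_sec_lin: "flat_sec a b y = a *s flat_sec 1 0 y + b *s flat_sec 0 1 y"
 unfolding flat_sec_def flat_vec_lin[of \<alpha> a b] by (simp only: mat_vec_sums smult_vec)

lemma flat_sec_lin2: "c *s flat_sec a b y + d *s flat_sec a' b' y = flat_sec (c * a + d * a') (c * b + d * b') y"
 unfolding flat_sec_lin[of a b] flat_sec_lin[of a' b'] flat_sec_lin[of "c * a + d * a'"]
 by (simp add: vec_eq_iff algebra_simps)

lemma flat_sec_inj:
 assumes "flat_sec a b (\<zeta>, t) = flat_sec c d (\<zeta>, t)" shows "a = c & b = d"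
proof -
 have "invertible (E (exp \<zeta>, t))" by (rule E_inv) (simp add: base_R)
 from invertible_cancel_vec[OF this] assms show ?thesis
  unfolding flat_sec_def covering_def fst_conv snd_conv using flat_vec_inj by blast
qed

lemma flat_sec_monodromy: "monodromy (flat_sec a b) y = exp (- 2 * of_real pi * \<i> * \<alpha>) *s flat_sec a (b - 2 * of_real pi * \<i> * a) y"
proof -
 have c: "covering (fst y + 2 * of_real pi * \<i>, snd y) = covering y" by (simp add: covering_def exp_add)
 have "exp (- \<alpha> * (fst y + 2 * of_real pi * \<i>)) = exp (- 2 * of_real pi * \<i> * \<alpha>) * exp (- \<alpha> * fst y)"
  by (simp add: exp_add[symmetric] algebra_simps)
 then have "flat_vec \<alpha> a b (fst y + 2 * of_real pi * \<i>) =
   exp (- 2 * of_real pi * \<i> * \<alpha>) *s flat_vec \<alpha> a (b - 2 * of_real pi * \<i> * a) (fst y)"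
  by (simp add: flat_vec_def vec_eq_iff forall_2 algebra_simps)
 then show ?thesis unfolding monodromy_def flat_sec_def c fst_conv by (simp only: smult_vec)
qed

lemma flat_basis_flat_sec:
 assumes "c ~= 0" shows "flat_basis R (flat_sec 1 0) (flat_sec 0 c)" unfolding flat_basis_def
proof (intro conjI allI impI)
 fix S assume "flat_multivalued R S"
 from flat_iff[OF this] obtain a b where S: "!!y. y : total_base R ==> S y = flat_sec a b y" by blast
 have comb: "x *s flat_sec 1 0 y + w *s flat_sec 0 c y = flat_sec x (w * c) y" for x w y
  using flat_sec_lin2[of x 1 0 y w 0 c] by simp
 show "\<exists>!(x, w). ALL y:total_base R. S y = x *s flat_sec 1 0 y + w *s flat_sec 0 c y"
 proof (rule ex1I[of _ "(a, b / c)"])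
  show "case (a, b / c) of (x, w) => ALL y:total_base R. S y = x *s flat_sec 1 0 y + w *s flat_sec 0 c y"
   using S assms by (simp add: comb)
  fix p assume p: "case p of (x, w) => ALL y:total_base R. S y = x *s flat_sec 1 0 y + w *s flat_sec 0 c y"
  obtain x w where xw: "p = (x, w)" by force
  have "flat_sec a b (0, t) = flat_sec x (w * c) (0, t)" using p S[of "(0, t)"] by (simp add: xw comb base_R)
  then show "p = (a, b / c)" using flat_sec_inj assms by (force simp: xw)
 qed
qed (rule flat_sec_flat)+

lemma monodromy_jordan_block_iff:
 "monodromy_jordan_block R \<nu> \<longleftrightarrow> \<nu> = exp (- 2 * of_real pi * \<i> * \<alpha>)"
proof
 let ?\<mu> = "exp (- 2 * of_real pi * \<i> * \<alpha>)"
 assume \<nu>: "\<nu> = ?\<mu>"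
 let ?c = "- 2 * of_real pi * \<i> * ?\<mu>"
 show "monodromy_jordan_block R \<nu>" unfolding monodromy_jordan_block_def
 proof (intro exI conjI ballI)
  show "flat_basis R (flat_sec 1 0) (flat_sec 0 ?c)" by (rule flat_basis_flat_sec) simp
  fix y
  have e: "k *s flat_sec a b y = flat_sec (k * a) (k * b) y" for k a b using flat_sec_lin2[of k a b y 0 0 0] by simp
  show "monodromy (flat_sec 1 0) y = \<nu> *s flat_sec 1 0 y + flat_sec 0 ?c y"
   using flat_sec_lin2[of \<nu> 1 0 y 1 0 ?c] unfolding flat_sec_monodromy \<nu> e by (simp add: algebra_simps)
  show "monodromy (flat_sec 0 ?c) y = \<nu> *s flat_sec 0 ?c y" unfolding flat_sec_monodromy \<nu> by simp
 qed
next
 let ?\<mu> = "exp (- 2 * of_real pi * \<i> * \<alpha>)"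
 assume "monodromy_jordan_block R \<nu>"
 then obtain S1 S2 where S: "flat_basis R S1 S2" and M: "!!y. y : total_base R ==> monodromy S2 y = \<nu> *s S2 y"
  unfolding monodromy_jordan_block_def by blast
 have S2: "flat_multivalued R S2" using S unfolding flat_basis_def by (elim conjE)
 from flat_iff[OF this] obtain a b where ab: "!!y. y : total_base R ==> S2 y = flat_sec a b y" by blast
 have ne: "a ~= 0 \<or> b ~= 0"
 proof (rule ccontr)
  assume "~ ?thesis"
  then have S20: "S2 y = 0" if "y : total_base R" for y
   using ab[OF that] by (simp add: flat_sec_def flat_vec_def vec_eq_iff forall_2)
  define Q where "Q = (%p :: complex \<times> complex. ALL y:total_base R. S2 y = fst p *s S1 y + snd p *s S2 y)"
  have "\<exists>!p. case p of (a, b) => ALL y:total_base R. S2 y = a *s S1 y + b *s S2 y"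
   using S S2 unfolding flat_basis_def by (elim conjE allE[of _ S2]) (erule mp)
  then have "\<exists>!p. Q p" unfolding Q_def case_prod_unfold .
  moreover have "Q (0, 1)" "Q (0, 0)" using S20 by (auto simp: Q_def)
  ultimately have "(0, 1) = ((0, 0) :: complex \<times> complex)" by blast
  then show False by simp
 qed
 have "monodromy S2 (0, t) = monodromy (flat_sec a b) (0, t)" unfolding monodromy_def by (rule ab) (simp add: base_R)
 moreover have "monodromy S2 (0, t) = \<nu> *s S2 (0, t)" by (rule M) (simp add: base_R)
 moreover have "S2 (0, t) = flat_sec a b (0, t)" by (rule ab) (simp add: base_R)
 ultimately have "?\<mu> *s flat_sec a (b - 2 * of_real pi * \<i> * a) (0, t) = \<nu> *s flat_sec a b (0, t)"
  by (simp only: flat_sec_monodromy)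
 then have "flat_sec (?\<mu> * a) (?\<mu> * (b - 2 * of_real pi * \<i> * a)) (0, t) = flat_sec (\<nu> * a) (\<nu> * b) (0, t)"
  using flat_sec_lin2[of ?\<mu> a "b - 2 * of_real pi * \<i> * a" "(0, t)" 0 0 0] flat_sec_lin2[of \<nu> a b "(0, t)" 0 0 0] by simp
 from flat_sec_inj[OF this] ne show "\<nu> = ?\<mu>" by auto
qed

end

section \<open>Growth, logarithmic lattices and leading exponents over a point\<close>

lemma nf_mat_inv: "z ~= 0 ==> invertible (nf_mat a b h z)" by (simp add: invertible_det_nz nf_mat_def det_2)

lemma euler_identity:
 fixes z :: complex
 assumes Y: "z * Y = X" and X: "z * X = B" and Q: "B * Q = A" and I: "B * I = X"
 shows "z * (h * ((b - 1) * Y * D1 + D1' * X) + (b * X * D2 + D2' * B)) + A * D1 + \<alpha> * (h * X * D1 + B * D2)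
   = h * X * (z * D1' + (\<alpha> + a) * D1) + B * (z * D2' + (\<alpha> + b) * D2 + (Q - h * (a - b + 1) * I) * D1)"
proof -
 have l: "z * (h * ((b - 1) * Y * D1 + D1' * X) + (b * X * D2 + D2' * B)) =
   h * ((b - 1) * (z * Y) * D1 + z * D1' * X) + (b * (z * X) * D2 + z * D2' * B)" by (simp add: algebra_simps)
 have r: "B * (z * D2' + (\<alpha> + b) * D2 + (Q - h * (a - b + 1) * I) * D1) =
   B * (z * D2' + (\<alpha> + b) * D2) + ((B * Q) * D1 - h * (a - b + 1) * (B * I) * D1)" by (simp add: algebra_simps)
 show ?thesis unfolding l r Y X Q I by (simp add: algebra_simps)
qed

definition nf_basis :: "te => (pt => complex^2^2) => complex => int => int => complex => bool" where
 "nf_basis R E t a b h \<longleftrightarrow> b <= a + 1 & lattice_basis R E (0, t) (%y. nf_mat a b h (fst y))"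

context framed_point
begin

text \<open>
 The coordinates with respect to \<open>E\<close> and to flat sections differ by powers and logarithms, which
 grow at most polynomially on a sector; one sector of angle \<open>2 \<pi>\<close> covers a punctured
 neighbourhood.
\<close>

lemma moderate_growth_frame:
 assumes "moderate_growth R \<tau>"
 shows "EX C N. ALL i. EV z. norm ((matrix_inv (E (z, t)) *v \<tau> (z, t)) $ i) <= C / norm z ^ N"
proof -
 obtain S1 S2 a1 a2 where S: "flat_basis R S1 S2"
  and \<tau>: "!!y. y : total_base R ==> \<tau> (covering y) = a1 (fst y) *s S1 y + a2 (fst y) *s S2 y"
  and gr: "ALL \<theta>1 \<theta>2 :: real. EX C r :: real. EX N :: nat. ALL \<zeta>. Re \<zeta> < r & \<theta>1 <= Im \<zeta> & Im \<zeta> <= \<theta>2 -->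
      norm (a1 \<zeta>) <= C / norm (exp \<zeta>) ^ N & norm (a2 \<zeta>) <= C / norm (exp \<zeta>) ^ N"
  using assms unfolding moderate_growth_def by blast
 have fl1: "flat_multivalued R S1" using S unfolding flat_basis_def by (elim conjE)
 have fl2: "flat_multivalued R S2" using S unfolding flat_basis_def by (elim conjE)
 obtain p1 q1 where pq1: "!!y. y : total_base R ==> S1 y = flat_sec p1 q1 y" using flat_iff[OF fl1] by blast
 obtain p2 q2 where pq2: "!!y. y : total_base R ==> S2 y = flat_sec p2 q2 y" using flat_iff[OF fl2] by blast
 obtain C r :: real and N :: nat where CrN: "!!\<zeta>. Re \<zeta> < r ==> - pi <= Im \<zeta> ==> Im \<zeta> <= pi ==>
   norm (a1 \<zeta>) <= C / norm (exp \<zeta>) ^ N & norm (a2 \<zeta>) <= C / norm (exp \<zeta>) ^ N"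
  using gr by blast
 define K where "K = norm p1 + norm p2 + norm q1 + norm q2"
 define n where "n = nat \<lceil>norm \<alpha>\<rceil>"
 define C' where "C' = exp (norm \<alpha> * pi) * (K * (2 + pi)) * C"
 have main: "norm ((matrix_inv (E (z, t)) *v \<tau> (z, t)) $ i) <= C' / norm z ^ (N + Suc n)"
  if z: "z ~= 0" "norm z < 1" "norm z < exp r" for z i
 proof -
  define \<zeta> where "\<zeta> = Ln z"
  have e: "exp \<zeta> = z" using z by (simp add: \<zeta>_def)
  have Re: "Re \<zeta> = ln (norm z)" using z by (simp add: \<zeta>_def)
  have Im: "- pi <= Im \<zeta>" "Im \<zeta> <= pi" using z mpi_less_Im_Ln[of z] Im_Ln_le_pi[of z] by (auto simp: \<zeta>_def)
  have "ln (norm z) < r" using z ln_less_cancel_iff[of "norm z" "exp r"] by simp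
  then have a: "norm (a1 \<zeta>) <= C / norm z ^ N" "norm (a2 \<zeta>) <= C / norm z ^ N"
   using CrN[of \<zeta>] Re Im e by auto
  define X where "X = C / norm z ^ N"
  have X: "X >= 0" using a(1) norm_ge_zero[of "a1 \<zeta>"] unfolding X_def by linarith
  define A where "A = a1 \<zeta> * p1 + a2 \<zeta> * p2"
  define B where "B = a1 \<zeta> * q1 + a2 \<zeta> * q2"
  have c\<zeta>: "covering (\<zeta>, t) = (z, t)" by (simp add: covering_def e)
  have tot: "(\<zeta>, t) : total_base R" by (simp add: base_R)
  have "\<tau> (z, t) = flat_sec A B (\<zeta>, t)"
   using \<tau>[OF tot] flat_sec_lin2[of "a1 \<zeta>" p1 q1 "(\<zeta>, t)" "a2 \<zeta>" p2 q2]
   by (simp only: c\<zeta> pq1[OF tot] pq2[OF tot] A_def B_def fst_conv)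
  also have "\<dots> = E (z, t) *v flat_vec \<alpha> A B \<zeta>" by (simp only: flat_sec_def c\<zeta> fst_conv)
  finally have \<tau>z: "\<tau> (z, t) = E (z, t) *v flat_vec \<alpha> A B \<zeta>" .
  have Ez: "invertible (E (z, t))" using E_inv[of "(z, t)"] z by (simp add: base_R)
  have g: "matrix_inv (E (z, t)) *v \<tau> (z, t) = flat_vec \<alpha> A B \<zeta>"
   unfolding \<tau>z by (rule inv_cancel(5)[OF Ez])
  have bound: "norm (a1 \<zeta> * x + a2 \<zeta> * y) <= X * (norm x + norm y)" for x y
  proof -
   have "norm (a1 \<zeta> * x + a2 \<zeta> * y) <= norm (a1 \<zeta>) * norm x + norm (a2 \<zeta>) * norm y"
    by (rule norm_triangle_le) (simp add: norm_mult)
   also have "\<dots> <= X * norm x + X * norm y" using a by (intro add_mono mult_right_mono) (auto simp: X_def)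
   finally show ?thesis by (simp add: algebra_simps)
  qed
  have A: "norm A <= X * K" and B: "norm B <= X * K" unfolding A_def B_def K_def using X
   by (auto intro!: order.trans[OF bound] mult_left_mono)
  have K: "K >= 0" by (simp add: K_def)
  have nz: "0 < norm z" using z by simp
  have inv1: "1 <= 1 / norm z" using z nz by simp
  have lnz: "ln (norm z) <= 0" using z nz by simp
  have "- ln (norm z) <= 1 / norm z" using ln_le_minus_one[of "1 / norm z"] nz by (simp add: ln_div)
  moreover have \<zeta>le: "norm \<zeta> <= - ln (norm z) + pi"
  proof -
   have "\<bar>Re \<zeta>\<bar> = - ln (norm z)" "\<bar>Im \<zeta>\<bar> <= pi" using Im Re lnz by (auto simp: abs_le_iff)
   then show ?thesis using cmod_le[of \<zeta>] by linarith
  qed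
  ultimately have "norm \<zeta> <= 1 / norm z + pi * 1" by simp
  also have "\<dots> <= 1 / norm z + pi * (1 / norm z)" using inv1 by (intro add_left_mono mult_left_mono) auto
  finally have \<zeta>2: "norm \<zeta> <= (1 + pi) / norm z" by (simp add: add_divide_distrib)
  have "norm (exp (- \<alpha> * \<zeta>)) <= exp (norm (- \<alpha> * \<zeta>))" by (rule norm_exp)
  also have "\<dots> <= exp (norm \<alpha> * pi + real n * (- ln (norm z)))"
  proof -
   have "norm (- \<alpha> * \<zeta>) <= norm \<alpha> * (- ln (norm z) + pi)"
    using \<zeta>le by (simp add: norm_mult mult_left_mono)
   also have "\<dots> = norm \<alpha> * pi + norm \<alpha> * (- ln (norm z))" by (simp add: algebra_simps)
   also have "\<dots> <= norm \<alpha> * pi + real n * (- ln (norm z))"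
    using lnz by (intro add_left_mono mult_right_mono) (auto simp: n_def real_nat_ceiling_ge)
   finally show ?thesis by simp
  qed
  also have "\<dots> = exp (norm \<alpha> * pi) * (1 / norm z ^ n)"
   unfolding exp_add exp_of_nat_mult using nz by (simp add: exp_minus power_one_over divide_inverse power_inverse)
  finally have ex: "norm (exp (- \<alpha> * \<zeta>)) <= exp (norm \<alpha> * pi) * (1 / norm z ^ n)" .
  have comb: "norm (exp (- \<alpha> * \<zeta>) * D) <= C' / norm z ^ (N + Suc n)"
   if D: "norm D <= X * K * (2 + pi) * (1 / norm z)" for D
  proof -
   have "norm (exp (- \<alpha> * \<zeta>) * D) <= (exp (norm \<alpha> * pi) * (1 / norm z ^ n)) * (X * K * (2 + pi) * (1 / norm z))"
    unfolding norm_mult using ex D by (intro mult_mono) auto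
   also have "\<dots> = C' / norm z ^ (N + Suc n)" by (simp add: C'_def X_def power_add mult_ac)
   finally show ?thesis .
  qed
  have XK: "0 <= X * K" using X K by simp
  have D1: "norm A <= X * K * (2 + pi) * (1 / norm z)"
  proof -
   have "X * K * 1 * 1 <= X * K * (2 + pi) * (1 / norm z)" using X K XK inv1 pi_ge_zero by (intro mult_mono) auto
   then show ?thesis using A by simp
  qed
  have D2: "norm (B - A * \<zeta>) <= X * K * (2 + pi) * (1 / norm z)"
  proof -
   have "norm (B - A * \<zeta>) <= norm B + norm A * norm \<zeta>"
    by (rule order.trans[OF norm_triangle_ineq4]) (simp add: norm_mult)
   also have "\<dots> <= X * K * (1 / norm z) + X * K * ((1 + pi) / norm z)"
   proof (intro add_mono mult_mono)
    have "X * K * 1 <= X * K * (1 / norm z)" using XK inv1 by (intro mult_left_mono) auto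
    then show "norm B <= X * K * (1 / norm z)" using B by simp
   qed (use A \<zeta>2 XK X K in auto)
   also have "\<dots> = X * K * (2 + pi) * (1 / norm z)" by (simp add: algebra_simps add_divide_distrib)
   finally show ?thesis .
  qed
  show ?thesis unfolding g flat_vec_def using comb[OF D1] comb[OF D2] exhaust_2[of i] by auto
 qed
 have "EV z. norm ((matrix_inv (E (z, t)) *v \<tau> (z, t)) $ i) <= C' / norm z ^ (N + Suc n)" for i
  unfolding eventually_at by (intro exI[of _ "min 1 (exp r)"]) (use main in auto)
 then show ?thesis by blast
qed

lemma euler_in_basis:
 fixes D :: "complex => complex^2"
 assumes z: "z ~= 0" and D: "!!i. (%w. D w $ i) field_differentiable at z"
  and g: "!!w. w ~= 0 ==> g (w, t) = nf_mat a b h w *v D w"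
 shows "log_op 0 g (z, t) + \<alpha> *s g (z, t) = nf_mat a b h z *v
   vector [z * deriv (%w. D w $ 1) z + (\<alpha> + of_int a) * D z $ 1,
    z * deriv (%w. D w $ 2) z + (\<alpha> + of_int b) * D z $ 2
     + (z powi (a - b) - h * of_int (a - b + 1) * z powi (- 1)) * D z $ 1]"
proof -
 have ev0: "\<forall>\<^sub>F w in nhds z. w ~= 0" using z by (intro t1_space_nhds) auto
 have ev: "\<forall>\<^sub>F w in nhds z. g (w, t) $ i = (nf_mat a b h w *v D w) $ i" for i
  using ev0 by eventually_elim (simp add: g)
 have DD: "((%w. D w $ i) has_field_derivative deriv (%w. D w $ i) z) (at z)" for i
  using D by (simp add: DERIV_deriv_iff_field_differentiable)
 have Pw: "((%w. w powi m) has_field_derivative of_int m * z powi (m - 1)) (at z)" for m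
  using z by (auto intro!: derivative_eq_intros)
 have d1: "deriv (%w. g (w, t) $ 1) z = of_int a * z powi (a - 1) * D z $ 1 + deriv (%w. D w $ 1) z * z powi a"
 proof -
  have "((%w. w powi a * D w $ 1) has_field_derivative
   of_int a * z powi (a - 1) * D z $ 1 + deriv (%w. D w $ 1) z * z powi a) (at z)" by (rule DERIV_mult[OF Pw DD])
  moreover have "deriv (%w. g (w, t) $ 1) z = deriv (%w. w powi a * D w $ 1) z"
   by (rule deriv_cong_ev[OF _ refl]) (use ev[of 1] in \<open>simp add: nf_mat_def\<close>)
  ultimately show ?thesis by (simp add: DERIV_imp_deriv)
 qed
 have d2: "deriv (%w. g (w, t) $ 2) z =
   h * (of_int (b - 1) * z powi (b - 1 - 1) * D z $ 1 + deriv (%w. D w $ 1) z * z powi (b - 1))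
   + (of_int b * z powi (b - 1) * D z $ 2 + deriv (%w. D w $ 2) z * z powi b)"
 proof -
  have "((%w. h * (w powi (b - 1) * D w $ 1) + w powi b * D w $ 2) has_field_derivative
   h * (of_int (b - 1) * z powi (b - 1 - 1) * D z $ 1 + deriv (%w. D w $ 1) z * z powi (b - 1))
   + (of_int b * z powi (b - 1) * D z $ 2 + deriv (%w. D w $ 2) z * z powi b)) (at z)"
   by (intro DERIV_add DERIV_cmult DERIV_mult Pw DD)
  moreover have "deriv (%w. g (w, t) $ 2) z = deriv (%w. h * (w powi (b - 1) * D w $ 1) + w powi b * D w $ 2) z"
   by (rule deriv_cong_ev[OF _ refl]) (use ev[of 2] in \<open>simp add: nf_mat_def mult.assoc\<close>)
  ultimately show ?thesis by (simp add: DERIV_imp_deriv)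
 qed
 have za: "z * z powi (a - 1) = z powi a" "z * z powi (b - 1) = z powi b" "z * z powi (b - 1 - 1) = z powi (b - 1)"
  using power_int_add[OF disjI1[OF z], of 1 "a - 1"] power_int_add[OF disjI1[OF z], of 1 "b - 1"]
   power_int_add[OF disjI1[OF z], of 1 "b - 1 - 1"] by simp_all
 have zb: "z powi b * z powi (a - b) = z powi a" "z powi b * z powi (- 1) = z powi (b - 1)"
  using power_int_add[OF disjI1[OF z], of b "a - b"] power_int_add[OF disjI1[OF z], of b "- 1"] by simp_all
 define D1 where "D1 = D z $ 1" define D2 where "D2 = D z $ 2"
 define D1' where "D1' = deriv (%w. D w $ 1) z" define D2' where "D2' = deriv (%w. D w $ 2) z"
 have g1: "g (z, t) $ 1 = z powi a * D1" "g (z, t) $ 2 = h * z powi (b - 1) * D1 + z powi b * D2"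
  unfolding g[OF z] by (simp_all add: nf_mat_def D1_def D2_def)
 have r1: "z * (of_int a * z powi (a - 1) * D1 + D1' * z powi a) + \<alpha> * (z powi a * D1)
   = z powi a * (z * D1' + (\<alpha> + of_int a) * D1)"
 proof -
  have "z * (of_int a * z powi (a - 1) * D1 + D1' * z powi a) = of_int a * (z * z powi (a - 1)) * D1 + z * D1' * z powi a"
   by (simp add: algebra_simps)
  then show ?thesis unfolding za by (simp add: algebra_simps)
 qed
 have r2: "z * (h * (of_int (b - 1) * z powi (b - 1 - 1) * D1 + D1' * z powi (b - 1))
   + (of_int b * z powi (b - 1) * D2 + D2' * z powi b)) + z powi a * D1 + \<alpha> * (h * z powi (b - 1) * D1 + z powi b * D2)
   = h * z powi (b - 1) * (z * D1' + (\<alpha> + of_int a) * D1) +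
    z powi b * (z * D2' + (\<alpha> + of_int b) * D2 + (z powi (a - b) - h * of_int (a - b + 1) * z powi (- 1)) * D1)"
  using euler_identity[OF za(3,2) zb, of h "of_int b" D1 D1' D2 D2' \<alpha> "of_int a"]
  by (simp only: of_int_diff of_int_add of_int_1)
 show ?thesis unfolding vec_eq_iff forall_2
  using r1 r2 by (simp add: log_op_def g1 d1 d2 D1_def[symmetric] D2_def[symmetric] D1'_def[symmetric] D2'_def[symmetric] nf_mat_def)
qed

lemma euler_in_stalk_iff:
 assumes nf: "lattice_basis R E (0, t) (%y. nf_mat a b h (fst y))"
  and D: "!!i. ext0 (%z. D z $ i) (D0 $ i)" and \<sigma>: "!!z. z ~= 0 ==> \<sigma> (z, t) = E (z, t) *v (nf_mat a b h z *v D z)"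
 shows "(%x. fst x *s nabla_z R \<sigma> x) : stalk R (0, t) \<longleftrightarrow>
   (EX c. ext0 (%z. (z powi (a - b) - h * of_int (a - b + 1) * z powi (- 1)) * D z $ 1) c)"
proof -
 let ?\<tau> = "%x. fst x *s nabla_z R \<sigma> x"
 define g where "g x = nf_mat a b h (fst x) *v D (fst x)" for x :: pt
 define d where "d z = matrix_inv (nf_mat a b h z) *v (matrix_inv (E (z, t)) *v ?\<tau> (z, t))" for z
 have Ei: "invertible (E (z, t))" if "z ~= 0" for z using E_inv[of "(z, t)"] that by (simp add: base_R)
 have \<tau>d: "?\<tau> (z, t) = E (z, t) *v (nf_mat a b h z *v d z)" if "z ~= 0" for z
  unfolding d_def inv_cancel(6)[OF nf_mat_inv[OF that]] inv_cancel(6)[OF Ei[OF that]] ..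
 have iff: "?\<tau> : stalk R (0, t) \<longleftrightarrow> (ALL i. EX c. ext0 (%z. d z $ i) c)"
  by (rule stalk_ext0_iff[OF nf]) (use nf_mat_inv \<tau>d in auto)
 obtain r1 F1 where F1: "r1 > 0" "F1 holomorphic_on ball 0 r1" "F1 0 = D0 $ 1" "!!z. z : ball 0 r1 - {0} ==> D z $ 1 = F1 z"
  using ext0_holomorphic[OF D[of 1]] by metis
 obtain r2 F2 where F2: "r2 > 0" "F2 holomorphic_on ball 0 r2" "F2 0 = D0 $ 2" "!!z. z : ball 0 r2 - {0} ==> D z $ 2 = F2 z"
  using ext0_holomorphic[OF D[of 2]] by metis
 define r where "r = min r1 r2"
 have r: "r > 0" using F1 F2 by (simp add: r_def)
 have Dd: "(%w. D w $ i) field_differentiable at z" if z: "z : ball 0 r - {0}" for z i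
 proof -
  have "(%w. D w $ i) holomorphic_on ball 0 r - {0}"
  proof -
   have "F1 holomorphic_on ball 0 r - {0}" "F2 holomorphic_on ball 0 r - {0}"
    by (rule holomorphic_on_subset[OF F1(2)] holomorphic_on_subset[OF F2(2)], auto simp: r_def)+
   then have "(%w. D w $ 1) holomorphic_on ball 0 r - {0} & (%w. D w $ 2) holomorphic_on ball 0 r - {0}"
    by (intro conjI holomorphic_transform[of F1 _ "%w. D w $ 1"] holomorphic_transform[of F2 _ "%w. D w $ 2"])
      (use F1(4) F2(4) in \<open>simp_all add: r_def\<close>)
   then show ?thesis using exhaust_2[of i] by auto
  qed
  then show ?thesis by (rule holomorphic_on_imp_differentiable_at) (use z in auto)
 qed
 define e where "e z = (vector [z * deriv (%w. D w $ 1) z + (\<alpha> + of_int a) * D z $ 1,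
    z * deriv (%w. D w $ 2) z + (\<alpha> + of_int b) * D z $ 2
     + (z powi (a - b) - h * of_int (a - b + 1) * z powi (- 1)) * D z $ 1] :: complex^2)" for z
 have de: "d z = e z" if z: "z : ball 0 r - {0}" for z
 proof -
  have z0: "z ~= 0" using z by auto
  have x: "(z, t) : punctured R" using z0 by (simp add: base_R)
  have \<sigma>g: "\<sigma> y = E y *v g y" if "y : punctured R" for y
   using \<sigma>[of "fst y"] that unfolding g_def by (metis punctured_R prod.collapse)
  have gz: "zdiff (%y. g y $ i) (z, t)" for i
  proof -
   have p: "(%w. w powi m) field_differentiable at z" for m
    using DERIV_power_int[OF DERIV_ident, where x=z and n=m and s=UNIV] z0 by (auto simp: field_differentiable_def)
   show ?thesis unfolding zdiff_def g_def using exhaust_2[of i]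
    by (auto simp: nf_mat_def intro!: derivative_intros p Dd[OF z] field_differentiable_add field_differentiable_mult)
  qed
  have "nabla_log R (\<alpha> + of_int 0) \<sigma> (z, t) = E (z, t) *v log_op 0 g (z, t)"
   by (rule nabla_log_frame[OF x gz \<sigma>g])
  then have "?\<tau> (z, t) = E (z, t) *v log_op 0 g (z, t) + \<alpha> *s \<sigma> (z, t)"
   by (simp add: nabla_log_def vec_eq_iff algebra_simps)
  also have "\<dots> = E (z, t) *v (log_op 0 g (z, t) + \<alpha> *s g (z, t))"
   unfolding \<sigma>g[OF x] by (simp only: mat_vec_sums smult_vec)
  also have "log_op 0 g (z, t) + \<alpha> *s g (z, t) = nf_mat a b h z *v e z"
   unfolding e_def by (rule euler_in_basis[OF z0 Dd[OF z]]) (simp add: g_def)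
  finally have \<tau>e: "?\<tau> (z, t) = E (z, t) *v (nf_mat a b h z *v e z)" .
  show ?thesis unfolding d_def \<tau>e inv_cancel(5)[OF Ei[OF z0]] inv_cancel(5)[OF nf_mat_inv[OF z0]] ..
 qed
 have ev: "EV z. d z = e z" using eventually_at0_in_ball[OF r] by eventually_elim (rule de)
 have ev': "EV z. d z $ i = e z $ i" "EV z. e z $ i = d z $ i" for i using ev by (auto elim: eventually_mono)
 have iff2: "(EX c. ext0 (%z. d z $ i) c) \<longleftrightarrow> (EX c. ext0 (%z. e z $ i) c)" for i
  using ext0_cong[OF _ ev'(1)] ext0_cong[OF _ ev'(2)] by blast
 obtain d1 where d1: "ext0 (deriv (%w. D w $ 1)) d1" using ext0_deriv[OF D] by blast
 obtain d2 where d2: "ext0 (deriv (%w. D w $ 2)) d2" using ext0_deriv[OF D] by blast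
 have e1: "ext0 (%z. e z $ 1) (0 * d1 + (\<alpha> + of_int a) * D0 $ 1)"
  unfolding e_def vector_2 by (intro ext0_add ext0_mult ext0_ident ext0_const d1 D)
 have e2a: "ext0 (%z. z * deriv (%w. D w $ 2) z + (\<alpha> + of_int b) * D z $ 2) (0 * d2 + (\<alpha> + of_int b) * D0 $ 2)"
  by (intro ext0_add ext0_mult ext0_ident ext0_const d2 D)
 let ?q = "%z. (z powi (a - b) - h * of_int (a - b + 1) * z powi (- 1)) * D z $ 1"
 have "(EX c. ext0 (%z. e z $ 2) c) \<longleftrightarrow> (EX c. ext0 ?q c)"
 proof
  assume "EX c. ext0 (%z. e z $ 2) c"
  then obtain c where "ext0 (%z. e z $ 2) c" by blast
  from ext0_diff[OF this e2a] have "ext0 ?q (c - (0 * d2 + (\<alpha> + of_int b) * D0 $ 2))"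
   by (rule ext0_cong) (simp add: e_def)
  then show "EX c. ext0 ?q c" by blast
 next
  assume "EX c. ext0 ?q c"
  then obtain c where "ext0 ?q c" by blast
  from ext0_add[OF e2a this] show "EX c. ext0 (%z. e z $ 2) c" unfolding e_def vector_2 by blast
 qed
 then show ?thesis unfolding iff forall_2 iff2 using e1 by blast
qed

text \<open>
 In the triangular basis, \<open>z \<nabla>\<^bsub>\<partial>z\<^esub>\<close> has a single entry that may
 have a pole, \<open>z^(a - b) - h (a - b + 1) / z\<close>.  It has none iff \<open>h = 0\<close> and
 \<open>b \<le> a\<close>, or else both terms cancel, which is impossible.
\<close>

lemma logarithmic_iff:
 assumes nf: "nf_basis R E t a b h"
 shows "logarithmic R \<longleftrightarrow> h = 0 & b <= a"
proof
 note nfb = nf[unfolded nf_basis_def, THEN conjunct2]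
 assume hb: "h = 0 & b <= a"
 show "logarithmic R" unfolding logarithmic_def origin_R
 proof
  fix \<sigma> assume \<sigma>: "\<sigma> : stalk R (0, t)"
  define D where "D z = matrix_inv (nf_mat a b h z) *v (matrix_inv (E (z, t)) *v \<sigma> (z, t))" for z
  have Ei: "invertible (E (z, t))" if "z ~= 0" for z using E_inv[of "(z, t)"] that by (simp add: base_R)
  have \<sigma>D: "\<sigma> (z, t) = E (z, t) *v (nf_mat a b h z *v D z)" if "z ~= 0" for z
   unfolding D_def inv_cancel(6)[OF nf_mat_inv[OF that]] inv_cancel(6)[OF Ei[OF that]] ..
  have "\<sigma> : stalk R (0, t) \<longleftrightarrow> (ALL i. EX c. ext0 (%z. D z $ i) c)"
   by (rule stalk_ext0_iff[OF nfb]) (use nf_mat_inv \<sigma>D in auto)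
  then obtain c where "!!i. ext0 (%z. D z $ i) (c i)" using \<sigma> by metis
  then have D: "!!i. ext0 (%z. D z $ i) ((\<chi> i. c i) $ i)" by simp
  have "ext0 (%z. z powi (a - b) * D z $ 1) (0 powi (a - b) * (\<chi> i. c i) $ 1)"
   by (intro ext0_mult ext0_powi D) (use hb in simp)
  then have "EX c. ext0 (%z. (z powi (a - b) - h * of_int (a - b + 1) * z powi (- 1)) * D z $ 1) c" using hb by auto
  then show "(%x. fst x *s nabla_z R \<sigma> x) : stalk R (0, t)"
   using euler_in_stalk_iff[OF nfb D \<sigma>D] by blast
 qed
next
 note nfb = nf[unfolded nf_basis_def, THEN conjunct2] and ba = nf[unfolded nf_basis_def, THEN conjunct1]
 assume L: "logarithmic R"
 define D :: "complex => complex^2" where "D z = vector [1, 0]" for z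
 define \<sigma> where "\<sigma> x = E x *v (nf_mat a b h (fst x) *v D (fst x))" for x
 have D: "ext0 (%z. D z $ i) ((vector [1, 0] :: complex^2) $ i)" for i unfolding D_def by (rule ext0_const)
 have \<sigma>D: "\<sigma> (z, t) = E (z, t) *v (nf_mat a b h z *v D z)" for z by (simp add: \<sigma>_def)
 have "\<sigma> : stalk R (0, t) \<longleftrightarrow> (ALL i. EX c. ext0 (%z. D z $ i) c)"
  by (rule stalk_ext0_iff[OF nfb]) (use nf_mat_inv \<sigma>D in auto)
 then have "\<sigma> : stalk R (0, t)" using D by blast
 then have "(%x. fst x *s nabla_z R \<sigma> x) : stalk R (0, t)" using L unfolding logarithmic_def origin_R by blast
 then obtain c where "ext0 (%z. (z powi (a - b) - h * of_int (a - b + 1) * z powi (- 1)) * D z $ 1) c"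
  using euler_in_stalk_iff[OF nfb D \<sigma>D] by blast
 then have e: "ext0 (%z. z powi (a - b) - h * of_int (a - b + 1) * z powi (- 1)) c" by (simp add: D_def)
 have neg: False if "ext0 (%z. k * z powi (- 1)) c" "k ~= 0" for k c
 proof -
  have "ext0 (%z. z powi (- 1) * k) c" using that(1) by (simp add: mult.commute)
  from ext0_powi_unit_nonneg[OF this ext0_const that(2)] show False by simp
 qed
 show "h = 0 & b <= a"
 proof (cases "b <= a")
  case True
  have "ext0 (%z. z powi (a - b) - (z powi (a - b) - h * of_int (a - b + 1) * z powi (- 1))) (0 powi (a - b) - c)"
   by (intro ext0_diff ext0_powi e) (use True in simp)
  then have "ext0 (%z. (h * of_int (a - b + 1)) * z powi (- 1)) (0 powi (a - b) - c)" by simp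
  then have "h * of_int (a - b + 1) = 0" using neg by blast
  moreover have "(of_int (a - b + 1) :: complex) ~= 0" using True by (simp only: of_int_eq_0_iff)
  ultimately show ?thesis using True by simp
 next
  case False
  then have "a - b = - 1" using ba by simp
  then have "ext0 (%z. 1 * z powi (- 1)) c" using e by simp
  from neg[OF this] show ?thesis by simp
 qed
qed

lemma triangular_bases_exponents:
 assumes nf: "lattice_basis R E (0, t) (%y. nf_mat a b h (fst y))"
  and V: "lattice_basis R E (0, t) (%y. mat2 (fst y powi a') 0 (u (fst y)) (fst y powi b'))"
 shows "a' = a" "b' = b"
proof -
 let ?V = "%z. mat2 (z powi a') 0 (u z) (z powi b')"
 have Vi: "invertible (?V z)" if "z ~= 0" for z using that by (simp add: invertible_det_nz det_2)
 obtain C C0 where C: "ext0_mat C C0" "EV z. ?V z = nf_mat a b h z ** C z"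
  using lattice_bases_related_ext0[OF nf V] nf_mat_inv by auto
 obtain B B0 where B: "ext0_mat B B0" "EV z. nf_mat a b h z = ?V z ** B z"
  using lattice_bases_related_ext0[OF V nf] Vi by auto
 have pw: "n >= 0" if "EV z. z powi n = f z" "ext0 f c" for n f c
 proof (rule ext0_powi_unit_nonneg)
  show "ext0 (%z. z powi n * 1) c" using ext0_cong[OF that(2,1)] by simp
  show "ext0 (%z. 1) 1" by (rule ext0_const)
 qed simp
 have quot: "z powi (m - n) = x" if "z ~= 0" "z powi m = z powi n * x" for z x :: complex and m n
  using that by (simp add: power_int_diff)
 have "EV z. z powi (a' - a) = C z $ 1 $ 1" using C(2) ev_nz
 proof eventually_elim
  case (elim z)
  have "?V z $ 1 $ 1 = (nf_mat a b h z ** C z) $ 1 $ 1" unfolding elim(1) ..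
  then show ?case using quot[OF elim(2)] by (simp add: nf_mat_def)
 qed
 from pw[OF this] have 1: "a' - a >= 0" using C(1) unfolding ext0_mat_def by blast
 have "EV z. z powi (a - a') = B z $ 1 $ 1" using B(2) ev_nz
 proof eventually_elim
  case (elim z)
  have "nf_mat a b h z $ 1 $ 1 = (?V z ** B z) $ 1 $ 1" unfolding elim(1) ..
  then show ?case using quot[OF elim(2)] by (simp add: nf_mat_def)
 qed
 from pw[OF this] have 2: "a - a' >= 0" using B(1) unfolding ext0_mat_def by blast
 have "EV z. z powi (b' - b) = C z $ 2 $ 2" using C(2) ev_nz
 proof eventually_elim
  case (elim z)
  have "?V z $ 1 $ 2 = (nf_mat a b h z ** C z) $ 1 $ 2" "?V z $ 2 $ 2 = (nf_mat a b h z ** C z) $ 2 $ 2" unfolding elim(1) by (rule refl)+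
  then show ?case using quot[OF elim(2)] elim(2) by (simp add: nf_mat_def)
 qed
 from pw[OF this] have 3: "b' - b >= 0" using C(1) unfolding ext0_mat_def by blast
 have "EV z. z powi (b - b') = B z $ 2 $ 2" using B(2) ev_nz
 proof eventually_elim
  case (elim z)
  have "nf_mat a b h z $ 1 $ 2 = (?V z ** B z) $ 1 $ 2" "nf_mat a b h z $ 2 $ 2 = (?V z ** B z) $ 2 $ 2" unfolding elim(1) by (rule refl)+
  then show ?case using quot[OF elim(2)] elim(2) by (simp add: nf_mat_def)
 qed
 from pw[OF this] have 4: "b - b' >= 0" using B(1) unfolding ext0_mat_def by blast
 show "a' = a" "b' = b" using 1 2 3 4 by auto
qed

lemma lattice_basis_change_ext0:
 assumes V: "lattice_basis R E (0, t) V" and C: "ext0_mat C C0" "det C0 ~= 0"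
  and V': "!!z. z ~= 0 ==> V' (z, t) = V (z, t) ** C z"
 shows "lattice_basis R E (0, t) V'"
proof -
 obtain r K where K: "r > 0" "hol2_mat_on K (ball 0 r \<times> {t})" "K (0, t) = C0" "ALL z:ball 0 r - {0}. K (z, t) = C z"
  using ext0_mat_hol2_point[OF C(1), of t] by blast
 show ?thesis
 proof (rule lattice_basis_change[OF origin_total fst_conv V])
  show "rel_open (base R) (ball 0 r \<times> {t})" unfolding base_R by (rule rel_open_ball_point)
  show "V' y = V y ** K y" if "y : ball 0 r \<times> {t}" "fst y ~= 0" for y using that K(4) V' by auto
 qed (use K C in auto)
qed

lemma stalk_direct_sum_power_vecs:
 assumes "!!x. x : punctured R ==> v1 x = E x *v column 1 (V x)" "!!x. x : punctured R ==> v2 x = E x *v column 2 (V x)"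
 shows "stalk_direct_sum R (0, t) v1 v2 \<longleftrightarrow> lattice_basis R E (0, t) V"
 unfolding lattice_basis_def by (rule stalk_direct_sum_cong) (use assms in auto)

lemma exponent_shift:
 assumes "exp (- 2 * of_real pi * \<i> * \<beta>) = exp (- 2 * of_real pi * \<i> * \<alpha>)"
 shows "EX n. \<beta> = \<alpha> + of_int n"
proof -
 obtain n :: int where "- 2 * of_real pi * \<i> * \<beta> = - 2 * of_real pi * \<i> * \<alpha> + (of_int (2 * n) * pi) * \<i>"
  using assms exp_eq by blast
 then have "(- 2 * of_real pi * \<i>) * \<beta> = (- 2 * of_real pi * \<i>) * (\<alpha> + of_int (- n))"
  by (simp add: algebra_simps)
 then have "\<beta> = \<alpha> + of_int (- n)" by (rule mult_left_cancel[THEN iffD1, rotated]) simp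
 then show ?thesis by blast
qed

lemma exponent_monodromy: "exp (- 2 * of_real pi * \<i> * (\<alpha> + of_int n)) = exp (- 2 * of_real pi * \<i> * \<alpha>)"
proof -
 have "exp (- 2 * of_real pi * \<i> * (\<alpha> + of_int n)) = exp (- 2 * of_real pi * \<i> * \<alpha>) * exp (of_int (- n) * (2 * of_real pi * \<i>))"
  by (simp add: exp_add[symmetric] algebra_simps)
 also have "exp (of_int (- n) * (2 * of_real pi * \<i>)) = (1::complex)"
  using exp_integer_2pi[of "of_int (- n)"] by (simp add: mult_ac)
 finally show ?thesis by simp
qed

text \<open>
 Both defining forms of leading exponents are triangular bases with respect to \<open>e\<^sub>1, e\<^sub>2\<close>, so the
 exponents can be read off from the orders on the diagonal.
\<close>

theorem leading_exponents_nf: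
 assumes nf: "nf_basis R E t a b h"
 shows "leading_exponents R (\<alpha> + of_int a) (\<alpha> + of_int (if h = 0 & b <= a then b else b - 1))"
proof -
 note nfb = nf[unfolded nf_basis_def, THEN conjunct2] and ba = nf[unfolded nf_basis_def, THEN conjunct1]
 note L = logarithmic_iff[OF nf]
 let ?b = "if h = 0 & b <= a then b else b - 1"
 have uniq: "\<beta>1 = \<alpha> + of_int a & \<beta>2 = \<alpha> + of_int ?b" if F: "leading_exponents_form R \<beta>1 \<beta>2" for \<beta>1 \<beta>2
 proof -
  have "exp (- 2 * of_real pi * \<i> * \<beta>1) = exp (- 2 * of_real pi * \<i> * \<alpha>)"
   using F monodromy_jordan_block_iff unfolding leading_exponents_form_def by metis
  from exponent_shift[OF this] obtain m where m: "\<beta>1 = \<alpha> + of_int m" by blast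
  obtain k where k: "\<beta>1 - \<beta>2 = of_nat k" using F unfolding leading_exponents_form_def Nats_def by auto
  have \<beta>2: "\<beta>2 = \<alpha> + of_int (m - int k)" using k m by (simp add: algebra_simps)
  define s1 where "s1 x = E x *v power_vec m 1 0 x" for x
  define s2 where "s2 x = E x *v power_vec (m - int k) 0 1 x" for x
  have lk: "linked R \<beta>1 \<beta>2 s1 s2" unfolding m linked_frame_iff[OF conn]
   by (intro exI[of _ k] exI[of _ 1] exI[of _ 0]) (simp add: s1_def s2_def \<beta>2)
  have F': "if logarithmic R then stalk_direct_sum R (origin R) s1 s2
     else EX t2. (\<beta>1 ~= \<beta>2 --> t2 ~= 0) & stalk_direct_sum R (origin R) (%x. s1 x + t2 *s s2 x) (%x. fst x *s s2 x)"
   using F lk unfolding leading_exponents_form_def by blast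
  show ?thesis
  proof (cases "logarithmic R")
   case True
   have "lattice_basis R E (0, t) (%y. mat2 (fst y powi m) 0 ((%_. 0) (fst y)) (fst y powi (m - int k)))"
    using F' True unfolding origin_R by (subst stalk_direct_sum_power_vecs[symmetric, of s1 _ s2])
      (auto simp: s1_def s2_def power_vec_def column_def vec_eq_iff forall_2)
   from triangular_bases_exponents[OF nfb this] show ?thesis using True L m \<beta>2 by auto
  next
   case False
   then obtain t2 where t2: "stalk_direct_sum R (0, t) (%x. s1 x + t2 *s s2 x) (%x. fst x *s s2 x)"
    using F' unfolding origin_R by auto
   have "lattice_basis R E (0, t) (%y. mat2 (fst y powi m) 0 ((%z. t2 * z powi (m - int k)) (fst y)) (fst y powi (m - int k + 1)))"
   proof (rule stalk_direct_sum_power_vecs[THEN iffD1, OF _ _ t2])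
    fix x assume "x : punctured R"
    then have z: "fst x ~= 0" by auto
    show "s1 x + t2 *s s2 x = E x *v column 1 (mat2 (fst x powi m) 0 ((%z. t2 * z powi (m - int k)) (fst x)) (fst x powi (m - int k + 1)))"
     unfolding s1_def s2_def smult_vec[symmetric] mat_vec_sums(1)[symmetric]
     by (rule arg_cong[where f="%v. E x *v v"]) (simp add: power_vec_def column_def vec_eq_iff forall_2)
    have "fst x * fst x powi (m - int k) = fst x powi (m - int k + 1)"
     using power_int_add[OF disjI1[OF z], of "m - int k" 1] by simp
    then show "fst x *s s2 x = E x *v column 2 (mat2 (fst x powi m) 0 ((%z. t2 * z powi (m - int k)) (fst x)) (fst x powi (m - int k + 1)))"
     unfolding s2_def smult_vec[symmetric]
     by (intro arg_cong[where f="%v. E x *v v"]) (simp add: power_vec_def column_def vec_eq_iff forall_2)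
   qed
   from triangular_bases_exponents[OF nfb this] show ?thesis using False L m \<beta>2 by auto
  qed
 qed
 have form: "leading_exponents_form R (\<alpha> + of_int a) (\<alpha> + of_int ?b)"
  unfolding leading_exponents_form_def
 proof (intro conjI allI impI)
  show "EX \<mu>. monodromy_jordan_block R \<mu> & exp (- 2 * of_real pi * \<i> * (\<alpha> + of_int a)) = \<mu> &
    exp (- 2 * of_real pi * \<i> * (\<alpha> + of_int ?b)) = \<mu>"
   unfolding exponent_monodromy monodromy_jordan_block_iff by blast
  have "\<alpha> + of_int a - (\<alpha> + of_int ?b) = of_nat (nat (a - ?b))" using ba by (simp add: of_nat_nat)
  then show "\<alpha> + of_int a - (\<alpha> + of_int ?b) : \<nat>" by (metis of_nat_in_Nats)
  fix s1 s2 assume "linked R (\<alpha> + of_int a) (\<alpha> + of_int ?b) s1 s2"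
  then obtain k l d where l: "l ~= 0" "\<alpha> + of_int ?b = \<alpha> + of_int (a - int k)"
   and s1: "!!x. x : punctured R ==> s1 x = E x *v power_vec a l d x"
   and s2': "!!x. x : punctured R ==> s2 x = E x *v power_vec (a - int k) 0 l x"
   unfolding linked_frame_iff[OF conn] by blast
  have "a - int k = ?b" using l(2) by (simp only: add_left_cancel of_int_eq_iff)
  then have s2: "!!x. x : punctured R ==> s2 x = E x *v power_vec ?b 0 l x" using s2' by simp
  show "if logarithmic R then stalk_direct_sum R (origin R) s1 s2
     else EX t2. (\<alpha> + of_int a ~= \<alpha> + of_int ?b --> t2 ~= 0) &
      stalk_direct_sum R (origin R) (%x. s1 x + t2 *s s2 x) (%x. fst x *s s2 x)"
  proof (cases "logarithmic R")
   case True
   then have hb: "h = 0" "b <= a" using L by auto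
   let ?V = "%y. mat2 (l * fst y powi a) 0 (d * fst y powi a) (l * fst y powi b)"
   have "lattice_basis R E (0, t) ?V"
   proof (rule lattice_basis_change_ext0[OF nfb])
    show "ext0_mat (%z. mat2 l 0 (d * z powi (a - b)) l) (mat2 l 0 (d * 0 powi (a - b)) l)"
     using hb by (auto simp: ext0_mat_def forall_2 intro!: ext0_const ext0_mult ext0_powi)
    show "det (mat2 l 0 (d * 0 powi (a - b)) l) ~= 0" using l by (simp add: det_2)
    fix z :: complex assume z: "z ~= 0"
    have "z powi b * z powi (a - b) = z powi a" using power_int_add[OF disjI1[OF z], of b "a - b"] by simp
    then show "mat2 (l * fst (z, t) powi a) 0 (d * fst (z, t) powi a) (l * fst (z, t) powi b) =
      nf_mat a b h (fst (z, t)) ** mat2 l 0 (d * z powi (a - b)) l"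
     by (intro mat2_eqI) (simp_all add: nf_mat_def hb mult_ac)
   qed
   then have "stalk_direct_sum R (0, t) s1 s2" by (subst stalk_direct_sum_power_vecs[of _ ?V])
      (simp_all add: s1 s2 hb power_vec_def column_def vec_eq_iff forall_2)
   then show ?thesis using True by (simp add: origin_R)
  next
   case False
   then have nhb: "~ (h = 0 & b <= a)" using L by simp
   then have b': "?b = b - 1" by simp
   have ba': "b = a + 1" if "~ b <= a" using ba that by simp
   define t2 where "t2 = (if b <= a then h else h - d / l)"
   define e where "e = (%z::complex. if b <= a then d * z powi (a - b) else 0)"
   have ee: "ext0 e (e 0)"
   proof (cases "b <= a")
    case True
    then show ?thesis unfolding e_def by (simp add: ext0_mult ext0_const ext0_powi)
   next
    case False
    then show ?thesis unfolding e_def by (simp add: ext0_const)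
   qed
   let ?V = "%y. mat2 (l * fst y powi a) 0 (d * fst y powi a + t2 * (l * fst y powi (b - 1))) (l * fst y powi b)"
   have V: "lattice_basis R E (0, t) ?V"
   proof (rule lattice_basis_change_ext0[OF nfb])
    show "ext0_mat (%z. mat2 l 0 (e z) l) (mat2 l 0 (e 0) l)"
     using ee by (auto simp: ext0_mat_def forall_2 intro!: ext0_const)
    show "det (mat2 l 0 (e 0) l) ~= 0" using l by (simp add: det_2)
    fix z :: complex assume z: "z ~= 0"
    have "d * z powi a + t2 * (l * z powi (b - 1)) = h * z powi (b - 1) * l + z powi b * e z"
    proof (cases "b <= a")
     case True
     have "z powi b * z powi (a - b) = z powi a" using power_int_add[OF disjI1[OF z], of b "a - b"] by simp
     then show ?thesis using True by (simp add: t2_def e_def algebra_simps)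
    next
     case False
     then show ?thesis using ba' l by (simp add: t2_def e_def field_simps)
    qed
    then show "mat2 (l * fst (z, t) powi a) 0 (d * fst (z, t) powi a + t2 * (l * fst (z, t) powi (b - 1))) (l * fst (z, t) powi b) =
      nf_mat a b h (fst (z, t)) ** mat2 l 0 (e z) l" by (intro mat2_eqI) (simp_all add: nf_mat_def mult_ac)
   qed
   have c1: "s1 x + t2 *s s2 x = E x *v column 1 (?V x)" if x: "x : punctured R" for x
    unfolding s1[OF x] s2[OF x] b' smult_vec[symmetric] mat_vec_sums(1)[symmetric]
    by (rule arg_cong[where f="%v. E x *v v"]) (simp add: power_vec_def column_def vec_eq_iff forall_2)
   have c2: "fst x *s s2 x = E x *v column 2 (?V x)" if x: "x : punctured R" for x
   proof -
    have z: "fst x ~= 0" using x by auto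
    have "fst x * fst x powi (b - 1) = fst x powi b" using power_int_add[OF disjI1[OF z], of 1 "b - 1"] by simp
    then have "fst x * (l * fst x powi (b - 1)) = l * fst x powi b" by (simp add: mult.left_commute)
    then show ?thesis unfolding s2[OF x] b' smult_vec[symmetric]
     by (intro arg_cong[where f="%v. E x *v v"]) (simp add: power_vec_def column_def vec_eq_iff forall_2)
   qed
   have "stalk_direct_sum R (0, t) (%x. s1 x + t2 *s s2 x) (%x. fst x *s s2 x)"
   proof (rule iffD2[OF stalk_direct_sum_power_vecs[of _ ?V] V])
    show "!!x. x : punctured R ==> s1 x + t2 *s s2 x = E x *v column 1 (?V x)" by (rule c1)
    show "!!x. x : punctured R ==> fst x *s s2 x = E x *v column 2 (?V x)" by (rule c2)
   qed
   moreover have "\<alpha> + of_int a ~= \<alpha> + of_int ?b --> t2 ~= 0"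
   proof
    assume "\<alpha> + of_int a ~= \<alpha> + of_int ?b"
    then have "a ~= b - 1" using b' by auto
    then have "b <= a" using ba by simp
    then show "t2 ~= 0" using nhb by (simp add: t2_def)
   qed
   ultimately show ?thesis using False by (auto simp: origin_R)
  qed
 qed
 show ?thesis unfolding leading_exponents_def using form uniq by blast
qed

end

section \<open>Linear differential equations along a line\<close>

text \<open>
 The function \<open>exp (- 2 K s) |w s|\<^sup>2\<close> decreases.
\<close>

lemma gronwall_norm:
 fixes w :: "real => 'a::real_inner"
 assumes T: "0 <= T" and d: "!!s. 0 <= s ==> s <= T ==> (w has_vector_derivative w' s) (at s)"
  and b: "!!s. 0 <= s ==> s <= T ==> norm (w' s) <= K * norm (w s)"
 shows "norm (w T) <= norm (w 0) * exp (K * T)"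
proof -
 define \<phi> where "\<phi> s = exp (- 2 * K * s) * (w s \<bullet> w s)" for s
 have "\<phi> T <= \<phi> 0"
 proof (rule DERIV_nonpos_imp_nonincreasing[OF T])
  fix s assume s: "0 <= s" "s <= T"
  have "((%s. w s \<bullet> w s) has_derivative (%h. w s \<bullet> (h *\<^sub>R w' s) + (h *\<^sub>R w' s) \<bullet> w s)) (at s)"
   using d[OF s] unfolding has_vector_derivative_def by (intro has_derivative_inner)
  then have "((%s. w s \<bullet> w s) has_real_derivative 2 * (w s \<bullet> w' s)) (at s)"
   by (rule has_derivative_imp_has_field_derivative) (simp add: inner_commute)
  moreover have "((%s. exp (- 2 * K * s)) has_real_derivative - 2 * K * exp (- 2 * K * s)) (at s)"
   by (auto intro!: derivative_eq_intros)
  ultimately have D: "(\<phi> has_real_derivative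
    (- 2 * K * exp (- 2 * K * s)) * (w s \<bullet> w s) + 2 * (w s \<bullet> w' s) * exp (- 2 * K * s)) (at s)"
   unfolding \<phi>_def using DERIV_mult by blast
  have "w s \<bullet> w' s <= norm (w s) * norm (w' s)" by (rule norm_cauchy_schwarz)
  also have "\<dots> <= norm (w s) * (K * norm (w s))" using b[OF s] by (intro mult_left_mono) auto
  also have "\<dots> = K * (w s \<bullet> w s)" by (simp add: dot_square_norm power2_eq_square)
  finally have "exp (- 2 * K * s) * (w s \<bullet> w' s) <= exp (- 2 * K * s) * (K * (w s \<bullet> w s))"
   by (intro mult_left_mono) auto
  then have "(- 2 * K * exp (- 2 * K * s)) * (w s \<bullet> w s) + 2 * (w s \<bullet> w' s) * exp (- 2 * K * s) <= 0"
   by (simp add: algebra_simps)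
  then show "EX y. (\<phi> has_real_derivative y) (at s) & y <= 0" using D by blast
 qed
 then have "exp (- 2 * K * T) * (norm (w T))\<^sup>2 <= (norm (w 0))\<^sup>2"
  by (simp add: \<phi>_def dot_square_norm)
 then have "exp (2 * K * T) * (exp (- 2 * K * T) * (norm (w T))\<^sup>2) <= exp (2 * K * T) * (norm (w 0))\<^sup>2"
  by (intro mult_left_mono) auto
 moreover have "exp (2 * K * T) * (exp (- 2 * K * T) * (norm (w T))\<^sup>2) = (norm (w T))\<^sup>2"
  unfolding mult.assoc[symmetric] exp_add[symmetric] by simp
 moreover have "exp (2 * K * T) * (norm (w 0))\<^sup>2 = (norm (w 0) * exp (K * T))\<^sup>2"
 proof -
  have "exp (2 * K * T) = exp (K * T) * exp (K * T)" unfolding exp_add[symmetric] by (rule arg_cong[where f=exp]) simp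
  then show ?thesis by (simp only: power2_eq_square mult_ac)
 qed
 ultimately have "(norm (w T))\<^sup>2 <= (norm (w 0) * exp (K * T))\<^sup>2" by linarith
 then show ?thesis by (rule power2_le_imp_le) auto
qed

section \<open>Independence of flat sections\<close>

text \<open>
 The connection is defined by a chosen chart; the gluing conditions give the same formula in every chart.
\<close>

lemma nabla_chart:
 assumes te: "te_structure P" and W: "rel_open (base P) W" "W \<subseteq> punctured P" and \<sigma>: "holsec_on P \<sigma> W"
  and c: "c : atlas P" and x: "x : W" "x : chart_dom c"
 shows "dz_vec (%y. triv c y *v \<sigma> y) x + omega_z c x *v (triv c x *v \<sigma> x) = triv c x *v nabla_z P \<sigma> x"
  and "snd x : interior (base P) ==>
    dt_vec (%y. triv c y *v \<sigma> y) x + omega_t c x *v (triv c x *v \<sigma> x) = triv c x *v nabla_t P \<sigma> x"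
proof -
 note D = te_structureD[OF te]
 define c0 where "c0 = chart_at P x"
 have x0: "fst x ~= 0" "x : total_base P" using x W(2) by auto
 have c0: "c0 : atlas P" "x : chart_dom c0" using chart_at[OF te x0(2)] by (auto simp: c0_def)
 let ?u = "%y. triv c0 y *v \<sigma> y" and ?T = "transition c0 c"
 have ro: "rel_open (base P) (W Int chart_dom c0)" "rel_open (base P) (chart_dom c0 Int chart_dom c)"
  by (intro rel_open_Int W D c c0)+
 have tu: "triv c y *v \<sigma> y = ?T y *v ?u y" if "y : chart_dom c0" for y
  using transition_triv[OF te c0(1) that, of c] by (simp only: matrix_vector_mul_assoc)
 have h: "hol2_vec_on ?u (W Int chart_dom c0)" "hol2_mat_on ?T (chart_dom c0 Int chart_dom c)"
  using \<sigma> c0 D(9)[OF c0(1) c] by (auto simp: holsec_on_def)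
 have inv0: "invertible (triv c0 x)" using D(5)[OF c0] .
 {
  have zu: "zdiff (%y. ?u y $ i) x" for i by (rule hol2_on_zdiff[OF hol2_vec_onD[OF h(1)] ro(1)]) (use x c0 in auto)
  have zT: "zdiff (%y. ?T y $ i $ j) x" for i j
   by (rule hol2_on_zdiff[OF hol2_mat_onD[OF h(2)] ro(2)]) (use x c0 in auto)
  have z0: "dz_vec ?u x + omega_z c0 x *v ?u x = triv c0 x *v nabla_z P \<sigma> x"
   unfolding nabla_z_def Let_def c0_def[symmetric] using inv_cancel(6)[OF inv0] by simp
  have "dz_vec (%y. triv c y *v \<sigma> y) x = dz_vec (%y. ?T y *v ?u y) x"
  proof (rule dz_vec_cong)
   show "\<forall>\<^sub>F w in nhds (fst x). triv c (w, snd x) *v \<sigma> (w, snd x) = ?T (w, snd x) *v ?u (w, snd x)"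
    using rel_open_ev_fst[OF D(4)[OF c0(1)] c0(2)] by eventually_elim (rule tu)
  qed
  also have "\<dots> = dz_mat ?T x *v ?u x + ?T x *v dz_vec ?u x" by (rule dz_vec_mult[OF zT zu])
  finally have "dz_vec (%y. triv c y *v \<sigma> y) x + omega_z c x *v (triv c x *v \<sigma> x) =
    (dz_mat ?T x + omega_z c x ** ?T x) *v ?u x + ?T x *v dz_vec ?u x"
   unfolding tu[OF c0(2)] by (simp only: mat_vec_sums mat_mult_sums matrix_vector_mul_assoc matrix_mul_assoc add_ac)
  also have "dz_mat ?T x + omega_z c x ** ?T x = ?T x ** omega_z c0 x"
   by (rule D(10)[OF c0(1) c]) (use c0 x x0 in auto)
  also have "(?T x ** omega_z c0 x) *v ?u x + ?T x *v dz_vec ?u x = ?T x *v (dz_vec ?u x + omega_z c0 x *v ?u x)"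
   by (simp only: mat_vec_sums matrix_vector_mul_assoc matrix_mul_assoc add_ac)
  finally show "dz_vec (%y. triv c y *v \<sigma> y) x + omega_z c x *v (triv c x *v \<sigma> x) = triv c x *v nabla_z P \<sigma> x"
   by (simp only: z0 matrix_vector_mul_assoc[of "transition c0 c x" "triv c0 x" "nabla_z P \<sigma> x"] transition_triv[OF te c0])
 next
  assume xi: "snd x : interior (base P)"
  have zu: "tdiff (%y. ?u y $ i) x" for i
   by (rule hol2_on_tdiff[OF hol2_vec_onD[OF h(1)] ro(1) _ xi]) (use x c0 in auto)
  have zT: "tdiff (%y. ?T y $ i $ j) x" for i j
   by (rule hol2_on_tdiff[OF hol2_mat_onD[OF h(2)] ro(2) _ xi]) (use x c0 in auto)
  have z0: "dt_vec ?u x + omega_t c0 x *v ?u x = triv c0 x *v nabla_t P \<sigma> x"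
   unfolding nabla_t_def Let_def c0_def[symmetric] using inv_cancel(6)[OF inv0] by simp
  have "dt_vec (%y. triv c y *v \<sigma> y) x = dt_vec (%y. ?T y *v ?u y) x"
  proof (rule dt_vec_cong)
   show "\<forall>\<^sub>F w in nhds (snd x). triv c (fst x, w) *v \<sigma> (fst x, w) = ?T (fst x, w) *v ?u (fst x, w)"
    using rel_open_ev_snd[OF D(4)[OF c0(1)] c0(2) xi] by eventually_elim (rule tu)
  qed
  also have "\<dots> = dt_mat ?T x *v ?u x + ?T x *v dt_vec ?u x" by (rule dt_vec_mult[OF zT zu])
  finally have "dt_vec (%y. triv c y *v \<sigma> y) x + omega_t c x *v (triv c x *v \<sigma> x) =
    (dt_mat ?T x + omega_t c x ** ?T x) *v ?u x + ?T x *v dt_vec ?u x"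
   unfolding tu[OF c0(2)] by (simp only: mat_vec_sums mat_mult_sums matrix_vector_mul_assoc matrix_mul_assoc add_ac)
  also have "dt_mat ?T x + omega_t c x ** ?T x = ?T x ** omega_t c0 x"
   by (rule D(11)[OF c0(1) c _ _ xi]) (use c0 x x0 in auto)
  also have "(?T x ** omega_t c0 x) *v ?u x + ?T x *v dt_vec ?u x = ?T x *v (dt_vec ?u x + omega_t c0 x *v ?u x)"
   by (simp only: mat_vec_sums matrix_vector_mul_assoc matrix_mul_assoc add_ac)
  finally show "dt_vec (%y. triv c y *v \<sigma> y) x + omega_t c x *v (triv c x *v \<sigma> x) = triv c x *v nabla_t P \<sigma> x"
   by (simp only: z0 matrix_vector_mul_assoc[of "transition c0 c x" "triv c0 x" "nabla_t P \<sigma> x"] transition_triv[OF te c0])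
 }
qed

definition branch :: "complex => (pt => complex^2) => pt => complex^2" where
 "branch c S x = S (local_log c (fst x), snd x)"

text \<open>Flatness of all branches, expressed in every chart.  In this form it is visibly a linear condition.\<close>

definition chart_flat :: "te => (pt => complex^2) => bool" where
 "chart_flat P S \<longleftrightarrow> (ALL \<zeta>. ALL c:atlas P.
   hol2_vec_on (%x. triv c x *v branch \<zeta> S x) (exp ` strip \<zeta> \<times> base P Int chart_dom c) &
   (ALL x:exp ` strip \<zeta> \<times> base P Int chart_dom c.
    dz_vec (%y. triv c y *v branch \<zeta> S y) x + omega_z c x *v (triv c x *v branch \<zeta> S x) = 0 &
    (snd x : interior (base P) -->
      dt_vec (%y. triv c y *v branch \<zeta> S y) x + omega_t c x *v (triv c x *v branch \<zeta> S x) = 0)))"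

lemma rel_open_strip: "rel_open B (exp ` strip \<zeta> \<times> B)"
proof -
 have "exp ` strip \<zeta> \<times> B = (UNIV \<times> B) Int (exp ` strip \<zeta> \<times> UNIV)" by auto
 moreover have "open (exp ` strip \<zeta> \<times> (UNIV :: complex set))"
  by (intro open_Times exp_image_open strip_open exp_strip_inj open_UNIV)
 ultimately show ?thesis by (simp only: openin_open_Int)
qed

lemma flat_imp_chart_flat:
 assumes te: "te_structure P" and S: "flat_multivalued P S"
 shows "chart_flat P S" unfolding chart_flat_def
proof (intro allI ballI)
 fix \<zeta> c assume c: "c : atlas P"
 let ?W = "exp ` strip \<zeta> \<times> base P"
 note br = flat_multivalued_branch[OF te S, where c=\<zeta>, folded branch_def]
 have "(%x. S (local_log \<zeta> (fst x), snd x)) = branch \<zeta> S" by (simp add: fun_eq_iff branch_def)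
 note br = br[unfolded this]
 have "hol2_vec_on (%x. triv c x *v branch \<zeta> S x) (?W Int chart_dom c)"
  using br(3) c by (simp add: holsec_on_def)
 moreover have "dz_vec (%y. triv c y *v branch \<zeta> S y) x + omega_z c x *v (triv c x *v branch \<zeta> S x) = 0 &
    (snd x : interior (base P) -->
      dt_vec (%y. triv c y *v branch \<zeta> S y) x + omega_t c x *v (triv c x *v branch \<zeta> S x) = 0)"
  if x: "x : ?W Int chart_dom c" for x
  using nabla_chart[OF te br(1,2,3) c, of x] br(4)[of x] br(5)[of x] x mat_vec_sums(4)[of "triv c x"] by auto
 ultimately show "hol2_vec_on (%x. triv c x *v branch \<zeta> S x) (?W Int chart_dom c) &
   (ALL x:?W Int chart_dom c.
    dz_vec (%y. triv c y *v branch \<zeta> S y) x + omega_z c x *v (triv c x *v branch \<zeta> S x) = 0 &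
    (snd x : interior (base P) -->
      dt_vec (%y. triv c y *v branch \<zeta> S y) x + omega_t c x *v (triv c x *v branch \<zeta> S x) = 0))" by blast
qed

lemma matrix_const_vec: "triv c x *v (colmat u v *v k) = colmat (triv c x *v u) (triv c x *v v) *v k"
 by (simp only: matrix_vector_mul_assoc colmat_mult)

lemma chart_flat_matrix:
 assumes te: "te_structure P" and S: "chart_flat P S1" "chart_flat P S2" and c: "c : atlas P"
 defines "G \<equiv> %\<zeta> x. colmat (triv c x *v branch \<zeta> S1 x) (triv c x *v branch \<zeta> S2 x)"
 shows "hol2_mat_on (G \<zeta>) (exp ` strip \<zeta> \<times> base P Int chart_dom c)"
  and "x : exp ` strip \<zeta> \<times> base P Int chart_dom c ==> dz_mat (G \<zeta>) x = - (omega_z c x ** G \<zeta> x)"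
  and "x : exp ` strip \<zeta> \<times> base P Int chart_dom c ==> snd x : interior (base P) ==>
    dt_mat (G \<zeta>) x = - (omega_t c x ** G \<zeta> x)"
proof -
 note F = S[unfolded chart_flat_def, rule_format, OF c]
 show "hol2_mat_on (G \<zeta>) (exp ` strip \<zeta> \<times> base P Int chart_dom c)"
  unfolding G_def by (intro hol2_mat_on_colmat) (use F in blast)+
 have neg: "(a::complex^2) = - b" if "a + b = 0" for a b using that by (simp add: eq_neg_iff_add_eq_0)
 have cz: "dz_mat (%y. colmat (u y) (v y)) x = colmat (dz_vec u x) (dz_vec v x)"
  and ct: "dt_mat (%y. colmat (u y) (v y)) x = colmat (dt_vec u x) (dt_vec v x)" for u v x
  by (simp_all add: vec_eq_iff forall_2 dz_mat_def dz_vec_def dt_mat_def dt_vec_def colmat_def)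
 have cm: "colmat (- u) (- v) = - colmat u v" for u v by (simp add: vec_eq_iff forall_2 colmat_def)
 {
  assume x: "x : exp ` strip \<zeta> \<times> base P Int chart_dom c"
  have "dz_vec (%y. triv c y *v branch \<zeta> S1 y) x = - (omega_z c x *v (triv c x *v branch \<zeta> S1 x))"
   "dz_vec (%y. triv c y *v branch \<zeta> S2 y) x = - (omega_z c x *v (triv c x *v branch \<zeta> S2 x))"
   using F x by (blast intro: neg)+
  then show "dz_mat (G \<zeta>) x = - (omega_z c x ** G \<zeta> x)" unfolding G_def cz by (simp only: cm colmat_mult)
 next
  assume x: "x : exp ` strip \<zeta> \<times> base P Int chart_dom c" and xi: "snd x : interior (base P)"
  have "dt_vec (%y. triv c y *v branch \<zeta> S1 y) x = - (omega_t c x *v (triv c x *v branch \<zeta> S1 x))"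
   "dt_vec (%y. triv c y *v branch \<zeta> S2 y) x = - (omega_t c x *v (triv c x *v branch \<zeta> S2 x))"
   using F x xi by (blast intro: neg)+
  then show "dt_mat (G \<zeta>) x = - (omega_t c x ** G \<zeta> x)" unfolding G_def ct by (simp only: cm colmat_mult)
 }
qed

lemma norm_matrix_vec_component:
 fixes A :: "complex^2^2"
 assumes "!!i j. norm (A $ i $ j) <= B" "norm (v $ 1) <= m" "norm (v $ 2) <= m" "m >= 0"
 shows "norm ((A *v v) $ i) <= 2 * B * m"
proof -
 have B: "B >= 0" using assms(1)[of 1 1] norm_ge_zero order.trans by blast
 have "norm ((A *v v) $ i) <= norm (A $ i $ 1) * norm (v $ 1) + norm (A $ i $ 2) * norm (v $ 2)"
  unfolding matrix_vec2 by (rule norm_triangle_le) (simp add: norm_mult)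
 also have "\<dots> <= B * m + B * m" using assms B by (intro add_mono mult_mono) auto
 finally show ?thesis by simp
qed

lemma continuous_bounded_near:
 fixes f :: "pt => complex"
 assumes "open W" "continuous_on W f" "x : W"
 shows "EX B. \<forall>\<^sub>F y in nhds x. norm (f y) <= B"
proof -
 have "isCont f x" using assms by (simp add: continuous_on_eq_continuous_at)
 then have "\<forall>\<^sub>F y in nhds x. norm (f y - f x) < 1"
  unfolding continuous_at_eps_delta eventually_nhds_metric dist_norm by (metis zero_less_one)
 then have "\<forall>\<^sub>F y in nhds x. norm (f y) <= norm (f x) + 1"
 proof eventually_elim
  case (elim y)
  then show ?case using norm_triangle_ineq2[of "f y" "f x"] by linarith
 qed
 then show ?thesis by blast
qed

lemma continuous_mat_bounded_near:
 fixes A :: "pt => complex^2^2"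
 assumes "open W" "hol2_mat_on A W" "x : W"
 shows "EX B. \<forall>\<^sub>F y in nhds x. ALL i j. norm (A y $ i $ j) <= B"
proof -
 have "EX B. \<forall>\<^sub>F y in nhds x. norm (A y $ i $ j) <= B" for i j
  by (rule continuous_bounded_near[OF assms(1) _ assms(3)])
    (intro hol2_on_imp_continuous_on hol2_mat_onD assms)
 then obtain B where B: "!!i j. \<forall>\<^sub>F y in nhds x. norm (A y $ i $ j) <= B i j" by metis
 have "\<forall>\<^sub>F y in nhds x. ALL i j. norm (A y $ i $ j) <= B i j"
  unfolding forall_2 by (intro eventually_conj B)
 then have "\<forall>\<^sub>F y in nhds x. ALL i j. norm (A y $ i $ j) <= (\<Sum>p\<in>UNIV. \<bar>B (fst p) (snd p)\<bar>)"
 proof eventually_elim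
  case (elim y)
  show ?case
  proof (intro allI)
   fix i j
   have "norm (A y $ i $ j) <= \<bar>B (fst (i, j)) (snd (i, j))\<bar>" using elim by (simp add: abs_le_iff) (metis abs_ge_self order.trans)
   also have "\<dots> <= (\<Sum>p\<in>UNIV. \<bar>B (fst p) (snd p)\<bar>)" by (rule member_le_sum) auto
   finally show "norm (A y $ i $ j) <= (\<Sum>p\<in>UNIV. \<bar>B (fst p) (snd p)\<bar>)" .
  qed
 qed
 then show ?thesis by blast
qed

lemma line_derivative:
 fixes h :: "pt => complex"
 assumes h: "hol2_on h W" "open W" and y: "p + of_real s * v : fst ` {y\<in>W. snd y = q + of_real s * w}"
 shows "((%s. h (p + of_real s * v, q + of_real s * w)) has_vector_derivative
   (deriv (%z. h (z, q + of_real s * w)) (p + of_real s * v) * v + deriv (%t. h (p + of_real s * v, t)) (q + of_real s * w) * w)) (at s)"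
proof -
 let ?x = "(p + of_real s * v, q + of_real s * w)"
 have x: "?x : W" using y by force
 then obtain a b where D: "(h has_derivative (%v. a * fst v + b * snd v)) (at ?x within W)"
  using h(1) unfolding hol2_on_def by blast
 obtain A B where AB: "open A" "open B" "?x : A \<times> B" "A \<times> B \<subseteq> W" using open_prod_elim[OF h(2) x] by metis
 have a: "deriv (%z. h (z, q + of_real s * w)) (p + of_real s * v) = a"
  by (rule DERIV_imp_deriv, rule has_derivative_slice_fst[OF D AB(1)]) (use AB in auto)
 have b: "deriv (%t. h (p + of_real s * v, t)) (q + of_real s * w) = b"
  by (rule DERIV_imp_deriv, rule has_derivative_slice_snd[OF D AB(2)]) (use AB in auto)
 have "at ?x within W = at ?x" by (rule at_within_open[OF x h(2)])
 then have D': "(h has_derivative (%v. a * fst v + b * snd v)) (at ?x)" using D by simp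
 have l: "((%s. (p + of_real s * v, q + of_real s * w)) has_derivative (%k. (of_real k * v, of_real k * w))) (at s)"
  by (auto intro!: derivative_eq_intros)
 have "((%s. h (p + of_real s * v, q + of_real s * w)) has_derivative (%k. a * (of_real k * v) + b * (of_real k * w))) (at s)"
  using has_derivative_compose[OF l D'] by simp
 then show ?thesis unfolding has_vector_derivative_def a b by (simp add: scaleR_conv_of_real algebra_simps)
qed

lemma chart_flat_zero_locally:
 assumes te: "te_structure P" and op: "open (base P)" and S: "chart_flat P S"
  and y: "y : total_base P"
 shows "EX V. open V & y : V & (ALL y1:V Int total_base P. ALL y2:V Int total_base P. S y1 = 0 --> S y2 = 0)"
proof -
 note D = te_structureD[OF te]
 define \<zeta> where "\<zeta> = fst y"
 define x where "x = covering y"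
 have xt: "x : total_base P" using y by (auto simp: x_def covering_def)
 obtain c where c: "c : atlas P" "x : chart_dom c" using D(3)[OF xt] by blast
 define W where "W = exp ` strip \<zeta> \<times> base P Int chart_dom c"
 have "rel_open (base P) W" unfolding W_def by (intro rel_open_Int rel_open_strip D c)
 moreover have "open (UNIV \<times> base P)" using op by (intro open_Times) auto
 ultimately have oW: "open W" using openin_open_eq by blast
 have xW: "x : W" using c y strip_centre[of \<zeta>] by (auto simp: W_def x_def covering_def \<zeta>_def)
 define u where "u x = triv c x *v branch \<zeta> S x" for x
 have u: "hol2_vec_on u W" and uz: "!!x. x : W ==> dz_vec u x + omega_z c x *v u x = 0"
  and ut: "!!x. x : W ==> dt_vec u x + omega_t c x *v u x = 0"
  using S c(1) op unfolding chart_flat_def W_def u_def by (auto simp: interior_open)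
 have W0: "fst x ~= 0" if "x : W" for x using that by (auto simp: W_def)
 have oz: "hol2_mat_on (omega_z c) W" "hol2_mat_on (omega_t c) W"
 proof -
  have "W \<subseteq> chart_dom c" by (auto simp: W_def)
  note p = hol2_mat_onD[OF hol2_mat_on_subset[OF D(7)[OF c(1)] this]]
   hol2_mat_onD[OF hol2_mat_on_subset[OF D(8)[OF c(1)] this]]
  show "hol2_mat_on (omega_z c) W" "hol2_mat_on (omega_t c) W"
   unfolding hol2_mat_on_def omega_z_def omega_t_def vec_lambda_beta
   by (intro allI hol2_on_divide hol2_on_power hol2_on_fst p; use W0 in simp)+
 qed
 obtain Bz where Bz: "\<forall>\<^sub>F y in nhds x. ALL i j. norm (omega_z c y $ i $ j) <= Bz"
  using continuous_mat_bounded_near[OF oW oz(1) xW] by blast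
 obtain Bt where Bt: "\<forall>\<^sub>F y in nhds x. ALL i j. norm (omega_t c y $ i $ j) <= Bt"
  using continuous_mat_bounded_near[OF oW oz(2) xW] by blast
 have "\<forall>\<^sub>F y in nhds x. y : W" by (rule eventually_nhds_in_open[OF oW xW])
 then have "\<forall>\<^sub>F y in nhds x. y : W & (ALL i j. norm (omega_z c y $ i $ j) <= Bz) & (ALL i j. norm (omega_t c y $ i $ j) <= Bt)"
  by (intro eventually_conj Bz Bt)
 then obtain r where r: "r > 0" and rB: "!!y. dist y x < r ==> y : W"
  "!!y i j. dist y x < r ==> norm (omega_z c y $ i $ j) <= Bz" "!!y i j. dist y x < r ==> norm (omega_t c y $ i $ j) <= Bt"
  unfolding eventually_nhds_metric by blast
 have key: "u x2 = 0" if x1: "x1 : ball x r" and x2: "x2 : ball x r" and u1: "u x1 = 0" for x1 x2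
 proof -
  obtain p q where pq: "x1 = (p, q)" by force
  obtain p' q' where pq': "x2 = (p', q')" by force
  define v where "v = p' - p"
  define w where "w = q' - q"
  define X where "X s = (p + complex_of_real s * v, q + complex_of_real s * w)" for s
  have Xb: "X s : ball x r" if s: "0 <= s" "s <= 1" for s
  proof -
   have "X s = (1 - s) *\<^sub>R x1 + s *\<^sub>R x2"
    by (simp add: X_def pq pq' v_def w_def scaleR_conv_of_real algebra_simps)
   then show ?thesis using convexD[OF convex_ball x1 x2, of "1 - s" s] s by simp
  qed
  have XW: "X s : W" if "0 <= s" "s <= 1" for s using rB(1)[of "X s"] Xb[OF that] by (simp add: dist_commute)
  define \<omega> where "\<omega> s = (u (X s) $ 1, u (X s) $ 2)" for s
  define d where "d s = - (v *s (omega_z c (X s) *v u (X s)) + w *s (omega_t c (X s) *v u (X s)))" for s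
  have der: "((%s. u (X s) $ i) has_vector_derivative d s $ i) (at s)" if s: "0 <= s" "s <= 1" for i s
  proof -
   have "p + of_real s * v : fst ` {y\<in>W. snd y = q + of_real s * w}" using XW[OF s] by (force simp: X_def)
   from line_derivative[OF hol2_vec_onD[OF u] oW this, of i]
   have "((%s. u (X s) $ i) has_vector_derivative dz_vec u (X s) $ i * v + dt_vec u (X s) $ i * w) (at s)"
    by (simp add: X_def dz_vec_def dt_vec_def)
   moreover have "dz_vec u (X s) = - (omega_z c (X s) *v u (X s))" "dt_vec u (X s) = - (omega_t c (X s) *v u (X s))"
    using uz[OF XW[OF s]] ut[OF XW[OF s]] by (simp_all add: eq_neg_iff_add_eq_0)
   ultimately show ?thesis by (simp add: d_def algebra_simps)
  qed
  define K where "K = 2 * (norm v * (2 * Bz) + norm w * (2 * Bt))"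
  have "norm (\<omega> 1) <= norm (\<omega> 0) * exp (K * 1)"
  proof (rule gronwall_norm)
   fix s :: real assume s: "0 <= s" "s <= 1"
   show "(\<omega> has_vector_derivative (d s $ 1, d s $ 2)) (at s)"
    unfolding \<omega>_def by (intro has_vector_derivative_Pair der s)
   have m: "norm (u (X s) $ 1) <= norm (\<omega> s)" "norm (u (X s) $ 2) <= norm (\<omega> s)"
    unfolding \<omega>_def using norm_fst_le[of "u (X s) $ 1" "u (X s) $ 2"] norm_snd_le[of "u (X s) $ 2" "u (X s) $ 1"] by auto
   have dX: "dist (X s) x < r" using Xb[OF s] by (simp add: dist_commute)
   have di: "norm (d s $ i) <= (norm v * (2 * Bz) + norm w * (2 * Bt)) * norm (\<omega> s)" for i
   proof -
    have "norm (d s $ i) <= norm v * norm ((omega_z c (X s) *v u (X s)) $ i) + norm w * norm ((omega_t c (X s) *v u (X s)) $ i)"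
     unfolding d_def vector_uminus_component norm_minus_cancel vector_add_component vector_smult_component
     by (rule norm_triangle_le) (simp only: norm_mult)
    also have "\<dots> <= norm v * (2 * Bz * norm (\<omega> s)) + norm w * (2 * Bt * norm (\<omega> s))"
     by (intro add_mono mult_left_mono norm_matrix_vec_component m rB(2)[OF dX] rB(3)[OF dX]) auto
    finally show ?thesis by (simp add: algebra_simps)
   qed
   have "norm (d s $ 1, d s $ 2) <= norm (d s $ 1) + norm (d s $ 2)" by (rule norm_Pair_le)
   also have "\<dots> <= K * norm (\<omega> s)" using di[of 1] di[of 2] by (simp add: K_def algebra_simps)
   finally show "norm (d s $ 1, d s $ 2) <= K * norm (\<omega> s)" .
  qed simp
  moreover have "\<omega> 0 = 0" using u1 by (simp add: \<omega>_def X_def pq zero_prod_def)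
  ultimately have "\<omega> 1 = 0" by simp
  moreover have "X 1 = x2" by (simp add: X_def v_def w_def pq')
  ultimately show "u x2 = 0" by (simp add: \<omega>_def zero_prod_def vec_eq_iff forall_2)
 qed
 define V where "V = (strip \<zeta> \<times> UNIV) Int covering -` ball x r"
 have "open V"
  unfolding V_def by (intro open_Int open_Times strip_open open_UNIV open_vimage) (auto simp: covering_def intro!: continuous_intros)
 moreover have "y : V" using r strip_centre[of \<zeta>] by (auto simp: V_def x_def \<zeta>_def mem_Times_iff)
 moreover have "u (covering y') = triv c (covering y') *v S y' & invertible (triv c (covering y')) & covering y' : ball x r" if "y' : V" for y'
 proof (intro conjI)
  have s: "fst y' : strip \<zeta>" and b: "covering y' : ball x r" using that by (auto simp: V_def mem_Times_iff)
  show "u (covering y') = triv c (covering y') *v S y'"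
   by (simp add: u_def branch_def covering_def local_log_exp[OF s])
  show "covering y' : ball x r" by (rule b)
  have "covering y' : W" using rB(1) b by (simp add: dist_commute)
  then show "invertible (triv c (covering y'))" using D(5)[OF c(1)] by (simp add: W_def)
 qed
 note tr = this
 have "ALL y1:V Int total_base P. ALL y2:V Int total_base P. S y1 = 0 --> S y2 = 0"
 proof (intro ballI impI)
  fix y1 y2 assume y1: "y1 : V Int total_base P" and y2: "y2 : V Int total_base P" and "S y1 = 0"
  then have "u (covering y1) = 0" using tr[of y1] by (simp add: mat_vec_sums(4))
  then have "u (covering y2) = 0" using key[of "covering y1" "covering y2"] tr[of y1] tr[of y2] y1 y2 by blast
  then have "triv c (covering y2) *v S y2 = triv c (covering y2) *v 0" using tr[of y2] y2 by (simp add: mat_vec_sums(4))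
  then show "S y2 = 0" using invertible_cancel_vec[of "triv c (covering y2)"] tr[of y2] y2 by blast
 qed
 ultimately show ?thesis by blast
qed

text \<open>
 Zeros of a flat section form an open and closed subset of the connected covering.
\<close>

lemma chart_flat_zero:
 assumes te: "te_structure P" and op: "open (base P)" and conn: "connected (base P)" and S: "chart_flat P S"
  and y0: "y0 : total_base P" "S y0 = 0" and y: "y : total_base P"
 shows "S y = 0"
proof -
 have oB: "open (total_base P)" using op by (intro open_Times) auto
 have cB: "connected (total_base P)" using conn by (intro connected_Times) auto
 let ?Z = "{y\<in>total_base P. S y = 0}" and ?N = "{y\<in>total_base P. S y ~= 0}"
 obtain V where V: "!!y. y : total_base P ==> open (V y) & y : V y &
   (ALL y1:V y Int total_base P. ALL y2:V y Int total_base P. S y1 = 0 --> S y2 = 0)"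
  using chart_flat_zero_locally[OF te op S] by metis
 have "open ?Z"
 proof (subst open_subopen, intro ballI)
  fix y assume "y : ?Z"
  then show "EX T. open T & y : T & T \<subseteq> ?Z"
   using V[of y] oB by (intro exI[of _ "V y Int total_base P"]) blast
 qed
 moreover have "open ?N"
 proof (subst open_subopen, intro ballI)
  fix y assume "y : ?N"
  then show "EX T. open T & y : T & T \<subseteq> ?N"
   using V[of y] oB by (intro exI[of _ "V y Int total_base P"]) blast
 qed
 moreover have "?Z Int ?N Int total_base P = {}" "total_base P \<subseteq> ?Z \<union> ?N" by auto
 ultimately have "?Z Int total_base P = {} \<or> ?N Int total_base P = {}" using cB unfolding connected_def by blast
 then show ?thesis using y0 y by blast
qed

lemma chart_flat_combination:
 assumes te: "te_structure P" and S: "chart_flat P S1" "chart_flat P S2"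
 shows "chart_flat P (%y. colmat (S1 y) (S2 y) *v k)" unfolding chart_flat_def
proof (intro allI ballI)
 fix \<zeta> c assume c: "c : atlas P"
 let ?W = "exp ` strip \<zeta> \<times> base P Int chart_dom c"
 define G where "G x = colmat (triv c x *v branch \<zeta> S1 x) (triv c x *v branch \<zeta> S2 x)" for x
 note CM = chart_flat_matrix[OF te S c, where \<zeta>=\<zeta>]
 have "(%x. colmat (triv c x *v branch \<zeta> S1 x) (triv c x *v branch \<zeta> S2 x)) = G" by (simp add: fun_eq_iff G_def)
 note CM = CM[unfolded this, folded G_def]
 have rW: "rel_open (base P) ?W" by (intro rel_open_Int rel_open_strip te_structureD(4)[OF te] c)
 have eq: "triv c x *v branch \<zeta> (%y. colmat (S1 y) (S2 y) *v k) x = G x *v k" for x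
  by (simp only: branch_def G_def matrix_const_vec)
 have h: "hol2_vec_on (%x. G x *v k) ?W"
  by (rule hol2_vec_on_mult[OF CM(1)]) (simp add: hol2_vec_on_def hol2_on_const)
 have cancel: "(- (A ** B)) *v k + B *v 0 + A *v (B *v k) = 0" for A B :: "complex^2^2"
  unfolding matrix_vector_mul_assoc mat_vec_sums(4) by (simp add: vec_eq_iff del: matrix_mult2)
 have kz: "zdiff (%y. k $ i) x" "tdiff (%y. k $ i) x" for i x by (simp_all add: zdiff_def tdiff_def)
 have k0: "dz_vec (%y. k) x = 0" "dt_vec (%y. k) x = 0" for x by (simp_all add: dz_vec_def dt_vec_def vec_eq_iff)
 have "dz_vec (%x. G x *v k) x + omega_z c x *v (G x *v k) = 0" if x: "x : ?W" for x
 proof -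
  have "dz_vec (%x. G x *v k) x = dz_mat G x *v k + G x *v dz_vec (%y. k) x"
   by (rule dz_vec_mult[OF hol2_on_zdiff[OF hol2_mat_onD[OF CM(1)] rW x] kz(1)])
  then show ?thesis unfolding CM(2)[OF x] k0 by (simp only: cancel)
 qed
 moreover have "dt_vec (%x. G x *v k) x + omega_t c x *v (G x *v k) = 0" if x: "x : ?W" "snd x : interior (base P)" for x
 proof -
  have "dt_vec (%x. G x *v k) x = dt_mat G x *v k + G x *v dt_vec (%y. k) x"
   by (rule dt_vec_mult[OF hol2_on_tdiff[OF hol2_mat_onD[OF CM(1)] rW x] kz(2)])
  then show ?thesis unfolding CM(3)[OF x] k0 by (simp only: cancel)
 qed
 ultimately show "hol2_vec_on (%x. triv c x *v branch \<zeta> (%y. colmat (S1 y) (S2 y) *v k) x) ?W &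
   (ALL x:?W. dz_vec (%y. triv c y *v branch \<zeta> (%y. colmat (S1 y) (S2 y) *v k) y) x
     + omega_z c x *v (triv c x *v branch \<zeta> (%y. colmat (S1 y) (S2 y) *v k) x) = 0 &
    (snd x : interior (base P) -->
      dt_vec (%y. triv c y *v branch \<zeta> (%y. colmat (S1 y) (S2 y) *v k) y) x
      + omega_t c x *v (triv c x *v branch \<zeta> (%y. colmat (S1 y) (S2 y) *v k) x) = 0))"
  unfolding eq using h by blast
qed

text \<open>
 A flat basis is only required to give unique coefficients; a linear relation at one point would propagate to
 all points and contradict this.
\<close>

lemma flat_basis_independent:
 assumes te: "te_structure P" and op: "open (base P)" and conn: "connected (base P)"
  and B: "flat_basis P S1 S2" and y: "y : total_base P"
 shows "invertible (colmat (S1 y) (S2 y))"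
proof (rule ccontr)
 assume ni: "~ invertible (colmat (S1 y) (S2 y))"
 have f1: "flat_multivalued P S1" using B unfolding flat_basis_def by (elim conjE)
 have f2: "flat_multivalued P S2" using B unfolding flat_basis_def by (elim conjE)
 let ?A = "colmat (S1 y) (S2 y)"
 have d: "?A$1$1 * ?A$2$2 - ?A$1$2 * ?A$2$1 = 0" using ni by (simp add: invertible_det_nz det_2)
 obtain k :: "complex^2" where k: "k ~= 0" "?A *v k = 0"
 proof (cases "?A$1$1 = 0 & ?A$1$2 = 0")
  case True
  show ?thesis
  proof (cases "?A$2$1 = 0 & ?A$2$2 = 0")
   case T2: True
   show ?thesis by (rule that[of "vector [1, 0]"]) (use True T2 in \<open>simp_all add: vec_eq_iff forall_2\<close>)
  next
   case False
   show ?thesis by (rule that[of "vector [- ?A$2$2, ?A$2$1]"]) (use True False in \<open>auto simp: vec_eq_iff forall_2\<close>)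
  qed
 next
  case False
  show ?thesis by (rule that[of "vector [- ?A$1$2, ?A$1$1]"])
    (use False d in \<open>auto simp: vec_eq_iff forall_2 algebra_simps\<close>)
 qed
 let ?S = "%y. colmat (S1 y) (S2 y) *v k"
 have "chart_flat P ?S" by (intro chart_flat_combination te flat_imp_chart_flat f1 f2)
 from chart_flat_zero[OF te op conn this y] k(2) have "?S y' = 0" if "y' : total_base P" for y' using that by blast
 then have z: "k$1 *s S1 y' + k$2 *s S2 y' = 0" if "y' : total_base P" for y' using that by (simp only: colmat_vec)
 define Q where "Q = (%p :: complex \<times> complex. ALL y:total_base P. S1 y = fst p *s S1 y + snd p *s S2 y)"
 have "\<exists>!p. case p of (a, b) => ALL y:total_base P. S1 y = a *s S1 y + b *s S2 y"
  using B f1 unfolding flat_basis_def by (elim conjE allE[of _ S1]) (erule mp)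
 then have "\<exists>!p. Q p" unfolding Q_def case_prod_unfold .
 moreover have "Q (1, 0)" by (simp add: Q_def)
 moreover have "Q (1 + k$1, k$2)"
 proof -
  have "S1 y = (1 + k$1) *s S1 y + k$2 *s S2 y" if "y : total_base P" for y
  proof -
   have "(1 + k$1) *s S1 y + k$2 *s S2 y = S1 y + (k$1 *s S1 y + k$2 *s S2 y)" by (simp add: vec_eq_iff algebra_simps)
   then show ?thesis using z[OF that] by simp
  qed
  then show ?thesis by (simp add: Q_def)
 qed
 ultimately have "(1 + k$1, k$2) = (1, 0)" by blast
 then show False using k(1) by (simp add: vec_eq_iff forall_2)
qed

section \<open>Existence of an adapted frame\<close>

text \<open>
 The inverse of the monodromy in exponential form: \<open>exp (\<alpha> \<zeta>)\<close> cancels the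
 eigenvalue, and the entry with \<open>\<zeta>\<close> cancels the Jordan block.
\<close>

definition frame_twist :: "complex => complex => complex => complex^2^2" where
 "frame_twist \<alpha> \<kappa> \<zeta> = mat2 (exp (\<alpha> * \<zeta>) * \<kappa>) 0 (exp (\<alpha> * \<zeta>) * \<zeta>) (exp (\<alpha> * \<zeta>))"

text \<open>
 Multiplied by the twist, a flat multivalued basis has trivial monodromy and descends to a frame of
 \<open>H'\<close>.
\<close>

theorem adapted_frame_exists:
 assumes te: "te_structure P" and op: "open (base P)" and conn: "connected (base P)"
  and J: "monodromy_jordan_block P \<mu>"
 shows "EX \<alpha> E. adapted_frame P \<alpha> E"
proof -
 note D = te_structureD[OF te]
 obtain S1 S2 where B: "flat_basis P S1 S2"
  and M: "!!y. y : total_base P ==> monodromy S1 y = \<mu> *s S1 y + S2 y"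
   "!!y. y : total_base P ==> monodromy S2 y = \<mu> *s S2 y" using J unfolding monodromy_jordan_block_def by blast
 have f1: "flat_multivalued P S1" using B unfolding flat_basis_def by (elim conjE)
 have f2: "flat_multivalued P S2" using B unfolding flat_basis_def by (elim conjE)
 note F = flat_imp_chart_flat[OF te f1] flat_imp_chart_flat[OF te f2]
 define A where "A y = colmat (S1 y) (S2 y)" for y
 have Ai: "invertible (A y)" if "y : total_base P" for y
  unfolding A_def by (rule flat_basis_independent[OF te op conn B that])
 have MA: "A (fst y + 2 * of_real pi * \<i>, snd y) = A y ** mat2 \<mu> 0 1 \<mu>" if "y : total_base P" for y
  using M[OF that] by (simp add: A_def monodromy_def colmat_def vec_eq_iff forall_2 algebra_simps)
 have \<mu>: "\<mu> ~= 0"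
 proof
  assume "\<mu> = 0"
  obtain t where t: "t : base P" using D(1) by blast
  have "A (0 + 2 * of_real pi * \<i>, t) = A (0, t) ** mat2 0 0 1 0" using MA[of "(0, t)"] t \<open>\<mu> = 0\<close> by simp
  then have "det (A (2 * of_real pi * \<i>, t)) = 0" by (simp add: det_2)
  then show False using Ai[of "(2 * of_real pi * \<i>, t)"] t by (simp add: invertible_det_nz)
 qed
 define \<alpha> where "\<alpha> = - Ln \<mu> / (2 * of_real pi * \<i>)"
 define \<kappa> where "\<kappa> = - 2 * of_real pi * \<i> * \<mu>"
 have e\<mu>: "exp (\<alpha> * (2 * of_real pi * \<i>)) * \<mu> = 1"
 proof -
  have "\<alpha> * (2 * of_real pi * \<i>) = - Ln \<mu>" by (simp add: \<alpha>_def)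
  then show ?thesis using \<mu> by (simp add: exp_minus)
 qed
 define W where "W y = A y ** frame_twist \<alpha> \<kappa> (fst y)" for y
 have W2: "W (\<zeta> + 2 * of_real pi * \<i>, t) = W (\<zeta>, t)" if t: "t : base P" for \<zeta> t
 proof -
  have "exp (\<alpha> * (\<zeta> + 2 * of_real pi * \<i>)) = exp (\<alpha> * \<zeta>) * exp (\<alpha> * (2 * of_real pi * \<i>))"
   by (simp add: exp_add[symmetric] algebra_simps)
  then have e: "\<mu> * exp (\<alpha> * (\<zeta> + 2 * of_real pi * \<i>)) = exp (\<alpha> * \<zeta>)"
   using e\<mu> by (simp add: mult_ac)
  have "mat2 \<mu> 0 1 \<mu> ** frame_twist \<alpha> \<kappa> (\<zeta> + 2 * of_real pi * \<i>) = frame_twist \<alpha> \<kappa> \<zeta>"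
  proof (rule mat2_eqI)
   have "exp (\<alpha> * (\<zeta> + 2 * of_real pi * \<i>)) * \<kappa> + \<mu> * (exp (\<alpha> * (\<zeta> + 2 * of_real pi * \<i>)) * (\<zeta> + 2 * of_real pi * \<i>))
    = (\<mu> * exp (\<alpha> * (\<zeta> + 2 * of_real pi * \<i>))) * \<zeta>"
    by (simp add: \<kappa>_def algebra_simps)
   then show "(mat2 \<mu> 0 1 \<mu> ** frame_twist \<alpha> \<kappa> (\<zeta> + 2 * of_real pi * \<i>)) $ 2 $ 1 = frame_twist \<alpha> \<kappa> \<zeta> $ 2 $ 1"
    unfolding e by (simp add: frame_twist_def)
  qed (use e in \<open>simp_all add: frame_twist_def mult.assoc[symmetric]\<close>)
  then show ?thesis
   using MA[of "(\<zeta>, t)"] t by (simp only: W_def fst_conv snd_conv) (simp only: mem_Times_iff UNIV_I fst_conv snd_conv simp_thms matrix_mul_assoc[symmetric])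
 qed
 have Wn: "W (\<zeta> + of_nat n * (2 * of_real pi * \<i>), t) = W (\<zeta>, t)" if t: "t : base P" for \<zeta> t n
 proof (induction n)
  case (Suc n)
  have "\<zeta> + of_nat (Suc n) * (2 * of_real pi * \<i>) = (\<zeta> + of_nat n * (2 * of_real pi * \<i>)) + 2 * of_real pi * \<i>"
   by (simp add: algebra_simps)
  then show ?case using W2[OF t] Suc by metis
 qed simp
 have Wz: "W (\<zeta>, t) = W (\<zeta>', t)" if t: "t : base P" and e: "exp \<zeta> = exp \<zeta>'" for \<zeta> \<zeta>' t
 proof -
  obtain n :: int where n: "\<zeta> = \<zeta>' + (of_int (2 * n) * pi) * \<i>" using e exp_eq by blast
  show ?thesis
  proof (cases "n >= 0")
   case True
   then have "\<zeta> = \<zeta>' + of_nat (nat n) * (2 * of_real pi * \<i>)" using n by (simp add: of_nat_nat algebra_simps)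
   then show ?thesis using Wn[OF t] by metis
  next
   case False
   then have "\<zeta>' = \<zeta> + of_nat (nat (- n)) * (2 * of_real pi * \<i>)" using n by (simp add: of_nat_nat algebra_simps)
   then show ?thesis using Wn[OF t] by metis
  qed
 qed
 define E where "E x = W (Ln (fst x), snd x)" for x
 have Wi: "invertible (W y)" if "y : total_base P" for y unfolding W_def by (intro invertible_mult Ai that)
    (use \<mu> in \<open>simp add: invertible_det_nz frame_twist_def det_2 \<kappa>_def\<close>)
 have loc: "hol2_mat_on (%x. triv c x ** E x) (exp ` strip \<zeta> \<times> base P Int chart_dom c) &
   (ALL x:exp ` strip \<zeta> \<times> base P Int chart_dom c.
    dz_mat (%x. triv c x ** E x) x + omega_z c x ** (triv c x ** E x) = triv c x ** E x ** jordan_pole \<alpha> (fst x) &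
    (snd x : interior (base P) --> dt_mat (%x. triv c x ** E x) x + omega_t c x ** (triv c x ** E x) = 0))"
  if c: "c : atlas P" for c \<zeta>
 proof -
  let ?W = "exp ` strip \<zeta> \<times> base P Int chart_dom c"
  define G where "G x = colmat (triv c x *v branch \<zeta> S1 x) (triv c x *v branch \<zeta> S2 x)" for x
  note CM = chart_flat_matrix[OF te F c, where \<zeta>=\<zeta>]
  have "(%x. colmat (triv c x *v branch \<zeta> S1 x) (triv c x *v branch \<zeta> S2 x)) = G" by (simp add: fun_eq_iff G_def)
  note CM = CM[unfolded this, folded G_def]
  have rW: "rel_open (base P) ?W" by (intro rel_open_Int rel_open_strip D c)
  define T where "T x = frame_twist \<alpha> \<kappa> (local_log \<zeta> (fst x))" for x :: pt
  have eq: "triv c x ** E x = G x ** T x" if x: "x : ?W" for x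
  proof -
   have t: "snd x : base P" and z: "fst x ~= 0" using x by auto
   have "E x = W (local_log \<zeta> (fst x), snd x)"
    unfolding E_def by (rule Wz[OF t]) (simp add: exp_local_log[OF z] z)
   also have "\<dots> = colmat (branch \<zeta> S1 x) (branch \<zeta> S2 x) ** T x"
    by (simp only: W_def A_def T_def branch_def fst_conv)
   finally show ?thesis by (simp only: G_def colmat_mult[symmetric] matrix_mul_assoc)
  qed
  have ll: "(local_log \<zeta> has_field_derivative 1 / fst x) (at (fst x))" if "x : ?W" for x
   by (rule local_log_deriv) (use that in auto)
  have lh: "hol2_on (%x. f (local_log \<zeta> (fst x))) ?W" if "!!z. f field_differentiable at z" for f
  proof (rule hol2_on_compose[OF hol2_on_fst, of _ "%z. f (local_log \<zeta> z)"])
   fix x assume "x : ?W"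
   have "local_log \<zeta> field_differentiable at (fst x)"
    unfolding field_differentiable_def by (rule exI, rule ll) fact
   then show "(%z. f (local_log \<zeta> z)) field_differentiable at (fst x)"
    using field_differentiable_compose[OF _ that, of "local_log \<zeta>" "fst x"] by (simp add: o_def)
  qed
  have Th: "hol2_mat_on T ?W" unfolding T_def frame_twist_def
   by (intro hol2_mat_on_mat2 hol2_on_const lh[of "%w. exp (\<alpha> * w) * \<kappa>"] lh[of "%w. exp (\<alpha> * w) * w"] lh[of "%w. exp (\<alpha> * w)"])
     (auto simp: field_differentiable_def intro!: exI derivative_eq_intros)
  have h: "hol2_mat_on (%x. triv c x ** E x) ?W"
   by (rule hol2_mat_on_cong[OF eq, THEN iffD2, OF _ hol2_mat_on_mult[OF CM(1) Th]])
  have dT: "dz_mat T x = T x ** jordan_pole \<alpha> (fst x)" if x: "x : ?W" for x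
  proof -
   have z: "fst x ~= 0" using x by auto
   have e1: "((%w. exp (\<alpha> * local_log \<zeta> w)) has_field_derivative exp (\<alpha> * local_log \<zeta> (fst x)) * (\<alpha> / fst x)) (at (fst x))"
    by (rule derivative_eq_intros ll[OF x] refl)+ simp
   have e2: "((%w. exp (\<alpha> * local_log \<zeta> w) * \<kappa>) has_field_derivative exp (\<alpha> * local_log \<zeta> (fst x)) * (\<alpha> / fst x) * \<kappa>) (at (fst x))"
    by (rule DERIV_cmult_right[OF e1])
   have e3: "((%w. exp (\<alpha> * local_log \<zeta> w) * local_log \<zeta> w) has_field_derivative
     exp (\<alpha> * local_log \<zeta> (fst x)) * (\<alpha> / fst x) * local_log \<zeta> (fst x) + 1 / fst x * exp (\<alpha> * local_log \<zeta> (fst x))) (at (fst x))"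
    by (rule DERIV_mult[OF e1 ll[OF x]])
   show ?thesis unfolding dz_mat_def T_def frame_twist_def fst_conv snd_conv
    by (rule mat2_eqI; simp only: vec_lambda_beta mat2_nth)
     (simp_all only: DERIV_imp_deriv[OF e1] DERIV_imp_deriv[OF e2] DERIV_imp_deriv[OF e3] deriv_const,
      simp_all add: jordan_pole_def algebra_simps)
  qed
  have tT: "dt_mat T x = 0" for x by (simp add: dt_mat_def T_def vec_eq_iff)
  have zG: "dz_mat (%x. triv c x ** E x) x + omega_z c x ** (triv c x ** E x) = triv c x ** E x ** jordan_pole \<alpha> (fst x)"
   if x: "x : ?W" for x
  proof -
   have "dz_mat (%x. triv c x ** E x) x = dz_mat (%x. G x ** T x) x"
    by (rule dz_mat_cong) (rule eventually_mono[OF rel_open_ev_fst[OF rW x]], rule eq)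
   also have "\<dots> = dz_mat G x ** T x + G x ** dz_mat T x"
    by (rule dz_mat_mult[OF hol2_on_zdiff[OF hol2_mat_onD[OF CM(1)] rW x] hol2_on_zdiff[OF hol2_mat_onD[OF Th] rW x]])
   finally show ?thesis unfolding CM(2)[OF x] dT[OF x] eq[OF x] by (simp add: mat_mult_sums matrix_mul_assoc)
  qed
  have tG: "dt_mat (%x. triv c x ** E x) x + omega_t c x ** (triv c x ** E x) = 0"
   if x: "x : ?W" and xi: "snd x : interior (base P)" for x
  proof -
   have "dt_mat (%x. triv c x ** E x) x = dt_mat (%x. G x ** T x) x"
    by (rule dt_mat_cong) (rule eventually_mono[OF rel_open_ev_snd[OF rW x xi]], rule eq)
   also have "\<dots> = dt_mat G x ** T x + G x ** dt_mat T x"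
    by (rule dt_mat_mult[OF hol2_on_tdiff[OF hol2_mat_onD[OF CM(1)] rW x xi] hol2_on_tdiff[OF hol2_mat_onD[OF Th] rW x xi]])
   finally show ?thesis unfolding CM(3)[OF x xi] tT eq[OF x] by (simp add: mat_mult_sums matrix_mul_assoc)
  qed
  show ?thesis using h zG tG by blast
 qed
 have instrip: "x : exp ` strip (Ln (fst x)) \<times> base P" if "x : punctured P" for x
  using that strip_centre[of "Ln (fst x)"] by (auto simp: mem_Times_iff image_iff intro!: bexI[of _ "Ln (fst x)"])
 have "adapted_frame P \<alpha> E" unfolding adapted_frame_def
 proof (intro conjI ballI)
  show "te_structure P" by (rule te)
  show "invertible (E x)" if "x : punctured P" for x unfolding E_def using that by (intro Wi) auto
  fix c assume c: "c : atlas P"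
  show "hol2_mat_on (%x. triv c x ** E x) (chart_dom c Int punctured P)"
  proof (rule hol2_mat_on_local)
   fix x assume x: "x : chart_dom c Int punctured P"
   let ?V = "exp ` strip (Ln (fst x)) \<times> (UNIV :: complex set)"
   have "open ?V" by (intro open_Times exp_image_open strip_open exp_strip_inj open_UNIV)
   moreover have "x : ?V" using instrip x by (auto simp: mem_Times_iff)
   moreover have "hol2_mat_on (%x. triv c x ** E x) (chart_dom c Int punctured P Int ?V)"
    by (rule hol2_mat_on_subset[OF conjunct1[OF loc[OF c, of "Ln (fst x)"]]]) auto
   ultimately show "EX V. open V & x : V & hol2_mat_on (%x. triv c x ** E x) (chart_dom c Int punctured P Int V)" by blast
  qed
  fix x assume x: "x : chart_dom c Int punctured P"
  then have xs: "x : exp ` strip (Ln (fst x)) \<times> base P Int chart_dom c" using instrip by blast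
  show "dz_mat (%x. triv c x ** E x) x + omega_z c x ** (triv c x ** E x) = triv c x ** E x ** jordan_pole \<alpha> (fst x)"
   "snd x : interior (base P) --> dt_mat (%x. triv c x ** E x) x + omega_t c x ** (triv c x ** E x) = 0"
   using loc[OF c, of "Ln (fst x)"] xs by blast+
 qed
 then show ?thesis by blast
qed

section \<open>The lattice of a regular singular structure over a point\<close>

lemma ext0_mat_inv:
 assumes U: "ext0_mat U U0" and d: "det U0 ~= 0"
 shows "EV z. invertible (U z)" and "EX K0. ext0_mat (%z. matrix_inv (U z)) K0 & det K0 ~= 0"
proof -
 have e: "ext0 (%z. U z $ i $ j) (U0 $ i $ j)" for i j using U by (simp add: ext0_mat_def)
 have de: "ext0 (%z. det (U z)) (det U0)" unfolding det_2 by (intro ext0_diff ext0_mult e)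
 have dn: "EV z. det (U z) ~= 0" by (rule ext0_nonzero[OF de d])
 then show inv: "EV z. invertible (U z)" by (simp add: invertible_det_nz)
 have i0: "invertible U0" using d by (simp add: invertible_det_nz)
 have "ext0_mat (%z. mat2 (U z$2$2 / det (U z)) (- U z$1$2 / det (U z)) (- U z$2$1 / det (U z)) (U z$1$1 / det (U z)))
   (matrix_inv U0)" unfolding ext0_mat_def matrix_inv2[OF i0] forall_2 mat2_nth
  by (intro conjI ext0_divide ext0_uminus e de d)
 moreover have "EV z. matrix_inv (U z) $ i $ j =
   mat2 (U z$2$2 / det (U z)) (- U z$1$2 / det (U z)) (- U z$2$1 / det (U z)) (U z$1$1 / det (U z)) $ i $ j" for i j
  using inv by eventually_elim (simp only: matrix_inv2)
 ultimately have "ext0_mat (%z. matrix_inv (U z)) (matrix_inv U0)" unfolding ext0_mat_def by (blast intro: ext0_cong)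
 moreover have "det (matrix_inv U0) ~= 0" using invertible_inv[OF i0] by (simp add: invertible_det_nz)
 ultimately show "EX K0. ext0_mat (%z. matrix_inv (U z)) K0 & det K0 ~= 0" by blast
qed

context framed_te
begin

definition frame_inv :: "te_chart => pt => complex^2^2" where
 "frame_inv c x = matrix_inv (triv c x ** E x)"

lemma frame_inv_hol: "c : atlas P ==> hol2_mat_on (frame_inv c) (chart_dom c Int punctured P)"
 unfolding frame_inv_def using triv_E_inv by (intro hol2_mat_on_inv E_hol) auto

lemma frame_inv_invertible: "c : atlas P ==> x : chart_dom c ==> x : punctured P ==> invertible (frame_inv c x)"
 unfolding frame_inv_def by (intro invertible_inv triv_E_inv)

lemma frame_inv_ode:
 assumes c: "c : atlas P" and x: "x : chart_dom c" "x : punctured P"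
 shows "dz_mat (frame_inv c) x = frame_inv c x ** omega_z c x - jordan_pole \<alpha> (fst x) ** frame_inv c x"
proof -
 let ?F = "%y. triv c y ** E y" and ?W = "chart_dom c Int punctured P"
 note rW = rel_open_chart_punctured[OF c]
 have xW: "x : ?W" using x by blast
 have Fi: "invertible (?F x)" by (rule triv_E_inv[OF c x])
 have one: "?F y ** frame_inv c y = mat 1" if "y : ?W" for y
  unfolding frame_inv_def using that by (intro inv_cancel triv_E_inv[OF c]) auto
 have "dz_mat (%y. ?F y ** frame_inv c y) x = dz_mat ?F x ** frame_inv c x + ?F x ** dz_mat (frame_inv c) x"
  by (rule dz_mat_mult[OF hol2_on_zdiff[OF hol2_mat_onD[OF E_hol[OF c]] rW xW]
     hol2_on_zdiff[OF hol2_mat_onD[OF frame_inv_hol[OF c]] rW xW]])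
 moreover have "dz_mat (%y. ?F y ** frame_inv c y) x = dz_mat (%y. mat 1) x"
  by (rule dz_mat_cong, rule eventually_mono[OF rel_open_ev_fst[OF rW xW]], rule one)
 moreover have "dz_mat (%y. mat 1 :: complex^2^2) x = 0" by (simp add: dz_mat_def vec_eq_iff)
 moreover have "dz_mat ?F x = ?F x ** jordan_pole \<alpha> (fst x) - omega_z c x ** ?F x"
  using E_z[OF c x] by (simp only: eq_diff_eq)
 ultimately have "?F x ** dz_mat (frame_inv c) x =
   - ((?F x ** jordan_pole \<alpha> (fst x) - omega_z c x ** ?F x) ** frame_inv c x)"
  by (simp only: eq_neg_iff_add_eq_0 add.commute)
 also have "\<dots> = (omega_z c x ** ?F x) ** frame_inv c x - ?F x ** jordan_pole \<alpha> (fst x) ** frame_inv c x"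
  by (simp only: mat_mult_sums minus_diff_eq)
 also have "(omega_z c x ** ?F x) ** frame_inv c x = omega_z c x ** (?F x ** frame_inv c x)"
  by (simp only: matrix_mul_assoc)
 also have "\<dots> = (?F x ** frame_inv c x) ** omega_z c x"
  unfolding one[OF xW] by (simp only: matrix_mul_lid matrix_mul_rid)
 also have "\<dots> - ?F x ** jordan_pole \<alpha> (fst x) ** frame_inv c x =
   ?F x ** (frame_inv c x ** omega_z c x - jordan_pole \<alpha> (fst x) ** frame_inv c x)"
  by (simp only: mat_mult_sums matrix_mul_assoc)
 finally show ?thesis by (rule invertible_cancel_left[OF Fi])
qed

lemma nabla_z_chart_constant:
 fixes u :: "complex^2"
 assumes c: "c : atlas P" and x: "x : chart_dom c" "x : punctured P"
 shows "triv c x *v nabla_z P (%y. matrix_inv (triv c y) *v u) x = omega_z c x *v u"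
proof -
 let ?\<sigma> = "%y. matrix_inv (triv c y) *v u" and ?W = "chart_dom c Int punctured P"
 have h: "holsec_on P ?\<sigma> ?W" by (rule holsec_of_chart[OF te c]) (auto intro: hol2_vec_onI)
 have t\<sigma>: "triv c y *v ?\<sigma> y = u" if "y : ?W" for y using that by (intro inv_cancel teD(5)[OF c]) auto
 have "dz_vec (%y. triv c y *v ?\<sigma> y) x = dz_vec (%y. u) x"
  by (rule dz_vec_cong, rule eventually_mono[OF rel_open_ev_fst[OF rel_open_chart_punctured[OF c]]])
   (use x t\<sigma> in auto)
 moreover have "dz_vec (%y. u) x = 0" by (simp add: dz_vec_def vec_eq_iff)
 moreover have "dz_vec (%y. triv c y *v ?\<sigma> y) x + omega_z c x *v (triv c x *v ?\<sigma> x) = triv c x *v nabla_z P ?\<sigma> x"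
  by (rule nabla_chart(1)[OF te rel_open_chart_punctured[OF c] _ h c]) (use x in auto)
 ultimately show ?thesis using t\<sigma>[of x] x by (simp del: matrix_vec2)
qed

end

context framed_point
begin

lemma chart_ball:
 assumes c: "c : atlas R" "(0, t) : chart_dom c"
 obtains r where "r > 0" "ball (0::complex) r \<times> {t} \<subseteq> chart_dom c"
 using rel_open_point_ball[of t "chart_dom c"] teD(4)[OF c(1)] c(2) base_R by auto

lemma frame_inv_slice:
 assumes c: "c : atlas R" and r: "ball (0::complex) r \<times> {t} \<subseteq> chart_dom c"
 shows "(%z. frame_inv c (z, t) $ i $ j) holomorphic_on ball 0 r - {0}"
 by (rule hol2_on_slice_fst[OF hol2_mat_onD[OF frame_inv_hol[OF c]]])
   (use r base_R in \<open>auto intro!: open_delete\<close>)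

text \<open>Multiplied by \<open>z\<^sup>2\<close>, the equation for the inverse frame has holomorphic coefficients
 in the pole part; its rows are coupled by the nilpotent part of the residue only.\<close>

lemma frame_inv_row_ode:
 assumes c: "c : atlas R" and z: "z ~= 0" "(z, t) : chart_dom c"
 defines "M \<equiv> %z. frame_inv c (z, t)" and "A \<equiv> %z. pole_z c (z, t)"
 shows "z\<^sup>2 * deriv (%w. M w $ 1 $ j) z = M z $1$1 * A z $1$j + M z $1$2 * A z $2$j - \<alpha> * z * M z $1$j"
  and "z\<^sup>2 * deriv (%w. M w $ 2 $ j) z + z * M z $1$j = M z $2$1 * A z $1$j + M z $2$2 * A z $2$j - \<alpha> * z * M z $2$j"
proof -
 have x: "(z, t) : punctured R" using z base_R by auto
 have e: "deriv (%w. M w $ i $ j) z =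
   (frame_inv c (z, t) ** omega_z c (z, t) - jordan_pole \<alpha> z ** frame_inv c (z, t)) $ i $ j" for i
  using arg_cong[OF frame_inv_ode[OF c z(2) x], of "%B. B $ i $ j"] by (simp add: dz_mat_def M_def)
 show "z\<^sup>2 * deriv (%w. M w $ 1 $ j) z = M z $1$1 * A z $1$j + M z $1$2 * A z $2$j - \<alpha> * z * M z $1$j"
  and "z\<^sup>2 * deriv (%w. M w $ 2 $ j) z + z * M z $1$j = M z $2$1 * A z $1$j + M z $2$2 * A z $2$j - \<alpha> * z * M z $2$j"
  unfolding e unfolding M_def A_def using z(1) by (simp_all add: omega_z_def jordan_pole_def field_simps power2_eq_square)
qed

lemma pole_ext0:
 assumes c: "c : atlas R" "(0, t) : chart_dom c"
 shows "ext0 (%z. pole_z c (z, t) $ i $ j) (pole_z c (0, t) $ i $ j)"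
 by (rule hol2_point_ext0[OF hol2_mat_onD[OF teD(7)[OF c(1)]] _ c(2)])
   (use teD(4)[OF c(1)] base_R in simp)

lemma meromorphic_imp_lattice_nf:
 assumes c: "c : atlas R" "(0, t) : chart_dom c"
  and g: "!!j. EX C N. ALL i. EV z. norm (frame_inv c (z, t) $ i $ j) <= C / norm z ^ N"
 shows "EX a b h. lattice_nf (%z. frame_inv c (z, t)) a b h"
proof -
 obtain r where r: "r > 0" "ball (0::complex) r \<times> {t} \<subseteq> chart_dom c" by (rule chart_ball[OF c])
 define M where "M z = frame_inv c (z, t)" for z
 define A where "A z = pole_z c (z, t)" for z
 have hol: "(%z. M z $ i $ j) holomorphic_on ball 0 r - {0}" for i j
  unfolding M_def by (rule frame_inv_slice[OF c(1) r(2)])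
 have "EX N. ALL i. ext0 (%z. z ^ Suc N * M z $ i $ j) 0" for j
 proof -
  obtain C N where CN: "ALL i. EV z. norm (M z $ i $ j) <= C / norm z ^ N" using g[of j] unfolding M_def by (elim exE)
  show ?thesis by (intro exI[of _ N] allI ext0_of_growth[OF hol r(1) CN[rule_format]])
 qed
 then obtain N where N: "ALL j. ALL i. ext0 (%z. z ^ Suc (N j) * M z $ i $ j) 0"
  using choice[of "%j N. ALL i. ext0 (%z. z ^ Suc N * M z $ i $ j) 0"] by auto
 define K where "K = Suc (N 1) + Suc (N 2)"
 have mer: "EX c. ext0 (%z. z ^ K * M z $ i $ j) c" for i j
 proof -
  note e = N[rule_format, of j i]
  have "Suc (N j) <= K" using exhaust_2[of j] by (auto simp: K_def)
  then have "z ^ K * M z $ i $ j = z ^ (K - Suc (N j)) * (z ^ Suc (N j) * M z $ i $ j)" for z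
   by (simp only: mult.assoc[symmetric] power_add[symmetric]) simp
  then have "(%z. z ^ K * M z $ i $ j) = (%z. z ^ (K - Suc (N j)) * (z ^ Suc (N j) * M z $ i $ j))" by (rule ext)
  then show ?thesis by (simp only:) (rule exI, rule ext0_mult[OF ext0_power[OF ext0_ident] e])
 qed
 define \<beta> where "\<beta> z = mat2 (A z $1$1 - \<alpha> * z) (A z $1$2) (A z $2$1) (A z $2$2 - \<alpha> * z)" for z
 have A0: "ext0 (%z. A z $ i $ j) (A 0 $ i $ j)" for i j unfolding A_def by (rule pole_ext0[OF c])
 have "ext0_mat \<beta> (\<beta> 0)" unfolding ext0_mat_def \<beta>_def forall_2 mat2_nth
  by (intro conjI ext0_diff ext0_mult ext0_const ext0_ident A0)
 have dom: "(z, t) : chart_dom c" if "z : ball 0 r - {0}" for z using that r by auto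
 have d: "M z $1$1 * M z $2$2 - M z $1$2 * M z $2$1 ~= 0" if "z : ball 0 r - {0}" for z
  using frame_inv_invertible[OF c(1) dom[OF that]] that base_R by (auto simp: invertible_det_nz det_2 M_def)
 note ode = frame_inv_row_ode[OF c(1) _ dom, folded M_def A_def]
 have "EX a b h. lattice_nf (%z. mat2 (M z $1$1) (M z $1$2) (M z $2$1) (M z $2$2)) a b h"
 proof (rule lattice_normal_form_exists[OF r(1) hol hol hol hol mer mer mer mer d \<open>ext0_mat \<beta> (\<beta> 0)\<close>])
  fix z :: complex assume z: "z : ball 0 r - {0}"
  then have z0: "z ~= 0" by simp
  show "z\<^sup>2 * deriv (%z. M z $1$1) z = M z $1$1 * \<beta> z $1$1 + M z $1$2 * \<beta> z $2$1"
   "z\<^sup>2 * deriv (%z. M z $1$2) z = M z $1$1 * \<beta> z $1$2 + M z $1$2 * \<beta> z $2$2"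
   "z\<^sup>2 * deriv (%z. M z $2$1) z + z * M z $1$1 = M z $2$1 * \<beta> z $1$1 + M z $2$2 * \<beta> z $2$1"
   "z\<^sup>2 * deriv (%z. M z $2$2) z + z * M z $1$2 = M z $2$1 * \<beta> z $1$2 + M z $2$2 * \<beta> z $2$2"
   unfolding ode[OF z0 z] by (simp_all add: \<beta>_def algebra_simps)
 qed
 moreover have "mat2 (M z $1$1) (M z $1$2) (M z $2$1) (M z $2$2) = M z" for z by (rule mat2_eqI) simp_all
 ultimately show ?thesis by (simp add: M_def)
qed

lemma lattice_nf_imp_nf_basis:
 assumes c: "c : atlas R" "(0, t) : chart_dom c" and nf: "lattice_nf (%z. frame_inv c (z, t)) a b h"
 shows "nf_basis R E t a b h"
proof -
 obtain r where r: "r > 0" "ball (0::complex) r \<times> {t} \<subseteq> chart_dom c" by (rule chart_ball[OF c])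
 obtain U U0 where U: "ext0_mat U U0" "det U0 ~= 0" and ba: "b <= a + 1"
  and MU: "EV z. frame_inv c (z, t) = nf_mat a b h z ** U z" using nf unfolding lattice_nf_def by blast
 obtain K0 where K0: "ext0_mat (%z. matrix_inv (U z)) K0" "det K0 ~= 0" using ext0_mat_inv(2)[OF U] by blast
 have "EV z. triv c (z, t) ** E (z, t) ** nf_mat a b h z = matrix_inv (U z)"
  using MU ext0_mat_inv(1)[OF U] eventually_at0_in_ball[OF r(1)]
 proof eventually_elim
  case (elim z)
  have Fi: "invertible (triv c (z, t) ** E (z, t))" by (rule triv_E_inv[OF c(1)]) (use elim r base_R in auto)
  let ?X = "triv c (z, t) ** E (z, t) ** nf_mat a b h z"
  have "?X ** U z = (triv c (z, t) ** E (z, t)) ** frame_inv c (z, t)"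
   unfolding elim(1) by (simp only: matrix_mul_assoc)
  also have "\<dots> = mat 1" unfolding frame_inv_def by (rule inv_cancel(2)[OF Fi])
  finally have "?X ** U z ** matrix_inv (U z) = mat 1 ** matrix_inv (U z)" by simp
  then show ?case unfolding matrix_mul_assoc[symmetric] inv_cancel(2)[OF elim(2)]
   by (simp only: matrix_mul_lid matrix_mul_rid)
 qed
 then have ev: "EV z. (triv c (z, t) ** E (z, t) ** nf_mat a b h z) $ i $ j = matrix_inv (U z) $ i $ j" for i j
  by eventually_elim (rule arg_cong)
 have "ext0_mat (%z. triv c (z, t) ** E (z, t) ** nf_mat a b h z) K0" unfolding ext0_mat_def
 proof (intro allI)
  fix i j show "ext0 (%z. (triv c (z, t) ** E (z, t) ** nf_mat a b h z) $ i $ j) (K0 $ i $ j)"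
   by (rule ext0_cong[OF _ ev]) (use K0(1) in \<open>simp add: ext0_mat_def\<close>)
 qed
 then show ?thesis unfolding nf_basis_def lattice_basis_ext0[OF c] fst_conv using ba K0(2) by blast
qed

lemma chart_constant_in_stalk:
 assumes c: "c : atlas R" "(0, t) : chart_dom c"
 shows "(%y. matrix_inv (triv c y) *v u) : stalk R (0, t)" unfolding stalk_chart_iff[OF te c]
 by (rule exI[of _ "%y. u"], rule exI[of _ "chart_dom c"])
   (use c teD(4)[OF c(1)] inv_cancel(6)[OF teD(5)[OF c(1)]] in \<open>auto intro: hol2_vec_onI\<close>)

text \<open>
 The columns of the inverse frame are the coordinates of the constant sections of the chart, which lie in the
 stalk.
\<close>

theorem regular_singular_imp_lattice_nf:
 assumes c: "c : atlas R" "(0, t) : chart_dom c" and rs: "regular_singular R"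
 shows "EX a b h. lattice_nf (%z. frame_inv c (z, t)) a b h"
proof (rule meromorphic_imp_lattice_nf[OF c])
 fix j :: 2
 obtain r where r: "r > 0" "ball (0::complex) r \<times> {t} \<subseteq> chart_dom c" by (rule chart_ball[OF c])
 let ?\<tau> = "%y. matrix_inv (triv c y) *v axis j 1"
 have "moderate_growth R ?\<tau>" using rs chart_constant_in_stalk[OF c] by (simp add: regular_singular_def origin_R)
 then obtain C N where CN: "!!i. EV z. norm ((matrix_inv (E (z, t)) *v ?\<tau> (z, t)) $ i) <= C / norm z ^ N"
  using moderate_growth_frame by blast
 have "EV z. norm (frame_inv c (z, t) $ i $ j) <= C / norm z ^ N" for i using CN[of i] eventually_at0_in_ball[OF r(1)]
 proof eventually_elim
  case (elim z)
  have x: "(z, t) : chart_dom c" "(z, t) : punctured R" using elim(2) r base_R by auto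
  have "matrix_inv (E (z, t)) *v ?\<tau> (z, t) = frame_inv c (z, t) *v axis j 1"
   unfolding frame_inv_def matrix_inv_mult2[OF teD(5)[OF c(1) x(1)] E_inv[OF x(2)]]
   by (simp only: matrix_vector_mul_assoc)
  moreover have "(frame_inv c (z, t) *v axis j 1) $ i = frame_inv c (z, t) $ i $ j"
   using exhaust_2[of j] by (auto simp: axis_def)
  ultimately show ?case using elim(1) by simp
 qed
 then show "EX C N. ALL i. EV z. norm (frame_inv c (z, t) $ i $ j) <= C / norm z ^ N" by (intro exI allI)
qed

text \<open>
 Applying \<open>z \<nabla>\<^bsub>\<partial>z\<^esub>\<close> to the constant sections of a chart gives the
 columns of the pole part divided by \<open>z\<close>.
\<close>

lemma logarithmic_imp_pole_zero:
 assumes c: "c : atlas R" "(0, t) : chart_dom c" and l: "logarithmic R"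
 shows "pole_z c (0, t) = 0"
proof -
 have "pole_z c (0, t) $ i $ j = 0" for i j
 proof -
  let ?u = "axis j 1 :: complex^2"
  let ?\<sigma> = "%y. matrix_inv (triv c y) *v ?u"
  have "(%x. fst x *s nabla_z R ?\<sigma> x) : stalk R (0, t)"
   using l chart_constant_in_stalk[OF c] by (simp add: logarithmic_def origin_R)
  then obtain F W where F: "rel_open (base R) W" "(0, t) : W" "W \<subseteq> chart_dom c" "hol2_vec_on F W"
   and FW: "!!y. y : W ==> fst y ~= 0 ==> F y = triv c y *v (fst y *s nabla_z R ?\<sigma> y)"
   unfolding stalk_chart_iff[OF te c] by blast
  have pf: "pole_z c (z, t) $ i $ j = z * F (z, t) $ i" if z: "z ~= 0" "(z, t) : W" for z
  proof -
   have x: "(z, t) : chart_dom c" "(z, t) : punctured R" using z F(3) base_R by auto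
   have "F (z, t) = z *s (omega_z c (z, t) *v ?u)"
    using FW[OF z(2), unfolded fst_conv, OF z(1)] by (simp only: fst_conv smult_vec nabla_z_chart_constant[OF c(1) x])
   then have "F (z, t) $ i = pole_z c (z, t) $ i $ j / z"
    using exhaust_2[of j] z(1) by (auto simp: omega_z_def axis_def power2_eq_square)
   then show ?thesis using z(1) by simp
  qed
  obtain r where r: "r > 0" "ball (0::complex) r \<times> {t} \<subseteq> W" using rel_open_point_ball[of t W] F base_R by auto
  have "ext0 (%z. z * F (z, t) $ i) (0 * F (0, t) $ i)"
   by (intro ext0_mult ext0_ident hol2_point_ext0[OF hol2_vec_onD[OF F(4)] _ F(2)])
     (use F(1) base_R in simp)
  moreover have "EV z. pole_z c (z, t) $ i $ j = z * F (z, t) $ i"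
   using eventually_at0_in_ball[OF r(1)] by eventually_elim (rule pf, use r in auto)
  ultimately have "ext0 (%z. pole_z c (z, t) $ i $ j) 0" using ext0_cong by fastforce
  then show ?thesis using ext0_unique pole_ext0[OF c] by blast
 qed
 then show ?thesis by (simp add: vec_eq_iff)
qed

text \<open>
 The definition of a logarithmic structure does not mention growth. As the connection matrix has a simple
 pole, the inverse frame \<open>M\<close> satisfies \<open>|z M'| \<le> K |M|\<close>, and Gronwall's
 inequality along the ray \<open>\<tau> \<mapsto> v exp (- \<tau>)\<close> bounds it by a power of \<open>1 /
 |z|\<close>.
\<close>

theorem logarithmic_imp_lattice_nf:
 assumes c: "c : atlas R" "(0, t) : chart_dom c" and l: "logarithmic R"
 shows "EX a b h. lattice_nf (%z. frame_inv c (z, t)) a b h"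
proof -
 obtain r where r: "r > 0" "ball (0::complex) r \<times> {t} \<subseteq> chart_dom c" by (rule chart_ball[OF c])
 define M where "M z = frame_inv c (z, t)" for z
 define A where "A z = pole_z c (z, t)" for z
 have A0: "A 0 = 0" unfolding A_def by (rule logarithmic_imp_pole_zero[OF c l])
 have hol: "(%z. M z $ i $ j) holomorphic_on ball 0 r - {0}" for i j
  unfolding M_def by (rule frame_inv_slice[OF c(1) r(2)])
 have "EX B. EV z. norm (A z $ i $ j / z) <= B" for i j
 proof -
  have "ext0 (%z. A z $ i $ j) 0" using pole_ext0[OF c, of i j] A0 by (simp add: A_def)
  then obtain d where "ext0 (%z. A z $ i $ j / z) d" using ext0_div_ident by blast
  then have "((%z. norm (A z $ i $ j / z)) \<longlongrightarrow> norm d) (at 0)" by (intro tendsto_norm ext0_tendsto)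
  then have "EV z. norm (A z $ i $ j / z) < norm d + 1" by (rule order_tendstoD) simp
  then show ?thesis by (intro exI[of _ "norm d + 1"]) (auto elim: eventually_mono)
 qed
 note bound = this
 obtain B1 B2 B3 B4 where B: "EV z. norm (A z $ 1 $ 1 / z) <= B1" "EV z. norm (A z $ 1 $ 2 / z) <= B2"
   "EV z. norm (A z $ 2 $ 1 / z) <= B3" "EV z. norm (A z $ 2 $ 2 / z) <= B4"
  using bound[of 1 1] bound[of 1 2] bound[of 2 1] bound[of 2 2] by (elim exE) (rule that)
 define B' where "B' = \<bar>B1\<bar> + \<bar>B2\<bar> + \<bar>B3\<bar> + \<bar>B4\<bar>"
 have BB: "B1 <= B'" "B2 <= B'" "B3 <= B'" "B4 <= B'" and B'0: "B' >= 0" by (auto simp: B'_def)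
 have "EV z. ALL i j. norm (A z $ i $ j / z) <= B'" unfolding forall_2 using B by eventually_elim (use BB in linarith)
 then obtain s where s: "s > 0" and sB: "!!z i j. z ~= 0 ==> norm z < s ==> norm (A z $ i $ j / z) <= B'"
  unfolding eventually_at by (auto simp: dist_norm)
 define \<rho> where "\<rho> = min s r / 2"
 have \<rho>: "\<rho> > 0" "\<rho> < s" "\<rho> < r" using s r by (auto simp: \<rho>_def)
 define w where "w z = ((M z $1$1, M z $1$2), (M z $2$1, M z $2$2))" for z
 define K where "K = 4 * (2 * B' + norm \<alpha> + 1)"
 have dom: "(z, t) : chart_dom c" if "norm z < r" for z using that r by auto
 note ode = frame_inv_row_ode[OF c(1) _ dom, folded M_def A_def]
 have Mw: "norm (M z $ i $ j) <= norm (w z)" for z i j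
 proof -
  have "norm (fst (w z)) <= norm (w z)" "norm (snd (w z)) <= norm (w z)"
   by (metis norm_fst_le norm_snd_le prod.collapse)+
  moreover have "norm (M z $1$1) <= norm (fst (w z))" "norm (M z $1$2) <= norm (fst (w z))"
   "norm (M z $2$1) <= norm (snd (w z))" "norm (M z $2$2) <= norm (snd (w z))"
   unfolding w_def fst_conv snd_conv by (rule norm_fst_le norm_snd_le)+
  ultimately show ?thesis using exhaust_2[of i] exhaust_2[of j] by fastforce
 qed
 \<comment> \<open>the Euler derivative of every entry is bounded by the matrix itself\<close>
 have Mb: "norm (z * deriv (%v. M v $ i $ j) z) <= (2 * B' + norm \<alpha> + 1) * norm (w z)"
  if z: "z ~= 0" "norm z <= \<rho>" for z i j
 proof -
  have zr: "norm z < r" "norm z < s" using z \<rho> by auto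
  have t0: "norm (M z $ i $ k * (A z $ k $ j / z)) <= norm (w z) * B'" for k
   unfolding norm_mult by (intro mult_mono Mw sB z zr) auto
  have t1: "norm (\<alpha> * M z $ i $ j) <= norm \<alpha> * norm (w z)"
   unfolding norm_mult by (intro mult_left_mono Mw) auto
  define e where "e = (if i = 2 then M z $ 1 $ j else 0)"
  have t2: "norm e <= norm (w z)" using Mw by (simp add: e_def)
  have "z * (z * deriv (%v. M v $ i $ j) z) =
    M z $ i $ 1 * A z $ 1 $ j + M z $ i $ 2 * A z $ 2 $ j - \<alpha> * z * M z $ i $ j - z * e"
   using exhaust_2[of i] ode[OF z(1) zr(1), of j] by (auto simp: e_def power2_eq_square algebra_simps)
  also have "\<dots> = z * (M z $ i $ 1 * (A z $ 1 $ j / z) + M z $ i $ 2 * (A z $ 2 $ j / z) - \<alpha> * M z $ i $ j - e)"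
   using z(1) by (simp add: field_simps)
  finally have "z * deriv (%v. M v $ i $ j) z =
    M z $ i $ 1 * (A z $ 1 $ j / z) + M z $ i $ 2 * (A z $ 2 $ j / z) - \<alpha> * M z $ i $ j - e"
   by (rule mult_left_cancel[OF z(1), THEN iffD1])
  also have "norm \<dots> <= norm (w z) * B' + norm (w z) * B' + norm \<alpha> * norm (w z) + norm (w z)"
   by (intro order_trans[OF norm_triangle_ineq4] order_trans[OF norm_triangle_ineq] add_mono t0 t1 t2)
  finally show ?thesis by (simp add: algebra_simps)
 qed
 have "compact (w ` sphere 0 \<rho>)" unfolding w_def
  by (intro compact_continuous_image compact_sphere continuous_on_Pair;
    rule continuous_on_subset[OF holomorphic_on_imp_continuous_on[OF hol]]) (use \<rho> in auto)
 then obtain C where C0: "ALL x:w ` sphere 0 \<rho>. norm x <= C" using compact_imp_bounded bounded_iff by blast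
 have C: "norm (w z) <= C" if "norm z = \<rho>" for z by (rule C0[rule_format]) (use that in simp)
 obtain N :: nat where N: "K <= N" using real_arch_simple by blast
 have ray: "norm (w z) <= C * \<rho> ^ N / norm z ^ N" if z: "z ~= 0" "norm z < \<rho>" for z
 proof -
  define T where "T = ln (\<rho> / norm z)"
  have T: "T >= 0" "exp T = \<rho> / norm z" using z \<rho> by (simp_all add: T_def)
  define v where "v = z * of_real (\<rho> / norm z)"
  have v: "norm v = \<rho>" using z \<rho> by (simp add: v_def norm_mult norm_divide)
  define \<zeta> where "\<zeta> = (%\<tau>::real. v * exp (- of_real \<tau>))"
  have \<zeta>n: "norm (\<zeta> \<tau>) <= \<rho>" "\<zeta> \<tau> ~= 0" if "\<tau> >= 0" for \<tau>
   using v \<rho> that by (auto simp: \<zeta>_def norm_mult mult_le_cancel_left1)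
  have \<zeta>d: "(\<zeta> has_vector_derivative - \<zeta> \<tau>) (at \<tau>)" for \<tau>
   unfolding \<zeta>_def by (rule has_vector_derivative_real_field) (auto intro!: derivative_eq_intros)
  have der: "((%\<tau>. M (\<zeta> \<tau>) $ i $ j) has_vector_derivative - (\<zeta> \<tau> * deriv (%v. M v $ i $ j) (\<zeta> \<tau>))) (at \<tau>)"
   if "\<tau> >= 0" for \<tau> i j
  proof -
   have "((%v. M v $ i $ j) has_field_derivative deriv (%v. M v $ i $ j) (\<zeta> \<tau>)) (at (\<zeta> \<tau>))"
    by (rule holomorphic_derivI[OF hol]) (use \<zeta>n[OF that] \<rho> in \<open>auto intro!: open_delete\<close>)
   from field_vector_diff_chain_at[OF \<zeta>d this] show ?thesis by (simp add: o_def)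
  qed
  have "norm (w (\<zeta> T)) <= norm (w (\<zeta> 0)) * exp (K * T)"
  proof (rule gronwall_norm[OF T(1)])
   fix \<tau> :: real assume \<tau>: "0 <= \<tau>" "\<tau> <= T"
   let ?d = "%i j. - (\<zeta> \<tau> * deriv (%v. M v $ i $ j) (\<zeta> \<tau>))"
   show "((%\<tau>. w (\<zeta> \<tau>)) has_vector_derivative ((?d 1 1, ?d 1 2), (?d 2 1, ?d 2 2))) (at \<tau>)"
    unfolding w_def by (intro has_vector_derivative_Pair der \<tau>)
   have n: "norm (?d i j) <= (2 * B' + norm \<alpha> + 1) * norm (w (\<zeta> \<tau>))" for i j
    unfolding norm_minus_cancel by (rule Mb) (use \<zeta>n[OF \<tau>(1)] in auto)
   have "norm ((?d 1 1, ?d 1 2), (?d 2 1, ?d 2 2)) <= (norm (?d 1 1) + norm (?d 1 2)) + (norm (?d 2 1) + norm (?d 2 2))"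
    by (rule order_trans[OF norm_Pair_le add_mono[OF norm_Pair_le norm_Pair_le]])
   also have "\<dots> <= K * norm (w (\<zeta> \<tau>))"
    using n[of 1 1] n[of 1 2] n[of 2 1] n[of 2 2] unfolding K_def by (simp only: algebra_simps)
   finally show "norm ((?d 1 1, ?d 1 2), (?d 2 1, ?d 2 2)) <= K * norm (w (\<zeta> \<tau>))" .
  qed
  moreover have "\<zeta> T = z"
  proof -
   have "exp (- complex_of_real T) = of_real (norm z / \<rho>)"
    by (simp only: of_real_minus[symmetric] exp_of_real exp_minus T(2)) simp
   then show ?thesis using z \<rho> by (simp add: \<zeta>_def v_def)
  qed
  moreover have "norm (w (\<zeta> 0)) <= C" using C[OF v] by (simp add: \<zeta>_def)
  moreover have "exp (K * T) <= (\<rho> / norm z) ^ N"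
  proof -
   have "exp (K * T) <= exp (of_nat N * T)" using N T(1) by (simp add: mult_right_mono)
   also have "\<dots> = (\<rho> / norm z) ^ N" by (simp only: exp_of_nat_mult T(2))
   finally show ?thesis .
  qed
  moreover have "norm (w (\<zeta> 0)) * exp (K * T) <= C * (\<rho> / norm z) ^ N"
   by (intro mult_mono calculation(3,4)) (use order_trans[OF norm_ge_zero calculation(3)] in auto)
  ultimately have "norm (w z) <= C * (\<rho> / norm z) ^ N" by simp
  then show ?thesis by (simp add: power_divide)
 qed
 have "EV z. norm (frame_inv c (z, t) $ i $ j) <= C * \<rho> ^ N / norm z ^ N" for i j
  using eventually_at0_in_ball[OF \<rho>(1)] by eventually_elim (rule order_trans[OF Mw[unfolded M_def] ray], auto)
 then show ?thesis by (intro meromorphic_imp_lattice_nf[OF c]) blast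
qed

text \<open>The determinant of the inverse frame is \<open>z\<^bsup>a+b\<^esup>\<close> times a unit, and its logarithmic derivative is the
 trace of the connection matrix.\<close>

theorem trace_exponent_sum:
 assumes c: "c : atlas R" "(0, t) : chart_dom c" and nf: "lattice_nf (%z. frame_inv c (z, t)) a b h"
 shows "deriv (%z. trace (pole_z c (z, t))) 0 = of_int (a + b) + 2 * \<alpha>"
proof -
 obtain r where r: "r > 0" "ball (0::complex) r \<times> {t} \<subseteq> chart_dom c" by (rule chart_ball[OF c])
 define M where "M z = frame_inv c (z, t)" for z
 define A where "A z = pole_z c (z, t)" for z
 have hol: "(%z. M z $ i $ j) holomorphic_on ball 0 r - {0}" for i j
  unfolding M_def by (rule frame_inv_slice[OF c(1) r(2)])
 obtain U U0 where U: "ext0_mat U U0" "det U0 ~= 0" and MU: "EV z. M z = nf_mat a b h z ** U z"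
  using nf unfolding lattice_nf_def M_def by blast
 have dU: "ext0 (%z. det (U z)) (det U0)"
  unfolding det_2 using U(1) by (intro ext0_diff ext0_mult) (auto simp: ext0_mat_def)
 obtain s F where F: "s > 0" "F holomorphic_on ball 0 s" "F 0 = det U0"
   "!!z. z : ball 0 s - {0} ==> det (U z) = F z" by (rule ext0_holomorphic[OF dU]) (rule that)
 define \<delta> where "\<delta> z = M z $1$1 * M z $2$2 - M z $1$2 * M z $2$1" for z
 have \<delta>F: "EV z. \<delta> z = z powi (a + b) * F z" using MU eventually_at0_in_ball[OF F(1)]
 proof eventually_elim
  case (elim z)
  have "\<delta> z = det (nf_mat a b h z) * det (U z)"
   unfolding det_mult2[symmetric] elim(1)[symmetric] by (simp add: \<delta>_def det_2)
  then show ?case using elim(2) F(4)[of z] by (simp add: det_2 nf_mat_def power_int_add)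
 qed
 have eF: "ext0 F (F 0)" "ext0 (deriv F) (deriv F 0)" using ext0_deriv_ball[OF F(2,1)] by auto
 have Fn: "EV z. F z ~= 0" by (rule ext0_nonzero[OF eF(1)]) (use U F in simp)
 have key: "EV z. trace (A z) / z = of_int (a + b) + 2 * \<alpha> + z * (deriv F z / F z)"
  using eventually_at0_deriv_cong[OF \<delta>F] \<delta>F Fn eventually_at0_in_ball[OF F(1)] eventually_at0_in_ball[OF r(1)]
 proof eventually_elim
  case (elim z)
  have z: "z ~= 0" "(z, t) : chart_dom c" using elim(5) r by auto
  note ode = frame_inv_row_ode[OF c(1) z, folded M_def A_def]
  have d: "((%z. M z $ i $ j) has_field_derivative deriv (%z. M z $ i $ j) z) (at z)" for i j
   by (rule holomorphic_derivI[OF hol]) (use elim(5) in \<open>auto intro!: open_delete\<close>)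
  have e0: "deriv \<delta> z = (deriv (%z. M z $1$1) z * M z $2$2 + deriv (%z. M z $2$2) z * M z $1$1)
    - (deriv (%z. M z $1$2) z * M z $2$1 + deriv (%z. M z $2$1) z * M z $1$2)"
   unfolding \<delta>_def by (intro DERIV_imp_deriv DERIV_diff DERIV_mult d)
  have "z\<^sup>2 * deriv \<delta> z = ((z\<^sup>2 * deriv (%z. M z $1$1) z) * M z $2$2 + (z\<^sup>2 * deriv (%z. M z $2$2) z + z * M z $1$2) * M z $1$1)
    - ((z\<^sup>2 * deriv (%z. M z $1$2) z) * M z $2$1 + (z\<^sup>2 * deriv (%z. M z $2$1) z + z * M z $1$1) * M z $1$2)"
   unfolding e0 by (simp add: algebra_simps)
  also have "\<dots> = \<delta> z * (trace (A z) - 2 * \<alpha> * z)"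
   unfolding ode by (simp add: \<delta>_def trace_def sum_2 algebra_simps)
  finally have e1: "z\<^sup>2 * deriv \<delta> z = \<delta> z * (trace (A z) - 2 * \<alpha> * z)" .
  have dF: "(F has_field_derivative deriv F z) (at z)" by (rule holomorphic_derivI[OF F(2)]) (use elim(4) in auto)
  have "((%z. z powi (a + b) * F z) has_field_derivative
    of_int (a + b) * z powi (a + b - 1) * F z + deriv F z * z powi (a + b)) (at z)"
   by (rule DERIV_mult[OF _ dF, THEN DERIV_cong], rule DERIV_power_int[OF DERIV_ident disjI2[OF z(1)]]) simp
  then have "deriv \<delta> z = of_int (a + b) * z powi (a + b - 1) * F z + deriv F z * z powi (a + b)"
   unfolding elim(1) by (rule DERIV_imp_deriv)
  moreover have "z powi (a + b) = z * z powi (a + b - 1)"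
   using power_int_add[OF disjI1[OF z(1)], of 1 "a + b - 1"] by simp
  ultimately have "z\<^sup>2 * z powi (a + b - 1) * (of_int (a + b) * F z + z * deriv F z) =
    z * z powi (a + b - 1) * F z * (trace (A z) - 2 * \<alpha> * z)" using e1 elim(2) by (simp add: algebra_simps)
  then have "z * z powi (a + b - 1) * (z * (of_int (a + b) * F z + z * deriv F z)) =
    z * z powi (a + b - 1) * (F z * (trace (A z) - 2 * \<alpha> * z))" by (simp only: power2_eq_square mult_ac)
  then have "z * (of_int (a + b) * F z + z * deriv F z) = F z * (trace (A z) - 2 * \<alpha> * z)"
   using z(1) by (simp only: mult_cancel_left mult_eq_0_iff power_int_eq_0_iff simp_thms)
  then show ?case using z(1) elim(3) by (simp add: field_simps)
 qed
 define L where "L = of_int (a + b) + 2 * \<alpha>"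
 have "ext0 (%z. of_int (a + b) + 2 * \<alpha> + z * (deriv F z / F z)) (L + 0 * (deriv F 0 / F 0))"
  unfolding L_def by (intro ext0_add ext0_const ext0_mult ext0_ident ext0_divide eF) (use U F in simp)
 then have q: "ext0 (%z. trace (A z) / z) L" using ext0_cong[OF _ key] by simp
 have "ext0 (%z. z * (trace (A z) / z)) (0 * L)" by (intro ext0_mult ext0_ident q)
 then have "ext0 (%z. z * (trace (A z) / z)) 0" by simp
 then have "ext0 (%z. trace (A z)) 0" by (rule ext0_cong) (simp add: eventually_at_filter)
 moreover have "ext0 (%z. trace (A z)) (trace (A 0))"
  unfolding trace_def sum_2 A_def by (intro ext0_add pole_ext0[OF c])
 ultimately have t0: "trace (A 0) = 0" using ext0_unique by blast
 have "((%z. trace (A z)) has_field_derivative L) (at 0)"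
  unfolding has_field_derivative_iff using ext0_tendsto[OF q] by (simp add: t0)
 then show ?thesis unfolding L_def A_def by (rule DERIV_imp_deriv)
qed

end

section \<open>From the fibres to the total space\<close>

abbreviation restr_chart :: "te_chart => complex => te_chart" where
 "restr_chart c t \<equiv> c\<lparr>chart_dom := chart_dom c Int UNIV \<times> {t}\<rparr>"

lemma eventually_nhds_imp_at: "\<forall>\<^sub>F t in nhds x. Q t ==> \<forall>\<^sub>F t in at x. Q t"
 by (rule filter_leD[OF at_within_le_nhds])

lemma ev_ball: "r > 0 ==> \<forall>\<^sub>F t in nhds (0::complex). t : ball 0 r"
 by (rule eventually_nhds_in_open) auto

context framed_te
begin

lemma restr_point: "t : base P ==> framed_point (restr P t) \<alpha> E t"
 using restr_frame[OF framed_te_axioms] by (simp add: framed_point_def framed_point_axioms_def)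

lemma frame_inv_restr: "frame_inv (restr_chart c t) = frame_inv c" by (simp add: fun_eq_iff frame_inv_def)

lemma restr_chart_in:
 assumes "c : atlas P" "(0, t) : chart_dom c"
 shows "restr_chart c t : atlas (restr P t)" "(0, t) : chart_dom (restr_chart c t)" using assms by auto

lemma bidisc_chart:
 assumes op: "open (base P)" and b0: "0 : base P"
 obtains c r eps where "c : atlas P" "r > 0" "eps > 0" "ball (0::complex) r \<times> ball (0::complex) eps \<subseteq> chart_dom c"
proof -
 obtain c where c: "c : atlas P" "(0, 0) : chart_dom c" using teD(3)[of "(0, 0)"] b0 by auto
 have "open (chart_dom c)" using teD(4)[OF c(1)] openin_open_eq[OF open_Times[OF open_UNIV op]] by blast
 then obtain A B where AB: "open A" "open B" "(0, 0) : A \<times> B" "A \<times> B \<subseteq> chart_dom c"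
  using open_prod_elim[of "chart_dom c" "(0, 0)"] c(2) by blast
 then have "0 : A" "0 : B" by auto
 then obtain r eps where "r > 0" "ball 0 r \<subseteq> A" "eps > 0" "ball 0 eps \<subseteq> B"
  using openE[OF AB(1)] openE[OF AB(2)] by metis
 then have "ball (0::complex) r \<times> ball (0::complex) eps \<subseteq> chart_dom c" using AB(4) by blast
 then show ?thesis using that c(1) \<open>r > 0\<close> \<open>eps > 0\<close> by blast
qed

lemma bidisc_base:
 assumes "c : atlas P" "r > 0" "ball (0::complex) r \<times> T \<subseteq> chart_dom c"
 shows "T \<subseteq> base P"
proof
 fix t assume "t : T"
 then have "(0, t) : chart_dom c" using assms(2,3) by auto
 then show "t : base P" using teD(6)[OF assms(1)] by auto
qed

text \<open>A frame that is a basis of the lattice in every fibre is one in the total space: in a chart, the entries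
 extend across \<open>z = 0\<close> in every fibre, and Cauchy's formula makes the extension holomorphic in both variables.\<close>

lemma joint_lattice_basis:
 assumes op: "open (base P)" and \<delta>: "\<delta> > 0" "ball 0 \<delta> \<subseteq> base P"
  and V: "hol2_mat_on V ((- {0}) \<times> ball 0 \<delta>)"
  and fib: "!!t. t : ball 0 \<delta> ==> lattice_basis (restr P t) E (0, t) V"
 shows "lattice_basis P E (0, 0) V"
proof -
 have b0: "0 : base P" using \<delta> by auto
 obtain c r eps where c: "c : atlas P" and r: "r > 0" "eps > 0" "ball (0::complex) r \<times> ball (0::complex) eps \<subseteq> chart_dom c"
  by (rule bidisc_chart[OF op b0])
 define T where "T = ball (0::complex) (min eps \<delta>)"
 have T: "open T" "0 : T" "T \<subseteq> ball 0 eps" "T \<subseteq> ball 0 \<delta>" using r \<delta> by (auto simp: T_def)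
 define K where "K x = triv c x ** E x ** V x" for x
 have K: "hol2_mat_on K ((ball 0 r - {0}) \<times> T)" unfolding K_def
 proof (rule hol2_mat_on_mult)
  show "hol2_mat_on (%x. triv c x ** E x) ((ball 0 r - {0}) \<times> T)"
   by (rule hol2_mat_on_subset[OF E_hol[OF c]]) (use r T \<delta> in auto)
  show "hol2_mat_on V ((ball 0 r - {0}) \<times> T)" by (rule hol2_mat_on_subset[OF V]) (use T in auto)
 qed
 have e: "EX K0. ext0_mat (%z. K (z, t)) K0 & det K0 ~= 0" if t: "t : T" for t
 proof -
  have tb: "t : base P" "t : ball 0 \<delta>" using t T \<delta> by auto
  have ct: "(0, t) : chart_dom c" using t T r by auto
  show ?thesis
   using fib[OF tb(2)] framed_point.lattice_basis_ext0[OF restr_point[OF tb(1)] restr_chart_in[OF c ct], of V]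
   by (simp add: K_def)
 qed
 define Q where "Q i j H \<longleftrightarrow> hol2_on H (ball 0 (r/2) \<times> T) & (ALL z:ball 0 (r/2) - {0}. ALL t:T. H (z, t) = K (z, t) $ i $ j) &
   (ALL t:T. ext0 (%z. K (z, t) $ i $ j) (H (0, t)))" for i j H
 have "EX H. Q i j H" for i j unfolding Q_def
 proof (rule hol2_on_extension[OF hol2_mat_onD[OF K] T(1)])
  show "0 < r / 2" "r / 2 < r" using r by auto
  fix t assume "t : T"
  from e[OF this] show "EX c. ext0 (%z. K (z, t) $ i $ j) c" by (auto simp: ext0_mat_def)
 qed
 note ex = this
 define H where "H i j = (SOME H. Q i j H)" for i j
 have H: "Q i j (H i j)" for i j unfolding H_def by (rule someI_ex[OF ex])
 define L where "L y = (\<chi> i j. H i j y)" for y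
 let ?W = "ball (0::complex) (r/2) \<times> T"
 have f1: "hol2_mat_on L ?W" using H by (simp add: hol2_mat_on_def L_def Q_def)
 have f2: "det (L (0, 0)) ~= 0"
 proof -
  obtain K0 where K0: "ext0_mat (%z. K (z, 0)) K0" "det K0 ~= 0" using e[OF T(2)] by blast
  have "H i j (0, 0) = K0 $ i $ j" for i j
   by (rule ext0_unique[of "%z. K (z, 0) $ i $ j"]) (use H[of i j] T(2) K0(1) in \<open>auto simp: Q_def ext0_mat_def\<close>)
  then have "L (0, 0) = K0" by (simp add: L_def vec_eq_iff)
  then show ?thesis using K0 by simp
 qed
 have f3: "L y = triv c y ** E y ** V y" if "y : ?W" "fst y ~= 0" for y
 proof -
  have "H i j (fst y, snd y) = K (fst y, snd y) $ i $ j" for i j using H[of i j] that by (auto simp: Q_def)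
  then have "L y = K y" by (simp add: L_def vec_eq_iff)
  then show ?thesis by (simp only: K_def)
 qed
 have f4: "rel_open (base P) ?W"
 proof -
  have "?W \<subseteq> total_base P" using T(4) \<delta>(2) by auto
  moreover have "open ?W" by (intro open_Times T) auto
  ultimately show ?thesis by (rule open_subset)
 qed
 have f5: "(0, 0) : ?W" using r T by simp
 have f6: "?W \<subseteq> chart_dom c" using r T by (auto simp: subset_iff)
 have c0: "(0, 0) : chart_dom c" using f5 f6 by blast
 show ?thesis
 proof (rule iffD2[OF lattice_basis_iff[OF c c0]])
  show "fst (0, 0) = (0::complex)" by simp
  show "EX W K. rel_open (base P) W & (0, 0) : W & W \<subseteq> chart_dom c & hol2_mat_on K W & det (K (0, 0)) ~= 0 &
    (ALL y:W. fst y ~= 0 --> K y = triv c y ** E y ** V y)"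
   by (rule exI[of _ ?W], rule exI[of _ L]) (intro conjI ballI impI f1 f2 f3 f4 f5 f6)
 qed
qed

lemma fibre_basis_change:
 assumes t: "t : base P" and nf: "nf_basis (restr P t) E t a b h" and C: "ext0_mat C C0" "det C0 ~= 0"
  and V: "!!z. z ~= 0 ==> V (z, t) = nf_mat a b h z ** C z"
 shows "lattice_basis (restr P t) E (0, t) V"
proof (rule framed_point.lattice_basis_change_ext0[OF restr_point[OF t] _ C])
 show "lattice_basis (restr P t) E (0, t) (%y. nf_mat a b h (fst y))" using nf unfolding nf_basis_def by (rule conjunct2)
 show "!!z. z ~= 0 ==> V (z, t) = nf_mat a b h (fst (z, t)) ** C z" using V by simp
qed

section \<open>Normal forms over the germ\<close>

text \<open>
 The three cases arise from the Laurent coefficients of the inverse frame, once the fibres are known to have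
 normal forms with constant \<open>a + b\<close>.
\<close>

theorem family_normal_form:
 assumes op: "open (base P)" and b0: "0 : base P"
  and rs: "EV t. regular_singular (restr P t)" and lg: "logarithmic (restr P 0)"
 shows "EX a b \<delta> f. \<delta> > 0 & ball 0 \<delta> \<subseteq> base P & f holomorphic_on ball 0 \<delta> & f 0 = 0 &
   ((b <= a & (ALL t:ball 0 \<delta>. nf_basis (restr P t) E t a b (f t)) &
     ((ALL t:ball 0 \<delta>. f t = 0) \<or> (ALL t:ball 0 \<delta> - {0}. f t ~= 0))) \<or>
   (b <= a + 1 & (ALL t:ball 0 \<delta> - {0}. f t ~= 0 & nf_basis (restr P t) E t a b (1 / f t)) &
     nf_basis (restr P 0) E 0 (a + 1) (b - 1) 0))"
proof -
 obtain c r eps1 where c: "c : atlas P" and r: "r > 0" "eps1 > 0" "ball (0::complex) r \<times> ball (0::complex) eps1 \<subseteq> chart_dom c"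
  by (rule bidisc_chart[OF op b0])
 have bb: "ball 0 eps1 \<subseteq> base P" by (rule bidisc_base[OF c r(1,3)])
 obtain eps2 where eps2: "eps2 > 0" "!!t. t ~= 0 ==> norm t < eps2 ==> regular_singular (restr P t)"
  using rs unfolding eventually_at by (auto simp: dist_norm)
 have dom: "(0, t) : chart_dom c" if "t : ball 0 eps1" for t using r that by auto
 let ?M = "frame_inv c"
 have nfb: "nf_basis (restr P t) E t a b h" if "t : ball 0 eps1" "lattice_nf (%z. ?M (z, t)) a b h" for t a b h
  using framed_point.lattice_nf_imp_nf_basis[OF restr_point restr_chart_in[OF c dom[OF that(1)]]] that bb
  by (auto simp: frame_inv_restr)
 have ex: "EX a b h. lattice_nf (%z. ?M (z, t)) a b h" if t: "t : ball 0 eps1" "norm t < eps2" for t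
 proof (cases "t = 0")
  case True
  show ?thesis
   using framed_point.logarithmic_imp_lattice_nf[OF restr_point[OF b0] restr_chart_in[OF c dom] lg] r(2) True
   by (simp add: frame_inv_restr)
 next
  case False
  have tb: "t : base P" using bb t by auto
  show ?thesis
   using framed_point.regular_singular_imp_lattice_nf[OF restr_point[OF tb] restr_chart_in[OF c dom[OF t(1)]] eps2(2)[OF False t(2)]]
   by (simp add: frame_inv_restr)
 qed
 \<comment> \<open>the sum of the exponents is read off from the trace of the pole part, hence continuous in the parameter\<close>
 define S where "S t = deriv (%z. trace (pole_z c (z, t))) 0" for t
 have S: "S t = of_int (a + b) + 2 * \<alpha>" if "t : ball 0 eps1" "lattice_nf (%z. ?M (z, t)) a b h" for t a b h
 proof -
  have tb: "t : base P" using bb that by auto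
  show ?thesis
   using framed_point.trace_exponent_sum[OF restr_point[OF tb] restr_chart_in[OF c dom[OF that(1)]], of a b h] that(2)
   by (simp add: frame_inv_restr S_def)
 qed
 obtain a0 b0' h0 where n0: "lattice_nf (%z. ?M (z, 0)) a0 b0' h0" using ex[of 0] r(2) eps2(1) by auto
 have "nf_basis (restr P 0) E 0 a0 b0' h0" by (rule nfb[OF _ n0]) (use r in simp)
 then have h0: "h0 = 0" "b0' <= a0" using framed_point.logarithmic_iff[OF restr_point[OF b0]] lg by blast+
 have "open (chart_dom c)" using teD(4)[OF c] openin_open_eq[OF open_Times[OF open_UNIV op]] by blast
 moreover have "hol2_on (%x. trace (pole_z c x)) (chart_dom c)"
  unfolding trace_def sum_2 by (intro hol2_on_add hol2_mat_onD teD(7) c)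
 ultimately have "continuous_on (chart_dom c) (%x. deriv (%w. trace (pole_z c (w, snd x))) (fst x))"
  by (intro hol2_on_continuous_deriv_fst)
 note cont = this
 have c2: "continuous_on (ball 0 eps1) (%t. (0::complex, t))" by (intro continuous_intros)
 have "(%t. (0::complex, t)) ` ball 0 eps1 \<subseteq> chart_dom c" using dom by blast
 from continuous_on_compose2[OF cont c2 this] have "continuous_on (ball 0 eps1) S" unfolding S_def fst_conv snd_conv .
 then have "isCont S 0" using r(2) continuous_on_eq_continuous_at[of "ball 0 eps1" S] by simp
 then obtain eps3 where eps3: "eps3 > 0" "!!t. norm t < eps3 ==> norm (S t - S 0) < 1"
  unfolding continuous_at_eps_delta by (metis diff_zero dist_norm zero_less_one)
 define eps where "eps = min eps1 (min eps2 eps3)"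
 have eps: "eps > 0" "ball 0 eps \<subseteq> ball (0::complex) eps1" using r eps2 eps3 by (auto simp: eps_def)
 have nf: "EX a b h. a + b = a0 + b0' & lattice_nf (%z. ?M (z, t)) a b h" if t: "t : ball 0 eps" for t
 proof -
  have t': "t : ball 0 eps1" "norm t < eps2" "norm t < eps3" using t by (auto simp: eps_def)
  obtain a b h where n: "lattice_nf (%z. ?M (z, t)) a b h" using ex[OF t'(1,2)] by blast
  have "S t - S 0 = of_int ((a + b) - (a0 + b0'))" using S[OF t'(1) n] S[OF _ n0] r(2) by simp
  then have "norm (of_int ((a + b) - (a0 + b0')) :: complex) < 1" using eps3(2)[OF t'(3)] by simp
  then have "\<bar>(a + b) - (a0 + b0')\<bar> < 1" unfolding norm_of_int by linarith
  then show ?thesis using n by (intro exI[of _ a] exI[of _ b] exI[of _ h]) auto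
 qed
 have hM: "hol2_on (%x. ?M x $ i $ j) ((ball 0 r - {0}) \<times> ball 0 eps)" for i j
  by (rule hol2_on_subset[OF hol2_mat_onD[OF frame_inv_hol[OF c]]]) (use r eps bb in auto)
 obtain a b \<delta> f where F: "\<delta> > 0" "\<delta> <= eps" "f holomorphic_on ball 0 \<delta>" "f 0 = 0"
  and tri: "(b <= a & (ALL t:ball 0 \<delta>. lattice_nf (%z. ?M (z, t)) a b (f t)) &
     ((ALL t:ball 0 \<delta>. f t = 0) \<or> (ALL t:ball 0 \<delta> - {0}. f t ~= 0))) \<or>
   (b <= a + 1 & (ALL t:ball 0 \<delta> - {0}. f t ~= 0 & lattice_nf (%z. ?M (z, t)) a b (1 / f t)) &
     lattice_nf (%z. ?M (z, 0)) (a + 1) (b - 1) 0)"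
  using lattice_family_trichotomy[OF hM r(1) eps(1) nf n0[unfolded h0(1)] refl h0(2)]
  by - (drule meta_mp, assumption, elim exE conjE, rule that)
 have sub: "t : ball 0 eps1" if "t : ball 0 \<delta>" for t :: complex
  using that subset_ball[OF F(2), of "0::complex"] eps(2) by blast
 have z1: "(0::complex) : ball 0 eps1" using r by simp
 show ?thesis
 proof (intro exI conjI)
  show "\<delta> > 0" "f holomorphic_on ball 0 \<delta>" "f 0 = 0" by (fact F)+
  show "ball 0 \<delta> \<subseteq> base P" using sub bb by blast
  show "(b <= a & (ALL t:ball 0 \<delta>. nf_basis (restr P t) E t a b (f t)) &
     ((ALL t:ball 0 \<delta>. f t = 0) \<or> (ALL t:ball 0 \<delta> - {0}. f t ~= 0))) \<or>
   (b <= a + 1 & (ALL t:ball 0 \<delta> - {0}. f t ~= 0 & nf_basis (restr P t) E t a b (1 / f t)) &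
     nf_basis (restr P 0) E 0 (a + 1) (b - 1) 0)" using tri
  proof (elim disjE conjE)
   assume "b <= a" "ALL t:ball 0 \<delta>. lattice_nf (%z. ?M (z, t)) a b (f t)"
    and "ALL t:ball 0 \<delta>. f t = 0"
   then show ?thesis using nfb sub by blast
  next
   assume "b <= a" "ALL t:ball 0 \<delta>. lattice_nf (%z. ?M (z, t)) a b (f t)"
    and "ALL t:ball 0 \<delta> - {0}. f t ~= 0"
   then show ?thesis using nfb sub by blast
  next
   assume B: "b <= a + 1" "ALL t:ball 0 \<delta> - {0}. f t ~= 0 & lattice_nf (%z. ?M (z, t)) a b (1 / f t)"
    and "lattice_nf (%z. ?M (z, 0)) (a + 1) (b - 1) 0"
   then have "nf_basis (restr P 0) E 0 (a + 1) (b - 1) 0" by (intro nfb[OF z1])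
   then show ?thesis using B nfb sub by blast
  qed
 qed
qed

lemma powi_split: "(z::complex) ~= 0 ==> z powi m * z powi n = z powi (m + n)" by (simp add: power_int_add)

lemma powi_hol: "hol2_on (%x. fst x powi n) ((- {0}) \<times> T)" by (intro hol2_on_powi hol2_on_fst) auto

lemma basis_family_I:
 assumes op: "open (base P)" and \<delta>: "\<delta> > 0" "ball 0 \<delta> \<subseteq> base P" and f: "f holomorphic_on ball 0 \<delta>"
  and ba: "b <= a" and nf: "!!t. t : ball 0 \<delta> ==> nf_basis (restr P t) E t a b (f t)" and l: "l ~= 0"
 shows "lattice_basis P E (0, 0) (%y. mat2 (l * fst y powi a) 0
   (d * fst y powi a + f (snd y) * (l * fst y powi (b - 1))) (l * fst y powi b))" (is "lattice_basis P E _ ?V")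
proof (rule joint_lattice_basis[OF op \<delta>])
 show "hol2_mat_on ?V ((- {0}) \<times> ball 0 \<delta>)"
  by (intro hol2_mat_on_mat2 hol2_on_add hol2_on_mult hol2_on_const powi_hol hol2_on_of_snd[OF f open_ball])
 fix t :: complex assume t: "t : ball 0 \<delta>"
 show "lattice_basis (restr P t) E (0, t) ?V"
 proof (rule fibre_basis_change[OF _ nf[OF t]])
  show "t : base P" using t \<delta> by auto
  show "ext0_mat (%z. mat2 l 0 (d * z powi (a - b)) l) (mat2 l 0 (d * 0 powi (a - b)) l)"
   unfolding ext0_mat_def forall_2 mat2_nth using ba by (intro conjI ext0_const ext0_mult ext0_powi) auto
  show "det (mat2 l 0 (d * 0 powi (a - b)) l) ~= 0" using l by (simp add: det_2)
  fix z :: complex assume z: "z ~= 0"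
  have "z powi b * z powi (a - b) = z powi a" using powi_split[OF z, of b "a - b"] by simp
  then show "?V (z, t) = nf_mat a b (f t) z ** mat2 l 0 (d * z powi (a - b)) l"
   by (intro mat2_eqI) (simp_all add: nf_mat_def mult_ac)
 qed
qed

text \<open>
 If \<open>g = f\<close> and \<open>h = 1 / f\<close>, the first column is \<open>f z^a (e\<^sub>1 + h z^(b -
 1 - a) e\<^sub>2)\<close>, up to the term with \<open>d\<close>.  For \<open>b = a + 1\<close> that term has
 the same order as the others and has to be absorbed in \<open>g\<close>.
\<close>

lemma basis_family_II:
 assumes op: "open (base P)" and \<delta>: "\<delta> > 0" "ball 0 \<delta> \<subseteq> base P"
  and g: "g holomorphic_on ball 0 \<delta>" "g 0 = 0"
  and ba: "b <= a + 1" and nf: "!!t. t : ball 0 \<delta> - {0} ==> f t ~= 0 & nf_basis (restr P t) E t a b (1 / f t)"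
  and nf0: "nf_basis (restr P 0) E 0 (a + 1) (b - 1) 0" and l: "l ~= 0"
  and gf: "!!t. t : ball 0 \<delta> - {0} ==> g t * l = f t * (l + (if b = a + 1 then g t * d else 0))"
 shows "lattice_basis P E (0, 0) (%y. mat2 (g (snd y) * (l * fst y powi a)) (l * fst y powi (a + 1))
   (l * fst y powi (b - 1) + g (snd y) * (d * fst y powi a)) (d * fst y powi (a + 1)))" (is "lattice_basis P E _ ?V")
proof (rule joint_lattice_basis[OF op \<delta>])
 show "hol2_mat_on ?V ((- {0}) \<times> ball 0 \<delta>)"
  by (intro hol2_mat_on_mat2 hol2_on_add hol2_on_mult hol2_on_const powi_hol hol2_on_of_snd[OF g(1) open_ball])
 fix t :: complex assume t: "t : ball 0 \<delta>"
 have tb: "t : base P" using t \<delta> by auto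
 show "lattice_basis (restr P t) E (0, t) ?V"
 proof (cases "t = 0")
  case True
  show ?thesis unfolding True
  proof (rule fibre_basis_change[OF _ nf0])
   show "0 : base P" using tb True by simp
   show "ext0_mat (%z. mat2 0 l l (d * z powi (a + 2 - b))) (mat2 0 l l (d * 0 powi (a + 2 - b)))"
    unfolding ext0_mat_def forall_2 mat2_nth using ba by (intro conjI ext0_const ext0_mult ext0_powi) auto
   show "det (mat2 0 l l (d * 0 powi (a + 2 - b))) ~= 0" using l by (simp add: det_2)
   fix z :: complex assume z: "z ~= 0"
   have "z powi (b - 1) * z powi (a + 2 - b) = z powi (a + 1)" unfolding powi_split[OF z] by (simp add: add.commute)
   then show "?V (z, 0) = nf_mat (a + 1) (b - 1) 0 z ** mat2 0 l l (d * z powi (a + 2 - b))"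
    by (intro mat2_eqI) (simp_all add: nf_mat_def g(2) mult_ac)
  qed
 next
  case False
  then have t0: "t : ball 0 \<delta> - {0}" using t by simp
  have f0: "f t ~= 0" using nf[OF t0] by simp
  define e where "e z = (if b = a + 1 then 0 else g t * d * z powi (a - b))" for z :: complex
  have e: "ext0 e (e 0)"
  proof (cases "b = a + 1")
   case True
   then show ?thesis unfolding e_def by (simp add: ext0_const)
  next
   case False
   then show ?thesis unfolding e_def using ba by (simp add: ext0_mult ext0_const ext0_powi)
  qed
  let ?C = "%z. mat2 (g t * l) (l * z) (e z) (d * z powi (a + 1 - b) - l / f t)"
  show ?thesis
  proof (rule fibre_basis_change[OF tb, of a b "1 / f t" ?C "?C 0"])
   show "nf_basis (restr P t) E t a b (1 / f t)" using nf[OF t0] by simp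
   show "ext0_mat ?C (?C 0)" unfolding ext0_mat_def forall_2 mat2_nth using ba
    by (intro conjI ext0_const ext0_mult ext0_powi ext0_ident ext0_diff e) auto
   have "g t * l * (d * 0 powi (a + 1 - b) - l / f t) = - l * l"
   proof (cases "b = a + 1")
    case True
    then have q: "g t * l / f t = l + g t * d" using gf[OF t0] f0 by simp
    have "g t * l * (d * 0 powi (a + 1 - b) - l / f t) = g t * l * d - (g t * l / f t) * l"
     using True by (simp add: algebra_simps)
    then show ?thesis unfolding q by (simp add: algebra_simps)
   next
    case nb: False
    then have "(0::complex) powi (a + 1 - b) = 0" by (simp add: power_int_0_left)
    then show ?thesis using nb gf[OF t0] f0 by (simp add: field_simps)
   qed
   then show "det (?C 0) ~= 0" using l by (simp add: det_2)
   fix z :: complex assume z: "z ~= 0"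
   have p1: "z powi b = z * z powi (b - 1)" using powi_split[OF z, of 1 "b - 1"] by simp
   have p2: "z powi (a + 1) = z * z powi a" using powi_split[OF z, of 1 a] by (simp add: add.commute)
   have r2: "1 / f t * z powi (b - 1) * (g t * l) + z powi b * e z = l * z powi (b - 1) + g t * (d * z powi a)"
   proof (cases "b = a + 1")
    case True
    then show ?thesis using gf[OF t0] f0 by (simp add: e_def field_simps)
   next
    case nb: False
    have "z powi b * z powi (a - b) = z powi a" using powi_split[OF z, of b "a - b"] by simp
    then have "z powi b * e z = g t * (d * z powi a)" using nb by (simp add: e_def mult_ac)
    moreover have "g t * l = f t * l" using gf[OF t0] nb by simp
    ultimately show ?thesis using f0 by (auto simp: field_simps)
   qed
   have "z powi b * z powi (a + 1 - b) = z powi (a + 1)" using powi_split[OF z, of b "a + 1 - b"] by simp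
   then have r3: "1 / f t * z powi (b - 1) * (l * z) + z powi b * (d * z powi (a + 1 - b) - l / f t) = d * z powi (a + 1)"
    using f0 p1 by (simp add: field_simps)
   show "?V (z, t) = nf_mat a b (1 / f t) z ** ?C z"
    by (rule mat2_eqI) (simp_all only: nf_mat_def mat2_nth matrix_mult2 r2 r3 fst_conv snd_conv p2, simp_all add: mult_ac)
  qed
 qed
qed

end

lemma germ_holomorphic: "nonzero_vanishing_germ f ==> EX eps>0. f holomorphic_on ball 0 eps"
 by (simp add: nonzero_vanishing_germ_def analytic_at_ball)

lemma nonzero_vanishing_germI:
 assumes f: "f holomorphic_on ball 0 \<delta>" "\<delta> > 0" "f 0 = 0" and nz: "!!t. t : ball 0 \<delta> - {0} ==> f t ~= 0"
 shows "nonzero_vanishing_germ f" unfolding nonzero_vanishing_germ_def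
proof (intro conjI notI)
 show "f analytic_on {0}" using f by (auto simp: analytic_at_ball)
 show "f 0 = 0" by fact
 assume "\<forall>\<^sub>F t in nhds 0. f t = 0"
 then have "EV t. f t = 0" by (rule eventually_nhds_imp_at)
 then have "\<forall>\<^sub>F t in at (0::complex). False"
  using eventually_at0_in_ball[OF f(2)] by eventually_elim (use nz in blast)
 then show False by simp
qed

context framed_te
begin

lemma sds_power_vecs:
 assumes "!!x. x : punctured P ==> v1 x = E x *v column 1 (V x)" "!!x. x : punctured P ==> v2 x = E x *v column 2 (V x)"
 shows "stalk_direct_sum P x v1 v2 \<longleftrightarrow> lattice_basis P E x V"
 unfolding lattice_basis_def by (rule stalk_direct_sum_cong) (use assms in auto)

lemma linked_coords:
 assumes conn: "connected (base P)" and l: "linked P (\<alpha> + of_int a) (\<alpha> + of_int (a - int k)) s1 s2"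
 obtains l d where "l ~= 0" "ALL x:punctured P. s1 x = E x *v power_vec a l d x"
  "ALL x:punctured P. s2 x = E x *v power_vec (a - int k) 0 l x"
proof -
 obtain k' l d where L: "l ~= 0" "\<alpha> + of_int (a - int k) = \<alpha> + of_int (a - int k')"
  and s: "ALL x:punctured P. s1 x = E x *v power_vec a l d x" "ALL x:punctured P. s2 x = E x *v power_vec (a - int k') 0 l x"
  using l unfolding linked_frame_iff[OF conn] by (elim exE conjE) (rule that)
 have "(of_int (a - int k) :: complex) = of_int (a - int k')" using L(2) by (simp only: add_left_cancel)
 then have "a - int k = a - int k'" by (simp only: of_int_eq_iff)
 then have "k' = k" by simp
 then show ?thesis using that[OF L(1)] s by blast
qed

lemma form_I_basis:
 assumes "ALL x:punctured P. s1 x = E x *v power_vec a l d x" "ALL x:punctured P. s2 x = E x *v power_vec (b - 1) 0 l x"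
 shows "stalk_direct_sum P (0, 0) (%x. s1 x + f (snd x) *s s2 x) (%x. fst x *s s2 x) \<longleftrightarrow>
  lattice_basis P E (0, 0) (%y. mat2 (l * fst y powi a) 0
   (d * fst y powi a + f (snd y) * (l * fst y powi (b - 1))) (l * fst y powi b))"
proof (rule sds_power_vecs)
 fix x assume x: "x : punctured P"
 then have z: "fst x ~= 0" by auto
 have p: "fst x * (l * fst x powi (b - 1)) = l * fst x powi b"
  using powi_split[OF z, of 1 "b - 1"] by (simp add: mult.left_commute)
 show "s1 x + f (snd x) *s s2 x = E x *v column 1 (mat2 (l * fst x powi a) 0
   (d * fst x powi a + f (snd x) * (l * fst x powi (b - 1))) (l * fst x powi b))"
  unfolding assms(1)[rule_format, OF x] assms(2)[rule_format, OF x] smult_vec[symmetric] mat_vec_sums(1)[symmetric]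
  by (rule arg_cong[where f="%v. E x *v v"]) (simp add: power_vec_def column_def vec_eq_iff forall_2)
 show "fst x *s s2 x = E x *v column 2 (mat2 (l * fst x powi a) 0
   (d * fst x powi a + f (snd x) * (l * fst x powi (b - 1))) (l * fst x powi b))"
  unfolding assms(2)[rule_format, OF x] smult_vec[symmetric]
  by (rule arg_cong[where f="%v. E x *v v"]) (simp add: power_vec_def column_def vec_eq_iff forall_2 p)
qed

lemma form_II_basis:
 assumes "ALL x:punctured P. s1 x = E x *v power_vec a l d x" "ALL x:punctured P. s2 x = E x *v power_vec (b - 1) 0 l x"
 shows "stalk_direct_sum P (0, 0) (%x. s2 x + f (snd x) *s s1 x) (%x. fst x *s s1 x) \<longleftrightarrow>
  lattice_basis P E (0, 0) (%y. mat2 (f (snd y) * (l * fst y powi a)) (l * fst y powi (a + 1))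
   (l * fst y powi (b - 1) + f (snd y) * (d * fst y powi a)) (d * fst y powi (a + 1)))"
proof (rule sds_power_vecs)
 fix x assume x: "x : punctured P"
 then have z: "fst x ~= 0" by auto
 have p: "fst x * (c * fst x powi a) = c * fst x powi (a + 1)" for c
  using powi_split[OF z, of 1 a] by (simp add: mult.left_commute add.commute)
 let ?V = "mat2 (f (snd x) * (l * fst x powi a)) (l * fst x powi (a + 1))
   (l * fst x powi (b - 1) + f (snd x) * (d * fst x powi a)) (d * fst x powi (a + 1))"
 show "s2 x + f (snd x) *s s1 x = E x *v column 1 ?V"
  unfolding assms(1)[rule_format, OF x] assms(2)[rule_format, OF x] smult_vec[symmetric] mat_vec_sums(1)[symmetric]
  by (rule arg_cong[where f="%v. E x *v v"]) (simp add: power_vec_def column_def vec_eq_iff forall_2)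
 show "fst x *s s1 x = E x *v column 2 ?V" unfolding assms(1)[rule_format, OF x] smult_vec[symmetric]
  by (rule arg_cong[where f="%v. E x *v v"]) (simp add: power_vec_def column_def vec_eq_iff forall_2 p)
qed

definition special_I where "special_I a k \<longleftrightarrow> k >= 1 &
  (ALL s1 s2. linked P (\<alpha> + of_int a) (\<alpha> + of_int (a - int k)) s1 s2 --> (EX f. normal_form_I P s1 s2 f))"
definition special_II where "special_II a k \<longleftrightarrow>
  (ALL s1 s2. linked P (\<alpha> + of_int a) (\<alpha> + of_int (a - int k)) s1 s2 --> (EX f. normal_form_II P s1 s2 f))"
definition special_III where "special_III a k \<longleftrightarrow>
  (ALL s1 s2. linked P (\<alpha> + of_int a) (\<alpha> + of_int (a - int k)) s1 s2 --> stalk_direct_sum P (0, 0) s1 s2)"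

lemma leading_exponents_fibre:
 "t : base P ==> nf_basis (restr P t) E t a b h ==>
  leading_exponents (restr P t) (\<alpha> + of_int a) (\<alpha> + of_int (if h = 0 & b <= a then b else b - 1))"
 by (rule framed_point.leading_exponents_nf[OF restr_point])

lemma logarithmic_fibre:
 "t : base P ==> nf_basis (restr P t) E t a b h ==> logarithmic (restr P t) \<longleftrightarrow> h = 0 & b <= a"
 by (rule framed_point.logarithmic_iff[OF restr_point])

lemma pole_part_logarithmic:
 assumes t: "t : base P" and l: "logarithmic (restr P t)"
 shows "pole_part P t = 0"
proof -
 have x: "(0, t) : total_base P" using t by simp
 note c = chart_at[OF te x]
 have "pole_z (restr_chart (chart_at P (0, t)) t) (0, t) = 0"
  by (rule framed_point.logarithmic_imp_pole_zero[OF restr_point[OF t] restr_chart_in[OF c] l])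
 then have "pole_z (chart_at P (0, t)) (0, t) = 0" by simp
 then show ?thesis by (simp only: pole_part_def Let_def mat_mult_sums)
qed

text \<open>
 The special exponents are those of the normal form at \<open>t = 0\<close>, where \<open>h = 0\<close>; the
 generic ones are those with \<open>h \<noteq> 0\<close> in cases (I) and (II), which shifts the second
 exponent by one.
\<close>

theorem special_fibre_cases:
 assumes op: "open (base P)" and conn: "connected (base P)" and b0: "0 : base P"
  and rs: "EV t. regular_singular (restr P t)" and lg: "logarithmic (restr P 0)"
 obtains a k \<alpha>01 \<alpha>02 where
  "generic_leading_exponents P (\<alpha> + of_int a) (\<alpha> + of_int (a - int k))"
  "leading_exponents (restr P 0) \<alpha>01 \<alpha>02" "\<alpha>01 - \<alpha>02 : \<nat>"
  "generic_type_Reg P \<or> generic_type_Log P"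
  "(\<alpha>01 = \<alpha> + of_int a & \<alpha>02 = \<alpha> + of_int (a - int k) + 1 & special_I a k) \<or>
   (\<alpha>01 = \<alpha> + of_int a + 1 & \<alpha>02 = \<alpha> + of_int (a - int k) & special_II a k) \<or>
   (\<alpha>01 = \<alpha> + of_int a & \<alpha>02 = \<alpha> + of_int (a - int k) & special_III a k)"
  "\<forall>\<^sub>F t in nhds 0. t : base P & (EX a b h. nf_basis (restr P t) E t a b h)"
proof -
 obtain a b \<delta> f where F: "\<delta> > 0" "ball 0 \<delta> \<subseteq> base P" "f holomorphic_on ball 0 \<delta>" "f 0 = 0"
  and tri: "(b <= a & (ALL t:ball 0 \<delta>. nf_basis (restr P t) E t a b (f t)) &
     ((ALL t:ball 0 \<delta>. f t = 0) \<or> (ALL t:ball 0 \<delta> - {0}. f t ~= 0))) \<or>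
   (b <= a + 1 & (ALL t:ball 0 \<delta> - {0}. f t ~= 0 & nf_basis (restr P t) E t a b (1 / f t)) &
     nf_basis (restr P 0) E 0 (a + 1) (b - 1) 0)"
  using family_normal_form[OF op b0 rs lg] by (elim exE conjE) (rule that)
 have z0: "(0::complex) : ball 0 \<delta>" using F by simp
 have tb: "t : base P" if "t : ball 0 \<delta>" for t using that F by blast
 have at0: "\<forall>\<^sub>F t in at (0::complex). t : ball 0 \<delta> - {0}" by (rule eventually_at0_in_ball[OF F(1)])
 have nh0: "\<forall>\<^sub>F t in nhds (0::complex). t : ball 0 \<delta>" by (rule ev_ball[OF F(1)])
 consider (I) "b <= a" "ALL t:ball 0 \<delta>. nf_basis (restr P t) E t a b (f t)" "ALL t:ball 0 \<delta> - {0}. f t ~= 0"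
  | (III) "b <= a" "ALL t:ball 0 \<delta>. nf_basis (restr P t) E t a b (f t)" "ALL t:ball 0 \<delta>. f t = 0"
  | (II) "b <= a + 1" "ALL t:ball 0 \<delta> - {0}. f t ~= 0 & nf_basis (restr P t) E t a b (1 / f t)"
    "nf_basis (restr P 0) E 0 (a + 1) (b - 1) 0" using tri by (elim disjE conjE)
 then show ?thesis
 proof cases
  case I
  define k where "k = nat (a - b + 1)"
  have k: "a - int k = b - 1" "k >= 1" using I(1) by (auto simp: k_def)
  have nfI: "special_I a k" unfolding special_I_def
  proof (intro conjI allI impI)
   show "k >= 1" by fact
   fix s1 s2 assume "linked P (\<alpha> + of_int a) (\<alpha> + of_int (a - int k)) s1 s2"
   then obtain l d where l: "l ~= 0" and s: "ALL x:punctured P. s1 x = E x *v power_vec a l d x"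
    "ALL x:punctured P. s2 x = E x *v power_vec (b - 1) 0 l x"
    unfolding k(1)[symmetric] by (rule linked_coords[OF conn])
   have "normal_form_I P s1 s2 f" unfolding normal_form_I_def form_I_basis[OF s, where f=f]
   proof
    show "nonzero_vanishing_germ f" by (rule nonzero_vanishing_germI[OF F(3,1,4)]) (use I in blast)
    show "lattice_basis P E (0, 0) (%y. mat2 (l * fst y powi a) 0
      (d * fst y powi a + f (snd y) * (l * fst y powi (b - 1))) (l * fst y powi b))"
     by (rule basis_family_I[OF op F(1,2,3) I(1) _ l]) (use I(2) in blast)
   qed
   then show "EX f. normal_form_I P s1 s2 f" by blast
  qed
  show ?thesis
  proof (rule that[of a k "\<alpha> + of_int a" "\<alpha> + of_int b"])
   show "generic_leading_exponents P (\<alpha> + of_int a) (\<alpha> + of_int (a - int k))"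
    unfolding generic_leading_exponents_def k(1) using at0
   proof eventually_elim
    case (elim t)
    then show ?case using leading_exponents_fibre[of t a b "f t"] I tb by auto
   qed
   show "leading_exponents (restr P 0) (\<alpha> + of_int a) (\<alpha> + of_int b)"
    using leading_exponents_fibre[OF b0, of a b 0] bspec[OF I(2) z0] I(1) F(4) by simp
   have "\<alpha> + of_int a - (\<alpha> + of_int b) = (of_nat (nat (a - b)) :: complex)" using I(1) by (simp add: of_nat_nat)
   then show "\<alpha> + of_int a - (\<alpha> + of_int b) : \<nat>" by simp
   have "generic_type_Reg P" unfolding generic_type_Reg_def using rs at0
   proof eventually_elim
    case (elim t)
    then show ?case using logarithmic_fibre[of t a b "f t"] I tb by auto
   qed
   then show "generic_type_Reg P \<or> generic_type_Log P" ..
   show "(\<alpha> + of_int a = \<alpha> + of_int a & \<alpha> + of_int b = \<alpha> + of_int (a - int k) + 1 & special_I a k) \<or>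
    (\<alpha> + of_int a = \<alpha> + of_int a + 1 & \<alpha> + of_int b = \<alpha> + of_int (a - int k) & special_II a k) \<or>
    (\<alpha> + of_int a = \<alpha> + of_int a & \<alpha> + of_int b = \<alpha> + of_int (a - int k) & special_III a k)"
    unfolding k(1) using nfI by simp
   show "\<forall>\<^sub>F t in nhds 0. t : base P & (EX a b h. nf_basis (restr P t) E t a b h)"
    using nh0 by eventually_elim (use I(2) tb in blast)
  qed
 next
  case III
  define k where "k = nat (a - b)"
  have k: "a - int k = b" using III(1) by (auto simp: k_def)
  have nfIII: "special_III a k" unfolding special_III_def
  proof (intro allI impI)
   fix s1 s2 assume "linked P (\<alpha> + of_int a) (\<alpha> + of_int (a - int k)) s1 s2"
   then obtain l d where l: "l ~= 0" and s: "ALL x:punctured P. s1 x = E x *v power_vec a l d x"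
    "ALL x:punctured P. s2 x = E x *v power_vec b 0 l x" unfolding k[symmetric] by (rule linked_coords[OF conn])
   let ?V = "%y. mat2 (l * fst y powi a) 0 (d * fst y powi a) (l * fst y powi b)"
   have "lattice_basis P E (0, 0) (%y. mat2 (l * fst y powi a) 0
      (d * fst y powi a + (%t. 0) (snd y) * (l * fst y powi (b - 1))) (l * fst y powi b))"
    by (rule basis_family_I[OF op F(1,2) holomorphic_on_const III(1) _ l]) (use III(2,3) in auto)
   then have "lattice_basis P E (0, 0) ?V" by simp
   moreover have "s1 x = E x *v column 1 (?V x)" "s2 x = E x *v column 2 (?V x)" if "x : punctured P" for x
    unfolding s(1)[rule_format, OF that] s(2)[rule_format, OF that]
    by (rule arg_cong[where f="%v. E x *v v"], simp add: power_vec_def column_def vec_eq_iff forall_2)+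
   ultimately show "stalk_direct_sum P (0, 0) s1 s2" using sds_power_vecs[of s1 ?V s2 "(0, 0)"] by blast
  qed
  have lgt: "logarithmic (restr P t)" if "t : ball 0 \<delta>" for t
   using logarithmic_fibre[of t a b "f t"] III that tb by auto
  show ?thesis
  proof (rule that[of a k "\<alpha> + of_int a" "\<alpha> + of_int b"])
   show "generic_leading_exponents P (\<alpha> + of_int a) (\<alpha> + of_int (a - int k))"
    unfolding generic_leading_exponents_def k using at0
   proof eventually_elim
    case (elim t)
    then show ?case using leading_exponents_fibre[of t a b "f t"] III tb by auto
   qed
   show "leading_exponents (restr P 0) (\<alpha> + of_int a) (\<alpha> + of_int b)"
    using leading_exponents_fibre[OF b0, of a b 0] bspec[OF III(2) z0] III(1) F(4) by simp
   have "\<alpha> + of_int a - (\<alpha> + of_int b) = (of_nat (nat (a - b)) :: complex)" using III(1) by (simp add: of_nat_nat)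
   then show "\<alpha> + of_int a - (\<alpha> + of_int b) : \<nat>" by simp
   have "generic_type_Log P" unfolding generic_type_Log_def
    using nh0 by eventually_elim (intro pole_part_logarithmic tb lgt)
   then show "generic_type_Reg P \<or> generic_type_Log P" ..
   show "(\<alpha> + of_int a = \<alpha> + of_int a & \<alpha> + of_int b = \<alpha> + of_int (a - int k) + 1 & special_I a k) \<or>
    (\<alpha> + of_int a = \<alpha> + of_int a + 1 & \<alpha> + of_int b = \<alpha> + of_int (a - int k) & special_II a k) \<or>
    (\<alpha> + of_int a = \<alpha> + of_int a & \<alpha> + of_int b = \<alpha> + of_int (a - int k) & special_III a k)"
    unfolding k using nfIII by simp
   show "\<forall>\<^sub>F t in nhds 0. t : base P & (EX a b h. nf_basis (restr P t) E t a b h)"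
    using nh0 by eventually_elim (use III(2) tb in blast)
  qed
 next
  case II
  define k where "k = nat (a - b + 1)"
  have k: "a - int k = b - 1" using II(1) by (auto simp: k_def)
  have nfII: "special_II a k" unfolding special_II_def
  proof (intro allI impI)
   fix s1 s2 assume "linked P (\<alpha> + of_int a) (\<alpha> + of_int (a - int k)) s1 s2"
   then obtain l d where l: "l ~= 0" and s: "ALL x:punctured P. s1 x = E x *v power_vec a l d x"
    "ALL x:punctured P. s2 x = E x *v power_vec (b - 1) 0 l x" unfolding k[symmetric] by (rule linked_coords[OF conn])
   define c where "c = (if b = a + 1 then d / l else 0)"
   have "(%t. 1 - c * f t) holomorphic_on ball 0 \<delta>" by (intro holomorphic_intros F)
   then obtain eps where eps: "eps > 0" "eps <= \<delta>" "!!t. t : ball 0 eps ==> 1 - c * f t ~= 0"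
    using holomorphic_nonzero_near_centre[of "%t. 1 - c * f t" \<delta>] F(1,4) by auto
   have eb: "ball (0::complex) eps \<subseteq> ball 0 \<delta>" by (rule subset_ball[OF eps(2)])
   \<comment> \<open>for equal exponents, the choice of \<open>s\<^sub>1\<close> changes the function by a fractional linear map\<close>
   define g where "g t = f t / (1 - c * f t)" for t
   have gh: "g holomorphic_on ball 0 eps" unfolding g_def
    by (intro holomorphic_intros holomorphic_on_subset[OF F(3) eb]) (use eps in auto)
   have g0: "g 0 = 0" by (simp add: g_def F)
   have "normal_form_II P s1 s2 g" unfolding normal_form_II_def form_II_basis[OF s, where f=g]
   proof
    show "nonzero_vanishing_germ g"
     by (rule nonzero_vanishing_germI[OF gh eps(1) g0]) (use II(2) eb eps(3) in \<open>auto simp: g_def\<close>)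
    show "lattice_basis P E (0, 0) (%y. mat2 (g (snd y) * (l * fst y powi a)) (l * fst y powi (a + 1))
      (l * fst y powi (b - 1) + g (snd y) * (d * fst y powi a)) (d * fst y powi (a + 1)))"
    proof (rule basis_family_II[OF op eps(1) _ gh g0 II(1) _ II(3) l])
     show "ball 0 eps \<subseteq> base P" using eb F(2) by blast
     fix t assume t: "t : ball (0::complex) eps - {0}"
     then show "f t ~= 0 & nf_basis (restr P t) E t a b (1 / f t)" using II(2) eb by blast
     have n: "1 - c * f t ~= 0" using t eps(3) by blast
     have "g t * (1 - c * f t) = f t" using n by (simp add: g_def)
     then have "g t = f t + g t * c * f t" by (simp add: algebra_simps)
     then have "g t * l = (f t + g t * c * f t) * l" by simp
     moreover have "c * l = (if b = a + 1 then d else 0)" using l by (simp add: c_def)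
     ultimately show "g t * l = f t * (l + (if b = a + 1 then g t * d else 0))"
      by (auto simp: algebra_simps split: if_splits)
    qed
   qed
   then show "EX f. normal_form_II P s1 s2 f" by blast
  qed
  show ?thesis
  proof (rule that[of a k "\<alpha> + of_int (a + 1)" "\<alpha> + of_int (b - 1)"])
   show "generic_leading_exponents P (\<alpha> + of_int a) (\<alpha> + of_int (a - int k))"
    unfolding generic_leading_exponents_def k using at0
   proof eventually_elim
    case (elim t)
    then show ?case using leading_exponents_fibre[of t a b "1 / f t"] II(2) tb by auto
   qed
   show "leading_exponents (restr P 0) (\<alpha> + of_int (a + 1)) (\<alpha> + of_int (b - 1))"
    using leading_exponents_fibre[OF b0 II(3)] II(1) by simp
   have "\<alpha> + of_int (a + 1) - (\<alpha> + of_int (b - 1)) = (of_nat (nat (a + 2 - b)) :: complex)" using II(1) by (simp add: of_nat_nat)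
   then show "\<alpha> + of_int (a + 1) - (\<alpha> + of_int (b - 1)) : \<nat>" by simp
   have "generic_type_Reg P" unfolding generic_type_Reg_def using rs at0
   proof eventually_elim
    case (elim t)
    then show ?case using logarithmic_fibre[of t a b "1 / f t"] II(2) tb by auto
   qed
   then show "generic_type_Reg P \<or> generic_type_Log P" ..
   show "(\<alpha> + of_int (a + 1) = \<alpha> + of_int a & \<alpha> + of_int (b - 1) = \<alpha> + of_int (a - int k) + 1 & special_I a k) \<or>
    (\<alpha> + of_int (a + 1) = \<alpha> + of_int a + 1 & \<alpha> + of_int (b - 1) = \<alpha> + of_int (a - int k) & special_II a k) \<or>
    (\<alpha> + of_int (a + 1) = \<alpha> + of_int a & \<alpha> + of_int (b - 1) = \<alpha> + of_int (a - int k) & special_III a k)"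
    unfolding k using nfII by simp
   show "\<forall>\<^sub>F t in nhds 0. t : base P & (EX a b h. nf_basis (restr P t) E t a b h)" using nh0
   proof eventually_elim
    case (elim t)
    then show ?case using II(2,3) tb b0 by (cases "t = 0") blast+
   qed
  qed
 qed
qed

section \<open>Uniqueness of the invariant\<close>

lemma bases_related_germ:
 assumes op: "open (base P)" and b0: "0 : base P"
  and V: "lattice_basis P E (0, 0) V" "lattice_basis P E (0, 0) V'"
  and Vi: "!!y. y : punctured P ==> invertible (V y)"
  and f: "f holomorphic_on ball 0 eps" "f' holomorphic_on ball 0 eps" "eps > 0"
 obtains W C where "rel_open (base P) W" "hol2_mat_on C W" "!!y. y : W ==> fst y ~= 0 ==> V' y = V y ** C y"
  "hol2_on (%y. f (snd y)) W" "hol2_on (%y. f' (snd y)) W" "\<forall>\<^sub>F t in nhds 0. (0, t) : W"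
proof -
 obtain W C where W: "rel_open (base P) W" "(0, 0) : W" "hol2_mat_on C W"
  and C: "ALL y:W. fst y ~= 0 --> V' y = V y ** C y"
  using lattice_bases_related[OF _ _ V Vi] b0 by (simp del: matrix_mult2) blast
 define W' where "W' = W Int UNIV \<times> (ball 0 eps Int base P)"
 have "rel_open (base P) (UNIV \<times> (ball 0 eps Int base P))"
  by (rule open_subset) (use op in \<open>auto intro!: open_Times\<close>)
 then have W': "rel_open (base P) W'" unfolding W'_def by (intro rel_open_Int W)
 have h: "hol2_on (%y. g (snd y)) W'" if "g holomorphic_on ball 0 eps" for g
  by (rule hol2_on_subset[OF hol2_on_of_snd[OF that open_ball, of UNIV]]) (auto simp: W'_def)
 show ?thesis
 proof (rule that[OF W'])
  show "hol2_mat_on C W'" by (rule hol2_mat_on_subset[OF W(3)]) (auto simp: W'_def)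
  show "V' y = V y ** C y" if "y : W'" "fst y ~= 0" for y using C that unfolding W'_def by blast
  show "hol2_on (%y. f (snd y)) W'" "hol2_on (%y. f' (snd y)) W'" by (intro h f)+
  have "(0, 0) : W'" using W(2) b0 f(3) by (simp add: W'_def)
  from rel_open_ev_snd[OF W' this] show "\<forall>\<^sub>F t in nhds 0. (0, t) : W'" using op b0 by (simp add: interior_open)
 qed
qed

lemma powi_diff_nat: "(z::complex) ~= 0 ==> z powi (a - int k) * z ^ k = z powi a"
 using powi_split[of z "a - int k" "int k"] by simp

text \<open>
 The holomorphic matrix relating the two bases is lower triangular with constant diagonal; its remaining row,
 divided by the lowest power of \<open>z\<close>, yields \<open>f' = f\<close> at \<open>z = 0\<close>.
\<close>

theorem form_I_unique:
 assumes op: "open (base P)" and b0: "0 : base P" and conn: "connected (base P)"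
  and k: "k >= 1"
  and L: "linked P (\<alpha> + of_int a) (\<alpha> + of_int (a - int k)) s1 s2" "linked P (\<alpha> + of_int a) (\<alpha> + of_int (a - int k)) s1' s2'"
  and N: "normal_form_I P s1 s2 f" "normal_form_I P s1' s2' f'"
 shows "\<forall>\<^sub>F t in nhds 0. f' t = f t"
proof -
 define b where "b = a - int k + 1"
 have kb: "a - int k = b - 1" by (simp add: b_def)
 obtain l d where l: "l ~= 0" and s: "ALL x:punctured P. s1 x = E x *v power_vec a l d x"
  "ALL x:punctured P. s2 x = E x *v power_vec (b - 1) 0 l x" using linked_coords[OF conn L(1)] unfolding kb by metis
 obtain l' d' where l': "l' ~= 0" and s': "ALL x:punctured P. s1' x = E x *v power_vec a l' d' x"
  "ALL x:punctured P. s2' x = E x *v power_vec (b - 1) 0 l' x" using linked_coords[OF conn L(2)] unfolding kb by metis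
 have G: "nonzero_vanishing_germ f" "nonzero_vanishing_germ f'" using N by (auto simp: normal_form_I_def)
 let ?V = "%l d f y. mat2 (l * fst y powi a) 0 (d * fst y powi a + f (snd y) * (l * fst y powi (b - 1))) (l * fst y powi b)"
 have V: "lattice_basis P E (0, 0) (?V l d f)" "lattice_basis P E (0, 0) (?V l' d' f')"
  using N unfolding normal_form_I_def form_I_basis[OF s, where f=f] form_I_basis[OF s', where f=f'] by blast+
 obtain eps1 eps2 where "eps1 > 0" "f holomorphic_on ball 0 eps1" "eps2 > 0" "f' holomorphic_on ball 0 eps2"
  using germ_holomorphic[OF G(1)] germ_holomorphic[OF G(2)] by blast
 then have h: "f holomorphic_on ball 0 (min eps1 eps2)" "f' holomorphic_on ball 0 (min eps1 eps2)" "min eps1 eps2 > 0"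
  by (auto elim: holomorphic_on_subset)
 have Vi: "invertible (?V l d f y)" if "y : punctured P" for y using l that by (auto simp: invertible_det_nz det_2)
 obtain W C where W: "rel_open (base P) W" "hol2_mat_on C W" "!!y. y : W ==> fst y ~= 0 ==> ?V l' d' f' y = ?V l d f y ** C y"
  and fW: "hol2_on (%y. f (snd y)) W" "hol2_on (%y. f' (snd y)) W" and ev: "\<forall>\<^sub>F t in nhds 0. (0, t) : W"
  by (rule bases_related_germ[OF op b0 V _ h], rule Vi, assumption) (rule that)
 have "d' * fst y ^ k + f' (snd y) * l' = (d * fst y ^ k + f (snd y) * l) * (l' / l) + l * fst y * C y $ 2 $ 1" if y: "y : W" for y
 proof (rule hol2_eq_at_zero[OF _ _ W(1) _ y, where p="%y. d' * fst y ^ k + f' (snd y) * l'" and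
    q="%y. (d * fst y ^ k + f (snd y) * l) * (l' / l) + l * fst y * C y $ 2 $ 1"])
  show "hol2_on (%y. d' * fst y ^ k + f' (snd y) * l') W"
   "hol2_on (%y. (d * fst y ^ k + f (snd y) * l) * (l' / l) + l * fst y * C y $ 2 $ 1) W"
   by (intro hol2_on_add hol2_on_mult hol2_on_const hol2_on_power hol2_on_fst fW hol2_mat_onD[OF W(2)])+
  fix y assume y: "y : W" "fst y ~= 0"
  define w where "w = fst y powi (a - int k)"
  have w0: "w ~= 0" using y by (simp add: w_def)
  have pa: "fst y powi a = w * fst y ^ k" using powi_diff_nat[OF y(2), of a k] by (simp add: w_def)
  have pb: "fst y powi (b - 1) = w" by (simp add: w_def b_def)
  have pb': "fst y powi b = w * fst y" using powi_split[OF y(2), of "b - 1" 1] pb by simp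
  note M = W(3)[OF y]
  have "l' * (w * fst y ^ k) = l * (w * fst y ^ k) * C y $ 1 $ 1"
   using arg_cong[OF M, of "%A. A $ 1 $ 1"] by (simp add: pa)
  then have C1: "C y $ 1 $ 1 = l' / l" using w0 y(2) l by (simp add: field_simps)
  have "d' * (w * fst y ^ k) + f' (snd y) * (l' * w) =
    (d * (w * fst y ^ k) + f (snd y) * (l * w)) * C y $ 1 $ 1 + l * (w * fst y) * C y $ 2 $ 1"
   using arg_cong[OF M, of "%A. A $ 2 $ 1"] by (simp add: pa pb pb')
  then have "w * (d' * fst y ^ k + f' (snd y) * l') = w * ((d * fst y ^ k + f (snd y) * l) * (l' / l) + l * fst y * C y $ 2 $ 1)"
   unfolding C1 by (simp add: algebra_simps)
  then show "d' * fst y ^ k + f' (snd y) * l' = (d * fst y ^ k + f (snd y) * l) * (l' / l) + l * fst y * C y $ 2 $ 1"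
   by (rule mult_left_cancel[OF w0, THEN iffD1])
 qed
 note at = this
 show ?thesis using ev
 proof eventually_elim
  case (elim t)
  have "(0::complex) ^ k = 0" using k by (simp add: power_0_left)
  note at0 = at[OF elim, unfolded fst_conv snd_conv this]
  then show ?case using l l' by simp
 qed
qed

text \<open>
 At \<open>z = 0\<close> the first column of the relating matrix gives \<open>f' l' = f l C\<close> and, for
 \<open>k \<noteq> 0\<close>, \<open>l' = l C\<close>. For \<open>k = 0\<close> the second equation contains
 \<open>d\<close> and \<open>d'\<close> as well, and eliminating \<open>C\<close> gives a fractional linear
 relation.
\<close>

theorem form_II_unique:
 assumes op: "open (base P)" and b0: "0 : base P" and conn: "connected (base P)"
  and L: "linked P (\<alpha> + of_int a) (\<alpha> + of_int (a - int k)) s1 s2" "linked P (\<alpha> + of_int a) (\<alpha> + of_int (a - int k)) s1' s2'"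
  and N: "normal_form_II P s1 s2 f" "normal_form_II P s1' s2' f'"
 shows "k ~= 0 ==> \<forall>\<^sub>F t in nhds 0. f' t = f t"
  and "k = 0 ==> EX c. \<forall>\<^sub>F t in nhds 0. f' t = f t / (1 + c * f t)"
proof -
 define b where "b = a - int k + 1"
 have kb: "a - int k = b - 1" by (simp add: b_def)
 obtain l d where l: "l ~= 0" and s: "ALL x:punctured P. s1 x = E x *v power_vec a l d x"
  "ALL x:punctured P. s2 x = E x *v power_vec (b - 1) 0 l x" using linked_coords[OF conn L(1)] unfolding kb by metis
 obtain l' d' where l': "l' ~= 0" and s': "ALL x:punctured P. s1' x = E x *v power_vec a l' d' x"
  "ALL x:punctured P. s2' x = E x *v power_vec (b - 1) 0 l' x" using linked_coords[OF conn L(2)] unfolding kb by metis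
 have G: "nonzero_vanishing_germ f" "nonzero_vanishing_germ f'" using N by (auto simp: normal_form_II_def)
 let ?V = "%l d f y. mat2 (f (snd y) * (l * fst y powi a)) (l * fst y powi (a + 1))
   (l * fst y powi (b - 1) + f (snd y) * (d * fst y powi a)) (d * fst y powi (a + 1))"
 have V: "lattice_basis P E (0, 0) (?V l d f)" "lattice_basis P E (0, 0) (?V l' d' f')"
  using N unfolding normal_form_II_def form_II_basis[OF s, where f=f] form_II_basis[OF s', where f=f'] by blast+
 obtain eps1 eps2 where "eps1 > 0" "f holomorphic_on ball 0 eps1" "eps2 > 0" "f' holomorphic_on ball 0 eps2"
  using germ_holomorphic[OF G(1)] germ_holomorphic[OF G(2)] by blast
 then have h: "f holomorphic_on ball 0 (min eps1 eps2)" "f' holomorphic_on ball 0 (min eps1 eps2)" "min eps1 eps2 > 0"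
  by (auto elim: holomorphic_on_subset)
 have Vi: "invertible (?V l d f y)" if "y : punctured P" for y
 proof -
  have z: "fst y ~= 0" using that by auto
  have "det (?V l d f y) = - (l * l * (fst y powi (a + 1) * fst y powi (b - 1)))" by (simp add: det_2 algebra_simps)
  then show ?thesis using l z by (simp add: invertible_det_nz)
 qed
 obtain W C where W: "rel_open (base P) W" "hol2_mat_on C W" "!!y. y : W ==> fst y ~= 0 ==> ?V l' d' f' y = ?V l d f y ** C y"
  and fW: "hol2_on (%y. f (snd y)) W" "hol2_on (%y. f' (snd y)) W" and ev: "\<forall>\<^sub>F t in nhds 0. (0, t) : W"
  by (rule bases_related_germ[OF op b0 V _ h], rule Vi, assumption) (rule that)
 have off: "f' (snd y) * l' = f (snd y) * l * C y $ 1 $ 1 + l * fst y * C y $ 2 $ 1"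
  "l' + f' (snd y) * d' * fst y ^ k = (l + f (snd y) * d * fst y ^ k) * C y $ 1 $ 1 + d * fst y ^ Suc k * C y $ 2 $ 1"
  if y: "y : W" "fst y ~= 0" for y
 proof -
  define w where "w = fst y powi (a - int k)"
  have w0: "w ~= 0" "w * fst y ^ k ~= 0" using y by (simp_all add: w_def)
  have pa: "fst y powi a = w * fst y ^ k" using powi_diff_nat[OF y(2), of a k] by (simp add: w_def)
  have pa': "fst y powi (a + 1) = w * fst y ^ k * fst y" using powi_split[OF y(2), of a 1] pa by simp
  have pb: "fst y powi (b - 1) = w" by (simp add: w_def b_def)
  note M = W(3)[OF y, unfolded pa pa' pb]
  have "f' (snd y) * (l' * (w * fst y ^ k)) =
    f (snd y) * (l * (w * fst y ^ k)) * C y $ 1 $ 1 + l * (w * fst y ^ k * fst y) * C y $ 2 $ 1"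
   using arg_cong[OF M, of "%A. A $ 1 $ 1"] by (simp only: matrix_mult2 mat2_nth)
  then have "(w * fst y ^ k) * (f' (snd y) * l') = (w * fst y ^ k) * (f (snd y) * l * C y $ 1 $ 1 + l * fst y * C y $ 2 $ 1)"
   by (simp only: ring_distribs mult_ac)
  then show "f' (snd y) * l' = f (snd y) * l * C y $ 1 $ 1 + l * fst y * C y $ 2 $ 1"
   by (rule mult_left_cancel[OF w0(2), THEN iffD1])
  have "l' * w + f' (snd y) * (d' * (w * fst y ^ k)) =
    (l * w + f (snd y) * (d * (w * fst y ^ k))) * C y $ 1 $ 1 + d * (w * fst y ^ k * fst y) * C y $ 2 $ 1"
   using arg_cong[OF M, of "%A. A $ 2 $ 1"] by (simp only: matrix_mult2 mat2_nth)
  then have "w * (l' + f' (snd y) * d' * fst y ^ k) =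
    w * ((l + f (snd y) * d * fst y ^ k) * C y $ 1 $ 1 + d * fst y ^ Suc k * C y $ 2 $ 1)"
   by (simp only: ring_distribs mult_ac power_Suc)
  then show "l' + f' (snd y) * d' * fst y ^ k = (l + f (snd y) * d * fst y ^ k) * C y $ 1 $ 1 + d * fst y ^ Suc k * C y $ 2 $ 1"
   by (rule mult_left_cancel[OF w0(1), THEN iffD1])
 qed
 have on: "f' (snd y) * l' = f (snd y) * l * C y $ 1 $ 1 + l * fst y * C y $ 2 $ 1" if y: "y : W" for y
  by (rule hol2_eq_at_zero[OF _ _ W(1) off(1) y])
    (intro hol2_on_add hol2_on_mult hol2_on_const hol2_on_fst fW hol2_mat_onD[OF W(2)])+
 have on2: "l' + f' (snd y) * d' * fst y ^ k = (l + f (snd y) * d * fst y ^ k) * C y $ 1 $ 1 + d * fst y ^ Suc k * C y $ 2 $ 1"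
  if y: "y : W" for y by (rule hol2_eq_at_zero[OF _ _ W(1) off(2) y])
    (intro hol2_on_add hol2_on_mult hol2_on_const hol2_on_fst hol2_on_power fW hol2_mat_onD[OF W(2)])+
 show "\<forall>\<^sub>F t in nhds 0. f' t = f t" if k: "k ~= 0" using ev
 proof eventually_elim
  case (elim t)
  have "(0::complex) ^ k = 0" using k by (simp add: power_0_left)
  note on2' = on2[OF elim, unfolded fst_conv snd_conv this]
  have "l' = l * C (0, t) $ 1 $ 1" "f' t * l' = f t * l * C (0, t) $ 1 $ 1" using on[OF elim] on2' by simp_all
  then have "f' t * l' = f t * l'" by (simp add: mult.assoc)
  then show ?case using l' by simp
 qed
 show "EX c. \<forall>\<^sub>F t in nhds 0. f' t = f t / (1 + c * f t)" if k: "k = 0"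
 proof -
  define c where "c = (l' * d - l * d') / (l * l')"
  have "(%t. 1 + c * f t) holomorphic_on ball 0 (min eps1 eps2)" by (intro holomorphic_intros h)
  moreover have "1 + c * f 0 ~= 0" using G(1) by (simp add: nonzero_vanishing_germ_def)
  ultimately obtain \<eta> where \<eta>: "\<eta> > 0" "ALL t:ball 0 \<eta>. 1 + c * f t ~= 0"
   using holomorphic_nonzero_near_centre[OF _ h(3)] by blast
  have "\<forall>\<^sub>F t in nhds 0. f' t = f t / (1 + c * f t)" using ev ev_ball[OF \<eta>(1)]
  proof eventually_elim
   case (elim t)
   let ?C = "C (0, t) $ 1 $ 1"
   have e1: "f' t * l' = f t * l * ?C" and e2: "l' + f' t * d' = (l + f t * d) * ?C"
    using on[OF elim(1)] on2[OF elim(1)] by (simp_all add: k)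
   have "f' t * l' * (l + f t * d) = f t * l * (l' + f' t * d')" unfolding e1 e2 by (simp only: mult_ac)
   then have "f' t * (l * l' + (l' * d - l * d') * f t) = f t * (l * l')" by (simp add: algebra_simps)
   moreover have "l * l' + (l' * d - l * d') * f t = (l * l') * (1 + c * f t)"
    using l l' by (simp add: c_def field_simps)
   ultimately have "(l * l') * (f' t * (1 + c * f t)) = (l * l') * f t" by (simp only: mult_ac)
   then have "f' t * (1 + c * f t) = f t" using l l' by (simp only: mult_cancel_left mult_eq_0_iff simp_thms)
   moreover have "1 + c * f t ~= 0" using \<eta>(2) elim(2) by blast
   ultimately show ?case by (simp add: eq_divide_eq)
  qed
  then show ?thesis by blast
 qed
qed

end

section \<open>Gauge isomorphisms\<close>

text \<open>
 Gauge isomorphisms without the compatibility with the connections, which enters only through the transported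
 frame; in this form the inverse is obvious.
\<close>

definition bundle_iso :: "te => te => (pt => complex^2^2) => bool" where
 "bundle_iso P Q \<Phi> \<longleftrightarrow> te_structure P & te_structure Q & base P = base Q &
   (ALL x:total_base P. invertible (\<Phi> x)) &
   (ALL c:atlas P. ALL c':atlas Q.
    hol2_mat_on (%x. triv c' x ** \<Phi> x ** matrix_inv (triv c x)) (chart_dom c Int chart_dom c'))"

lemma bundle_isoD:
 assumes "bundle_iso P Q \<Phi>"
 shows "te_structure P" "te_structure Q" "base P = base Q" "x : total_base P ==> invertible (\<Phi> x)"
  "c : atlas P ==> c' : atlas Q ==>
    hol2_mat_on (%x. triv c' x ** \<Phi> x ** matrix_inv (triv c x)) (chart_dom c Int chart_dom c')"
 using assms unfolding bundle_iso_def by blast+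

lemma bundle_iso_inv:
 assumes iso: "bundle_iso P Q \<Phi>"
 shows "bundle_iso Q P (%x. matrix_inv (\<Phi> x))" unfolding bundle_iso_def
proof (intro conjI ballI)
 note I = bundle_isoD[OF iso]
 show "te_structure Q" "te_structure P" "base Q = base P" using I(1-3) by simp_all
 show "invertible (matrix_inv (\<Phi> x))" if "x : total_base Q" for x
  by (rule invertible_inv[OF I(4)]) (use that I(3) in simp)
 fix c' c assume c: "c' : atlas Q" "c : atlas P"
 let ?X = "%x. triv c' x ** \<Phi> x ** matrix_inv (triv c x)"
 have h: "hol2_mat_on ?X (chart_dom c' Int chart_dom c)" by (rule hol2_mat_on_subset[OF I(5)[OF c(2,1)]]) auto
 have X: "invertible (?X x)" "matrix_inv (?X x) = triv c x ** matrix_inv (\<Phi> x) ** matrix_inv (triv c' x)"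
  if x: "x : chart_dom c' Int chart_dom c" for x
 proof -
  have i: "invertible (triv c x)" "invertible (triv c' x)" "invertible (\<Phi> x)"
   using x te_structureD(5,6)[OF I(1) c(2)] te_structureD(5)[OF I(2) c(1)] I(4) by blast+
  show "invertible (?X x)" by (intro invertible_mult invertible_inv i)
  show "matrix_inv (?X x) = triv c x ** matrix_inv (\<Phi> x) ** matrix_inv (triv c' x)" by (rule matrix_inv_unique)
    (simp only: matrix_mul_assoc[symmetric] inv_cancel(3)[OF i(1)] inv_cancel(4)[OF i(3)] inv_cancel(2)[OF i(2)])
 qed
 have "hol2_mat_on (%x. matrix_inv (?X x)) (chart_dom c' Int chart_dom c)" by (rule hol2_mat_on_inv[OF h X(1)])
 then show "hol2_mat_on (%x. triv c x ** matrix_inv (\<Phi> x) ** matrix_inv (triv c' x)) (chart_dom c' Int chart_dom c)"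
  by (rule hol2_mat_on_cong[OF X(2), THEN iffD1, rotated])
qed

lemma bundle_iso_restr:
 assumes iso: "bundle_iso P Q \<Phi>" and t: "t : base P"
 shows "bundle_iso (restr P t) (restr Q t) \<Phi>" unfolding bundle_iso_def
proof (intro conjI ballI)
 note I = bundle_isoD[OF iso]
 show "te_structure (restr P t)" "te_structure (restr Q t)" using t I(3) by (intro te_structure_restr I(1,2); simp)+
 show "base (restr P t) = base (restr Q t)" by simp
 show "invertible (\<Phi> x)" if "x : total_base (restr P t)" for x by (rule I(4)) (use that t in auto)
 fix c c' assume "c : atlas (restr P t)" "c' : atlas (restr Q t)"
 then obtain d d' where d: "d : atlas P" "d' : atlas Q" and c: "c = restr_chart d t" "c' = restr_chart d' t" by auto
 show "hol2_mat_on (%x. triv c' x ** \<Phi> x ** matrix_inv (triv c x)) (chart_dom c Int chart_dom c')"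
  unfolding c by (simp del: matrix_mult2) (rule hol2_mat_on_subset[OF I(5)[OF d]], auto)
qed

lemma bundle_iso_direct_sum:
 assumes iso: "bundle_iso P Q \<Phi>" and x: "x : total_base P" "fst x = 0" and s: "stalk_direct_sum P x v1 v2"
 shows "stalk_direct_sum Q x (%y. \<Phi> y *v v1 y) (%y. \<Phi> y *v v2 y)"
proof -
 note I = bundle_isoD[OF iso]
 have xq: "x : total_base Q" using x I(3) by simp
 obtain c where c: "c : atlas P" "x : chart_dom c" using te_structureD(3)[OF I(1) x(1)] by blast
 obtain c' where c': "c' : atlas Q" "x : chart_dom c'" using te_structureD(3)[OF I(2) xq] by blast
 obtain W K where W: "rel_open (base P) W" "x : W" "W \<subseteq> chart_dom c" "hol2_mat_on K W" "det (K x) ~= 0"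
  and K: "ALL y:W. fst y ~= 0 --> K y = triv c y ** colmat (v1 y) (v2 y)"
  using s unfolding stalk_direct_sum_iff[OF I(1) c x(2)] by (elim exE conjE) (rule that)
 let ?X = "%y. triv c' y ** \<Phi> y ** matrix_inv (triv c y)" and ?W = "W Int chart_dom c'"
 have Xi: "invertible (?X x)"
  by (intro invertible_mult invertible_inv te_structureD(5)[OF I(1) c] te_structureD(5)[OF I(2) c'] I(4) x)
 have f1: "rel_open (base Q) ?W" using rel_open_Int[OF W(1)[unfolded I(3)] te_structureD(4)[OF I(2) c'(1)]] .
 have f2: "hol2_mat_on (%y. ?X y ** K y) ?W"
  by (intro hol2_mat_on_mult hol2_mat_on_subset[OF I(5)[OF c(1) c'(1)]] hol2_mat_on_subset[OF W(4)]) (use W(3) in auto)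
 have f3: "det (?X x ** K x) ~= 0" unfolding det_mult2 using Xi W(5) by (simp add: invertible_det_nz det_mult2)
 have f4: "?X y ** K y = triv c' y ** colmat (\<Phi> y *v v1 y) (\<Phi> y *v v2 y)" if y: "y : ?W" "fst y ~= 0" for y
 proof -
  have i: "invertible (triv c y)" using y W(3) te_structureD(5)[OF I(1) c(1)] by blast
  have "K y = triv c y ** colmat (v1 y) (v2 y)" using K y by blast
  then show ?thesis by (simp only: colmat_mult[symmetric] matrix_mul_assoc[symmetric] inv_cancel(3)[OF i])
 qed
 show ?thesis unfolding stalk_direct_sum_iff[OF I(2) c' x(2)]
  by (rule exI[of _ ?W], rule exI[of _ "%y. ?X y ** K y"]) (use f1 f2 f3 f4 W(2) c'(2) in blast)
qed

text \<open>The connection matrix of the transported frame is read off from its columns, on which the isomorphism commutes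
 with the two connections.\<close>

lemma gauge_frame:
 assumes fr: "framed_te P \<alpha> E" and op: "open (base P)" and iso: "bundle_iso P Q \<Phi>"
  and comm: "!!\<sigma> x. holsec_on P \<sigma> (punctured P) ==> x : punctured P ==>
    nabla_z Q (%y. \<Phi> y *v \<sigma> y) x = \<Phi> x *v nabla_z P \<sigma> x &
    (snd x : interior (base P) --> nabla_t Q (%y. \<Phi> y *v \<sigma> y) x = \<Phi> x *v nabla_t P \<sigma> x)"
 shows "framed_te Q \<alpha> (%x. \<Phi> x ** E x)"
proof -
 interpret framed_te P \<alpha> E by (rule fr)
 note I = bundle_isoD[OF iso]
 have pq: "punctured Q = punctured P" using I(3) by simp
 have h: "hol2_mat_on (%x. triv c' x ** (\<Phi> x ** E x)) (chart_dom c' Int punctured P)" if c': "c' : atlas Q" for c'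
 proof (rule hol2_mat_on_local)
  fix x assume x: "x : chart_dom c' Int punctured P"
  then obtain c where c: "c : atlas P" "x : chart_dom c" using teD(3)[of x] by auto
  have o: "open (chart_dom c)" using teD(4)[OF c(1)] openin_open_eq[OF open_Times[OF open_UNIV op]] by blast
  have "hol2_mat_on (%x. (triv c' x ** \<Phi> x ** matrix_inv (triv c x)) ** (triv c x ** E x))
    (chart_dom c' Int punctured P Int chart_dom c)"
   by (intro hol2_mat_on_mult hol2_mat_on_subset[OF I(5)[OF c(1) c']] hol2_mat_on_subset[OF E_hol[OF c(1)]]) auto
  note m1 = this
  have m2: "(triv c' y ** \<Phi> y ** matrix_inv (triv c y)) ** (triv c y ** E y) = triv c' y ** (\<Phi> y ** E y)"
   if "y : chart_dom c' Int punctured P Int chart_dom c" for y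
   using that by (simp only: matrix_mul_assoc[symmetric] inv_cancel(3)[OF teD(5)[OF c(1)]] Int_iff)
  have "hol2_mat_on (%x. triv c' x ** (\<Phi> x ** E x)) (chart_dom c' Int punctured P Int chart_dom c)"
   by (rule hol2_mat_on_cong[OF m2, THEN iffD1, OF _ m1])
  then show "EX V. open V & x : V & hol2_mat_on (%x. triv c' x ** (\<Phi> x ** E x)) (chart_dom c' Int punctured P Int V)"
   using o c(2) by blast
 qed
 define u where "u j = (axis j 1 :: complex^2)" for j :: 2
 define \<sigma> where "\<sigma> j y = E y *v u j" for j y
 have s\<sigma>: "holsec_on P (\<sigma> j) (punctured P)" for j
  unfolding holsec_frame[OF rel_open_punctured subset_refl \<sigma>_def] by (auto intro!: hol2_vec_onI)
 have s\<sigma>Q: "holsec_on Q (%y. \<Phi> y *v \<sigma> j y) (punctured P)" for j unfolding holsec_on_def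
 proof
  fix c' assume c': "c' : atlas Q"
  have "hol2_vec_on (%y. (triv c' y ** (\<Phi> y ** E y)) *v u j) (punctured P Int chart_dom c')"
   by (rule hol2_vec_on_mult[OF hol2_mat_on_subset[OF h[OF c']]]) (auto intro!: hol2_vec_onI)
  then show "hol2_vec_on (%x. triv c' x *v (\<Phi> x *v \<sigma> j x)) (punctured P Int chart_dom c')"
   by (simp only: \<sigma>_def matrix_vector_mul_assoc)
 qed
 have kz: "zdiff (%y. u j $ i) x" "tdiff (%y. u j $ i) x" for i j x by (simp_all add: zdiff_def tdiff_def)
 have k0: "dz_vec (%y. u j) x = 0" "dt_vec (%y. u j) x = 0" for j x by (simp_all add: dz_vec_def dt_vec_def vec_eq_iff)
 have col: "column 1 A = A *v u 1" "column 2 A = A *v u 2" for A :: "complex^2^2"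
  by (simp_all add: u_def vec_eq_iff column_def axis_def)
 have cols: "A = B" if "!!j. A *v u j = B *v u j" for A B :: "complex^2^2"
  by (rule columns_eqI) (simp_all only: col that)
 have rQ: "rel_open (base Q) (punctured P)" using rel_open_punctured[of "base Q"] I(3) by simp
 have "adapted_frame Q \<alpha> (%x. \<Phi> x ** E x)" unfolding adapted_frame_def pq
 proof (intro conjI ballI)
  show "te_structure Q" by (rule I)
  show "invertible (\<Phi> x ** E x)" if "x : punctured P" for x
   by (intro invertible_mult I(4) E_inv that) (use that in auto)
  fix c' assume c': "c' : atlas Q"
  show "hol2_mat_on (%x. triv c' x ** (\<Phi> x ** E x)) (chart_dom c' Int punctured P)" by (rule h[OF c'])
  fix x assume x: "x : chart_dom c' Int punctured P"
  then have x': "x : punctured P" "x : chart_dom c'" by auto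
  let ?G = "%x. triv c' x ** (\<Phi> x ** E x)"
  have rW: "rel_open (base Q) (chart_dom c' Int punctured P)"
   by (rule rel_open_Int[OF te_structureD(4)[OF I(2) c'] rQ])
  have Gu: "(%y. triv c' y *v (\<Phi> y *v \<sigma> j y)) = (%y. ?G y *v u j)" for j
   by (simp only: \<sigma>_def matrix_vector_mul_assoc)
  note nc = nabla_chart[OF I(2) rQ _ s\<sigma>Q c' x', unfolded Gu]
  show "dz_mat ?G x + omega_z c' x ** ?G x = ?G x ** jordan_pole \<alpha> (fst x)"
  proof (rule cols)
   fix j
   have d: "dz_vec (%y. ?G y *v u j) x = dz_mat ?G x *v u j + ?G x *v dz_vec (%y. u j) x"
    by (rule dz_vec_mult[OF hol2_on_zdiff[OF hol2_mat_onD[OF h[OF c']] rW x] kz(1)])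
   have n: "nabla_z P (\<sigma> j) x = E x *v (dz_vec (%y. u j) x + jordan_pole \<alpha> (fst x) *v u j)"
    by (rule nabla_z_frame[OF x'(1) kz(1)]) (simp add: \<sigma>_def)
   have "(dz_mat ?G x + omega_z c' x ** ?G x) *v u j = dz_vec (%y. ?G y *v u j) x + omega_z c' x *v (?G x *v u j)"
    unfolding d k0 mat_vec_sums by (simp only: matrix_vector_mul_assoc add_0_right)
   also have "\<dots> = triv c' x *v nabla_z Q (%y. \<Phi> y *v \<sigma> j y) x"
    using nc(1)[of j] fun_cong[OF Gu[of j], of x] pq by (simp del: matrix_vec2 matrix_mult2)
   also have "nabla_z Q (%y. \<Phi> y *v \<sigma> j y) x = \<Phi> x *v nabla_z P (\<sigma> j) x"
    using comm[OF s\<sigma> x'(1)] by blast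
   also have "triv c' x *v (\<Phi> x *v nabla_z P (\<sigma> j) x) = (?G x ** jordan_pole \<alpha> (fst x)) *v u j"
    unfolding n k0 add_0_left by (simp only: matrix_vector_mul_assoc matrix_mul_assoc)
   finally show "(dz_mat ?G x + omega_z c' x ** ?G x) *v u j = (?G x ** jordan_pole \<alpha> (fst x)) *v u j" .
  qed
  show "snd x : interior (base Q) --> dt_mat ?G x + omega_t c' x ** ?G x = 0"
  proof (intro impI cols)
   fix j assume xi: "snd x : interior (base Q)"
   then have xi': "snd x : interior (base P)" using I(3) by simp
   have d: "dt_vec (%y. ?G y *v u j) x = dt_mat ?G x *v u j + ?G x *v dt_vec (%y. u j) x"
    by (rule dt_vec_mult[OF hol2_on_tdiff[OF hol2_mat_onD[OF h[OF c']] rW x xi] kz(2)])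
   have n: "nabla_t P (\<sigma> j) x = E x *v dt_vec (%y. u j) x"
    by (rule nabla_t_frame[OF x'(1) xi' kz(2)]) (simp add: \<sigma>_def)
   have "(dt_mat ?G x + omega_t c' x ** ?G x) *v u j = dt_vec (%y. ?G y *v u j) x + omega_t c' x *v (?G x *v u j)"
    unfolding d k0 mat_vec_sums by (simp only: matrix_vector_mul_assoc add_0_right)
   also have "\<dots> = triv c' x *v nabla_t Q (%y. \<Phi> y *v \<sigma> j y) x"
    using nc(2)[of j] xi fun_cong[OF Gu[of j], of x] pq by (simp del: matrix_vec2 matrix_mult2)
   also have "nabla_t Q (%y. \<Phi> y *v \<sigma> j y) x = \<Phi> x *v nabla_t P (\<sigma> j) x"
    using comm[OF s\<sigma> x'(1)] xi' by blast
   also have "triv c' x *v (\<Phi> x *v nabla_t P (\<sigma> j) x) = 0 *v u j"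
    unfolding n k0 mat_vec_sums by (simp add: vec_eq_iff)
   finally show "(dt_mat ?G x + omega_t c' x ** ?G x) *v u j = 0 *v u j" .
  qed
 qed
 then show ?thesis by (simp add: framed_te_def)
qed

locale framed_iso = P: framed_te P \<alpha> E + Q: framed_te Q \<alpha> E' for P Q :: te and \<alpha> E E' +
 fixes \<Phi> :: "pt => complex^2^2"
 assumes iso: "bundle_iso P Q \<Phi>" and E': "!!x. x : punctured P ==> E' x = \<Phi> x ** E x"
  and conn: "connected (base P)"
  and nf: "\<forall>\<^sub>F t in nhds 0. t : base P & (EX a b h. nf_basis (restr P t) E t a b h)"
begin

lemma base_eq: "base Q = base P" using bundle_isoD(3)[OF iso] by simp

lemma base0: "0 : base P" using eventually_nhds_x_imp_x[OF nf] by blast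

lemma nf_basis_transfer:
 assumes t: "t : base P" and n: "nf_basis (restr P t) E t a b h"
 shows "nf_basis (restr Q t) E' t a b h"
proof -
 let ?V = "%y. nf_mat a b h (fst y)"
 have "stalk_direct_sum (restr P t) (0, t) (%y. E y *v column 1 (?V y)) (%y. E y *v column 2 (?V y))"
  using n unfolding nf_basis_def lattice_basis_def by (rule conjunct2)
 from bundle_iso_direct_sum[OF bundle_iso_restr[OF iso t] _ _ this]
 have "stalk_direct_sum (restr Q t) (0, t) (%y. \<Phi> y *v (E y *v column 1 (?V y))) (%y. \<Phi> y *v (E y *v column 2 (?V y)))"
  by simp
 moreover have "stalk_direct_sum (restr Q t) (0, t) (%y. \<Phi> y *v (E y *v column 1 (?V y))) (%y. \<Phi> y *v (E y *v column 2 (?V y)))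
   \<longleftrightarrow> lattice_basis (restr Q t) E' (0, t) ?V" unfolding lattice_basis_def
 proof (rule stalk_direct_sum_cong)
  fix y assume "y : punctured (restr Q t)"
  then have "y : punctured P" using t by auto
  then show "\<Phi> y *v (E y *v column 1 (?V y)) = E' y *v column 1 (?V y)"
   "\<Phi> y *v (E y *v column 2 (?V y)) = E' y *v column 2 (?V y)" by (simp_all only: E' matrix_vector_mul_assoc)
 qed
 ultimately show ?thesis using n unfolding nf_basis_def by blast
qed

lemma exponents_transfer:
 assumes t: "t : base P" and n: "nf_basis (restr P t) E t a b h" and l: "leading_exponents (restr P t) \<beta>1 \<beta>2"
 shows "leading_exponents (restr Q t) \<beta>1 \<beta>2" "\<beta>1 = \<alpha> + of_int a"
proof -
 note lp = P.leading_exponents_fibre[OF t n]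
 have e: "\<beta>1 = \<alpha> + of_int a" "\<beta>2 = \<alpha> + of_int (if h = 0 & b <= a then b else b - 1)"
  using lp l unfolding leading_exponents_def by blast+
 have "t : base Q" using t base_eq by simp
 from Q.leading_exponents_fibre[OF this nf_basis_transfer[OF t n]]
 show "leading_exponents (restr Q t) \<beta>1 \<beta>2" unfolding e .
 show "\<beta>1 = \<alpha> + of_int a" by (rule e)
qed

lemma generic_transfer:
 assumes g: "generic_leading_exponents P \<alpha>1 \<alpha>2"
 shows "generic_leading_exponents Q \<alpha>1 \<alpha>2" and "EX a. \<alpha>1 = \<alpha> + of_int a"
proof -
 have ev: "EV t. leading_exponents (restr Q t) \<alpha>1 \<alpha>2 & (EX a. \<alpha>1 = \<alpha> + of_int a)"
  using g[unfolded generic_leading_exponents_def] eventually_nhds_imp_at[OF nf]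
 proof eventually_elim
  case (elim t)
  then show ?case using exponents_transfer by blast
 qed
 then show "generic_leading_exponents Q \<alpha>1 \<alpha>2"
  unfolding generic_leading_exponents_def by eventually_elim (rule conjunct1)
 show "EX a. \<alpha>1 = \<alpha> + of_int a" using eventually_happens'[OF at_neq_bot ev] by blast
qed

lemma linked_transfer:
 assumes g: "\<alpha>1 = \<alpha> + of_int a" and l: "linked P \<alpha>1 \<alpha>2 s1 s2"
 shows "linked Q \<alpha>1 \<alpha>2 (%x. \<Phi> x *v s1 x) (%x. \<Phi> x *v s2 x)"
proof -
 obtain k m d where L: "m ~= 0" "\<alpha>2 = \<alpha> + of_int (a - int k)"
  and s: "ALL x:punctured P. s1 x = E x *v power_vec a m d x" "ALL x:punctured P. s2 x = E x *v power_vec (a - int k) 0 m x"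
  using l unfolding g P.linked_frame_iff[OF conn] by (elim exE conjE) (rule that)
 have "ALL x:punctured Q. \<Phi> x *v s1 x = E' x *v power_vec a m d x" "ALL x:punctured Q. \<Phi> x *v s2 x = E' x *v power_vec (a - int k) 0 m x"
  unfolding base_eq by (rule ballI, simp only: bspec[OF s(1)] bspec[OF s(2)] E' matrix_vector_mul_assoc)+
 then show ?thesis unfolding g Q.linked_frame_iff[OF conn[folded base_eq]] using L by blast
qed

lemma sum_transfer:
 assumes "stalk_direct_sum P (0, 0) v1 v2"
 shows "stalk_direct_sum Q (0, 0) (%y. \<Phi> y *v v1 y) (%y. \<Phi> y *v v2 y)"
 by (rule bundle_iso_direct_sum[OF iso _ _ assms]) (use base0 in simp_all)

lemma special_transfer:
 "leading_exponents (restr P 0) \<beta>1 \<beta>2 ==> leading_exponents (restr Q 0) \<beta>1 \<beta>2"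
 using exponents_transfer(1)[OF base0] eventually_nhds_x_imp_x[OF nf] by blast

lemma case_I_transfer:
 assumes "case_I_function P f" shows "case_I_function Q f"
proof -
 obtain \<alpha>1 \<alpha>2 s1 s2 where g: "generic_leading_exponents P \<alpha>1 \<alpha>2" and l0: "leading_exponents (restr P 0) \<alpha>1 (\<alpha>2 + 1)"
  and l: "linked P \<alpha>1 \<alpha>2 s1 s2" and n: "normal_form_I P s1 s2 f"
  using assms unfolding case_I_function_def by (elim exE conjE) (rule that)
 obtain a where a: "\<alpha>1 = \<alpha> + of_int a" using generic_transfer(2)[OF g] by blast
 have "normal_form_I Q (%x. \<Phi> x *v s1 x) (%x. \<Phi> x *v s2 x) f"
  using n sum_transfer[of "%x. s1 x + f (snd x) *s s2 x" "%x. fst x *s s2 x"]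
  unfolding normal_form_I_def mat_vec_sums smult_vec by blast
 then show ?thesis unfolding case_I_function_def
  using generic_transfer(1)[OF g] special_transfer[OF l0] linked_transfer[OF a l] by blast
qed

lemma case_II_transfer:
 assumes "case_II_function P f" shows "case_II_function Q f"
proof -
 obtain \<alpha>1 \<alpha>2 s1 s2 where g: "generic_leading_exponents P \<alpha>1 \<alpha>2" and l0: "leading_exponents (restr P 0) (\<alpha>1 + 1) \<alpha>2"
  and l: "linked P \<alpha>1 \<alpha>2 s1 s2" and n: "normal_form_II P s1 s2 f"
  using assms unfolding case_II_function_def by (elim exE conjE) (rule that)
 obtain a where a: "\<alpha>1 = \<alpha> + of_int a" using generic_transfer(2)[OF g] by blast
 have "normal_form_II Q (%x. \<Phi> x *v s1 x) (%x. \<Phi> x *v s2 x) f"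
  using n sum_transfer[of "%x. s2 x + f (snd x) *s s1 x" "%x. fst x *s s1 x"]
  unfolding normal_form_II_def mat_vec_sums smult_vec by blast
 then show ?thesis unfolding case_II_function_def
  using generic_transfer(1)[OF g] special_transfer[OF l0] linked_transfer[OF a l] by blast
qed

end

theorem gauge_case_functions:
 assumes g: "gauge_isomorphic P Q" and fr: "framed_te P \<alpha> E" and op: "open (base P)" and conn: "connected (base P)"
  and nf: "\<forall>\<^sub>F t in nhds 0. t : base P & (EX a b h. nf_basis (restr P t) E t a b h)"
 shows "case_I_function P f \<longleftrightarrow> case_I_function Q f" "case_II_function P f \<longleftrightarrow> case_II_function Q f"
proof -
 obtain \<Phi> where iso: "bundle_iso P Q \<Phi>"
  and comm: "ALL W \<sigma>. openin (top_of_set (total_base P)) W & W \<subseteq> punctured P & holsec_on P \<sigma> W -->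
     (ALL x:W. nabla_z Q (%y. \<Phi> y *v \<sigma> y) x = \<Phi> x *v nabla_z P \<sigma> x &
       (snd x : interior (base P) --> nabla_t Q (%y. \<Phi> y *v \<sigma> y) x = \<Phi> x *v nabla_t P \<sigma> x))"
  using g unfolding gauge_isomorphic_def bundle_iso_def by blast
 define E' where "E' x = \<Phi> x ** E x" for x
 have fQ: "framed_te Q \<alpha> E'" unfolding E'_def
 proof (rule gauge_frame[OF fr op iso])
  fix \<sigma> x assume s: "holsec_on P \<sigma> (punctured P)" and x: "x : punctured P"
  show "nabla_z Q (%y. \<Phi> y *v \<sigma> y) x = \<Phi> x *v nabla_z P \<sigma> x &
    (snd x : interior (base P) --> nabla_t Q (%y. \<Phi> y *v \<sigma> y) x = \<Phi> x *v nabla_t P \<sigma> x)"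
   by (rule comm[rule_format, OF _ x]) (use s rel_open_punctured in blast)
 qed
 have f1: "framed_iso P Q \<alpha> E E' \<Phi>"
  unfolding framed_iso_def framed_iso_axioms_def using fr fQ iso conn nf by (simp only: E'_def simp_thms)
 interpret F: framed_iso P Q \<alpha> E E' \<Phi> by (rule f1)
 have E: "E x = matrix_inv (\<Phi> x) ** E' x" if "x : punctured Q" for x
 proof -
  have "invertible (\<Phi> x)" by (rule bundle_isoD(4)[OF iso]) (use that F.base_eq in auto)
  then show ?thesis unfolding E'_def by (rule inv_cancel(3)[symmetric])
 qed
 have nfQ: "\<forall>\<^sub>F t in nhds 0. t : base Q & (EX a b h. nf_basis (restr Q t) E' t a b h)"
  using nf by eventually_elim (use F.nf_basis_transfer F.base_eq in blast)
 have f2: "framed_iso Q P \<alpha> E' E (%x. matrix_inv (\<Phi> x))"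
  unfolding framed_iso_def framed_iso_axioms_def F.base_eq using E[unfolded F.base_eq] nfQ[unfolded F.base_eq]
  by (intro conjI allI impI fr fQ bundle_iso_inv[OF iso] conn)
 show "case_I_function P f \<longleftrightarrow> case_I_function Q f" "case_II_function P f \<longleftrightarrow> case_II_function Q f"
  by (rule iffI, erule F.case_I_transfer, erule framed_iso.case_I_transfer[OF f2],
    rule iffI, erule F.case_II_transfer, erule framed_iso.case_II_transfer[OF f2])
qed

section \<open>The classification\<close>

context framed_te
begin

lemma C_space_not_kernel:
 assumes conn: "connected (base P)"
 shows "s1 : C_space P (\<alpha> + of_int a) - C_kernel P (\<alpha> + of_int a) \<longleftrightarrow>
  (EX l d. l ~= 0 & (ALL x:punctured P. s1 x = E x *v power_vec a l d x))" (is "?l \<longleftrightarrow> ?r")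
proof
 assume l: ?l
 then obtain c d where cd: "ALL x:punctured P. s1 x = E x *v power_vec a c d x"
  using C_space_frame_iff[OF conn] by blast
 have "c ~= 0" using l cd C_kernel_frame_iff[OF conn, of s1 a] by blast
 then show ?r using cd by blast
next
 assume ?r
 then obtain l d where l: "l ~= 0" and s: "ALL x:punctured P. s1 x = E x *v power_vec a l d x" by blast
 have "s1 \<notin> C_kernel P (\<alpha> + of_int a)"
 proof
  assume "s1 : C_kernel P (\<alpha> + of_int a)"
  then obtain d' where d': "ALL x:punctured P. s1 x = E x *v power_vec a 0 d' x" using C_kernel_frame_iff[OF conn] by blast
  obtain t where t: "t : base P" using teD(1) by blast
  have x: "(1, t) : punctured P" using t by simp
  have "E (1, t) *v power_vec a l d (1, t) = E (1, t) *v power_vec a 0 d' (1, t)" using s d' x by metis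
  then have "power_vec a l d (1, t) = power_vec a 0 d' (1, t)" by (rule invertible_cancel_vec[OF E_inv[OF x]])
  then show False using l by (simp add: power_vec_def vec_eq_iff forall_2)
 qed
 then show ?l using C_space_frame_iff[OF conn] s by blast
qed

lemma linked_exists_unique:
 assumes conn: "connected (base P)" and s1: "s1 : C_space P (\<alpha> + of_int a) - C_kernel P (\<alpha> + of_int a)"
 shows "EX s2. s2 : C_kernel P (\<alpha> + of_int (a - int k)) & ~ (ALL x:punctured P. s2 x = 0) &
   linked P (\<alpha> + of_int a) (\<alpha> + of_int (a - int k)) s1 s2 &
   (ALL s2'. linked P (\<alpha> + of_int a) (\<alpha> + of_int (a - int k)) s1 s2' --> (ALL x:punctured P. s2' x = s2 x))"
proof -
 obtain l d where l: "l ~= 0" and s: "ALL x:punctured P. s1 x = E x *v power_vec a l d x"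
  using s1 C_space_not_kernel[OF conn] by blast
 obtain t where t: "t : base P" using teD(1) by blast
 have x1: "(1, t) : punctured P" using t by simp
 define s2 where "s2 x = E x *v power_vec (a - int k) 0 l x" for x
 have "s2 : C_kernel P (\<alpha> + of_int (a - int k))" using C_kernel_frame_iff[OF conn] s2_def by blast
 moreover have "~ (ALL x:punctured P. s2 x = 0)"
 proof
  assume "ALL x:punctured P. s2 x = 0"
  then have "s2 (1, t) = 0" using x1 by blast
  then have "E (1, t) *v power_vec (a - int k) 0 l (1, t) = E (1, t) *v 0" by (simp only: s2_def mat_vec_sums)
  then have "power_vec (a - int k) 0 l (1, t) = 0" by (rule invertible_cancel_vec[OF E_inv[OF x1]])
  then show False using l by (simp add: power_vec_def vec_eq_iff forall_2)
 qed
 moreover have "linked P (\<alpha> + of_int a) (\<alpha> + of_int (a - int k)) s1 s2"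
  unfolding linked_frame_iff[OF conn] using l s s2_def by blast
 moreover have "s2' x = s2 x" if L: "linked P (\<alpha> + of_int a) (\<alpha> + of_int (a - int k)) s1 s2'" and x: "x : punctured P" for s2' x
 proof -
  obtain l' d' where s': "ALL x:punctured P. s1 x = E x *v power_vec a l' d' x"
   "ALL x:punctured P. s2' x = E x *v power_vec (a - int k) 0 l' x" by (rule linked_coords[OF conn L])
  have "E (1, t) *v power_vec a l d (1, t) = E (1, t) *v power_vec a l' d' (1, t)" using s s'(1) x1 by metis
  then have "power_vec a l d (1, t) = power_vec a l' d' (1, t)" by (rule invertible_cancel_vec[OF E_inv[OF x1]])
  then have "l' = l" by (simp add: power_vec_def vec_eq_iff forall_2)
  then show ?thesis using s'(2) x by (simp only: s2_def)
 qed
 ultimately show ?thesis by blast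
qed

end
theorem theorem6p7:
  fixes P :: te
  assumes "te_germ P"
    and "generically_regular_singular P"
    and "trace_free_pole_part P"
    and "logarithmic (restr P 0)"
    and "\<exists>\<mu>. monodromy_jordan_block P \<mu>"
  shows "(generic_type_Reg P \<or> generic_type_Log P) \<and>
    (\<exists>\<alpha>1 \<alpha>2 \<alpha>01 \<alpha>02.
      generic_leading_exponents P \<alpha>1 \<alpha>2 \<and> \<alpha>1 - \<alpha>2 \<in> \<nat> \<and>
      leading_exponents (restr P 0) \<alpha>01 \<alpha>02 \<and> \<alpha>01 - \<alpha>02 \<in> \<nat> \<and>
      (let caseI = (\<alpha>01 = \<alpha>1 \<and> \<alpha>02 = \<alpha>2 + 1);
           caseII = (\<alpha>01 = \<alpha>1 + 1 \<and> \<alpha>02 = \<alpha>2);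
           caseIII = (\<alpha>01 = \<alpha>1 \<and> \<alpha>02 = \<alpha>2)
       in
        ((caseI \<and> \<not> caseII \<and> \<not> caseIII) \<or>
         (\<not> caseI \<and> caseII \<and> \<not> caseIII) \<or>
         (\<not> caseI \<and> \<not> caseII \<and> caseIII)) \<and>
        (caseI \<longrightarrow> \<alpha>1 - \<alpha>2 \<in> \<nat> - {0}) \<and>
        (\<exists>s1. s1 \<in> C_space P \<alpha>1 - C_kernel P \<alpha>1) \<and>
        (\<forall>s1 \<in> C_space P \<alpha>1 - C_kernel P \<alpha>1.
          \<exists>s2. s2 \<in> C_kernel P \<alpha>2 \<and> \<not> (\<forall>x\<in>punctured P. s2 x = 0) \<and> linked P \<alpha>1 \<alpha>2 s1 s2 \<and>
            (\<forall>s2'. linked P \<alpha>1 \<alpha>2 s1 s2' \<longrightarrow> (\<forall>x\<in>punctured P. s2' x = s2 x))) \<and>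
        (\<forall>s1 s2. linked P \<alpha>1 \<alpha>2 s1 s2 \<longrightarrow>
          (caseI \<longrightarrow> (\<exists>f. normal_form_I P s1 s2 f)) \<and>
          (caseII \<longrightarrow> (\<exists>f. normal_form_II P s1 s2 f)) \<and>
          (caseIII \<longrightarrow> stalk_direct_sum P (0, 0) s1 s2)) \<and>
        (\<forall>s1 s2 s1' s2' f f'. linked P \<alpha>1 \<alpha>2 s1 s2 \<and> linked P \<alpha>1 \<alpha>2 s1' s2' \<longrightarrow>
          (caseI \<and> normal_form_I P s1 s2 f \<and> normal_form_I P s1' s2' f' \<longrightarrow>
            (\<forall>\<^sub>F t in nhds 0. f' t = f t)) \<and>
          (caseII \<and> \<alpha>1 \<noteq> \<alpha>2 \<and> normal_form_II P s1 s2 f \<and> normal_form_II P s1' s2' f' \<longrightarrow>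
            (\<forall>\<^sub>F t in nhds 0. f' t = f t)) \<and>
          (caseII \<and> \<alpha>1 = \<alpha>2 \<and> normal_form_II P s1 s2 f \<and> normal_form_II P s1' s2' f' \<longrightarrow>
            (\<exists>c. \<forall>\<^sub>F t in nhds 0. f' t = f t / (1 + c * f t)))) \<and>
        (\<forall>Q f. gauge_isomorphic P Q \<longrightarrow>
          (case_I_function P f \<longleftrightarrow> case_I_function Q f) \<and>
          (case_II_function P f \<longleftrightarrow> case_II_function Q f))))"
proof -
 have op: "open (base P)" and b0: "0 : base P" and teP: "te_structure P" and conn: "connected (base P)"
  using assms(1) simply_connected_imp_connected unfolding te_germ_def by blast+
 obtain \<alpha> E where fr: "framed_te P \<alpha> E"
  using adapted_frame_exists[OF teP op conn] assms(5) unfolding framed_te_def by blast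
 interpret framed_te P \<alpha> E by (rule fr)
 obtain a k \<alpha>01 \<alpha>02 where
  g: "generic_leading_exponents P (\<alpha> + of_int a) (\<alpha> + of_int (a - int k))"
  and l0: "leading_exponents (restr P 0) \<alpha>01 \<alpha>02" "\<alpha>01 - \<alpha>02 : \<nat>"
  and gt: "generic_type_Reg P \<or> generic_type_Log P"
  and cs: "(\<alpha>01 = \<alpha> + of_int a & \<alpha>02 = \<alpha> + of_int (a - int k) + 1 & special_I a k) \<or>
   (\<alpha>01 = \<alpha> + of_int a + 1 & \<alpha>02 = \<alpha> + of_int (a - int k) & special_II a k) \<or>
   (\<alpha>01 = \<alpha> + of_int a & \<alpha>02 = \<alpha> + of_int (a - int k) & special_III a k)"
  and nf: "\<forall>\<^sub>F t in nhds 0. t : base P & (EX a b h. nf_basis (restr P t) E t a b h)"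
  by (rule special_fibre_cases[OF op conn b0 assms(2)[unfolded generically_regular_singular_def] assms(4)])
 define \<alpha>1 where "\<alpha>1 = \<alpha> + of_int a"
 define \<alpha>2 where "\<alpha>2 = \<alpha> + of_int (a - int k)"
 note ab = \<alpha>1_def[symmetric] \<alpha>2_def[symmetric]
 have diff: "\<alpha>1 - \<alpha>2 = of_nat k" by (simp add: \<alpha>1_def \<alpha>2_def)
 have k0: "\<alpha>1 = \<alpha>2 \<longleftrightarrow> k = 0" by (metis diff of_nat_eq_0_iff right_minus_eq)
 have cI: "special_I a k" if "\<alpha>01 = \<alpha>1 & \<alpha>02 = \<alpha>2 + 1" using cs that unfolding ab by auto
 have cII: "special_II a k" if "\<alpha>01 = \<alpha>1 + 1 & \<alpha>02 = \<alpha>2" using cs that unfolding ab by auto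
 have cIII: "special_III a k" if "\<alpha>01 = \<alpha>1 & \<alpha>02 = \<alpha>2" using cs that unfolding ab by auto
 have r1: "generic_leading_exponents P \<alpha>1 \<alpha>2" using g unfolding ab .
 have r2: "\<alpha>1 - \<alpha>2 : \<nat>" unfolding diff by simp
 have r3: "((\<alpha>01 = \<alpha>1 & \<alpha>02 = \<alpha>2 + 1) & ~ (\<alpha>01 = \<alpha>1 + 1 & \<alpha>02 = \<alpha>2) & ~ (\<alpha>01 = \<alpha>1 & \<alpha>02 = \<alpha>2)) \<or>
   (~ (\<alpha>01 = \<alpha>1 & \<alpha>02 = \<alpha>2 + 1) & (\<alpha>01 = \<alpha>1 + 1 & \<alpha>02 = \<alpha>2) & ~ (\<alpha>01 = \<alpha>1 & \<alpha>02 = \<alpha>2)) \<or>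
   (~ (\<alpha>01 = \<alpha>1 & \<alpha>02 = \<alpha>2 + 1) & ~ (\<alpha>01 = \<alpha>1 + 1 & \<alpha>02 = \<alpha>2) & (\<alpha>01 = \<alpha>1 & \<alpha>02 = \<alpha>2))"
  using cs unfolding ab by auto
 have r4: "(\<alpha>01 = \<alpha>1 & \<alpha>02 = \<alpha>2 + 1) --> \<alpha>1 - \<alpha>2 : \<nat> - {0}"
  using cI unfolding diff special_I_def by auto
 have r5: "EX s1. s1 : C_space P \<alpha>1 - C_kernel P \<alpha>1" unfolding \<alpha>1_def C_space_not_kernel[OF conn]
  by (rule exI[of _ "%x. E x *v power_vec a 1 0 x"], rule exI[of _ 1], rule exI[of _ 0]) simp
 have r6: "ALL s1 : C_space P \<alpha>1 - C_kernel P \<alpha>1.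
     EX s2. s2 : C_kernel P \<alpha>2 & ~ (ALL x:punctured P. s2 x = 0) & linked P \<alpha>1 \<alpha>2 s1 s2 &
      (ALL s2'. linked P \<alpha>1 \<alpha>2 s1 s2' --> (ALL x:punctured P. s2' x = s2 x))"
  unfolding \<alpha>1_def \<alpha>2_def by (intro ballI linked_exists_unique[OF conn])
 have r7: "ALL s1 s2. linked P \<alpha>1 \<alpha>2 s1 s2 -->
     (\<alpha>01 = \<alpha>1 & \<alpha>02 = \<alpha>2 + 1 --> (EX f. normal_form_I P s1 s2 f)) &
     (\<alpha>01 = \<alpha>1 + 1 & \<alpha>02 = \<alpha>2 --> (EX f. normal_form_II P s1 s2 f)) &
     (\<alpha>01 = \<alpha>1 & \<alpha>02 = \<alpha>2 --> stalk_direct_sum P (0, 0) s1 s2)"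
  using cI cII cIII unfolding special_I_def special_II_def special_III_def ab by blast
 have r8: "ALL s1 s2 s1' s2' f f'. linked P \<alpha>1 \<alpha>2 s1 s2 & linked P \<alpha>1 \<alpha>2 s1' s2' -->
     ((\<alpha>01 = \<alpha>1 & \<alpha>02 = \<alpha>2 + 1) & normal_form_I P s1 s2 f & normal_form_I P s1' s2' f' -->
      (\<forall>\<^sub>F t in nhds 0. f' t = f t)) &
     ((\<alpha>01 = \<alpha>1 + 1 & \<alpha>02 = \<alpha>2) & \<alpha>1 ~= \<alpha>2 & normal_form_II P s1 s2 f & normal_form_II P s1' s2' f' -->
      (\<forall>\<^sub>F t in nhds 0. f' t = f t)) &
     ((\<alpha>01 = \<alpha>1 + 1 & \<alpha>02 = \<alpha>2) & \<alpha>1 = \<alpha>2 & normal_form_II P s1 s2 f & normal_form_II P s1' s2' f' -->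
      (EX c. \<forall>\<^sub>F t in nhds 0. f' t = f t / (1 + c * f t)))"
 proof (intro allI impI conjI; elim conjE)
  fix s1 s2 s1' s2' f f'
  assume L: "linked P \<alpha>1 \<alpha>2 s1 s2" "linked P \<alpha>1 \<alpha>2 s1' s2'"
  note L' = L[unfolded \<alpha>1_def \<alpha>2_def]
  show "\<forall>\<^sub>F t in nhds 0. f' t = f t"
   if N: "normal_form_I P s1 s2 f" "normal_form_I P s1' s2' f'" and "\<alpha>01 = \<alpha>1" "\<alpha>02 = \<alpha>2 + 1"
   using form_I_unique[OF op b0 conn _ L' N] cI that unfolding special_I_def by blast
  show "\<forall>\<^sub>F t in nhds 0. f' t = f t"
   if N: "normal_form_II P s1 s2 f" "normal_form_II P s1' s2' f'" and "\<alpha>1 ~= \<alpha>2"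
   by (rule form_II_unique(1)[OF op b0 conn L' N]) (use k0 that in blast)
  show "EX c. \<forall>\<^sub>F t in nhds 0. f' t = f t / (1 + c * f t)"
   if N: "normal_form_II P s1 s2 f" "normal_form_II P s1' s2' f'" and "\<alpha>1 = \<alpha>2"
   by (rule form_II_unique(2)[OF op b0 conn L' N]) (use k0 that in blast)
 qed
 have r9: "ALL Q f. gauge_isomorphic P Q -->
     (case_I_function P f \<longleftrightarrow> case_I_function Q f) &
     (case_II_function P f \<longleftrightarrow> case_II_function Q f)"
  using gauge_case_functions[OF _ fr op conn nf] by blast
 show ?thesis
  by (rule conjI[OF gt], rule exI[of _ \<alpha>1], rule exI[of _ \<alpha>2], rule exI[of _ \<alpha>01], rule exI[of _ \<alpha>02],
    unfold Let_def, intro conjI r1 r2 r3 r4 r5 r6 r7 r8 r9 l0)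
qed

end
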